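(* Let $(\zeta_i)_{i\ge 0}$ be i.i.d. random vectors with values in $\mathbb{Z}^2$ on a probability space $(\Omega,\mathbb{P})$, with $\mathbb{E}\zeta_0=0$, finite second moment, nonsingular covariance matrix $\Sigma$, and aperiodic (the subgroup generated by the support of $\zeta_0$ is $\mathbb{Z}^2$). Let $Z_0=\underline 0$, $Z_n=\zeta_0+\dots+\zeta_{n-1}$. Let $(X_{\underline{\ell}})_{\underline{\ell}\in\mathbb{Z}^2}$ be i.i.d. centered real random variables on a probability space $(E,\mu)$ with $\|X_{\underline 0}\|_2=1$, let $(a_{\underline q})_{\underline q\in\mathbb{Z}^2}$ be real numbers with $\sum_{\underline q}|a_{\underline q}|<\infty$ and $\sum_{\underline q}a_{\underline q}\neq 0$, and let $\Xi_{\underline\ell}=\sum_{\underline q\in\mathbb{Z}^2}a_{\underline q}X_{\underline\ell-\underline q}$. Put $S_n^{\omega,\Xi}(x)=\sum_{i=0}^{n-1}\Xi_{Z_i(\omega)}(x)$. Then for $\mathbb{P}$-a.e. $\omega$, the process $\Big(\frac{S^{\omega,\Xi}_{\lfloor nt\rfloor}(x)}{\sqrt{n\log n}}\Big)_{t\in[0,1]}$ on $(E,\mu)$ satisfies a functional central limit theorem with asymptotic variance $\sigma^2=|\sum_{\underline q\in\mathbb{Z}^2}a_{\underline q}|^2(\pi\sqrt{\det\Sigma})^{-1}$.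
   Context: "Satisfies a functional central limit theorem with asymptotic variance $\sigma^2$" means: the processes, viewed as random elements (under $\mu$) of $D[0,1]$, converge in distribution to $\sigma W$, where $W$ is a standard Wiener process on $[0,1]$ (convergence of finite-dimensional distributions plus tightness). *)

theory Defs
  imports "HOL-Probability.Probability" "HOL-Library.Product_Plus"
begin

definition cadlag01 :: "(real \<Rightarrow> real) \<Rightarrow> bool" where
  "cadlag01 x \<longleftrightarrow>
     (\<forall>t\<in>{0..<1}. (x \<longlongrightarrow> x t) (at_right t)) \<and>
     (\<forall>t\<in>{0<..1}. \<exists>l. (x \<longlongrightarrow> l) (at_left t))"

definition D01 :: "(real \<Rightarrow> real) set" where
  "D01 = {x. cadlag01 x}"

definition time_changes :: "(real \<Rightarrow> real) set" where
  "time_changes = {r. strict_mono_on {0..1} r \<and> continuous_on {0..1} r \<and> r ` {0..1} = {0..1}}"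

definition skorokhod_dist :: "(real \<Rightarrow> real) \<Rightarrow> (real \<Rightarrow> real) \<Rightarrow> real" where
  "skorokhod_dist x y = Inf {max (SUP t\<in>{0..1}. \<bar>r t - t\<bar>) (SUP t\<in>{0..1}. \<bar>x t - y (r t)\<bar>) | r. r \<in> time_changes}"

definition bcont_D01 :: "((real \<Rightarrow> real) \<Rightarrow> real) \<Rightarrow> bool" where
  "bcont_D01 f \<longleftrightarrow> (\<exists>B. \<forall>x\<in>D01. \<bar>f x\<bar> \<le> B) \<and>
     (\<forall>x\<in>D01. \<forall>e>0. \<exists>d>0. \<forall>y\<in>D01. skorokhod_dist x y < d \<longrightarrow> \<bar>f y - f x\<bar> < e)"

definition wiener01 :: "'w measure \<Rightarrow> ('w \<Rightarrow> real \<Rightarrow> real) \<Rightarrow> bool" where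
  "wiener01 M W \<longleftrightarrow> prob_space M \<and>
     (\<forall>t\<in>{0..1}. (\<lambda>w. W w t) \<in> borel_measurable M) \<and>
     (\<forall>w\<in>space M. W w 0 = 0 \<and> continuous_on {0..1} (W w)) \<and>
     (\<forall>s t. 0 \<le> s \<and> s < t \<and> t \<le> 1 \<longrightarrow>
        distributed M lborel (\<lambda>w. W w t - W w s) (normal_density 0 (sqrt (t - s)))) \<and>
     (\<forall>(k::nat) (ts::nat \<Rightarrow> real). 0 \<le> ts 0 \<and> ts k \<le> 1 \<and> (\<forall>i<k. ts i < ts (Suc i)) \<longrightarrow>
        prob_space.indep_vars M (\<lambda>_. borel) (\<lambda>i w. W w (ts (Suc i)) - W w (ts i)) {..<k})"

text \<open>The processes Y n (random elements of D[0,1] on the probability space mu) converge in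
  distribution to sigma W, W a standard Wiener process. The limit law is described by any
  standard Wiener process defined on the canonical path space type.\<close>
definition fclt :: "'e measure \<Rightarrow> (nat \<Rightarrow> 'e \<Rightarrow> real \<Rightarrow> real) \<Rightarrow> real \<Rightarrow> bool" where
  "fclt \<mu> Y \<sigma>2 \<longleftrightarrow>
     (\<forall>(M::(real \<Rightarrow> real) measure) W f. wiener01 M W \<and> bcont_D01 f \<longrightarrow>
        (\<lambda>n. \<integral>x. f (Y n x) \<partial>\<mu>) \<longlonglongrightarrow> (\<integral>w. f (\<lambda>t. sqrt \<sigma>2 * W w t) \<partial>M))"

definition gen_subgroup :: "(int \<times> int) set \<Rightarrow> (int \<times> int) set" where
  "gen_subgroup A = \<Inter>{H. A \<subseteq> H \<and> 0 \<in> H \<and> (\<forall>x\<in>H. \<forall>y\<in>H. x - y \<in> H)}"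

end

theory Submission
  imports Defs "HOL-Real_Asymp.Real_Asymp"
begin

text \<open>
  For almost every walk the number of pairs \<open>i, j < n\<close> with \<open>Z j - Z i = q\<close> is asymptotic to
  \<open>C n ln n\<close> with \<open>C = 1 / (\<pi> \<surd>(det \<Sigma>))\<close>, and for \<open>q = 0\<close> a time block of length
  \<open>n / m\<close> contributes \<open>C n ln n / m\<close>, so different blocks share few
  sites. The mean comes from Fourier inversion: the Green function of the lazy walk is governed
  by its Gaussian local limit, and an Abelian-Tauberian argument returns to the original walk,
  which may be periodic. A variance bound and Borel-Cantelli along \<open>exp (r powr (3/4))\<close>
  give the almost sure statement.

  For a fixed path with these properties the sum of the scenery over a time block is a weighted sum of
  independent variables with small weights, hence asymptotically Gaussian, and assigning each site to the block
  that visits it most often makes the blocks independent. Tightness follows from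
  the Newman-Wright maximal inequality for associated variables. Shifting the path by \<open>q\<close>
  changes the process by \<open>o(\<surd>(n ln n))\<close>, since the self-intersection counts for the
  displacements \<open>0\<close> and \<open>-q\<close> agree to first order; summing
  over \<open>q\<close> by dominated convergence passes from the scenery to its moving average.
\<close>

section \<open>Fourier analysis on the torus\<close>

text \<open>A periodic walk has no local limit theorem at single times. Only sums of return
  probabilities over time enter, however, and a change of variable turns their Abel sums into those
  of the lazy walk.

  Chebyshev's inequality for all pairs \<open>i < j < n\<close> leaves a probability of order
  \<open>1 / ln n\<close>, which is not summable along any sequence whose consecutive ratios tend to
  1. Treating lags above \<open>n / ln n\<close> separately, where the mean is negligible, improves
  this to \<open>(ln n) powr (-3/2)\<close>. The exponent 3/4 of the subsequence then works because
  it lies between 2/3, above which the bound is summable, and 1, below which the ratios tend to 1.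

  Sums over different stretches of one path are dependent, since sites are revisited. They are
  increasing functions of the same independent variables, and this monotonicity replaces
  independence in the maximal inequality.

  The functionals tested on path space carry no measurability assumption. All paths that occur are
  step functions or limits of step functions, and on step functions a continuous functional is a
  continuous function of finitely many values.\<close>

definition torus_box :: "(real \<times> real) set" where
  "torus_box = {-pi..pi} \<times> {-pi..pi}"

text \<open>Normalised to total mass 1, so that Fourier inversion carries no constant and every
  bounded measurable function is integrable.\<close>

definition torus :: "(real \<times> real) measure" where
  "torus = density lborel (\<lambda>\<theta>. ennreal (indicator torus_box \<theta> / (4 * pi\<^sup>2)))"

definition dotp :: "real \<times> real \<Rightarrow> int \<times> int \<Rightarrow> real" where
  "dotp \<theta> z = fst \<theta> * real_of_int (fst z) + snd \<theta> * real_of_int (snd z)"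

lemma dotp_simps [simp]:
  "dotp \<theta> 0 = 0" "dotp 0 z = 0"
  "dotp \<theta> (z + z') = dotp \<theta> z + dotp \<theta> z'"
  "dotp \<theta> (z - z') = dotp \<theta> z - dotp \<theta> z'"
  "dotp \<theta> (- z) = - dotp \<theta> z"
  "dotp (\<theta> + \<theta>') z = dotp \<theta> z + dotp \<theta>' z"
  "dotp (r *\<^sub>R \<theta>) z = r * dotp \<theta> z"
  by (auto simp: dotp_def algebra_simps)

lemma dotp_sum: "dotp \<theta> (\<Sum>i\<in>A. f i) = (\<Sum>i\<in>A. dotp \<theta> (f i))"
  by (induction A rule: infinite_finite_induct) auto

lemma dotp_measurable [measurable]: "(\<lambda>\<theta>. dotp \<theta> z) \<in> borel_measurable borel"
  unfolding dotp_def borel_prod[symmetric] by measurable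

lemma cis_measurable [measurable]: "cis \<in> borel_measurable borel"
  by (intro borel_measurable_continuous_onI continuous_intros)

lemma closed_torus_box: "compact torus_box"
  unfolding torus_box_def by (intro compact_Times compact_Icc)

lemma torus_box_borel [measurable]: "torus_box \<in> sets borel"
  using closed_torus_box by (intro borel_closed compact_imp_closed)

lemma emeasure_torus_box: "emeasure lborel torus_box = ennreal (4 * pi\<^sup>2)"
proof -
  have "emeasure lborel torus_box = emeasure (lborel \<Otimes>\<^sub>M lborel) ({-pi..pi} \<times> {-pi..pi})"
    by (simp add: lborel_prod torus_box_def)
  also have "\<dots> = ennreal (2 * pi) * ennreal (2 * pi)"
    by (subst lborel.emeasure_pair_measure_Times) auto
  also have "\<dots> = ennreal (4 * pi\<^sup>2)"
    by (subst ennreal_mult[symmetric]) (auto simp: power2_eq_square)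
  finally show ?thesis .
qed

lemma sets_torus [simp, measurable_cong]: "sets torus = sets borel"
  by (simp add: torus_def)

lemma prob_space_torus: "prob_space torus"
proof
  have "emeasure torus (space torus) = (\<integral>\<^sup>+\<theta>. ennreal (1 / (4 * pi\<^sup>2)) * indicator torus_box \<theta> \<partial>lborel)"
    unfolding torus_def by (subst emeasure_density)
      (auto intro!: nn_integral_cong simp: indicator_def simp del: ennreal_indicator split: if_splits)
  also have "\<dots> = ennreal (1 / (4 * pi\<^sup>2)) * ennreal (4 * pi\<^sup>2)"
    by (subst nn_integral_cmult_indicator) (auto simp: emeasure_torus_box)
  also have "\<dots> = 1"
    by (subst ennreal_mult[symmetric]) auto
  finally show "emeasure torus (space torus) = 1" .
qed

interpretation torus: prob_space torus
  by (rule prob_space_torus)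

lemma AE_torus: "AE \<theta> in torus. \<theta> \<in> torus_box"
  unfolding torus_def by (subst AE_density) (auto simp: indicator_def)

lemma integral_torus:
  fixes f :: "real \<times> real \<Rightarrow> 'a::{banach, second_countable_topology}"
  assumes [measurable]: "f \<in> borel_measurable borel"
  shows "(\<integral>\<theta>. f \<theta> \<partial>torus) = (1 / (4 * pi\<^sup>2)) *\<^sub>R (\<integral>\<theta>. indicator torus_box \<theta> *\<^sub>R f \<theta> \<partial>lborel)"
  unfolding torus_def
  by (subst integral_density) (auto simp: field_simps simp flip: integral_scaleR_right intro!: Bochner_Integration.integral_cong)

lemma integral_cis_period:
  "(\<integral>x. indicator {-pi..pi} x *\<^sub>R cis (x * real_of_int n) \<partial>lborel) = (if n = 0 then 2 * pi else 0)"
proof (cases "n = 0")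
  case True
  have "(\<integral>x. indicator {-pi..pi} x *\<^sub>R cis (x * real_of_int n) \<partial>lborel)
      = (\<integral>x. indicator {-pi..pi} x *\<^sub>R (1::complex) \<partial>lborel)"
    using True by simp
  also have "\<dots> = of_real pi - of_real (-pi)"
    by (rule integral_FTC_Icc[where F = "\<lambda>x. of_real x"]) (auto intro!: derivative_eq_intros)
  finally show ?thesis using True by simp
next
  case False
  let ?F = "\<lambda>x. cis (x * real_of_int n) / (\<i> * of_int n)"
  have "(\<integral>x. indicator {-pi..pi} x *\<^sub>R cis (x * real_of_int n) \<partial>lborel) = ?F pi - ?F (-pi)"
  proof (rule integral_FTC_Icc)
    fix x :: real
    have "((\<lambda>x. exp (\<i> * of_real (x * real_of_int n)) / (\<i> * of_int n)) has_vector_derivative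
        exp (\<i> * of_real (x * real_of_int n))) (at x within {-pi..pi})"
      using False
      by (auto intro!: derivative_eq_intros has_vector_derivative_real_field simp: field_simps)
    then show "(?F has_vector_derivative cis (x * real_of_int n)) (at x within {-pi..pi})"
      by (simp add: cis_conv_exp)
  qed (auto intro!: continuous_intros)
  also have "?F pi = ?F (-pi)"
  proof -
    have "cis (pi * of_int n) = cis (- pi * of_int n) * cis (2 * pi * of_int n)"
      by (simp add: cis_mult algebra_simps)
    also have "cis (2 * pi * of_int n) = 1"
      by (metis cis_multiple_2pi Ints_of_int mult.commute mult.left_commute)
    finally show ?thesis by simp
  qed
  finally show ?thesis using False by simp
qed

lemma (in pair_sigma_finite) integral_product_mult:
  fixes f :: "'a \<Rightarrow> 'c::{real_normed_field, banach, second_countable_topology}"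
  assumes f: "integrable M1 f" and g: "integrable M2 g"
  shows "integrable (M1 \<Otimes>\<^sub>M M2) (\<lambda>p. f (fst p) * g (snd p))"
    and "(\<integral>p. f (fst p) * g (snd p) \<partial>(M1 \<Otimes>\<^sub>M M2)) = (\<integral>x. f x \<partial>M1) * (\<integral>y. g y \<partial>M2)"
proof -
  note [measurable] = borel_measurable_integrable[OF f] borel_measurable_integrable[OF g]
  show int: "integrable (M1 \<Otimes>\<^sub>M M2) (\<lambda>p. f (fst p) * g (snd p))"
    using f g by (intro Fubini_integrable) (auto simp: norm_mult)
  show "(\<integral>p. f (fst p) * g (snd p) \<partial>(M1 \<Otimes>\<^sub>M M2)) = (\<integral>x. f x \<partial>M1) * (\<integral>y. g y \<partial>M2)"
    by (subst integral_fst'[OF int, symmetric]) simp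
qed

lemma integral_cis_torus:
  "(\<integral>\<theta>. cis (dotp \<theta> z) \<partial>torus) = (if z = 0 then 1 else 0)"
proof -
  have int1: "integrable lborel (\<lambda>x. indicator {-pi..pi} x *\<^sub>R cis (x * real_of_int n))" for n
    by (rule borel_integrable_compact) (auto intro!: continuous_intros)
  have "(\<integral>\<theta>. indicator torus_box \<theta> *\<^sub>R cis (dotp \<theta> z) \<partial>lborel)
     = (\<integral>\<theta>. (indicator {-pi..pi} (fst \<theta>) *\<^sub>R cis (fst \<theta> * real_of_int (fst z)))
            * (indicator {-pi..pi} (snd \<theta>) *\<^sub>R cis (snd \<theta> * real_of_int (snd z))) \<partial>(lborel \<Otimes>\<^sub>M lborel))"
    by (auto simp: lborel_prod torus_box_def dotp_def cis_mult[symmetric] indicator_def intro!: Bochner_Integration.integral_cong)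
  also have "\<dots> = (\<integral>x. indicator {-pi..pi} x *\<^sub>R cis (x * real_of_int (fst z)) \<partial>lborel)
      * (\<integral>x. indicator {-pi..pi} x *\<^sub>R cis (x * real_of_int (snd z)) \<partial>lborel)"
    by (rule lborel_pair.integral_product_mult[OF int1 int1])
  also have "\<dots> = (if z = 0 then 4 * pi\<^sup>2 else 0)"
    unfolding integral_cis_period by (auto simp: power2_eq_square prod_eq_iff)
  finally have *: "(\<integral>\<theta>. indicator torus_box \<theta> *\<^sub>R cis (dotp \<theta> z) \<partial>lborel) = (if z = 0 then 4 * pi\<^sup>2 else 0)" .
  show ?thesis
    by (subst integral_torus, measurable) (unfold *, simp add: scaleR_conv_of_real)
qed

section \<open>Gaussian integrals and elementary inequalities\<close>

lemma integral_gaussian: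
  assumes "a > 0"
  shows "integrable lborel (\<lambda>x. exp (- a * (x + b)\<^sup>2))"
    "(\<integral>x. exp (- a * (x + b)\<^sup>2) \<partial>lborel) = sqrt (pi / a)"
proof -
  define s where "s = sqrt (1 / (2 * a))"
  have s: "s > 0" "s\<^sup>2 = 1 / (2 * a)" using assms by (auto simp: s_def)
  have *: "exp (- a * (x + b)\<^sup>2) = sqrt (pi / a) * normal_density (-b) s x" for x
    using assms by (simp add: normal_density_def s)
  show "integrable lborel (\<lambda>x. exp (- a * (x + b)\<^sup>2))"
    unfolding * using s by simp
  show "(\<integral>x. exp (- a * (x + b)\<^sup>2) \<partial>lborel) = sqrt (pi / a)"
    unfolding * using s by simp
qed

lemma integral_gaussian_plane:
  fixes a b d :: real
  assumes "a > 0" "a * d - b\<^sup>2 > 0"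
  defines "Q \<equiv> \<lambda>\<theta>. a * (fst \<theta>)\<^sup>2 + 2 * b * fst \<theta> * snd \<theta> + d * (snd \<theta>)\<^sup>2"
  shows "integrable lborel (\<lambda>\<theta>::real \<times> real. exp (- Q \<theta>))"
    and "(\<integral>\<theta>. exp (- Q \<theta>) \<partial>lborel) = pi / sqrt (a * d - b\<^sup>2)"
proof -
  \<comment> \<open>Completing the square in the first coordinate turns the form into
    \<open>a * (x + y * b / a)^2 + e * y^2\<close>; \<open>e\<close> is the Schur complement of
    \<open>a\<close>.\<close>
  define e where "e = (a * d - b\<^sup>2) / a"
  have e: "e > 0" using assms by (simp add: e_def)
  have Q: "exp (- Q (x, y)) = exp (- a * (y * b / a + x)\<^sup>2) * exp (- e * (y + 0)\<^sup>2)" for x y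
    using assms(1) by (simp add: Q_def e_def exp_add[symmetric] field_simps power2_eq_square)
  have Q': "exp (- Q (x, y)) = exp (- a * (x + y * b / a)\<^sup>2) * exp (- e * (y + 0)\<^sup>2)" for x y
    using assms(1) by (simp add: Q_def e_def exp_add[symmetric] field_simps power2_eq_square)
  note G = integral_gaussian[OF assms(1)] integral_gaussian[OF e]
  have [measurable]: "(\<lambda>\<theta>. exp (- Q \<theta>)) \<in> borel_measurable (lborel \<Otimes>\<^sub>M lborel)"
    unfolding Q_def by measurable
  have [measurable]: "(\<lambda>\<theta>. exp (- Q (snd \<theta>, fst \<theta>))) \<in> borel_measurable (lborel \<Otimes>\<^sub>M lborel)"
    unfolding Q_def by measurable
  \<comment> \<open>The inner integral has to run over the coordinate in which the square was
    completed, hence the exchanged coordinates.\<close>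
  have int: "integrable (lborel \<Otimes>\<^sub>M lborel) (\<lambda>\<theta>. exp (- Q (snd \<theta>, fst \<theta>)))"
  proof (rule lborel_pair.Fubini_integrable)
    show "AE y in lborel. integrable lborel (\<lambda>x. exp (- Q (snd (y, x), fst (y, x))))"
      unfolding fst_conv snd_conv Q' by (intro AE_I2 integrable_mult_left G)
    show "integrable lborel (\<lambda>y. \<integral>x. norm (exp (- Q (snd (y, x), fst (y, x)))) \<partial>lborel)"
      unfolding fst_conv snd_conv Q' using G(1)[of "_ * b / a"] G(2) G(3)[of 0] by simp
  qed auto
  have "(\<integral>\<theta>. exp (- Q (snd \<theta>, fst \<theta>)) \<partial>(lborel \<Otimes>\<^sub>M lborel)) = (\<integral>y. \<integral>x. exp (- Q (x, y)) \<partial>lborel \<partial>lborel)"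
    by (subst lborel_pair.integral_fst'[OF int, symmetric]) simp
  also have "\<dots> = sqrt (pi / a) * sqrt (pi / e)"
    unfolding Q' using G(2) G(4)[of 0] by simp
  also have "\<dots> = pi / sqrt (a * d - b\<^sup>2)"
    using assms by (simp add: e_def real_sqrt_divide real_sqrt_mult)
  finally have val: "(\<integral>\<theta>. exp (- Q (snd \<theta>, fst \<theta>)) \<partial>(lborel \<Otimes>\<^sub>M lborel)) = pi / sqrt (a * d - b\<^sup>2)" .
  show "integrable lborel (\<lambda>\<theta>::real \<times> real. exp (- Q \<theta>))"
    using lborel_pair.integrable_product_swap[OF int] by (simp add: lborel_prod case_prod_beta')
  show "(\<integral>\<theta>. exp (- Q \<theta>) \<partial>lborel) = pi / sqrt (a * d - b\<^sup>2)"
    using val lborel_pair.integral_product_swap[OF borel_measurable_integrable[OF int]]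
    by (simp add: lborel_prod case_prod_beta')
qed

lemma lborel_plane_scale:
  fixes f :: "real \<times> real \<Rightarrow> 'a::{banach, second_countable_topology}"
  assumes [measurable]: "f \<in> borel_measurable borel" and c: "c > 0"
  shows "(\<integral>\<theta>. f \<theta> \<partial>lborel) = c\<^sup>2 *\<^sub>R (\<integral>\<theta>. f (c *\<^sub>R \<theta>) \<partial>lborel)"
proof -
  have "(\<integral>\<theta>. f \<theta> \<partial>lborel) = (\<integral>\<theta>. f \<theta> \<partial>(density (distr lborel borel (\<lambda>x. 0 + c *\<^sub>R x)) (\<lambda>_. \<bar>c\<bar>^DIM(real \<times> real))))"
    using c by (subst lborel_affine[of c 0]) auto
  also have "\<dots> = c\<^sup>2 *\<^sub>R (\<integral>\<theta>. f (c *\<^sub>R \<theta>) \<partial>lborel)"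
    using c by (subst integral_density) (auto simp: integral_distr power2_eq_square)
  finally show ?thesis .
qed

text \<open>The Taylor polynomial of degree 3 leaves an error of at most \<open>u^4 / 24\<close>,
  which for arguments up to 1 costs only a small part of \<open>u^2 / 2\<close>.\<close>

lemma one_minus_cos_ge:
  assumes "\<bar>u\<bar> \<le> (1::real)"
  shows "u\<^sup>2 / 4 \<le> 1 - cos u"
proof -
  have "cmod (iexp u - (\<Sum>k\<le>3. (\<i> * u)^k / fact k)) \<le> \<bar>u\<bar> ^ 4 / fact 4"
    using iexp_approx1[of u 3] by (simp add: numeral_eq_Suc)
  then have "\<bar>Re (iexp u - (\<Sum>k\<le>3. (\<i> * u)^k / fact k))\<bar> \<le> \<bar>u\<bar> ^ 4 / fact 4"
    using abs_Re_le_cmod order_trans by blast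
  also have "Re (iexp u - (\<Sum>k\<le>3. (\<i> * u)^k / fact k)) = cos u - (1 - u\<^sup>2 / 2)"
    by (simp add: numeral_eq_Suc cis_conv_exp[symmetric] power_mult_distrib)
  finally have "\<bar>cos u - (1 - u\<^sup>2 / 2)\<bar> \<le> \<bar>u\<bar> ^ 4 / 24"
    by (simp add: fact_numeral)
  then have "cos u - (1 - u\<^sup>2 / 2) \<le> \<bar>u\<bar> ^ 4 / 24"
    by (rule order_trans[OF abs_ge_self])
  moreover have "\<bar>u\<bar> ^ 4 \<le> u\<^sup>2"
    using power_decreasing[of 2 4 "\<bar>u\<bar>"] assms by simp
  ultimately show ?thesis using zero_le_power2[of u] by linarith
qed

lemma cis_approx: "cmod (cis u - (1 + \<i> * u)) \<le> u\<^sup>2 / 2"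
  using iexp_approx1[of u 1] by (simp add: cis_conv_exp numeral_2_eq_2)

text \<open>Cauchy-Schwarz, with Lagrange's identity exhibiting the difference of the two sides as a
  square.\<close>

lemma dotp_power2_le: "(dotp \<theta> z)\<^sup>2 \<le> (norm \<theta>)\<^sup>2 * ((real_of_int (fst z))\<^sup>2 + (real_of_int (snd z))\<^sup>2)"
proof -
  obtain x y where [simp]: "\<theta> = (x, y)" by force
  have "(norm \<theta>)\<^sup>2 * ((real_of_int (fst z))\<^sup>2 + (real_of_int (snd z))\<^sup>2) - (dotp \<theta> z)\<^sup>2
    = (x * real_of_int (snd z) - y * real_of_int (fst z))\<^sup>2"
    by (simp add: norm_Pair dotp_def power2_eq_square algebra_simps)
  then show ?thesis
    using zero_le_power2[of "x * real_of_int (snd z) - y * real_of_int (fst z)"] by linarith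
qed

text \<open>Cayley-Hamilton for the symmetric matrix of the form: the squared norm of the image of
  \<open>(x, y)\<close> is the trace times the form minus the determinant times the squared norm.
  For a positive trace this bounds the smallest eigenvalue below by determinant over trace.\<close>

lemma quadratic_form_lower:
  fixes a b d x y :: real
  shows "(a * d - b\<^sup>2) * (x\<^sup>2 + y\<^sup>2) \<le> (a + d) * (a * x\<^sup>2 + 2 * b * x * y + d * y\<^sup>2)"
proof -
  have "(a + d) * (a * x\<^sup>2 + 2 * b * x * y + d * y\<^sup>2) - (a * d - b\<^sup>2) * (x\<^sup>2 + y\<^sup>2)
    = (a * x + b * y)\<^sup>2 + (b * x + d * y)\<^sup>2"
    by (simp add: power2_eq_square algebra_simps)
  then show ?thesis
    using zero_le_power2[of "a * x + b * y"] zero_le_power2[of "b * x + d * y"] by linarith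
qed

section \<open>The characteristic function of a step near the origin\<close>

locale planar_walk = prob_space P for P :: "'o measure" +
  fixes \<zeta> :: "nat \<Rightarrow> 'o \<Rightarrow> int \<times> int" and s11 s12 s22 :: real
  assumes \<zeta>_indep: "indep_vars (\<lambda>_. count_space UNIV) \<zeta> UNIV"
    and \<zeta>_ident: "\<And>i. distr P (count_space UNIV) (\<zeta> i) = distr P (count_space UNIV) (\<zeta> 0)"
    and \<zeta>_sq1: "integrable P (\<lambda>w. (real_of_int (fst (\<zeta> 0 w)))\<^sup>2)"
    and \<zeta>_sq2: "integrable P (\<lambda>w. (real_of_int (snd (\<zeta> 0 w)))\<^sup>2)"
    and \<zeta>_mean1: "(\<integral>w. real_of_int (fst (\<zeta> 0 w)) \<partial>P) = 0"
    and \<zeta>_mean2: "(\<integral>w. real_of_int (snd (\<zeta> 0 w)) \<partial>P) = 0"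
    and s11: "s11 = (\<integral>w. (real_of_int (fst (\<zeta> 0 w)))\<^sup>2 \<partial>P)"
    and s22: "s22 = (\<integral>w. (real_of_int (snd (\<zeta> 0 w)))\<^sup>2 \<partial>P)"
    and s12: "s12 = (\<integral>w. real_of_int (fst (\<zeta> 0 w)) * real_of_int (snd (\<zeta> 0 w)) \<partial>P)"
    and nonsing: "s11 * s22 - s12\<^sup>2 \<noteq> 0"
    and aperiodic: "gen_subgroup {z. measure P {w\<in>space P. \<zeta> 0 w = z} > 0} = UNIV"
begin

definition "quad \<theta> = s11 * (fst \<theta>)\<^sup>2 + 2 * s12 * fst \<theta> * snd \<theta> + s22 * (snd \<theta>)\<^sup>2"

definition "\<phi> \<theta> = expectation (\<lambda>w. cis (dotp \<theta> (\<zeta> 0 w)))"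

lemma \<zeta>_meas [measurable]: "\<zeta> i \<in> P \<rightarrow>\<^sub>M count_space UNIV"
  using \<zeta>_indep by (auto simp: indep_vars_def)

lemma expectation_\<zeta>: "expectation (\<lambda>w. h (\<zeta> i w)) = expectation (\<lambda>w. h (\<zeta> 0 w))"
  for h :: "int \<times> int \<Rightarrow> 'b::{banach, second_countable_topology}"
proof -
  have "expectation (\<lambda>w. h (\<zeta> i w)) = integral\<^sup>L (distr P (count_space UNIV) (\<zeta> i)) h"
    by (subst integral_distr) auto
  also have "\<dots> = expectation (\<lambda>w. h (\<zeta> 0 w))"
    unfolding \<zeta>_ident[of i] by (subst integral_distr) auto
  finally show ?thesis .
qed

lemma \<zeta>_int1: "integrable P (\<lambda>w. real_of_int (fst (\<zeta> 0 w)))"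
  by (rule square_integrable_imp_integrable[OF _ \<zeta>_sq1]) measurable

lemma \<zeta>_int2: "integrable P (\<lambda>w. real_of_int (snd (\<zeta> 0 w)))"
  by (rule square_integrable_imp_integrable[OF _ \<zeta>_sq2]) measurable

lemma abs_mult_le_squares: "\<bar>a * b\<bar> \<le> a\<^sup>2 + (b::real)\<^sup>2"
proof -
  have "\<bar>a * b\<bar> = \<bar>a\<bar> * \<bar>b\<bar>" "0 \<le> \<bar>a\<bar> * \<bar>b\<bar>" by (auto simp: abs_mult)
  then show ?thesis using sum_squares_bound[of "\<bar>a\<bar>" "\<bar>b\<bar>"] by simp
qed

lemma \<zeta>_int12: "integrable P (\<lambda>w. real_of_int (fst (\<zeta> 0 w)) * real_of_int (snd (\<zeta> 0 w)))"
  by (rule Bochner_Integration.integrable_bound[OF Bochner_Integration.integrable_add[OF \<zeta>_sq1 \<zeta>_sq2]])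
     (auto intro!: AE_I2 abs_mult_le_squares)

lemma dotp_\<zeta>_int: "integrable P (\<lambda>w. dotp \<theta> (\<zeta> 0 w))"
  unfolding dotp_def by (intro Bochner_Integration.integrable_add integrable_mult_right \<zeta>_int1 \<zeta>_int2)

lemma dotp_\<zeta>_mean: "expectation (\<lambda>w. dotp \<theta> (\<zeta> 0 w)) = 0"
  unfolding dotp_def using \<zeta>_int1 \<zeta>_int2 \<zeta>_mean1 \<zeta>_mean2 by simp

lemma dotp_power2: "(dotp \<theta> z)\<^sup>2 = (fst \<theta>)\<^sup>2 * (real_of_int (fst z))\<^sup>2
   + 2 * fst \<theta> * snd \<theta> * (real_of_int (fst z) * real_of_int (snd z)) + (snd \<theta>)\<^sup>2 * (real_of_int (snd z))\<^sup>2"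
  by (simp add: dotp_def power2_eq_square algebra_simps)

lemma dotp_\<zeta>_sq_int: "integrable P (\<lambda>w. (dotp \<theta> (\<zeta> 0 w))\<^sup>2)"
  unfolding dotp_power2
  by (intro Bochner_Integration.integrable_add integrable_mult_right \<zeta>_sq1 \<zeta>_sq2 \<zeta>_int12)

lemma dotp_\<zeta>_sq: "expectation (\<lambda>w. (dotp \<theta> (\<zeta> 0 w))\<^sup>2) = quad \<theta>"
  unfolding dotp_power2 quad_def unfolding s11 s22 s12
  using \<zeta>_sq1 \<zeta>_sq2 \<zeta>_int12 by simp

lemma quad_nonneg: "quad \<theta> \<ge> 0"
  unfolding dotp_\<zeta>_sq[symmetric] by simp

lemma s11_nonneg: "s11 \<ge> 0" and s22_nonneg: "s22 \<ge> 0"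
  by (simp_all add: s11 s22)

lemma s11_pos: "s11 > 0"
proof (rule ccontr)
  assume "\<not> s11 > 0"
  then have "s11 = 0" using s11_nonneg by simp
  have "quad (x, 1) = s11 * x\<^sup>2 + 2 * s12 * x + s22" for x by (simp add: quad_def)
  then have *: "2 * s12 * x + s22 \<ge> 0" for x
    using quad_nonneg[of "(x, 1)"] \<open>s11 = 0\<close> by (metis add_0 mult_zero_left)
  \<comment> \<open>With \<open>s11 = 0\<close> the form is affine in the first coordinate, and an
    affine function that is nowhere negative is constant; at the point chosen here a nonconstant one
    would take the value -1.\<close>
  have "s12 = 0"
    using *[of "- (s22 + 1) / (2 * s12)"] by (cases "s12 = 0") (auto simp: field_simps)
  then show False using nonsing \<open>s11 = 0\<close> by simp
qed

text \<open>Evaluated at \<open>(s12, - s11)\<close> the covariance form equals \<open>s11\<close>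
  times the determinant.\<close>

lemma det_pos: "s11 * s22 - s12\<^sup>2 > 0"
proof -
  have "quad (s12, - s11) = s11 * (s11 * s22 - s12\<^sup>2)"
    by (simp add: quad_def power2_eq_square algebra_simps)
  then have "s11 * (s11 * s22 - s12\<^sup>2) \<ge> 0" using quad_nonneg[of "(s12, - s11)"] by simp
  then show ?thesis using s11_pos nonsing by (simp add: zero_le_mult_iff)
qed

lemma quad_le: "quad \<theta> \<le> (s11 + s22) * (norm \<theta>)\<^sup>2"
proof -
  have "quad \<theta> \<le> expectation (\<lambda>w. (norm \<theta>)\<^sup>2 * ((real_of_int (fst (\<zeta> 0 w)))\<^sup>2 + (real_of_int (snd (\<zeta> 0 w)))\<^sup>2))"
    unfolding dotp_\<zeta>_sq[symmetric]
    using \<zeta>_sq1 \<zeta>_sq2 by (intro integral_mono dotp_\<zeta>_sq_int dotp_power2_le) auto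
  also have "\<dots> = (s11 + s22) * (norm \<theta>)\<^sup>2"
    using \<zeta>_sq1 \<zeta>_sq2 by (simp add: s11 s22)
  finally show ?thesis .
qed

lemma cis_\<zeta>_int: "integrable P (\<lambda>w. cis (dotp \<theta> (\<zeta> i w)))"
  by (intro integrable_const_bound[where B=1]) auto

lemma norm_\<phi>_le: "cmod (\<phi> \<theta>) \<le> 1"
proof -
  have "cmod (\<phi> \<theta>) \<le> expectation (\<lambda>w. cmod (cis (dotp \<theta> (\<zeta> 0 w))))"
    unfolding \<phi>_def by (rule integral_norm_bound)
  then show ?thesis by (simp add: prob_space)
qed

lemma norm_\<phi>_minus_1_le: "cmod (\<phi> \<theta> - 1) \<le> quad \<theta> / 2"
proof -
  have int: "integrable P (\<lambda>w. \<i> * complex_of_real (dotp \<theta> (\<zeta> 0 w)))"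
    using dotp_\<zeta>_int by (intro integrable_mult_right integrable_of_real)
  have "expectation (\<lambda>w. cis (dotp \<theta> (\<zeta> 0 w)) - (1 + \<i> * dotp \<theta> (\<zeta> 0 w))) = \<phi> \<theta> - 1"
    using int cis_\<zeta>_int[of \<theta> 0] dotp_\<zeta>_int dotp_\<zeta>_mean by (simp add: \<phi>_def prob_space)
  then have "cmod (\<phi> \<theta> - 1) \<le> expectation (\<lambda>w. cmod (cis (dotp \<theta> (\<zeta> 0 w)) - (1 + \<i> * dotp \<theta> (\<zeta> 0 w))))"
    by (metis integral_norm_bound)
  also have "\<dots> \<le> expectation (\<lambda>w. (dotp \<theta> (\<zeta> 0 w))\<^sup>2 / 2)"
    using int cis_\<zeta>_int dotp_\<zeta>_sq_int
    by (intro integral_mono cis_approx) auto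
  also have "\<dots> = quad \<theta> / 2" by (simp add: dotp_\<zeta>_sq)
  finally show ?thesis .
qed

lemma Re_\<phi>: "Re (\<phi> \<theta>) = expectation (\<lambda>w. cos (dotp \<theta> (\<zeta> 0 w)))"
  unfolding \<phi>_def using cis_\<zeta>_int by (subst integral_Re[symmetric]) auto

lemma continuous_\<phi>: "continuous_on A \<phi>"
proof -
  have "continuous (at \<theta> within A) \<phi>" for \<theta>
    unfolding continuous_within tendsto_at_iff_sequentially comp_def
  proof (intro allI impI)
    fix X assume "(X \<longlonglongrightarrow> \<theta>)"
    then have "(\<lambda>n. cis (dotp (X n) z)) \<longlonglongrightarrow> cis (dotp \<theta> z)" for z
      unfolding dotp_def cis_conv_exp by (intro tendsto_intros)
    then show "(\<lambda>n. \<phi> (X n)) \<longlonglongrightarrow> \<phi> \<theta>"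
      unfolding \<phi>_def by (intro integral_dominated_convergence[where w = "\<lambda>_. 1"]) auto
  qed
  then show ?thesis by (simp add: continuous_on_eq_continuous_within)
qed

lemma \<phi>_measurable [measurable]: "\<phi> \<in> borel_measurable borel"
  by (intro borel_measurable_continuous_onI continuous_\<phi>)

text \<open>Only second moments are available, so the steps are truncated to a box of size
  \<open>R\<close>. For small \<theta> every remaining step has an inner product of modulus at most
  1, where \<open>1 - cos u\<close> dominates \<open>u^2 / 4\<close>. \<open>R\<close> is taken so
  large that the truncated covariance keeps half of the determinant.\<close>

lemma Re_\<phi>_local:
  obtains c \<delta> where "c > 0" "\<delta> > 0" "\<And>\<theta>. norm \<theta> \<le> \<delta> \<Longrightarrow> c * (norm \<theta>)\<^sup>2 \<le> 1 - Re (\<phi> \<theta>)"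
proof -
  define I where "I R z = (if \<bar>fst z\<bar> \<le> int R \<and> \<bar>snd z\<bar> \<le> int R then 1 else 0 :: real)" for R and z :: "int \<times> int"
  have I_meas [measurable]: "(\<lambda>w. I R (\<zeta> 0 w)) \<in> borel_measurable P" for R
    by (rule measurable_compose[OF \<zeta>_meas]) simp
  have I_le: "\<bar>I R z\<bar> \<le> 1" "0 \<le> I R z" "I R z \<le> 1" for R z by (auto simp: I_def)
  have I_lim: "(\<lambda>R. I R z * x) \<longlonglongrightarrow> x" for z x
  proof (rule tendsto_eventually)
    show "\<forall>\<^sub>F R in sequentially. I R z * x = x"
      using eventually_ge_at_top[of "nat (max \<bar>fst z\<bar> \<bar>snd z\<bar>)"] by eventually_elim (auto simp: I_def)
  qed
  define a where "a R = expectation (\<lambda>w. I R (\<zeta> 0 w) * (real_of_int (fst (\<zeta> 0 w)))\<^sup>2)" for R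
  define d where "d R = expectation (\<lambda>w. I R (\<zeta> 0 w) * (real_of_int (snd (\<zeta> 0 w)))\<^sup>2)" for R
  define b where "b R = expectation (\<lambda>w. I R (\<zeta> 0 w) * (real_of_int (fst (\<zeta> 0 w)) * real_of_int (snd (\<zeta> 0 w))))" for R
  have int: "integrable P (\<lambda>w. I R (\<zeta> 0 w) * (real_of_int (fst (\<zeta> 0 w)))\<^sup>2)"
     "integrable P (\<lambda>w. I R (\<zeta> 0 w) * (real_of_int (snd (\<zeta> 0 w)))\<^sup>2)"
     "integrable P (\<lambda>w. I R (\<zeta> 0 w) * (real_of_int (fst (\<zeta> 0 w)) * real_of_int (snd (\<zeta> 0 w))))" for R
    by (rule Bochner_Integration.integrable_bound[OF \<zeta>_sq1], measurable, simp add: abs_mult I_le mult_left_le_one_le)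
       (rule Bochner_Integration.integrable_bound[OF \<zeta>_sq2], measurable, simp add: abs_mult I_le mult_left_le_one_le,
        rule Bochner_Integration.integrable_bound[OF \<zeta>_int12], measurable, simp add: abs_mult I_le mult_left_le_one_le)
  have lim: "a \<longlonglongrightarrow> s11" "d \<longlonglongrightarrow> s22" "b \<longlonglongrightarrow> s12"
  proof -
    show "a \<longlonglongrightarrow> s11" unfolding a_def s11
      using \<zeta>_sq1 by (intro integral_dominated_convergence[where w = "\<lambda>w. (real_of_int (fst (\<zeta> 0 w)))\<^sup>2"])
        (auto intro!: I_lim simp: abs_mult I_le mult_left_le_one_le)
    show "d \<longlonglongrightarrow> s22" unfolding d_def s22
      using \<zeta>_sq2 by (intro integral_dominated_convergence[where w = "\<lambda>w. (real_of_int (snd (\<zeta> 0 w)))\<^sup>2"])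
        (auto intro!: I_lim simp: abs_mult I_le mult_left_le_one_le)
    show "b \<longlonglongrightarrow> s12" unfolding b_def s12
      using integrable_abs[OF \<zeta>_int12] by (intro integral_dominated_convergence[where w = "\<lambda>w. \<bar>real_of_int (fst (\<zeta> 0 w)) * real_of_int (snd (\<zeta> 0 w))\<bar>"])
        (auto intro!: I_lim simp: abs_mult I_le mult_left_le_one_le)
  qed
  let ?e = "s11 * s22 - s12\<^sup>2"
  have "(\<lambda>R. a R * d R - (b R)\<^sup>2) \<longlonglongrightarrow> ?e"
    by (intro tendsto_intros lim)
  then have "\<forall>\<^sub>F R in sequentially. a R * d R - (b R)\<^sup>2 > ?e / 2"
    using det_pos by (intro order_tendstoD) auto
  then obtain R where R: "a R * d R - (b R)\<^sup>2 > ?e / 2"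
    by (auto simp: eventually_sequentially)
  have ad: "0 \<le> a R" "0 \<le> d R" "a R \<le> s11" "d R \<le> s22"
    unfolding a_def d_def s11 s22 using int[of R] \<zeta>_sq1 \<zeta>_sq2
    by (auto intro!: integral_nonneg_AE integral_mono simp: I_def)
  \<comment> \<open>Half the determinant over the trace is a lower bound for the smallest eigenvalue
    of the truncated form; the final 4 is the constant of \<open>one_minus_cos_ge\<close>.\<close>
  define c where "c = ?e / 2 / (s11 + s22) / 4"
  have "c > 0" using det_pos s11_pos s22_nonneg by (simp add: c_def)
  \<comment> \<open>A truncated step changes the phase by at most \<open>2 * R\<close> times the
    norm of \<theta>; the added 1 covers \<open>R = 0\<close>.\<close>
  moreover have "1 / (2 * real R + 1) > 0" by simp
  moreover have "c * (norm \<theta>)\<^sup>2 \<le> 1 - Re (\<phi> \<theta>)" if "norm \<theta> \<le> 1 / (2 * real R + 1)" for \<theta>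
  proof -
    obtain x y where [simp]: "\<theta> = (x, y)" by force
    have small: "\<bar>dotp \<theta> z\<bar> \<le> 1" if "I R z \<noteq> 0" for z
    proof -
      have z: "\<bar>real_of_int (fst z)\<bar> \<le> real R" "\<bar>real_of_int (snd z)\<bar> \<le> real R"
        using that by (auto simp: I_def split: if_splits)
      have n: "\<bar>x\<bar> \<le> norm \<theta>" "\<bar>y\<bar> \<le> norm \<theta>"
        using norm_fst_le[of x y] norm_snd_le[of y x] by auto
      have "\<bar>dotp \<theta> z\<bar> \<le> \<bar>x\<bar> * \<bar>real_of_int (fst z)\<bar> + \<bar>y\<bar> * \<bar>real_of_int (snd z)\<bar>"
        by (simp add: dotp_def flip: abs_mult)
      also have "\<dots> \<le> norm \<theta> * real R + norm \<theta> * real R"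
        using z n by (intro add_mono mult_mono) auto
      also have "\<dots> \<le> norm \<theta> * (2 * real R + 1)" by (simp add: algebra_simps)
      also have "\<dots> \<le> 1" using \<open>norm \<theta> \<le> 1 / (2 * real R + 1)\<close> by (simp add: field_simps)
      finally show ?thesis .
    qed
    have trunc: "a R * x\<^sup>2 + 2 * b R * x * y + d R * y\<^sup>2 = expectation (\<lambda>w. I R (\<zeta> 0 w) * (dotp \<theta> (\<zeta> 0 w))\<^sup>2)"
    proof -
      have "I R z * (dotp \<theta> z)\<^sup>2 = x\<^sup>2 * (I R z * (real_of_int (fst z))\<^sup>2)
        + 2 * x * y * (I R z * (real_of_int (fst z) * real_of_int (snd z))) + y\<^sup>2 * (I R z * (real_of_int (snd z))\<^sup>2)" for z
        unfolding dotp_power2 by (simp add: algebra_simps)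
      then have "expectation (\<lambda>w. I R (\<zeta> 0 w) * (dotp \<theta> (\<zeta> 0 w))\<^sup>2) = x\<^sup>2 * a R + 2 * x * y * b R + y\<^sup>2 * d R"
        unfolding a_def b_def d_def using int[of R] by simp
      then show ?thesis by (simp add: algebra_simps)
    qed
    have "?e / 2 * (x\<^sup>2 + y\<^sup>2) \<le> (a R * d R - (b R)\<^sup>2) * (x\<^sup>2 + y\<^sup>2)"
      using R by (intro mult_right_mono) auto
    also have "\<dots> \<le> (a R + d R) * (a R * x\<^sup>2 + 2 * b R * x * y + d R * y\<^sup>2)"
      by (rule quadratic_form_lower)
    also have "\<dots> \<le> (s11 + s22) * (a R * x\<^sup>2 + 2 * b R * x * y + d R * y\<^sup>2)"
    proof (rule mult_right_mono)
      have "a R * x\<^sup>2 + 2 * b R * x * y + d R * y\<^sup>2 = expectation (\<lambda>w. I R (\<zeta> 0 w) * (dotp \<theta> (\<zeta> 0 w))\<^sup>2)"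
        by (rule trunc)
      also have "\<dots> \<ge> 0" by (intro integral_nonneg_AE) (auto simp: I_def)
      finally show "a R * x\<^sup>2 + 2 * b R * x * y + d R * y\<^sup>2 \<ge> 0" .
    qed (use ad in auto)
    also have "a R * x\<^sup>2 + 2 * b R * x * y + d R * y\<^sup>2 = expectation (\<lambda>w. I R (\<zeta> 0 w) * (dotp \<theta> (\<zeta> 0 w))\<^sup>2)"
      by (rule trunc)
    also have "\<dots> \<le> expectation (\<lambda>w. 4 * (1 - cos (dotp \<theta> (\<zeta> 0 w))))"
    proof (rule integral_mono)
      show "integrable P (\<lambda>w. I R (\<zeta> 0 w) * (dotp \<theta> (\<zeta> 0 w))\<^sup>2)"
        by (rule Bochner_Integration.integrable_bound[OF dotp_\<zeta>_sq_int[of \<theta>]]) (auto simp: abs_mult I_le mult_left_le_one_le)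
      have "norm (4 * (1 - v)) \<le> 8" if "-1 \<le> v" "v \<le> 1" for v :: real
        using that by (simp add: abs_le_iff)
      from this[OF cos_ge_minus_one cos_le_one] have "norm (4 * (1 - cos u)) \<le> 8" for u :: real .
      then show "integrable P (\<lambda>w. 4 * (1 - cos (dotp \<theta> (\<zeta> 0 w))))"
        by (intro integrable_const_bound[where B=8] AE_I2) measurable
      show "I R (\<zeta> 0 w) * (dotp \<theta> (\<zeta> 0 w))\<^sup>2 \<le> 4 * (1 - cos (dotp \<theta> (\<zeta> 0 w)))" for w
        using small[of "\<zeta> 0 w"] one_minus_cos_ge[of "dotp \<theta> (\<zeta> 0 w)"]
        by (cases "I R (\<zeta> 0 w) = 0") (auto simp: I_def split: if_splits)
    qed
    also have "\<dots> = 4 * (1 - Re (\<phi> \<theta>))"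
    proof -
      have "integrable P (\<lambda>w. cos (dotp \<theta> (\<zeta> 0 w)))"
        by (intro integrable_const_bound[where B=1]) auto
      then show ?thesis by (simp add: Re_\<phi> prob_space)
    qed
    finally have *: "?e / 2 * (x\<^sup>2 + y\<^sup>2) \<le> (s11 + s22) * (4 * (1 - Re (\<phi> \<theta>)))"
      using s11_pos s22_nonneg by simp
    have "x\<^sup>2 + y\<^sup>2 = (norm \<theta>)\<^sup>2" by (simp add: norm_Pair)
    then show ?thesis
      using * s11_pos s22_nonneg unfolding c_def by (simp add: field_simps)
  qed
  ultimately show ?thesis using that by blast
qed

text \<open>Expanding the squared modulus around 1 leaves \<open>1 - 2 * (1 - Re)\<close> plus the
  square of the distance from 1. That distance is itself quadratic in \<theta>, so the last term is
  of fourth order and is absorbed near the origin.\<close>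

lemma norm_\<phi>_local:
  obtains c \<delta> where "c > 0" "\<delta> > 0" "\<And>\<theta>. norm \<theta> \<le> \<delta> \<Longrightarrow> cmod (\<phi> \<theta>) \<le> exp (- c * (norm \<theta>)\<^sup>2)"
proof -
  obtain c \<delta> where c: "c > 0" "\<delta> > 0" and loc: "\<And>\<theta>. norm \<theta> \<le> \<delta> \<Longrightarrow> c * (norm \<theta>)\<^sup>2 \<le> 1 - Re (\<phi> \<theta>)"
    using Re_\<phi>_local by blast
  define C where "C = (s11 + s22) / 2"
  have C: "C > 0" using s11_pos s22_nonneg by (simp add: C_def)
  \<comment> \<open>The second radius makes the fourth-order term \<open>(C * r)^2\<close> at most
    \<open>c * r\<close>, where \<open>r\<close> is the squared norm of \<theta>.\<close>
  define \<delta>' where "\<delta>' = min \<delta> (sqrt c / C)"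
  have "\<delta>' > 0" using c C by (simp add: \<delta>'_def)
  moreover have "cmod (\<phi> \<theta>) \<le> exp (- (c / 2) * (norm \<theta>)\<^sup>2)" if "norm \<theta> \<le> \<delta>'" for \<theta>
  proof -
    let ?r = "(norm \<theta>)\<^sup>2"
    have r: "C * norm \<theta> \<le> sqrt c" using that C by (simp add: \<delta>'_def field_simps)
    have "(C * norm \<theta>)\<^sup>2 \<le> c" using power_mono[OF r, of 2] c C by simp
    then have r2: "C\<^sup>2 * ?r \<le> c" by (simp add: power_mult_distrib)
    have "(cmod (\<phi> \<theta>))\<^sup>2 = 1 - 2 * (1 - Re (\<phi> \<theta>)) + (cmod (\<phi> \<theta> - 1))\<^sup>2"
      unfolding cmod_power2 by (simp add: power2_eq_square algebra_simps)
    also have "\<dots> \<le> 1 - 2 * (c * ?r) + (C * ?r)\<^sup>2"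
    proof -
      have "cmod (\<phi> \<theta> - 1) \<le> C * ?r"
        using norm_\<phi>_minus_1_le[of \<theta>] quad_le[of \<theta>] by (simp add: C_def)
      then have "(cmod (\<phi> \<theta> - 1))\<^sup>2 \<le> (C * ?r)\<^sup>2" by (intro power_mono) auto
      then show ?thesis using loc[of \<theta>] that by (simp add: \<delta>'_def)
    qed
    also have "\<dots> \<le> 1 - c * ?r"
      using mult_right_mono[OF r2, of ?r] by (simp add: power2_eq_square algebra_simps)
    also have "\<dots> \<le> exp (- (c * ?r))" using exp_ge_add_one_self[of "- (c * ?r)"] by simp
    also have "\<dots> = (exp (- (c / 2) * ?r))\<^sup>2" by (simp add: exp_double[symmetric] power2_eq_square flip: exp_add)
    finally show ?thesis by (rule power2_le_imp_le) simp
  qed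
  ultimately show ?thesis using that[of "c / 2" \<delta>'] c by auto
qed

end

section \<open>Fourier inversion and the decay of transition probabilities\<close>

context planar_walk
begin

lemma walk_meas [measurable]: "(\<lambda>w. \<Sum>h\<in>A. \<zeta> h w) \<in> P \<rightarrow>\<^sub>M count_space UNIV"
proof (induction A rule: infinite_finite_induct)
  case (insert x F)
  have "(\<lambda>w. (\<zeta> x w, \<Sum>h\<in>F. \<zeta> h w)) \<in> P \<rightarrow>\<^sub>M (count_space UNIV \<Otimes>\<^sub>M count_space UNIV)"
    using insert by measurable
  then have "(\<lambda>w. (\<zeta> x w, \<Sum>h\<in>F. \<zeta> h w)) \<in> P \<rightarrow>\<^sub>M count_space UNIV"
    by (simp add: pair_measure_countable)
  from measurable_compose[OF this, of "\<lambda>p. fst p + snd p" "count_space UNIV"] insert show ?case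
    by simp
qed auto

lemma char_sum:
  assumes "finite A"
  shows "expectation (\<lambda>w. cis (dotp \<theta> (\<Sum>h\<in>A. \<zeta> h w))) = \<phi> \<theta> ^ card A"
proof -
  have "expectation (\<lambda>w. cis (dotp \<theta> (\<Sum>h\<in>A. \<zeta> h w))) = expectation (\<lambda>w. \<Prod>h\<in>A. cis (dotp \<theta> (\<zeta> h w)))"
    using assms by (simp add: dotp_sum cis_conv_exp sum_distrib_left exp_sum)
  also have "\<dots> = (\<Prod>h\<in>A. expectation (\<lambda>w. cis (dotp \<theta> (\<zeta> h w))))"
  proof (rule indep_vars_lebesgue_integral[OF assms])
    show "indep_vars (\<lambda>_. borel) (\<lambda>h w. cis (dotp \<theta> (\<zeta> h w))) A"
      by (rule indep_vars_compose2[OF indep_vars_subset[OF \<zeta>_indep subset_UNIV]]) auto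
  qed (rule cis_\<zeta>_int)
  also have "\<dots> = \<phi> \<theta> ^ card A"
    unfolding \<phi>_def by (subst expectation_\<zeta>) simp
  finally show ?thesis .
qed

text \<open>The orthogonality relation \<open>integral_cis_torus\<close> integrated against the law
  of the increment; all integrands have modulus 1, so Fubini applies. An arbitrary finite set of
  times is allowed in order to cover increments over any interval.\<close>

lemma prob_walk:
  assumes "finite A"
  shows "complex_of_real (prob {w\<in>space P. (\<Sum>h\<in>A. \<zeta> h w) = z}) = (\<integral>\<theta>. cis (- dotp \<theta> z) * \<phi> \<theta> ^ card A \<partial>torus)"
proof -
  interpret pair_sigma_finite P torus ..
  interpret PT: pair_prob_space P torus ..
  let ?S = "\<lambda>w. \<Sum>h\<in>A. \<zeta> h w"
  have [measurable]: "(\<lambda>p. dotp (snd p) (?S (fst p))) \<in> borel_measurable (P \<Otimes>\<^sub>M torus)"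
  proof -
    have [measurable]: "(\<lambda>w. real_of_int (fst (?S w))) \<in> borel_measurable P" "(\<lambda>w. real_of_int (snd (?S w))) \<in> borel_measurable P"
      by (rule measurable_compose[OF walk_meas]; simp)+
    have [measurable]: "(\<lambda>\<theta>::real\<times>real. fst \<theta>) \<in> borel_measurable torus" "(\<lambda>\<theta>::real\<times>real. snd \<theta>) \<in> borel_measurable torus"
      by (simp_all add: measurable_cong_sets[OF sets_torus refl] borel_measurable_continuous_onI continuous_on_fst continuous_on_snd continuous_on_id)
    show ?thesis unfolding dotp_def by measurable
  qed
  have int: "integrable (P \<Otimes>\<^sub>M torus) (\<lambda>p. cis (dotp (snd p) (?S (fst p) - z)))"
    by (intro PT.integrable_const_bound[where B=1]) auto
  have "(\<integral>\<theta>. cis (- dotp \<theta> z) * \<phi> \<theta> ^ card A \<partial>torus) = (\<integral>\<theta>. \<integral>w. cis (dotp \<theta> (?S w - z)) \<partial>P \<partial>torus)"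
  proof (rule Bochner_Integration.integral_cong[OF refl])
    fix \<theta>
    have "(\<integral>w. cis (dotp \<theta> (?S w - z)) \<partial>P) = (\<integral>w. cis (- dotp \<theta> z) * cis (dotp \<theta> (?S w)) \<partial>P)"
      by (simp add: cis_mult algebra_simps)
    also have "\<dots> = cis (- dotp \<theta> z) * \<phi> \<theta> ^ card A"
      by (simp add: char_sum[OF assms, symmetric])
    finally show "cis (- dotp \<theta> z) * \<phi> \<theta> ^ card A = (\<integral>w. cis (dotp \<theta> (?S w - z)) \<partial>P)" by simp
  qed
  also have "\<dots> = (\<integral>w. \<integral>\<theta>. cis (dotp \<theta> (?S w - z)) \<partial>torus \<partial>P)"
    using Fubini_integral[of "\<lambda>w \<theta>. cis (dotp \<theta> (?S w - z))"] int by (simp add: case_prod_beta')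
  also have "\<dots> = (\<integral>w. complex_of_real (indicator {w\<in>space P. ?S w = z} w) \<partial>P)"
    unfolding integral_cis_torus by (intro Bochner_Integration.integral_cong) (auto simp: indicator_def)
  also have "\<dots> = complex_of_real (\<integral>w. indicator {w\<in>space P. ?S w = z} w \<partial>P)"
    by (rule integral_complex_of_real)
  also have "\<dots> = complex_of_real (prob {w\<in>space P. ?S w = z})"
    by (subst Bochner_Integration.integral_indicator) (auto simp: Int_def intro!: arg_cong[where f = prob])
  finally show ?thesis by simp
qed

definition "step_prob k z = prob {w\<in>space P. (\<Sum>h<k. \<zeta> h w) = z}"

lemma step_prob_fourier: "complex_of_real (step_prob k z) = (\<integral>\<theta>. cis (- dotp \<theta> z) * \<phi> \<theta> ^ k \<partial>torus)"
  unfolding step_prob_def by (subst prob_walk) auto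

lemma prob_walk_eq: "finite A \<Longrightarrow> prob {w\<in>space P. (\<Sum>h\<in>A. \<zeta> h w) = z} = step_prob (card A) z"
  using prob_walk[of A z] step_prob_fourier[of "card A" z] by (metis of_real_eq_iff)

text \<open>The equality case of the triangle inequality for the expectation: the mean square
  distance from \<open>Z\<close> to its mean expands to \<open>2 - 2 = 0\<close>.\<close>

lemma AE_eq_of_norm_expectation_1:
  fixes Z :: "'o \<Rightarrow> complex"
  assumes [measurable]: "Z \<in> borel_measurable P" and Z: "\<And>w. w \<in> space P \<Longrightarrow> cmod (Z w) = 1"
    and m: "cmod (expectation Z) = 1"
  shows "AE w in P. Z w = expectation Z"
proof -
  let ?m = "expectation Z"
  have intZ: "integrable P Z" by (intro integrable_const_bound[where B=1]) (auto simp: Z)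
  have eq: "(cmod (Z w - ?m))\<^sup>2 = 2 - 2 * Re (cnj ?m * Z w)" if "w \<in> space P" for w
  proof -
    have "(cmod (Z w - ?m))\<^sup>2 = (cmod (Z w))\<^sup>2 + (cmod ?m)\<^sup>2 - 2 * Re (cnj ?m * Z w)"
      unfolding cmod_power2 by (simp add: power2_eq_square algebra_simps)
    then show ?thesis using Z[OF that] m by simp
  qed
  have int: "integrable P (\<lambda>w. (cmod (Z w - ?m))\<^sup>2)"
  proof (subst Bochner_Integration.integrable_cong[OF refl eq])
    show "integrable P (\<lambda>w. 2 - 2 * Re (cnj ?m * Z w))"
      using intZ by (intro Bochner_Integration.integrable_diff integrable_mult_right integrable_Re) auto
  qed auto
  have "expectation (\<lambda>w. (cmod (Z w - ?m))\<^sup>2) = expectation (\<lambda>w. 2 - 2 * Re (cnj ?m * Z w))"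
    by (intro Bochner_Integration.integral_cong refl eq)
  also have "\<dots> = 2 - 2 * Re (cnj ?m * ?m)"
    using intZ by (simp add: prob_space integral_Re[symmetric] del: Re_complex_of_real times_complex.simps)
  also have "cnj ?m * ?m = 1"
    using m by (metis complex_norm_square mult.commute of_real_1 one_power2)
  finally have "expectation (\<lambda>w. (cmod (Z w - ?m))\<^sup>2) = 0" by simp
  then have "AE w in P. (cmod (Z w - ?m))\<^sup>2 = 0"
    using integral_nonneg_eq_0_iff_AE[OF int] by simp
  then show ?thesis by eventually_elim simp
qed

text \<open>Where the modulus is 1, the character of a step is almost surely constant and factors
  out. For a periodic walk such points exist away from the origin, and this relation carries the
  decay at the origin over to them.\<close>

lemma \<phi>_shift:
  assumes "cmod (\<phi> \<theta>) = 1"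
  shows "\<phi> (\<theta> + h) = \<phi> \<theta> * \<phi> h"
proof -
  have "AE w in P. cis (dotp \<theta> (\<zeta> 0 w)) = \<phi> \<theta>"
    unfolding \<phi>_def using assms by (intro AE_eq_of_norm_expectation_1) (auto simp: \<phi>_def)
  then have "\<phi> (\<theta> + h) = expectation (\<lambda>w. \<phi> \<theta> * cis (dotp h (\<zeta> 0 w)))"
    unfolding \<phi>_def[of "\<theta> + h"]
    by (intro integral_cong_AE) (auto simp: cis_mult[symmetric])
  also have "\<dots> = \<phi> \<theta> * \<phi> h" by (simp add: \<phi>_def)
  finally show ?thesis .
qed

text \<open>The lattice points at which the character of \<theta> equals 1 form a subgroup that
  contains the support of the step. Aperiodicity makes it the whole lattice, and the two unit
  vectors then force both coordinates to vanish.\<close>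

lemma \<phi>_eq_1_imp:
  assumes "\<phi> \<theta> = 1" and box: "\<theta> \<in> torus_box"
  shows "\<theta> = 0"
proof -
  have AE: "AE w in P. cis (dotp \<theta> (\<zeta> 0 w)) = 1"
    using AE_eq_of_norm_expectation_1[of "\<lambda>w. cis (dotp \<theta> (\<zeta> 0 w))"] assms(1) by (simp add: \<phi>_def)
  let ?H = "{z. cis (dotp \<theta> z) = 1}"
  have "{z. prob {w\<in>space P. \<zeta> 0 w = z} > 0} \<subseteq> ?H"
  proof
    fix z assume "z \<in> {z. prob {w\<in>space P. \<zeta> 0 w = z} > 0}"
    then have "\<not> (AE w in P. w \<notin> {w\<in>space P. \<zeta> 0 w = z})"
      using prob_eq_0[of "{w\<in>space P. \<zeta> 0 w = z}"] by simp
    moreover have "AE w in P. w \<notin> {w\<in>space P. \<zeta> 0 w = z}" if "z \<notin> ?H"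
      using AE by eventually_elim (use that in auto)
    ultimately show "z \<in> ?H" by blast
  qed
  then have "gen_subgroup {z. prob {w\<in>space P. \<zeta> 0 w = z} > 0} \<subseteq> ?H"
    unfolding gen_subgroup_def
    by (intro Inter_lower) (auto simp: cis_divide[symmetric] cis_zero)
  then have H: "cis (dotp \<theta> z) = 1" for z unfolding aperiodic by auto
  have "x = 0" if "cis x = 1" "x \<in> {-pi..pi}" for x
  proof -
    have "cos x = 1" using that(1) by (metis cis.sel(1) one_complex.sel(1))
    then obtain n :: int where "x = n * 2 * pi" using cos_one_2pi_int by auto
    with that(2) have "pi * (2 * real_of_int n) \<le> pi * 1" "pi * (-1) \<le> pi * (2 * real_of_int n)"
      by (auto simp: algebra_simps)
    then have "2 * real_of_int n \<le> 1" "-1 \<le> 2 * real_of_int n"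
      by (simp_all only: mult_le_cancel_left_pos[OF pi_gt_zero])
    then have "n = 0" by linarith
    then show ?thesis using \<open>x = n * 2 * pi\<close> by simp
  qed
  from this[of "fst \<theta>"] this[of "snd \<theta>"] H[of "(1, 0)"] H[of "(0, 1)"] box show ?thesis
    by (auto simp: dotp_def torus_box_def prod_eq_iff)
qed

text \<open>The local bound settles a neighbourhood of the origin. Outside it the continuous
  function \<open>1 - Re\<close> attains its minimum on a compact set, and a minimum of 0 would mean
  that \<phi> equals 1 there, since its modulus is at most 1.\<close>

lemma Re_\<phi>_lower:
  obtains c where "c > 0" "\<And>\<theta>. \<theta> \<in> torus_box \<Longrightarrow> c * (norm \<theta>)\<^sup>2 \<le> 1 - Re (\<phi> \<theta>)"
proof -
  obtain c \<delta> where c: "c > 0" "\<delta> > 0" and loc: "\<And>\<theta>. norm \<theta> \<le> \<delta> \<Longrightarrow> c * (norm \<theta>)\<^sup>2 \<le> 1 - Re (\<phi> \<theta>)"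
    using Re_\<phi>_local by blast
  define K where "K = torus_box - ball 0 \<delta>"
  have "compact K" unfolding K_def by (intro compact_diff closed_torus_box) auto
  show ?thesis
  proof (cases "K = {}")
    case True
    then show ?thesis using that[OF c(1)] loc by (force simp: K_def)
  next
    case False
    have "continuous_on K (\<lambda>\<theta>. 1 - Re (\<phi> \<theta>))" by (intro continuous_intros continuous_\<phi>)
    then obtain \<theta>0 where \<theta>0: "\<theta>0 \<in> K" and min: "\<And>\<theta>. \<theta> \<in> K \<Longrightarrow> 1 - Re (\<phi> \<theta>0) \<le> 1 - Re (\<phi> \<theta>)"
      using continuous_attains_inf[OF \<open>compact K\<close> False] by blast
    define m where "m = 1 - Re (\<phi> \<theta>0)"
    have "\<phi> \<theta>0 \<noteq> 1" using \<phi>_eq_1_imp[of \<theta>0] \<theta>0 c by (auto simp: K_def)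
    have "m > 0"
    proof (rule ccontr)
      assume "\<not> m > 0"
      then have "Re (\<phi> \<theta>0) \<ge> 1" by (simp add: m_def)
      then have "Re (\<phi> \<theta>0) = 1" using norm_\<phi>_le[of \<theta>0] abs_Re_le_cmod[of "\<phi> \<theta>0"] by linarith
      moreover have "Im (\<phi> \<theta>0) = 0"
      proof -
        have "(cmod (\<phi> \<theta>0))\<^sup>2 \<le> 1" using norm_\<phi>_le[of \<theta>0] by (simp add: power_le_one)
        then show ?thesis using calculation by (simp add: cmod_power2)
      qed
      ultimately show False using \<open>\<phi> \<theta>0 \<noteq> 1\<close> by (simp add: complex_eq_iff)
    qed
    obtain B where B: "B > 0" "\<And>\<theta>. \<theta> \<in> torus_box \<Longrightarrow> norm \<theta> \<le> B"
      using compact_imp_bounded[OF closed_torus_box] bounded_pos by blast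
    define c' where "c' = min c (m / B\<^sup>2)"
    have "c' > 0" using c \<open>m > 0\<close> B by (simp add: c'_def)
    moreover have "c' * (norm \<theta>)\<^sup>2 \<le> 1 - Re (\<phi> \<theta>)" if \<theta>: "\<theta> \<in> torus_box" for \<theta>
    proof (cases "norm \<theta> < \<delta>")
      case True
      have "c' * (norm \<theta>)\<^sup>2 \<le> c * (norm \<theta>)\<^sup>2" by (intro mult_right_mono) (auto simp: c'_def)
      then show ?thesis using loc[of \<theta>] True by simp
    next
      case False
      have "c' * (norm \<theta>)\<^sup>2 \<le> (m / B\<^sup>2) * B\<^sup>2"
        using B \<theta> \<open>m > 0\<close> by (intro mult_mono power_mono) (auto simp: c'_def)
      also have "\<dots> = m" using B by simp
      also have "\<dots> \<le> 1 - Re (\<phi> \<theta>)"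
        using min[of \<theta>] \<theta> False by (auto simp: m_def K_def)
      finally show ?thesis .
    qed
    ultimately show ?thesis using that by blast
  qed
qed

text \<open>Two kinds of points occur. Where the modulus is below 1, the powers decay geometrically
  nearby. Where it equals 1, \<open>\<phi>_shift\<close> gives Gaussian decay around the point, and
  the planar Gaussian integral is of order \<open>1 / k\<close>.\<close>

lemma integral_\<phi>_power_local:
  obtains r K where "r > 0" "\<And>k. (\<integral>\<theta>. indicator (ball \<theta>0 r) \<theta> * cmod (\<phi> \<theta>) ^ k \<partial>torus) \<le> K / (real k + 1)"
proof (cases "cmod (\<phi> \<theta>0) = 1")
  case False
  then have less: "cmod (\<phi> \<theta>0) < 1" using norm_\<phi>_le[of \<theta>0] by simp
  define \<rho> where "\<rho> = (cmod (\<phi> \<theta>0) + 1) / 2"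
  have \<rho>: "cmod (\<phi> \<theta>0) < \<rho>" "\<rho> < 1" "0 < \<rho>" using less by (auto simp: \<rho>_def add_nonneg_pos)
  have "isCont (\<lambda>\<theta>. cmod (\<phi> \<theta>)) \<theta>0"
    using continuous_\<phi>[of UNIV] continuous_on_eq_continuous_at[OF open_UNIV, of \<phi>]
    by (intro continuous_intros) blast
  then obtain r where r: "r > 0" "\<And>\<theta>. dist \<theta> \<theta>0 < r \<Longrightarrow> dist (cmod (\<phi> \<theta>)) (cmod (\<phi> \<theta>0)) < \<rho> - cmod (\<phi> \<theta>0)"
    using \<rho>(1) unfolding continuous_at_eps_delta by (metis diff_gt_0_iff_gt)
  then have r: "r > 0" "\<And>\<theta>. dist \<theta> \<theta>0 < r \<Longrightarrow> cmod (\<phi> \<theta>) < \<rho>"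
    by (auto simp: dist_real_def abs_less_iff)
  have "(\<integral>\<theta>. indicator (ball \<theta>0 r) \<theta> * cmod (\<phi> \<theta>) ^ k \<partial>torus) \<le> (1 / (1 - \<rho>)) / (real k + 1)" for k
  proof -
    have "(\<integral>\<theta>. indicator (ball \<theta>0 r) \<theta> * cmod (\<phi> \<theta>) ^ k \<partial>torus) \<le> (\<integral>\<theta>. \<rho> ^ k \<partial>torus)"
    proof (rule integral_mono)
      show "integrable torus (\<lambda>\<theta>. indicator (ball \<theta>0 r) \<theta> * cmod (\<phi> \<theta>) ^ k)"
        by (intro torus.integrable_const_bound[where B=1])
          (auto simp: indicator_def norm_\<phi>_le power_le_one)
      show "indicator (ball \<theta>0 r) \<theta> * cmod (\<phi> \<theta>) ^ k \<le> \<rho> ^ k" for \<theta>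
        using r(2)[of \<theta>] \<rho> by (auto simp: indicator_def dist_commute less_imp_le intro!: power_mono)
    qed auto
    also have "\<dots> = \<rho> ^ k" using torus.prob_space by simp
    also have "\<dots> \<le> (1 / (1 - \<rho>)) / (real k + 1)"
    proof -
      \<comment> \<open>A decreasing sequence is bounded by its averages, so the convergence of the
        geometric series gives the factor \<open>1 / (k + 1)\<close>.\<close>
      have "(real k + 1) * \<rho> ^ k = (\<Sum>j\<le>k. \<rho> ^ k)" by simp
      also have "\<dots> \<le> (\<Sum>j\<le>k. \<rho> ^ j)" using \<rho> by (intro sum_mono power_decreasing) auto
      also have "\<dots> = (1 - \<rho> ^ Suc k) / (1 - \<rho>)" using \<rho> sum_gp_basic[of \<rho> k] by (simp add: field_simps)
      also have "\<dots> \<le> 1 / (1 - \<rho>)" using \<rho> by (intro divide_right_mono) auto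
      finally show ?thesis by (subst pos_le_divide_eq) (auto simp: mult.commute)
    qed
    finally show ?thesis .
  qed
  then show ?thesis using that[OF r(1)] by blast
next
  case True
  obtain c \<delta> where c: "c > 0" "\<delta> > 0" and loc: "\<And>\<theta>. norm \<theta> \<le> \<delta> \<Longrightarrow> cmod (\<phi> \<theta>) \<le> exp (- c * (norm \<theta>)\<^sup>2)"
    using norm_\<phi>_local by blast
  have "(\<integral>\<theta>. indicator (ball \<theta>0 \<delta>) \<theta> * cmod (\<phi> \<theta>) ^ k \<partial>torus) \<le> (1 + 1 / c) / (real k + 1)" for k
  proof (cases "k = 0")
    case True
    have "(\<integral>\<theta>. indicator (ball \<theta>0 \<delta>) \<theta> * cmod (\<phi> \<theta>) ^ k \<partial>torus) \<le> (\<integral>\<theta>. 1 \<partial>torus)"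
      using True by (intro integral_mono' ) (auto simp: indicator_def)
    also have "\<dots> = 1" using torus.prob_space by simp
    also have "\<dots> \<le> (1 + 1 / c) / (real k + 1)" using c True by simp
    finally show ?thesis .
  next
    case False
    define a where "a = c * real k"
    have a: "a > 0" using c False by (simp add: a_def)
    have gauss: "integrable lborel (\<lambda>\<theta>::real \<times> real. exp (- a * (norm \<theta>)\<^sup>2))"
      "(\<integral>\<theta>. exp (- a * (norm \<theta>)\<^sup>2) \<partial>(lborel :: (real \<times> real) measure)) = pi / a"
    proof -
      have *: "- a * (norm \<theta>)\<^sup>2 = - (a * (fst \<theta>)\<^sup>2 + 2 * 0 * fst \<theta> * snd \<theta> + a * (snd \<theta>)\<^sup>2)" for \<theta> :: "real \<times> real"
        by (cases \<theta>) (simp add: norm_Pair algebra_simps)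
      show "integrable lborel (\<lambda>\<theta>::real \<times> real. exp (- a * (norm \<theta>)\<^sup>2))"
        unfolding * using a by (intro integral_gaussian_plane) auto
      show "(\<integral>\<theta>. exp (- a * (norm \<theta>)\<^sup>2) \<partial>(lborel :: (real \<times> real) measure)) = pi / a"
        unfolding * using a by (subst integral_gaussian_plane) (auto simp: power2_eq_square)
    qed
    have shift: "integrable lborel (\<lambda>\<theta>::real \<times> real. exp (- a * (norm (\<theta> - \<theta>0))\<^sup>2))"
      "(\<integral>\<theta>. exp (- a * (norm (\<theta> - \<theta>0))\<^sup>2) \<partial>(lborel :: (real \<times> real) measure)) = pi / a"
    proof -
      have d: "distr lborel borel ((+) (- \<theta>0)) = lborel" by (rule lborel_distr_plus)
      have [measurable]: "(\<lambda>\<theta>::real \<times> real. exp (- a * (norm \<theta>)\<^sup>2)) \<in> borel_measurable borel" by measurable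
      have "integrable (distr lborel borel ((+) (- \<theta>0))) (\<lambda>\<theta>. exp (- a * (norm \<theta>)\<^sup>2))"
        unfolding d by (rule gauss)
      then show "integrable lborel (\<lambda>\<theta>::real \<times> real. exp (- a * (norm (\<theta> - \<theta>0))\<^sup>2))"
        by (subst (asm) integrable_distr_eq) auto
      have "(\<integral>\<theta>. exp (- a * (norm \<theta>)\<^sup>2) \<partial>distr lborel borel ((+) (- \<theta>0))) = pi / a"
        unfolding d by (rule gauss)
      then show "(\<integral>\<theta>. exp (- a * (norm (\<theta> - \<theta>0))\<^sup>2) \<partial>(lborel :: (real \<times> real) measure)) = pi / a"
        by (subst (asm) integral_distr) auto
    qed
    have bound: "cmod (\<phi> \<theta>) ^ k \<le> exp (- a * (norm (\<theta> - \<theta>0))\<^sup>2)" if "\<theta> \<in> ball \<theta>0 \<delta>" for \<theta>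
    proof -
      have "cmod (\<phi> \<theta>) = cmod (\<phi> (\<theta> - \<theta>0))"
        using \<phi>_shift[OF True, of "\<theta> - \<theta>0"] True by (simp add: norm_mult)
      also have "\<dots> \<le> exp (- c * (norm (\<theta> - \<theta>0))\<^sup>2)"
        using that by (intro loc) (auto simp: dist_norm norm_minus_commute)
      finally have "cmod (\<phi> \<theta>) ^ k \<le> exp (- c * (norm (\<theta> - \<theta>0))\<^sup>2) ^ k" by (intro power_mono) auto
      also have "\<dots> = exp (- a * (norm (\<theta> - \<theta>0))\<^sup>2)" by (simp add: exp_of_nat_mult[symmetric] a_def algebra_simps)
      finally show ?thesis .
    qed
    have "(\<integral>\<theta>. indicator (ball \<theta>0 \<delta>) \<theta> * cmod (\<phi> \<theta>) ^ k \<partial>torus)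
      = (1 / (4 * pi\<^sup>2)) * (\<integral>\<theta>. indicator torus_box \<theta> * (indicator (ball \<theta>0 \<delta>) \<theta> * cmod (\<phi> \<theta>) ^ k) \<partial>lborel)"
      by (subst integral_torus, rule borel_measurable_times[OF borel_measurable_indicator]) auto
    also have "\<dots> \<le> (1 / (4 * pi\<^sup>2)) * (\<integral>\<theta>. exp (- a * (norm (\<theta> - \<theta>0))\<^sup>2) \<partial>lborel)"
      using bound by (intro mult_left_mono integral_mono' shift) (auto simp: indicator_def)
    also have "\<dots> = 1 / (4 * pi * a)" unfolding shift by (simp add: power2_eq_square)
    also have "\<dots> \<le> 1 / (2 * a)"
      using a pi_gt3 by (intro divide_left_mono mult_pos_pos mult_right_mono) auto
    also have "\<dots> \<le> (1 + 1 / c) / (real k + 1)"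
    proof -
      have "1 / (2 * a) = (1 / c) / (2 * real k)" by (simp add: a_def)
      also have "\<dots> \<le> (1 + 1 / c) / (real k + 1)" using c False by (intro frac_le) auto
      finally show ?thesis .
    qed
    finally show ?thesis .
  qed
  then show ?thesis using that[OF c(2)] by blast
qed

text \<open>Finitely many of the local balls cover the compact box, and their bounds add up. Points
  of modulus 1 other than the origin are included, so the bound also holds for periodic
  walks.\<close>

lemma integral_\<phi>_power:
  obtains K where "K > 0" "\<And>k. (\<integral>\<theta>. cmod (\<phi> \<theta>) ^ k \<partial>torus) \<le> K / (real k + 1)"
proof -
  have "\<forall>\<theta>0. \<exists>r K. r > 0 \<and> (\<forall>k. (\<integral>\<theta>. indicator (ball \<theta>0 r) \<theta> * cmod (\<phi> \<theta>) ^ k \<partial>torus) \<le> K / (real k + 1))"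
    using integral_\<phi>_power_local by metis
  then obtain r K where r: "\<And>\<theta>0. r \<theta>0 > 0"
    and K: "\<And>\<theta>0 k. (\<integral>\<theta>. indicator (ball \<theta>0 (r \<theta>0)) \<theta> * cmod (\<phi> \<theta>) ^ k \<partial>torus) \<le> K \<theta>0 / (real k + 1)"
    by metis
  obtain D where D: "finite D" "torus_box \<subseteq> (\<Union>\<theta>0\<in>D. ball \<theta>0 (r \<theta>0))"
  proof (rule compactE_image[OF closed_torus_box, of torus_box "\<lambda>\<theta>0. ball \<theta>0 (r \<theta>0)"])
    show "torus_box \<subseteq> (\<Union>c\<in>torus_box. ball c (r c))" using r by auto
  qed (use that in auto)
  have int: "integrable torus (\<lambda>\<theta>. indicator (ball \<theta>0 r) \<theta> * cmod (\<phi> \<theta>) ^ k)" for \<theta>0 r k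
    by (intro torus.integrable_const_bound[where B=1])
      (auto simp: indicator_def norm_\<phi>_le power_le_one)
  have "(\<integral>\<theta>. cmod (\<phi> \<theta>) ^ k \<partial>torus) \<le> (\<Sum>\<theta>0\<in>D. K \<theta>0) / (real k + 1)" for k
  proof -
    have "(\<integral>\<theta>. cmod (\<phi> \<theta>) ^ k \<partial>torus) \<le> (\<integral>\<theta>. (\<Sum>\<theta>0\<in>D. indicator (ball \<theta>0 (r \<theta>0)) \<theta> * cmod (\<phi> \<theta>) ^ k) \<partial>torus)"
    proof (rule integral_mono_AE)
      show "integrable torus (\<lambda>\<theta>. cmod (\<phi> \<theta>) ^ k)"
        by (intro torus.integrable_const_bound[where B=1]) (auto simp: norm_\<phi>_le power_le_one)
      show "integrable torus (\<lambda>\<theta>. \<Sum>\<theta>0\<in>D. indicator (ball \<theta>0 (r \<theta>0)) \<theta> * cmod (\<phi> \<theta>) ^ k)"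
        by (intro Bochner_Integration.integrable_sum int)
      show "AE \<theta> in torus. cmod (\<phi> \<theta>) ^ k \<le> (\<Sum>\<theta>0\<in>D. indicator (ball \<theta>0 (r \<theta>0)) \<theta> * cmod (\<phi> \<theta>) ^ k)"
        using AE_torus
      proof eventually_elim
        case (elim \<theta>)
        then obtain \<theta>0 where "\<theta>0 \<in> D" "\<theta> \<in> ball \<theta>0 (r \<theta>0)" using D by auto
        then show ?case
          using D(1) by (intro order_trans[OF _ member_le_sum[of \<theta>0 D]]) auto
      qed
    qed
    also have "\<dots> = (\<Sum>\<theta>0\<in>D. \<integral>\<theta>. indicator (ball \<theta>0 (r \<theta>0)) \<theta> * cmod (\<phi> \<theta>) ^ k \<partial>torus)"
      by (intro Bochner_Integration.integral_sum int)
    also have "\<dots> \<le> (\<Sum>\<theta>0\<in>D. K \<theta>0) / (real k + 1)"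
      unfolding sum_divide_distrib by (intro sum_mono K)
    finally show ?thesis .
  qed
  then have "(\<integral>\<theta>. cmod (\<phi> \<theta>) ^ k \<partial>torus) \<le> max 1 (\<Sum>\<theta>0\<in>D. K \<theta>0) / (real k + 1)" for k
    by (rule order_trans) (auto intro!: divide_right_mono)
  then show ?thesis using that[of "max 1 (\<Sum>\<theta>0\<in>D. K \<theta>0)"] by auto
qed

lemma step_prob_nonneg: "step_prob k z \<ge> 0" by (simp add: step_prob_def)

lemma step_prob_bound:
  obtains K where "K > 0" "\<And>k z. step_prob k z \<le> K / (real k + 1)"
proof -
  obtain K where K: "K > 0" "\<And>k. (\<integral>\<theta>. cmod (\<phi> \<theta>) ^ k \<partial>torus) \<le> K / (real k + 1)"
    using integral_\<phi>_power by blast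
  have "step_prob k z \<le> K / (real k + 1)" for k z
  proof -
    have "step_prob k z = cmod (complex_of_real (step_prob k z))" by (simp add: step_prob_nonneg)
    also have "\<dots> \<le> (\<integral>\<theta>. cmod (cis (- dotp \<theta> z) * \<phi> \<theta> ^ k) \<partial>torus)"
      unfolding step_prob_fourier by (rule integral_norm_bound)
    also have "\<dots> = (\<integral>\<theta>. cmod (\<phi> \<theta>) ^ k \<partial>torus)" by (simp add: norm_mult norm_power)
    finally show ?thesis using K(2)[of k] by simp
  qed
  then show ?thesis using that K(1) by blast
qed

end

section \<open>Association of independent variables\<close>

text \<open>Two monotone functions move in the same direction, so
  \<open>(u y - u x) * (v y - v x)\<close> is never negative. Integrating over two independent
  copies gives twice the covariance.\<close>

lemma chebyshev_association:
  fixes u v :: "'a::linorder \<Rightarrow> real"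
  assumes "prob_space M" and [measurable]: "u \<in> borel_measurable M" "v \<in> borel_measurable M"
    and mono: "\<And>x y. x \<in> space M \<Longrightarrow> y \<in> space M \<Longrightarrow> x \<le> y \<Longrightarrow> u x \<le> u y \<and> v x \<le> v y"
    and bd: "\<And>x. x \<in> space M \<Longrightarrow> \<bar>u x\<bar> \<le> B \<and> \<bar>v x\<bar> \<le> B"
  shows "(\<integral>x. u x \<partial>M) * (\<integral>x. v x \<partial>M) \<le> (\<integral>x. u x * v x \<partial>M)"
proof -
  interpret prob_space M by fact
  have "B \<ge> 0" using bd not_empty by force
  have iu: "integrable M u" and iv: "integrable M v"
    using bd by (auto intro!: integrable_const_bound[where B=B])
  have iuv: "integrable M (\<lambda>x. u x * v x)"
    using bd \<open>B \<ge> 0\<close> by (intro integrable_const_bound[where B="B*B"]) (auto simp: abs_mult intro!: mult_mono)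
  have *: "(u y - u x) * (v y - v x) \<ge> 0" if "x \<in> space M" "y \<in> space M" for x y
    using mono[of x y] mono[of y x] that by (cases "x \<le> y") (auto simp: mult_nonpos_nonpos)
  have "0 \<le> (\<integral>x. \<integral>y. (u y - u x) * (v y - v x) \<partial>M \<partial>M)"
    by (intro integral_nonneg_AE AE_I2) (auto intro!: integral_nonneg_AE AE_I2 *)
  also have "\<dots> = (\<integral>x. (\<integral>y. u y * v y \<partial>M) - (\<integral>y. u y \<partial>M) * v x - (\<integral>y. v y \<partial>M) * u x + u x * v x \<partial>M)"
    using iu iv iuv by (simp add: algebra_simps prob_space)
  also have "\<dots> = 2 * ((\<integral>x. u x * v x \<partial>M) - (\<integral>x. u x \<partial>M) * (\<integral>x. v x \<partial>M))"
    using iu iv iuv by (simp add: algebra_simps prob_space)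
  finally show ?thesis by simp
qed

text \<open>Induction on the coordinates. Integrating out one coordinate preserves monotonicity, so
  the induction hypothesis applies to the partial integrals, and
  \<open>chebyshev_association\<close> handles the remaining coordinate for each fixed value of the
  others.\<close>

lemma harris_bounded:
  fixes M :: "'i \<Rightarrow> real measure" and f g :: "('i \<Rightarrow> real) \<Rightarrow> real"
  assumes fin: "finite I" and M: "\<And>i. prob_space (M i)" "\<And>i. sets (M i) = sets borel"
    and meas: "f \<in> borel_measurable (PiM I M)" "g \<in> borel_measurable (PiM I M)"
    and mono: "\<And>x y. x \<in> space (PiM I M) \<Longrightarrow> y \<in> space (PiM I M) \<Longrightarrow> (\<And>i. i \<in> I \<Longrightarrow> x i \<le> y i) \<Longrightarrow> f x \<le> f y \<and> g x \<le> g y"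
    and bd: "\<And>x. x \<in> space (PiM I M) \<Longrightarrow> \<bar>f x\<bar> \<le> B \<and> \<bar>g x\<bar> \<le> B"
  shows "(\<integral>x. f x \<partial>PiM I M) * (\<integral>x. g x \<partial>PiM I M) \<le> (\<integral>x. f x * g x \<partial>PiM I M)"
  using fin meas mono bd
proof (induction I arbitrary: f g rule: finite_induct)
  case empty
  have "integral\<^sup>L (PiM {} M) h = h (\<lambda>_. undefined)" for h :: "('i \<Rightarrow> real) \<Rightarrow> real"
    unfolding PiM_empty by (subst lebesgue_integral_count_space_finite) auto
  from this[of f] this[of g] this[of "\<lambda>x. f x * g x"] show ?case
    by simp
next
  case (insert i I)
  interpret prob_space "M j" for j by (rule M)
  interpret product_sigma_finite M by (simp add: product_sigma_finite.intro prob_space_imp_sigma_finite M)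
  have sp [simp]: "space (M j) = UNIV" for j using sets_eq_imp_space_eq[OF M(2)] by simp
  have ps: "prob_space (PiM J M)" for J by (intro prob_space_PiM M)
  interpret P: prob_space "PiM J M" for J by (rule ps)
  have "undefined \<in> space (PiM (insert i I) M)" "B \<ge> 0" if "space (PiM (insert i I) M) \<noteq> {}" "B < 0"
    using insert.prems(4) that by fastforce+
  then have B: "B \<ge> 0" using P.not_empty[of "insert i I"] by fastforce
  have upd: "x(i := y) \<in> space (PiM (insert i I) M)" if "x \<in> space (PiM I M)" for x y
    using that by (auto simp: space_PiM PiE_def extensional_def)
  have [measurable]: "(\<lambda>y. x(i := y)) \<in> M i \<rightarrow>\<^sub>M PiM (insert i I) M" if "x \<in> space (PiM I M)" for x
    using that by measurable
  note [measurable] = insert.prems(1,2)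
  have mx: "(\<lambda>y. h (x(i := y))) \<in> borel_measurable (M i)" if "x \<in> space (PiM I M)" "h \<in> borel_measurable (PiM (insert i I) M)" for x h
    using that by measurable
  have "(\<lambda>(x, y). x(i := y)) \<in> PiM I M \<Otimes>\<^sub>M M i \<rightarrow>\<^sub>M PiM (insert i I) M"
    using measurable_add_dim by (simp add: case_prod_beta)
  then have mI: "(\<lambda>x. \<integral>y. h (x(i := y)) \<partial>M i) \<in> borel_measurable (PiM I M)"
    if "h \<in> borel_measurable (PiM (insert i I) M)" for h :: "_ \<Rightarrow> real"
    using that by (intro borel_measurable_lebesgue_integral) (simp add: measurable_compose case_prod_beta')
  have int: "integrable (PiM (insert i I) M) f" "integrable (PiM (insert i I) M) g"
    using insert.prems(4) by (auto intro!: P.integrable_const_bound[where B=B])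
  have int2: "integrable (PiM (insert i I) M) (\<lambda>x. f x * g x)"
    using insert.prems(4) B by (intro P.integrable_const_bound[where B="B*B"]) (auto simp: abs_mult intro!: mult_mono)
  have int3: "integrable (M i) (\<lambda>y. f (x(i := y)))" "integrable (M i) (\<lambda>y. g (x(i := y)))" if "x \<in> space (PiM I M)" for x
    using insert.prems(4)[OF upd[OF that]] mx[OF that insert.prems(1)] mx[OF that insert.prems(2)]
    by (auto intro!: integrable_const_bound[where B=B] AE_I2 simp del: fun_upd_apply)
  define F where "F x = (\<integral>y. f (x(i := y)) \<partial>M i)" for x
  define G where "G x = (\<integral>y. g (x(i := y)) \<partial>M i)" for x
  have mono': "F x \<le> F x' \<and> G x \<le> G x'"
    if "x \<in> space (PiM I M)" "x' \<in> space (PiM I M)" "\<And>j. j \<in> I \<Longrightarrow> x j \<le> x' j" for x x'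
  proof -
    have "f (x(i := y)) \<le> f (x'(i := y)) \<and> g (x(i := y)) \<le> g (x'(i := y))" for y
      by (rule insert.prems(3)[OF upd[OF that(1)] upd[OF that(2)]]) (use that(3) in auto)
    then show ?thesis
      unfolding F_def G_def using that(1,2) by (auto intro!: integral_mono int3)
  qed
  have bd': "\<bar>F x\<bar> \<le> B \<and> \<bar>G x\<bar> \<le> B" if "x \<in> space (PiM I M)" for x
  proof -
    have "\<bar>\<integral>y. h y \<partial>M i\<bar> \<le> B" if "\<And>y. \<bar>h y\<bar> \<le> B" "integrable (M i) h" for h :: "real \<Rightarrow> real"
    proof -
      have "\<bar>\<integral>y. h y \<partial>M i\<bar> \<le> (\<integral>y. \<bar>h y\<bar> \<partial>M i)" by (rule integral_abs_bound)
      also have "\<dots> \<le> (\<integral>y. B \<partial>M i)" using that by (intro integral_mono) auto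
      finally show ?thesis using prob_space[of i] by simp
    qed
    from this[OF _ int3(1)[OF that]] this[OF _ int3(2)[OF that]] show ?thesis
      unfolding F_def G_def using insert.prems(4)[OF upd[OF that]] by auto
  qed
  have "(\<integral>x. f x \<partial>PiM (insert i I) M) * (\<integral>x. g x \<partial>PiM (insert i I) M) = (\<integral>x. F x \<partial>PiM I M) * (\<integral>x. G x \<partial>PiM I M)"
    unfolding F_def G_def
    by (simp only: product_integral_insert[OF insert.hyps(1,2) int(1)] product_integral_insert[OF insert.hyps(1,2) int(2)])
  also have "\<dots> \<le> (\<integral>x. F x * G x \<partial>PiM I M)"
    using mI[OF insert.prems(1)] mI[OF insert.prems(2)] mono' bd' by (intro insert.IH) (auto simp: F_def G_def)
  also have "\<dots> \<le> (\<integral>x. (\<integral>y. f (x(i := y)) * g (x(i := y)) \<partial>M i) \<partial>PiM I M)"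
  proof (rule integral_mono)
    have [measurable]: "F \<in> borel_measurable (PiM I M)" "G \<in> borel_measurable (PiM I M)"
      using mI[OF insert.prems(1)] mI[OF insert.prems(2)] by (auto simp: F_def[abs_def] G_def[abs_def])
    show "integrable (PiM I M) (\<lambda>x. F x * G x)"
      using bd' B by (intro P.integrable_const_bound[where B="B*B"]) (auto simp: abs_mult intro!: mult_mono)
    show "integrable (PiM I M) (\<lambda>x. \<integral>y. f (x(i := y)) * g (x(i := y)) \<partial>M i)"
    proof (rule P.integrable_const_bound[where B="B*B"])
      show "AE x in PiM I M. norm (\<integral>y. f (x(i := y)) * g (x(i := y)) \<partial>M i) \<le> B * B"
      proof (rule AE_I2)
        fix x assume x: "x \<in> space (PiM I M)"
        have b: "\<bar>f (x(i := y)) * g (x(i := y))\<bar> \<le> B * B" for y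
          using insert.prems(4)[OF upd[OF x]] B by (auto simp: abs_mult simp del: fun_upd_apply intro!: mult_mono)
        have "norm (\<integral>y. f (x(i := y)) * g (x(i := y)) \<partial>M i) \<le> (\<integral>y. norm (f (x(i := y)) * g (x(i := y))) \<partial>M i)"
          by (rule integral_norm_bound)
        also have "\<dots> \<le> (\<integral>y. B * B \<partial>M i)"
          using b mx[OF x] by (intro integral_mono' ) (auto)
        finally show "norm (\<integral>y. f (x(i := y)) * g (x(i := y)) \<partial>M i) \<le> B * B"
          using prob_space[of i] by simp
      qed
    qed (use mI[of "\<lambda>x. f x * g x"] in auto)
    fix x assume x: "x \<in> space (PiM I M)"
    show "F x * G x \<le> (\<integral>y. f (x(i := y)) * g (x(i := y)) \<partial>M i)"
      unfolding F_def G_def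
    proof (rule chebyshev_association[OF M(1), where B=B])
      show "(\<lambda>y. f (x(i := y))) \<in> borel_measurable (M i)" "(\<lambda>y. g (x(i := y))) \<in> borel_measurable (M i)"
        by (rule mx[OF x insert.prems(1)], rule mx[OF x insert.prems(2)])
      show "f (x(i := y)) \<le> f (x(i := y')) \<and> g (x(i := y)) \<le> g (x(i := y'))" if "y \<le> y'" for y y'
        by (rule insert.prems(3)[OF upd[OF x] upd[OF x]]) (use that in auto)
      show "\<bar>f (x(i := y))\<bar> \<le> B \<and> \<bar>g (x(i := y))\<bar> \<le> B" for y
        by (rule insert.prems(4)[OF upd[OF x]])
    qed
  qed
  also have "\<dots> = (\<integral>x. f x * g x \<partial>PiM (insert i I) M)"
    by (rule product_integral_insert[OF insert.hyps(1,2) int2, symmetric])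
  finally show ?case .
qed

lemma clip_tendsto: "(\<lambda>k. max (- real k) (min (real k) x)) \<longlonglongrightarrow> x"
proof (rule tendsto_eventually)
  have "\<forall>\<^sub>F k in sequentially. \<bar>x\<bar> \<le> real k"
    using eventually_ge_at_top[of "nat \<lceil>\<bar>x\<bar>\<rceil>"] by eventually_elim linarith
  then show "\<forall>\<^sub>F k in sequentially. max (- real k) (min (real k) x) = x"
    by eventually_elim auto
qed

text \<open>Clipping at \<open>k\<close> is monotone, so it preserves the hypotheses of the bounded
  case; the clipped integrals converge by dominated convergence, with square integrability
  dominating the product.\<close>

lemma harris:
  fixes M :: "'i \<Rightarrow> real measure" and f g :: "('i \<Rightarrow> real) \<Rightarrow> real"
  assumes fin: "finite I" and M: "\<And>i. prob_space (M i)" "\<And>i. sets (M i) = sets borel"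
    and meas: "f \<in> borel_measurable (PiM I M)" "g \<in> borel_measurable (PiM I M)"
    and mono: "\<And>x y. x \<in> space (PiM I M) \<Longrightarrow> y \<in> space (PiM I M) \<Longrightarrow> (\<And>i. i \<in> I \<Longrightarrow> x i \<le> y i) \<Longrightarrow> f x \<le> f y \<and> g x \<le> g y"
    and int: "integrable (PiM I M) (\<lambda>x. (f x)\<^sup>2)" "integrable (PiM I M) (\<lambda>x. (g x)\<^sup>2)"
  shows "(\<integral>x. f x \<partial>PiM I M) * (\<integral>x. g x \<partial>PiM I M) \<le> (\<integral>x. f x * g x \<partial>PiM I M)"
proof -
  interpret P: prob_space "PiM I M" by (intro prob_space_PiM M)
  note [measurable] = meas
  define c where "c k x = max (- real k) (min (real k) x)" for k and x :: real
  have c_le: "\<bar>c k x\<bar> \<le> \<bar>x\<bar>" for k x by (auto simp: c_def)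
  have [measurable]: "c k \<in> borel_measurable borel" for k unfolding c_def by measurable
  have c_lim: "(\<lambda>k. c k x) \<longlonglongrightarrow> x" for x using clip_tendsto[of x] by (simp add: c_def)
  have int1: "integrable (PiM I M) f" "integrable (PiM I M) g"
    by (rule P.square_integrable_imp_integrable[OF meas(1) int(1)])
       (rule P.square_integrable_imp_integrable[OF meas(2) int(2)])
  have int2: "integrable (PiM I M) (\<lambda>x. \<bar>f x\<bar> * \<bar>g x\<bar>)"
  proof (rule Bochner_Integration.integrable_bound[OF Bochner_Integration.integrable_add[OF int]])
    have "\<bar>a\<bar> * \<bar>b\<bar> \<le> a\<^sup>2 + b\<^sup>2" for a b :: real
      using sum_squares_bound[of "\<bar>a\<bar>" "\<bar>b\<bar>"] mult_nonneg_nonneg[of "\<bar>a\<bar>" "\<bar>b\<bar>"]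
      unfolding power2_abs by linarith
    then show "AE x in PiM I M. norm (\<bar>f x\<bar> * \<bar>g x\<bar>) \<le> norm ((f x)\<^sup>2 + (g x)\<^sup>2)"
      by (auto simp: abs_mult)
  qed auto
  have "(\<integral>x. c k (f x) \<partial>PiM I M) * (\<integral>x. c k (g x) \<partial>PiM I M) \<le> (\<integral>x. c k (f x) * c k (g x) \<partial>PiM I M)" for k
  proof (rule harris_bounded[OF fin M, where B = "real k"])
    fix x y assume "x \<in> space (PiM I M)" "y \<in> space (PiM I M)" "\<And>i. i \<in> I \<Longrightarrow> x i \<le> y i"
    from mono[OF this] show "c k (f x) \<le> c k (f y) \<and> c k (g x) \<le> c k (g y)"
      by (auto simp: c_def)
  qed (auto simp: c_def)
  moreover have "(\<lambda>k. \<integral>x. c k (f x) \<partial>PiM I M) \<longlonglongrightarrow> (\<integral>x. f x \<partial>PiM I M)"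
    using int1 c_lim c_le by (intro integral_dominated_convergence[where w = "\<lambda>x. \<bar>f x\<bar>"]) auto
  moreover have "(\<lambda>k. \<integral>x. c k (g x) \<partial>PiM I M) \<longlonglongrightarrow> (\<integral>x. g x \<partial>PiM I M)"
    using int1 c_lim c_le by (intro integral_dominated_convergence[where w = "\<lambda>x. \<bar>g x\<bar>"]) auto
  moreover have "(\<lambda>k. \<integral>x. c k (f x) * c k (g x) \<partial>PiM I M) \<longlonglongrightarrow> (\<integral>x. f x * g x \<partial>PiM I M)"
    using int2 c_lim c_le
    by (intro integral_dominated_convergence[where w = "\<lambda>x. \<bar>f x\<bar> * \<bar>g x\<bar>"])
       (auto intro!: tendsto_mult mult_mono simp: abs_mult)
  ultimately show ?thesis
    by (intro LIMSEQ_le[OF tendsto_mult]) auto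
qed

lemma (in prob_space) associated_indep_vars:
  fixes X :: "'i \<Rightarrow> 'a \<Rightarrow> real" and f g :: "('i \<Rightarrow> real) \<Rightarrow> real"
  assumes ind: "indep_vars (\<lambda>_. borel) X I" and fin: "finite I"
    and meas: "f \<in> borel_measurable (PiM I (\<lambda>_. borel))" "g \<in> borel_measurable (PiM I (\<lambda>_. borel))"
    and mono: "\<And>x y. (\<And>i. i \<in> I \<Longrightarrow> x i \<le> y i) \<Longrightarrow> f x \<le> f y \<and> g x \<le> g y"
    and int: "integrable M (\<lambda>\<omega>. (f (\<lambda>i\<in>I. X i \<omega>))\<^sup>2)" "integrable M (\<lambda>\<omega>. (g (\<lambda>i\<in>I. X i \<omega>))\<^sup>2)"
  shows "expectation (\<lambda>\<omega>. f (\<lambda>i\<in>I. X i \<omega>)) * expectation (\<lambda>\<omega>. g (\<lambda>i\<in>I. X i \<omega>))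
    \<le> expectation (\<lambda>\<omega>. f (\<lambda>i\<in>I. X i \<omega>) * g (\<lambda>i\<in>I. X i \<omega>))"
proof -
  \<comment> \<open>\<open>harris\<close> asks for a probability measure at every index; outside
    \<open>I\<close> a point mass serves as a filler.\<close>
  define N where "N i = (if i \<in> I then distr M borel (X i) else return borel (0::real))" for i
  have rv: "random_variable borel (X i)" if "i \<in> I" for i
    using ind that by (auto simp: indep_vars_def)
  have N: "prob_space (N i)" "sets (N i) = sets borel" for i
    using rv[of i] by (auto simp: N_def prob_space_distr prob_space_return)
  have [measurable]: "(\<lambda>\<omega>. \<lambda>i\<in>I. X i \<omega>) \<in> M \<rightarrow>\<^sub>M PiM I (\<lambda>_. borel)"
    using rv by (intro measurable_restrict)
  have D: "distr M (PiM I (\<lambda>_. borel)) (\<lambda>\<omega>. \<lambda>i\<in>I. X i \<omega>) = PiM I N"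
  proof (cases "I = {}")
    case False
    show ?thesis
      using indep_vars_iff_distr_eq_PiM'[OF False rv] ind by (auto simp: N_def intro!: PiM_cong)
  next
    case True
    \<comment> \<open>The characterisation of independence by product measures assumes a nonempty
      index set. With no coordinates both sides are the unit mass on a one-point space.\<close>
    interpret D: prob_space "distr M (PiM {} (\<lambda>_. borel::real measure)) (\<lambda>\<omega>. \<lambda>i\<in>{}. X i \<omega>)"
      using rv unfolding True by (intro prob_space_distr measurable_restrict) auto
    show ?thesis unfolding True
      apply (rule measure_eqI)
       apply (simp add: sets_PiM_empty)
      using D.emeasure_space_1
      by (auto simp: sets_PiM_empty space_PiM emeasure_PiM_empty)
  qed
  have sets: "sets (PiM I N) = sets (PiM I (\<lambda>_. borel))"
    by (intro sets_PiM_cong N) auto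
  note [measurable] = meas
  have meas': "f \<in> borel_measurable (PiM I N)" "g \<in> borel_measurable (PiM I N)"
    using meas by (auto simp: measurable_cong_sets[OF sets refl])
  have "(\<integral>x. f x \<partial>PiM I N) * (\<integral>x. g x \<partial>PiM I N) \<le> (\<integral>x. f x * g x \<partial>PiM I N)"
  proof (rule harris[OF fin N meas'])
    show "integrable (PiM I N) (\<lambda>x. (f x)\<^sup>2)" "integrable (PiM I N) (\<lambda>x. (g x)\<^sup>2)"
      unfolding D[symmetric] using int by (auto simp: integrable_distr_eq)
  qed (use mono in auto)
  then show ?thesis
    unfolding D[symmetric] by (simp add: integral_distr)
qed

section \<open>Asymptotics of the Green function\<close>

lemma log_series_sums:
  assumes "0 \<le> l" "l < (1::real)"
  shows "(\<lambda>k. l ^ k / real k) sums (- ln (1 - l))"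
  using sums_minus[OF ln_series'[of "- l"]] assms by simp

text \<open>An Abelian theorem on the logarithmic scale: \<open>b k\<close> is compared with
  \<open>c / k\<close>, whose Abel sum is exactly \<open>- ln (1 - l)\<close>. The finitely many
  early terms stay bounded while the logarithm diverges.\<close>

lemma abel_log:
  fixes b l :: "nat \<Rightarrow> real"
  assumes b: "(\<lambda>k. real k * b k) \<longlonglongrightarrow> c"
    and l: "\<And>n. 0 \<le> l n" "\<And>n. l n < 1" "l \<longlonglongrightarrow> 1"
  shows "(\<lambda>n. (\<Sum>k. l n ^ k * b k) / (- ln (1 - l n))) \<longlonglongrightarrow> c"
proof -
  define L where "L n = - ln (1 - l n)" for n
  have L_top: "filterlim L at_top sequentially"
  proof -
    have "(\<lambda>n. 1 - l n) \<longlonglongrightarrow> 0" using tendsto_diff[OF tendsto_const l(3), of 1] by simp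
    then have "filterlim (\<lambda>n. 1 - l n) (at_right 0) sequentially"
      using l by (auto simp: filterlim_at less_imp_neq[OF l(2)])
    then show ?thesis unfolding L_def
      by (intro filterlim_compose[OF filterlim_uminus_at_top_at_bot] filterlim_compose[OF ln_at_0])
  qed
  have sum_b: "summable (\<lambda>k. l n ^ k * b k)" for n
  proof -
    obtain B where B: "\<And>k. \<bar>real k * b k\<bar> \<le> B"
      using convergent_imp_Bseq[OF convergentI[OF b]] by (auto simp: Bseq_def)
    have B': "\<bar>b k\<bar> \<le> B + \<bar>b 0\<bar>" for k
    proof (cases "k = 0")
      case False
      have "\<bar>b k\<bar> \<le> real k * \<bar>b k\<bar>" using False by (simp add: mult_le_cancel_right1)
      then show ?thesis using B[of k] by (simp add: abs_mult)
    qed (use B[of 0] in auto)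
    show ?thesis
    proof (rule summable_comparison_test'[where g = "\<lambda>k. l n ^ k * (B + \<bar>b 0\<bar>)"])
      show "summable (\<lambda>k. l n ^ k * (B + \<bar>b 0\<bar>))"
        using l(1,2)[of n] by (intro summable_mult2 summable_geometric) auto
      show "norm (l n ^ k * b k) \<le> l n ^ k * (B + \<bar>b 0\<bar>)" for k
        using B'[of k] l(1)[of n] by (auto simp: abs_mult intro!: mult_left_mono)
    qed
  qed
  have key: "\<exists>C. \<forall>n. \<bar>(\<Sum>k. l n ^ k * b k) - c * L n\<bar> \<le> C + e * L n" if e: "e > 0" for e
  proof -
    obtain N where N: "\<And>k. k \<ge> N \<Longrightarrow> \<bar>real k * b k - c\<bar> < e"
      using LIMSEQ_D[OF b e] by auto
    \<comment> \<open>Collects the indices at which \<open>b\<close> is not yet close to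
      \<open>c / k\<close>, including \<open>k = 0\<close>, where the quotient is 0 by
      convention.\<close>
    define C where "C = (\<Sum>k\<le>N. \<bar>b k - c / real k\<bar>)"
    have "\<bar>(\<Sum>k. l n ^ k * b k) - c * L n\<bar> \<le> C + e * L n" for n
    proof -
      have s1: "(\<lambda>k. l n ^ k * b k - c * (l n ^ k / real k)) sums ((\<Sum>k. l n ^ k * b k) - c * L n)"
        unfolding L_def using l by (intro sums_diff summable_sums sum_b sums_mult log_series_sums) auto
      have s2: "(\<lambda>k. (if k \<in> {..N} then \<bar>b k - c / real k\<bar> else 0) + e * (l n ^ k / real k)) sums (C + e * L n)"
        unfolding L_def C_def using l by (intro sums_add sums_If_finite_set sums_mult log_series_sums) auto
      have "norm (l n ^ k * b k - c * (l n ^ k / real k)) \<le> (if k \<in> {..N} then \<bar>b k - c / real k\<bar> else 0) + e * (l n ^ k / real k)" for k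
      proof -
        have *: "l n ^ k * b k - c * (l n ^ k / real k) = l n ^ k * (b k - c / real k)" by (simp add: algebra_simps)
        have lk: "0 \<le> l n ^ k" "l n ^ k \<le> 1" using l(1,2)[of n] by (simp, intro power_le_one) auto
        show ?thesis
        proof (cases "k \<le> N")
          case True
          have "l n ^ k * \<bar>b k - c / real k\<bar> \<le> 1 * \<bar>b k - c / real k\<bar>" using lk by (intro mult_right_mono) auto
          moreover have "0 \<le> e * (l n ^ k / real k)" using e lk by simp
          ultimately show ?thesis using True lk unfolding * by (simp add: abs_mult)
        next
          case False
          then have k: "k > 0" by simp
          have "b k - c / real k = (real k * b k - c) / real k"
            using k by (simp add: field_simps)
          then have "\<bar>b k - c / real k\<bar> = \<bar>real k * b k - c\<bar> / real k"
            by (simp only: abs_divide abs_of_nat)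
          also have "\<dots> \<le> e / real k" using N[of k] False by (intro divide_right_mono) auto
          finally have "l n ^ k * \<bar>b k - c / real k\<bar> \<le> l n ^ k * (e / real k)" using lk by (intro mult_left_mono)
          then show ?thesis using False lk unfolding * by (simp add: abs_mult mult_ac)
        qed
      qed
      from norm_suminf_le[OF this sums_summable[OF s2]] show ?thesis
        using sums_unique[OF s1] sums_unique[OF s2] by simp
    qed
    then show ?thesis by blast
  qed
  show ?thesis
  proof (rule LIMSEQ_I)
    fix r :: real assume r: "r > 0"
    obtain C where C: "\<And>n. \<bar>(\<Sum>k. l n ^ k * b k) - c * L n\<bar> \<le> C + (r / 2) * L n"
      using key[of "r / 2"] r by auto
    have "\<forall>\<^sub>F n in sequentially. L n > max 1 (2 * C / r)"
      using L_top unfolding filterlim_at_top_dense by blast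
    then obtain n0 where n0: "\<And>n. n \<ge> n0 \<Longrightarrow> L n > max 1 (2 * C / r)"
      by (auto simp: eventually_sequentially)
    have "norm ((\<Sum>k. l n ^ k * b k) / L n - c) < r" if "n \<ge> n0" for n
    proof -
      have Ln: "L n > 1" "L n > 2 * C / r" using n0[OF that] by auto
      have "(\<Sum>k. l n ^ k * b k) / L n - c = ((\<Sum>k. l n ^ k * b k) - c * L n) / L n"
        using Ln by (simp add: field_simps)
      then have "norm ((\<Sum>k. l n ^ k * b k) / L n - c) = \<bar>(\<Sum>k. l n ^ k * b k) - c * L n\<bar> / L n"
        using Ln by (simp add: abs_divide)
      also have "\<dots> \<le> (C + (r / 2) * L n) / L n"
        using C[of n] Ln by (intro divide_right_mono) auto
      also have "\<dots> < r" using Ln r by (simp add: field_simps)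
      finally show ?thesis .
    qed
    then show "\<exists>no. \<forall>n\<ge>no. norm ((\<Sum>k. l n ^ k * b k) / (- ln (1 - l n)) - c) < r"
      unfolding L_def by blast
  qed
qed

text \<open>The geometric series under the integral; both functions have modulus at most 1, so the
  terms are dominated by \<open>l ^ k\<close>.\<close>

lemma integral_power_series:
  fixes f \<psi> :: "'a \<Rightarrow> complex" and l :: real
  assumes "prob_space M" and [measurable]: "f \<in> borel_measurable M" "\<psi> \<in> borel_measurable M"
    and f: "\<And>x. cmod (f x) \<le> 1" and \<psi>: "\<And>x. cmod (\<psi> x) \<le> 1" and l: "0 \<le> l" "l < 1"
  shows "(\<lambda>k. l ^ k * (\<integral>x. f x * \<psi> x ^ k \<partial>M)) sums (\<integral>x. f x / (1 - l * \<psi> x) \<partial>M)"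
proof -
  interpret prob_space M by fact
  have le: "cmod (of_real l ^ k * (f x * \<psi> x ^ k)) \<le> l ^ k" for k x
    using l f[of x] \<psi>[of x]
    by (auto simp: norm_mult norm_power intro!: mult_left_le mult_le_one power_le_one)
  have int: "integrable M (\<lambda>x. of_real l ^ k * (f x * \<psi> x ^ k))" for k
    by (rule integrable_const_bound[where B = "l ^ k"]) (use le in auto)
  have geo: "(\<lambda>k. of_real l ^ k * (f x * \<psi> x ^ k)) sums (f x / (1 - l * \<psi> x))" for x
  proof -
    have "cmod (of_real l * \<psi> x) \<le> l * 1"
      unfolding norm_mult using l \<psi>[of x] by (intro mult_mono) auto
    then have "cmod (of_real l * \<psi> x) < 1" using l by simp
    from sums_mult[OF geometric_sums[OF this], of "f x"] show ?thesis
      by (simp add: power_mult_distrib mult_ac)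
  qed
  have sl: "summable (\<lambda>k. l ^ k)" using l by (intro summable_geometric) auto
  have "(\<lambda>k. \<integral>x. of_real l ^ k * (f x * \<psi> x ^ k) \<partial>M) sums (\<integral>x. (\<Sum>k. of_real l ^ k * (f x * \<psi> x ^ k)) \<partial>M)"
  proof (rule sums_integral[OF int])
    show "AE x in M. summable (\<lambda>k. norm (of_real l ^ k * (f x * \<psi> x ^ k)))"
      by (intro AE_I2 summable_comparison_test'[OF sl]) (use le in auto)
    show "summable (\<lambda>k. \<integral>x. norm (of_real l ^ k * (f x * \<psi> x ^ k)) \<partial>M)"
    proof (rule summable_comparison_test'[OF sl])
      fix k
      have "(\<integral>x. norm (of_real l ^ k * (f x * \<psi> x ^ k)) \<partial>M) \<le> (\<integral>x. l ^ k \<partial>M)"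
        using le int by (intro integral_mono) auto
      then show "norm (\<integral>x. norm (of_real l ^ k * (f x * \<psi> x ^ k)) \<partial>M) \<le> l ^ k"
        by (simp add: prob_space)
    qed
  qed
  then show ?thesis by (simp add: sums_unique[OF geo, symmetric])
qed

section \<open>The lazy walk and its local limit\<close>

context planar_walk
begin

text \<open>The characteristic function of a step that stays put with probability 1/2. Its modulus
  is 1 only where \<phi> equals 1, which within the box happens at the origin alone, even if the
  walk is periodic.\<close>

definition "lazy \<theta> = (1 + \<phi> \<theta>) / 2"

lemma lazy_measurable [measurable]: "lazy \<in> borel_measurable borel"
  unfolding lazy_def by measurable

lemma norm_lazy_le: "cmod (lazy \<theta>) \<le> 1"
  using norm_triangle_ineq[of 1 "\<phi> \<theta>"] norm_\<phi>_le[of \<theta>] by (simp add: lazy_def norm_divide)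

text \<open>Since \<phi> has modulus at most 1, the squared modulus of the average with 1 is at most
  \<open>(1 + Re) / 2\<close>. Thus the bound on the real part alone yields Gaussian decay on the
  entire box.\<close>

lemma norm_lazy_gauss:
  obtains c where "c > 0" "\<And>\<theta>. \<theta> \<in> torus_box \<Longrightarrow> cmod (lazy \<theta>) \<le> exp (- c * (norm \<theta>)\<^sup>2)"
proof -
  obtain c where c: "c > 0" "\<And>\<theta>. \<theta> \<in> torus_box \<Longrightarrow> c * (norm \<theta>)\<^sup>2 \<le> 1 - Re (\<phi> \<theta>)"
    using Re_\<phi>_lower by blast
  have "cmod (lazy \<theta>) \<le> exp (- (c / 4) * (norm \<theta>)\<^sup>2)" if "\<theta> \<in> torus_box" for \<theta>
  proof -
    have "(cmod (\<phi> \<theta>))\<^sup>2 \<le> 1" using norm_\<phi>_le[of \<theta>] by (simp add: power_le_one)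
    then have "(cmod (lazy \<theta>))\<^sup>2 \<le> (1 + Re (\<phi> \<theta>)) / 2"
      unfolding lazy_def norm_divide power_divide cmod_power2 by (simp add: power2_eq_square algebra_simps)
    also have "\<dots> \<le> 1 + - (c / 2 * (norm \<theta>)\<^sup>2)" using c(2)[OF that] by simp
    also have "\<dots> \<le> exp (- (c / 2 * (norm \<theta>)\<^sup>2))" by (rule exp_ge_add_one_self)
    also have "\<dots> = (exp (- (c / 4) * (norm \<theta>)\<^sup>2))\<^sup>2" by (simp add: power2_eq_square flip: exp_add)
    finally show ?thesis by (rule power2_le_imp_le) simp
  qed
  then show ?thesis using that[of "c / 4"] c by auto
qed

text \<open>Second-order Taylor expansion with only a second moment: the remainder is controlled by
  the expectation of the minimum of \<open>6 * X^2\<close> and \<open>t * X^3\<close>, which tends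
  to 0 by dominated convergence, without a rate.\<close>

lemma \<phi>_expansion:
  "(\<lambda>k. real k * cmod (\<phi> ((1 / sqrt (real k)) *\<^sub>R u) - (1 - quad u / (2 * real k)))) \<longlonglongrightarrow> 0"
proof -
  define X where "X w = dotp u (\<zeta> 0 w)" for w
  define E where "E k = expectation (\<lambda>w. min (6 * (X w)\<^sup>2) (\<bar>1 / sqrt (real k)\<bar> * \<bar>X w\<bar> ^ 3))" for k
  have X: "X \<in> borel_measurable P" "integrable P X" "integrable P (\<lambda>w. (X w)\<^sup>2)" "expectation X = 0"
    "variance X = quad u"
    using dotp_\<zeta>_int dotp_\<zeta>_sq_int dotp_\<zeta>_mean dotp_\<zeta>_sq by (simp_all add: X_def[abs_def])
  note [measurable] = X(1)
  have char: "char (distr P borel X) t = \<phi> (t *\<^sub>R u)" for t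
    unfolding char_def \<phi>_def by (subst integral_distr) (auto simp: X_def cis_conv_exp)
  have "E \<longlonglongrightarrow> expectation (\<lambda>w. 0)"
    unfolding E_def
  proof (rule integral_dominated_convergence[where w = "\<lambda>w. 6 * (X w)\<^sup>2"])
    show "AE w in P. (\<lambda>k. min (6 * (X w)\<^sup>2) (\<bar>1 / sqrt (real k)\<bar> * \<bar>X w\<bar> ^ 3)) \<longlonglongrightarrow> 0"
    proof (rule AE_I2)
      fix w
      have "(\<lambda>k. \<bar>1 / sqrt (real k)\<bar> * \<bar>X w\<bar> ^ 3) \<longlonglongrightarrow> 0"
        by (intro tendsto_mult_left_zero tendsto_rabs_zero) real_asymp
      then have "(\<lambda>k. min (6 * (X w)\<^sup>2) (\<bar>1 / sqrt (real k)\<bar> * \<bar>X w\<bar> ^ 3)) \<longlonglongrightarrow> min (6 * (X w)\<^sup>2) 0"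
        by (intro tendsto_min tendsto_const)
      then show "(\<lambda>k. min (6 * (X w)\<^sup>2) (\<bar>1 / sqrt (real k)\<bar> * \<bar>X w\<bar> ^ 3)) \<longlonglongrightarrow> 0" by simp
    qed
  qed (use X in auto)
  then have E: "E \<longlonglongrightarrow> 0" by simp
  show ?thesis
  proof (rule Lim_null_comparison[OF _ tendsto_mult_right_zero[OF E, of "1/6"]])
    show "\<forall>\<^sub>F k in sequentially. norm (real k * cmod (\<phi> ((1 / sqrt (real k)) *\<^sub>R u) - (1 - quad u / (2 * real k)))) \<le> 1 / 6 * E k"
      using eventually_gt_at_top[of 0]
    proof eventually_elim
      case (elim k)
      let ?t = "1 / sqrt (real k)"
      have t: "?t\<^sup>2 = 1 / real k" by (simp add: power_divide)
      have "cmod (char (distr P borel X) ?t - (1 - ?t\<^sup>2 * quad u / 2)) \<le> ?t\<^sup>2 / 6 * E k"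
        unfolding E_def by (rule char_approx3'[OF X refl])
      then have "cmod (\<phi> (?t *\<^sub>R u) - (1 - quad u / (2 * real k))) \<le> 1 / real k / 6 * E k"
        unfolding char t by (simp add: mult.commute)
      then have "real k * cmod (\<phi> (?t *\<^sub>R u) - (1 - quad u / (2 * real k))) \<le> real k * (1 / real k / 6 * E k)"
        by (intro mult_left_mono) auto
      then show ?case using elim by simp
    qed
  qed
qed

text \<open>For numbers of modulus at most 1, the difference of the \<open>k\<close>-th powers is at
  most \<open>k\<close> times the difference; the expansion of \<phi> makes that product
  vanish.\<close>

lemma lazy_power_limit:
  "(\<lambda>k. lazy ((1 / sqrt (real k)) *\<^sub>R u) ^ k) \<longlonglongrightarrow> complex_of_real (exp (- quad u / 4))"
proof -
  define q where "q = quad u"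
  have q: "q \<ge> 0" using quad_nonneg by (simp add: q_def)
  \<comment> \<open>The exact \<open>k\<close>-th root of the limit, so that powers are compared
    with powers.\<close>
  define v where "v k = complex_of_real (exp (- q / (4 * real k)))" for k :: nat
  have vk: "v k ^ k = complex_of_real (exp (- q / 4))" if "k > 0" for k
    using that by (simp add: v_def exp_of_nat_mult[symmetric] flip: of_real_power)
  define h where "h k = (1/2) * (real k * cmod (\<phi> ((1 / sqrt (real k)) *\<^sub>R u) - (1 - q / (2 * real k)))) +
       real k * \<bar>1 - q / (4 * real k) - exp (- q / (4 * real k))\<bar>" for k
  have lim: "(\<lambda>k. (1/2) * (real k * cmod (\<phi> ((1 / sqrt (real k)) *\<^sub>R u) - (1 - q / (2 * real k)))) +
       real k * \<bar>1 - q / (4 * real k) - exp (- q / (4 * real k))\<bar>) \<longlonglongrightarrow> (1/2) * 0 + 0"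
  proof (intro tendsto_add tendsto_mult_left)
    show "(\<lambda>k. real k * cmod (\<phi> ((1 / sqrt (real k)) *\<^sub>R u) - (1 - q / (2 * real k)))) \<longlonglongrightarrow> 0"
      using \<phi>_expansion[of u] by (simp add: q_def)
    have "(\<lambda>k. real k * (1 - q / (4 * real k) - exp (- q / (4 * real k)))) \<longlonglongrightarrow> 0"
      by real_asymp
    from tendsto_rabs_zero[OF this] show "(\<lambda>k. real k * \<bar>1 - q / (4 * real k) - exp (- q / (4 * real k))\<bar>) \<longlonglongrightarrow> 0"
      by (simp add: abs_mult)
  qed
  have "(\<lambda>k. lazy ((1 / sqrt (real k)) *\<^sub>R u) ^ k - v k ^ k) \<longlonglongrightarrow> 0"
  proof (rule Lim_null_comparison)
    show "h \<longlonglongrightarrow> 0" using lim by (simp add: h_def[abs_def])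
    show "\<forall>\<^sub>F k in sequentially. norm (lazy ((1 / sqrt (real k)) *\<^sub>R u) ^ k - v k ^ k) \<le> h k"
      using eventually_gt_at_top[of 0]
    proof eventually_elim
      case (elim k)
      let ?\<theta> = "(1 / sqrt (real k)) *\<^sub>R u"
      have "lazy ?\<theta> - v k = (\<phi> ?\<theta> - (1 - q / (2 * real k))) / 2 + complex_of_real (1 - q / (4 * real k) - exp (- (q / (4 * real k))))"
        by (simp add: lazy_def v_def field_simps)
      then have "norm (lazy ?\<theta> - v k) \<le> norm ((\<phi> ?\<theta> - (1 - q / (2 * real k))) / 2) + norm (complex_of_real (1 - q / (4 * real k) - exp (- (q / (4 * real k)))))"
        by (metis norm_triangle_ineq)
      also have "\<dots> = cmod (\<phi> ?\<theta> - (1 - q / (2 * real k))) / 2 + \<bar>1 - q / (4 * real k) - exp (- (q / (4 * real k)))\<bar>"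
        by (simp add: norm_divide del: of_real_diff)
      finally have "real k * norm (lazy ?\<theta> - v k) \<le> real k *
         (cmod (\<phi> ?\<theta> - (1 - q / (2 * real k))) / 2 + \<bar>1 - q / (4 * real k) - exp (- (q / (4 * real k)))\<bar>)"
        by (intro mult_left_mono) auto
      moreover have "norm (lazy ?\<theta> ^ k - v k ^ k) \<le> real k * norm (lazy ?\<theta> - v k)"
        using q by (intro norm_power_diff norm_lazy_le) (simp add: v_def)
      ultimately show ?case unfolding h_def distrib_left by simp
    qed
  qed
  moreover have "(\<lambda>k. v k ^ k) \<longlonglongrightarrow> complex_of_real (exp (- q / 4))"
    by (rule tendsto_eventually, rule eventually_mono[OF eventually_gt_at_top[of 0]]) (rule vk)
  ultimately show ?thesis
    using tendsto_add[of "\<lambda>k. lazy ((1 / sqrt (real k)) *\<^sub>R u) ^ k - v k ^ k" 0] by (fastforce simp: q_def)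
qed

text \<open>The transition probability of the lazy walk, given by the inversion formula alone; no
  lazy walk is constructed, and the value is complex a priori.\<close>

definition "lazy_prob k z = (\<integral>\<theta>. cis (- dotp \<theta> z) * lazy \<theta> ^ k \<partial>torus)"

text \<open>Rescaling \<theta> by \<open>1 / sqrt k\<close> turns the integrand into one with a
  pointwise Gaussian limit and, by \<open>norm_lazy_gauss\<close>, a Gaussian majorant. The lazy
  step has half the covariance, so the limit is \<open>1 / (2 * pi)\<close> over the root of a
  quarter of the determinant.\<close>

lemma lazy_local_limit:
  "(\<lambda>k. of_nat k * lazy_prob k z) \<longlonglongrightarrow> complex_of_real (1 / (pi * sqrt (s11 * s22 - s12\<^sup>2)))"
proof -
  obtain c where c: "c > 0" and gauss: "\<And>\<theta>. \<theta> \<in> torus_box \<Longrightarrow> cmod (lazy \<theta>) \<le> exp (- c * (norm \<theta>)\<^sup>2)"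
    using norm_lazy_gauss by blast
  define r where "r k = 1 / sqrt (real k)" for k :: nat
  \<comment> \<open>For \<open>k = 0\<close> the scale \<open>r\<close> is 0 and the integrand would
    be the constant 1, which no Gaussian dominates; hence the separate value.\<close>
  define F where "F k u = (if k = 0 then 0 else complex_of_real (indicator torus_box (r k *\<^sub>R u)) * (cis (- r k * dotp u z) * lazy (r k *\<^sub>R u) ^ k))" for k u
  define G where "G u = complex_of_real (exp (- quad u / 4))" for u
  have [measurable]: "F k \<in> borel_measurable borel" for k unfolding F_def by measurable
  have r0: "r \<longlonglongrightarrow> 0" unfolding r_def by real_asymp
  have eq: "of_nat k * lazy_prob k z = (1 / (4 * pi\<^sup>2)) *\<^sub>R (\<integral>u. F k u \<partial>lborel)" if "k > 0" for k
  proof -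
    have rk: "r k > 0" "real k * (r k)\<^sup>2 = 1" using that by (auto simp: r_def power_divide)
    have "lazy_prob k z = (1 / (4 * pi\<^sup>2)) *\<^sub>R (\<integral>\<theta>. indicator torus_box \<theta> *\<^sub>R (cis (- dotp \<theta> z) * lazy \<theta> ^ k) \<partial>lborel)"
      unfolding lazy_prob_def by (subst integral_torus) auto
    also have "(\<integral>\<theta>. indicator torus_box \<theta> *\<^sub>R (cis (- dotp \<theta> z) * lazy \<theta> ^ k) \<partial>lborel)
       = (r k)\<^sup>2 *\<^sub>R (\<integral>u. indicator torus_box (r k *\<^sub>R u) *\<^sub>R (cis (- dotp (r k *\<^sub>R u) z) * lazy (r k *\<^sub>R u) ^ k) \<partial>lborel)"
      by (rule lborel_plane_scale[OF _ rk(1)]) measurable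
    also have "(\<integral>u. indicator torus_box (r k *\<^sub>R u) *\<^sub>R (cis (- dotp (r k *\<^sub>R u) z) * lazy (r k *\<^sub>R u) ^ k) \<partial>lborel)
       = (\<integral>u. F k u \<partial>lborel)"
      using that by (simp add: F_def scaleR_conv_of_real)
    finally have "of_nat k * lazy_prob k z = of_real (real k * (r k)\<^sup>2) * ((1 / (4 * pi\<^sup>2)) *\<^sub>R (\<integral>u. F k u \<partial>lborel))"
      by (simp add: scaleR_conv_of_real)
    then show ?thesis unfolding rk by simp
  qed
  have bnd: "integrable lborel (\<lambda>u::real \<times> real. exp (- c * (norm u)\<^sup>2))"
  proof -
    have *: "- c * (norm \<theta>)\<^sup>2 = - (c * (fst \<theta>)\<^sup>2 + 2 * 0 * fst \<theta> * snd \<theta> + c * (snd \<theta>)\<^sup>2)" for \<theta> :: "real \<times> real"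
      by (cases \<theta>) (simp add: norm_Pair algebra_simps)
    show ?thesis unfolding * using c by (intro integral_gaussian_plane) auto
  qed
  have "(\<lambda>k. \<integral>u. F k u \<partial>lborel) \<longlonglongrightarrow> (\<integral>u. G u \<partial>lborel)"
  proof (rule integral_dominated_convergence[OF _ _ bnd])
    have "continuous_on UNIV G" unfolding G_def quad_def by (intro continuous_intros) auto
    then show "G \<in> borel_measurable lborel" by (simp add: borel_measurable_continuous_onI)
    show "AE u in lborel. (\<lambda>k. F k u) \<longlonglongrightarrow> G u"
    proof (rule AE_I2)
      fix u :: "real \<times> real"
      have ev: "\<forall>\<^sub>F k in sequentially. complex_of_real (indicator torus_box (r k *\<^sub>R u)) = 1"
      proof -
        have "(\<lambda>k. r k * fst u) \<longlonglongrightarrow> 0" "(\<lambda>k. r k * snd u) \<longlonglongrightarrow> 0"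
          using r0 by (auto intro!: tendsto_mult_left_zero)
        then have "\<forall>\<^sub>F k in sequentially. r k * fst u < pi" "\<forall>\<^sub>F k in sequentially. r k * snd u < pi"
           "\<forall>\<^sub>F k in sequentially. r k * fst u > - pi" "\<forall>\<^sub>F k in sequentially. r k * snd u > - pi"
          by (auto intro: order_tendstoD)
        then show ?thesis by eventually_elim (auto simp: torus_box_def indicator_def mem_Times_iff)
      qed
      have "(\<lambda>k. cis (- r k * dotp u z)) \<longlonglongrightarrow> cis (- 0 * dotp u z)"
        unfolding cis_conv_exp by (intro tendsto_intros r0)
      then have "(\<lambda>k. 1 * (cis (- r k * dotp u z) * lazy (r k *\<^sub>R u) ^ k)) \<longlonglongrightarrow> 1 * (1 * G u)"
        using lazy_power_limit[of u] unfolding G_def r_def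
        by (intro tendsto_mult tendsto_const) (auto simp: cis_zero)
      then have "(\<lambda>k. cis (- r k * dotp u z) * lazy (r k *\<^sub>R u) ^ k) \<longlonglongrightarrow> G u" by simp
      moreover have "\<forall>\<^sub>F k in sequentially. cis (- r k * dotp u z) * lazy (r k *\<^sub>R u) ^ k = F k u"
        using ev eventually_gt_at_top[of 0] by eventually_elim (auto simp: F_def)
      ultimately show "(\<lambda>k. F k u) \<longlonglongrightarrow> G u" by (rule Lim_transform_eventually)
    qed
    show "AE u in lborel. norm (F k u) \<le> exp (- c * (norm u)\<^sup>2)" for k
    proof (rule AE_I2)
      fix u :: "real \<times> real"
      show "norm (F k u) \<le> exp (- c * (norm u)\<^sup>2)"
      proof (cases "r k *\<^sub>R u \<in> torus_box \<and> k > 0")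
        case True
        then have rk: "r k > 0" "real k * (r k)\<^sup>2 = 1" by (auto simp: r_def power_divide)
        have "norm (F k u) = cmod (lazy (r k *\<^sub>R u)) ^ k" using True by (simp add: F_def norm_mult norm_power)
        also have "\<dots> \<le> exp (- c * (norm (r k *\<^sub>R u))\<^sup>2) ^ k" using gauss[of "r k *\<^sub>R u"] True by (intro power_mono) (simp_all del: norm_scaleR)
        also have "\<dots> = exp (- c * ((real k * (r k)\<^sup>2) * (norm u)\<^sup>2))"
          by (simp add: exp_of_nat_mult[symmetric] power_mult_distrib mult_ac)
        finally show ?thesis using rk by simp
      next
        case False
        then show ?thesis by (auto simp: F_def indicator_def)
      qed
    qed
  qed auto
  also have "(\<integral>u. G u \<partial>lborel) = complex_of_real (4 * pi / sqrt (s11 * s22 - s12\<^sup>2))"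
  proof -
    have *: "- quad u / 4 = - (s11 / 4 * (fst u)\<^sup>2 + 2 * (s12 / 4) * fst u * snd u + s22 / 4 * (snd u)\<^sup>2)" for u
      by (simp add: quad_def field_simps)
    have det4: "s11 / 4 * (s22 / 4) - (s12 / 4)\<^sup>2 = (s11 * s22 - s12\<^sup>2) / 16" by (simp add: power2_eq_square)
    have "(\<integral>u. exp (- quad u / 4) \<partial>lborel) = pi / sqrt (s11 / 4 * (s22 / 4) - (s12 / 4)\<^sup>2)"
      unfolding * using s11_pos det_pos by (intro integral_gaussian_plane; simp only: det4) simp_all
    also have "\<dots> = 4 * pi / sqrt (s11 * s22 - s12\<^sup>2)"
      unfolding det4 real_sqrt_divide by simp
    finally show ?thesis unfolding G_def by (simp only: integral_complex_of_real)
  qed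
  finally have "(\<lambda>k. (1 / (4 * pi\<^sup>2)) *\<^sub>R (\<integral>u. F k u \<partial>lborel)) \<longlonglongrightarrow> (1 / (4 * pi\<^sup>2)) *\<^sub>R complex_of_real (4 * pi / sqrt (s11 * s22 - s12\<^sup>2))"
    by (intro tendsto_intros)
  moreover have "(1 / (4 * pi\<^sup>2)) *\<^sub>R complex_of_real (4 * pi / sqrt (s11 * s22 - s12\<^sup>2)) = complex_of_real (1 / (pi * sqrt (s11 * s22 - s12\<^sup>2)))"
    unfolding scaleR_conv_of_real of_real_mult[symmetric] by (simp add: power2_eq_square)
  ultimately have "(\<lambda>k. (1 / (4 * pi\<^sup>2)) *\<^sub>R (\<integral>u. F k u \<partial>lborel)) \<longlonglongrightarrow> complex_of_real (1 / (pi * sqrt (s11 * s22 - s12\<^sup>2)))"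
    by simp
  then show ?thesis
    by (rule Lim_transform_eventually, intro eventually_mono[OF eventually_gt_at_top[of 0]]) (simp add: eq)
qed

section \<open>From the lazy walk to the Green function\<close>

definition "green n z = (\<Sum>k=1..n. step_prob k z)"

text \<open>With \<open>l = 2 * L / (1 + L)\<close> the kernel \<open>1 - l * lazy\<close> becomes
  \<open>(1 - L * \<phi>) / (1 + L)\<close>. The Abel sums of both walks therefore agree up to the
  factor \<open>1 + L\<close>, although single return probabilities of a periodic walk
  oscillate.\<close>

lemma abel_green:
  fixes L :: real
  assumes L: "0 \<le> L" "L < 1"
  shows "summable (\<lambda>k. L ^ k * step_prob k z)"
    and "(\<Sum>k. (2 * L / (1 + L)) ^ k * Re (lazy_prob k z)) = (1 + L) * (\<Sum>k. L ^ k * step_prob k z)"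
proof -
  define l where "l = 2 * L / (1 + L)"
  have l: "0 \<le> l" "l < 1" using L by (auto simp: l_def)
  have s1: "(\<lambda>k. l ^ k * lazy_prob k z) sums (\<integral>\<theta>. cis (- dotp \<theta> z) / (1 - l * lazy \<theta>) \<partial>torus)"
    unfolding lazy_prob_def
    by (rule integral_power_series[OF prob_space_torus _ _ _ norm_lazy_le l]) (auto simp: measurable_cong_sets[OF sets_torus refl])
  have s2: "(\<lambda>k. L ^ k * complex_of_real (step_prob k z)) sums (\<integral>\<theta>. cis (- dotp \<theta> z) / (1 - L * \<phi> \<theta>) \<partial>torus)"
    unfolding step_prob_fourier
    by (rule integral_power_series[OF prob_space_torus _ _ _ norm_\<phi>_le L]) (auto simp: measurable_cong_sets[OF sets_torus refl])
  have "(\<integral>\<theta>. cis (- dotp \<theta> z) / (1 - l * lazy \<theta>) \<partial>torus) = (\<integral>\<theta>. (1 + L) * (cis (- dotp \<theta> z) / (1 - L * \<phi> \<theta>)) \<partial>torus)"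
  proof (intro Bochner_Integration.integral_cong refl)
    fix \<theta>
    have "1 + complex_of_real L \<noteq> 0" using L by (metis add_nonneg_eq_0_iff of_real_1 of_real_add of_real_eq_0_iff zero_le_one zero_neq_one)
    moreover have "complex_of_real l * lazy \<theta> = L * (1 + \<phi> \<theta>) / (1 + L)"
    proof -
      have eq: "2 + complex_of_real L * 2 = 2 * (1 + complex_of_real L)" by simp
      have "2 + complex_of_real L * 2 \<noteq> 0"
        unfolding eq mult_eq_0_iff using calculation by (simp only: de_Morgan_disj) simp
      then show ?thesis using calculation by (simp add: l_def lazy_def field_simps)
    qed
    ultimately have "1 - l * lazy \<theta> = (1 - L * \<phi> \<theta>) / (1 + L)"
      by (simp add: field_simps)
    then show "cis (- dotp \<theta> z) / (1 - l * lazy \<theta>) = (1 + L) * (cis (- dotp \<theta> z) / (1 - L * \<phi> \<theta>))"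
      by simp
  qed
  also have "\<dots> = (1 + L) * (\<integral>\<theta>. cis (- dotp \<theta> z) / (1 - L * \<phi> \<theta>) \<partial>torus)"
    by (rule integral_mult_right_zero)
  finally have eq: "(\<integral>\<theta>. cis (- dotp \<theta> z) / (1 - l * lazy \<theta>) \<partial>torus) = complex_of_real (1 + L) * (\<integral>\<theta>. cis (- dotp \<theta> z) / (1 - L * \<phi> \<theta>) \<partial>torus)"
    by simp
  have r2: "(\<lambda>k. L ^ k * step_prob k z) sums Re (\<integral>\<theta>. cis (- dotp \<theta> z) / (1 - L * \<phi> \<theta>) \<partial>torus)"
    using sums_Re[OF s2] by (simp flip: of_real_power of_real_mult)
  have r1: "(\<lambda>k. l ^ k * Re (lazy_prob k z)) sums ((1 + L) * Re (\<integral>\<theta>. cis (- dotp \<theta> z) / (1 - L * \<phi> \<theta>) \<partial>torus))"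
    using sums_Re[OF s1] unfolding eq by (simp del: of_real_add flip: of_real_power)
  show "summable (\<lambda>k. L ^ k * step_prob k z)" using r2 by (rule sums_summable)
  show "(\<Sum>k. (2 * L / (1 + L)) ^ k * Re (lazy_prob k z)) = (1 + L) * (\<Sum>k. L ^ k * step_prob k z)"
    using sums_unique[OF r1] sums_unique[OF r2] by (simp add: l_def)
qed

text \<open>The Tauberian step, made elementary by the bound \<open>K / (k + 1)\<close>. With
  \<open>L = 1 - 1 / (n + 1)\<close>, Bernoulli's inequality bounds each term up to \<open>n\<close>
  by \<open>K / (n + 1)\<close>; beyond \<open>n\<close> the geometric weights have total mass at
  most \<open>n + 1\<close> against probabilities of at most \<open>K / (n + 1)\<close>. The
  additional 1 is the term \<open>k = 0\<close>, which \<open>green\<close> omits.\<close>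

lemma green_abel_diff:
  obtains B where "\<And>n z. \<bar>green n z - (\<Sum>k. (1 - 1 / real (n + 1)) ^ k * step_prob k z)\<bar> \<le> B"
proof -
  obtain K where K: "K > 0" "\<And>k z. step_prob k z \<le> K / (real k + 1)"
    using step_prob_bound by blast
  have "\<bar>green n z - (\<Sum>k. (1 - 1 / real (n + 1)) ^ k * step_prob k z)\<bar> \<le> 1 + (K + K)" for n z
  proof -
    define L where "L = 1 - 1 / real (n + 1)"
    have L: "0 \<le> L" "L < 1" by (auto simp: L_def)
    let ?p = "\<lambda>k. step_prob k z"
    let ?i = "\<lambda>k. if k \<in> {1..n} then ?p k else 0"
    have s: "(\<lambda>k. ?i k - L ^ k * ?p k) sums (green n z - (\<Sum>k. L ^ k * ?p k))"
      unfolding green_def by (intro sums_diff sums_If_finite_set summable_sums abel_green[OF L]) auto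
    have geo: "(\<lambda>k. L ^ k) sums (real (n + 1))"
      using geometric_sums[of L] L by (simp add: L_def)
    have t: "(\<lambda>k. (if k \<in> {0} then 1 else 0) + ((if k \<in> {1..n} then K / real (n + 1) else 0) + K / real (n + 1) * L ^ k))
       sums ((\<Sum>k\<in>{0::nat}. 1) + ((\<Sum>k\<in>{1..n}. K / real (n + 1)) + K / real (n + 1) * real (n + 1)))"
      by (intro sums_add sums_If_finite_set sums_mult geo) auto
    have "norm (?i k - L ^ k * ?p k) \<le> (if k \<in> {0} then 1 else 0) + ((if k \<in> {1..n} then K / real (n + 1) else 0) + K / real (n + 1) * L ^ k)" for k
    proof -
      have p: "0 \<le> ?p k" "?p k \<le> 1" by (auto simp: step_prob_def)
      have Lk: "0 \<le> L ^ k" "L ^ k \<le> 1" using L by (auto intro!: power_le_one)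
      have pos: "0 \<le> K / real (n + 1) * L ^ k" "0 \<le> K / real (n + 1)" using K(1) Lk by auto
      consider "k = 0" | "k \<in> {1..n}" | "k > n" by fastforce
      then show ?thesis
      proof cases
        case 1
        then show ?thesis using p pos by simp
      next
        case 2
        have "1 - real k / real (n + 1) \<le> L ^ k"
          using Bernoulli_inequality[of "- 1 / real (n + 1)" k] by (simp add: L_def field_simps)
        then have "(1 - L ^ k) * ?p k \<le> (real k / real (n + 1)) * (K / (real k + 1))"
          using p K by (intro mult_mono) auto
        also have "\<dots> = (K / real (n + 1)) * (real k / (real k + 1))" by simp
        also have "\<dots> \<le> (K / real (n + 1)) * 1" using pos by (intro mult_left_mono) auto
        finally have "(1 - L ^ k) * ?p k \<le> K / real (n + 1)" by simp
        moreover have "norm (?i k - L ^ k * ?p k) = (1 - L ^ k) * ?p k"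
          using 2 p Lk by (simp add: algebra_simps mult_left_le_one_le)
        ultimately show ?thesis using 2 pos by simp
      next
        case 3
        have "L ^ k * ?p k \<le> L ^ k * (K / real (n + 1))"
        proof (intro mult_left_mono Lk order_trans[OF K(2)])
          show "K / (real k + 1) \<le> K / real (n + 1)" using K 3 by (intro divide_left_mono) auto
        qed
        then show ?thesis using 3 p Lk pos by (simp add: mult.commute)
      qed
    qed
    from norm_suminf_le[OF this sums_summable[OF t]]
    have "\<bar>green n z - (\<Sum>k. L ^ k * ?p k)\<bar> \<le> 1 + (real n * (K / real (n + 1)) + K)"
      unfolding sums_unique[OF s, symmetric] sums_unique[OF t, symmetric] by simp
    also have "\<dots> \<le> 1 + (K + K)"
      using K(1) by (simp add: field_simps)
    finally show ?thesis by (simp add: L_def)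
  qed
  then show ?thesis using that by blast
qed

text \<open>Here \<open>1 - l\<close> is of the order \<open>1 / n\<close>, so its logarithm is
  asymptotic to \<open>ln n\<close>, while \<open>1 + L\<close> tends to 2; this halves the constant
  of the lazy walk.\<close>

lemma green_asymp:
  "(\<lambda>n. green n z / ln (real n)) \<longlonglongrightarrow> 1 / (2 * pi * sqrt (s11 * s22 - s12\<^sup>2))"
proof -
  define C where "C = 1 / (pi * sqrt (s11 * s22 - s12\<^sup>2))"
  define L where "L n = 1 - 1 / real (n + 1)" for n
  define l where "l n = 2 * L n / (1 + L n)" for n
  have L: "0 \<le> L n" "L n < 1" for n by (auto simp: L_def)
  have l: "0 \<le> l n" "l n < 1" for n using L[of n] by (auto simp: l_def)
  have lim: "L \<longlonglongrightarrow> 1" "l \<longlonglongrightarrow> 1" unfolding l_def L_def by real_asymp+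
  have "(\<lambda>k. Re (of_nat k * lazy_prob k z)) \<longlonglongrightarrow> Re (complex_of_real C)"
    unfolding C_def by (intro tendsto_Re lazy_local_limit)
  then have "(\<lambda>k. real k * Re (lazy_prob k z)) \<longlonglongrightarrow> C" by simp
  from abel_log[OF this l lim(2)]
  have A: "(\<lambda>n. (1 + L n) * (\<Sum>k. L n ^ k * step_prob k z) / (- ln (1 - l n))) \<longlonglongrightarrow> C"
    by (simp add: l_def abel_green(2)[OF L])
  have R: "(\<lambda>n. (- ln (1 - l n)) / ((1 + L n) * ln (real n))) \<longlonglongrightarrow> 1 / 2"
    unfolding l_def L_def by real_asymp
  have "(\<lambda>n. (\<Sum>k. L n ^ k * step_prob k z) / ln (real n)) \<longlonglongrightarrow> C * (1 / 2)"
  proof (rule Lim_transform_eventually[OF tendsto_mult[OF A R]])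
    show "\<forall>\<^sub>F n in sequentially. (1 + L n) * (\<Sum>k. L n ^ k * step_prob k z) / - ln (1 - l n) * (- ln (1 - l n) / ((1 + L n) * ln (real n)))
      = (\<Sum>k. L n ^ k * step_prob k z) / ln (real n)"
      using eventually_gt_at_top[of 1]
    proof eventually_elim
      case (elim n)
      have "L n > 0" using elim by (simp add: L_def field_simps)
      then have "l n > 0" by (simp add: l_def)
      then have "ln (1 - l n) \<noteq> 0" using l[of n] by (simp add: ln_eq_zero_iff)
      moreover have "1 + L n \<noteq> 0" using L[of n] by simp
      moreover have "ln (real n) \<noteq> 0" using elim by simp
      moreover have R0: "a * S / x * (x / (a * y)) = S / y" if "a \<noteq> 0" "x \<noteq> 0" for a S x y :: real
        using that by simp
      ultimately show ?case by (intro R0) auto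
    qed
  qed
  moreover have "(\<lambda>n. (green n z - (\<Sum>k. L n ^ k * step_prob k z)) / ln (real n)) \<longlonglongrightarrow> 0"
  proof -
    obtain B where B: "\<And>n z. \<bar>green n z - (\<Sum>k. (1 - 1 / real (n + 1)) ^ k * step_prob k z)\<bar> \<le> B"
      using green_abel_diff by blast
    have "(\<lambda>n. B * (1 / ln (real n))) \<longlonglongrightarrow> B * 0" by (intro tendsto_mult_left) real_asymp
    then have B0: "(\<lambda>n. B * (1 / ln (real n))) \<longlonglongrightarrow> 0" by simp
    show ?thesis
    proof (rule Lim_null_comparison[OF _ B0])
      show "\<forall>\<^sub>F n in sequentially. norm ((green n z - (\<Sum>k. L n ^ k * step_prob k z)) / ln (real n)) \<le> B * (1 / ln (real n))"
        using eventually_gt_at_top[of 1]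
        by eventually_elim (use B[of _ z] in \<open>auto simp: L_def abs_divide intro!: divide_right_mono\<close>)
    qed
  qed
  ultimately have "(\<lambda>n. (\<Sum>k. L n ^ k * step_prob k z) / ln (real n) + (green n z - (\<Sum>k. L n ^ k * step_prob k z)) / ln (real n)) \<longlonglongrightarrow> C * (1/2) + 0"
    by (rule tendsto_add)
  then show ?thesis by (simp add: diff_divide_distrib C_def mult_ac)
qed

end

lemma sum_count_space_measurable:
  fixes f :: "'i \<Rightarrow> 'a \<Rightarrow> 'b::{countable, comm_monoid_add}"
  assumes "\<And>h. h \<in> A \<Longrightarrow> f h \<in> M \<rightarrow>\<^sub>M count_space UNIV"
  shows "(\<lambda>w. \<Sum>h\<in>A. f h w) \<in> M \<rightarrow>\<^sub>M count_space UNIV"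
  using assms
proof (induction A rule: infinite_finite_induct)
  case (insert x F)
  have "(\<lambda>w. (f x w, \<Sum>h\<in>F. f h w)) \<in> M \<rightarrow>\<^sub>M (count_space UNIV \<Otimes>\<^sub>M count_space UNIV)"
    using insert by measurable
  then have "(\<lambda>w. (f x w, \<Sum>h\<in>F. f h w)) \<in> M \<rightarrow>\<^sub>M count_space UNIV"
    by (simp add: pair_measure_countable)
  from measurable_compose[OF this, of "\<lambda>p. fst p + snd p" "count_space UNIV"] insert show ?case
    by simp
qed auto

text \<open>Condition on \<open>V\<close>: whatever value \<open>R V\<close> prescribes, the
  independent \<open>U\<close> takes it with probability at most \<open>s\<close>.\<close>

lemma (in prob_space) prob_indep_eq_le:
  fixes U V :: "'a \<Rightarrow> 'b::countable"
  assumes ind: "indep_var (count_space UNIV) U (count_space UNIV) V"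
    and s: "\<And>x. prob {w\<in>space M. U w = x} \<le> s"
  shows "prob {w\<in>space M. Q (V w) \<and> U w = R (V w)} \<le> s * prob {w\<in>space M. Q (V w)}"
proof -
  have s0: "s \<ge> 0" using s[of undefined] measure_nonneg order_trans by blast
  have [measurable]: "U \<in> M \<rightarrow>\<^sub>M count_space UNIV" "V \<in> M \<rightarrow>\<^sub>M count_space UNIV"
    and D: "distr M (count_space UNIV) U \<Otimes>\<^sub>M distr M (count_space UNIV) V = distr M (count_space UNIV \<Otimes>\<^sub>M count_space UNIV) (\<lambda>x. (U x, V x))"
    using ind unfolding indep_var_distribution_eq by auto
  interpret DU: prob_space "distr M (count_space UNIV) U" by (rule prob_space_distr) simp
  interpret DV: prob_space "distr M (count_space UNIV) V" by (rule prob_space_distr) simp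
  interpret pair_sigma_finite "distr M (count_space UNIV) U" "distr M (count_space UNIV) V" ..
  have pc: "count_space UNIV \<Otimes>\<^sub>M count_space UNIV = (count_space UNIV :: ('b \<times> 'b) measure)"
    by (simp add: pair_measure_countable)
  have [measurable]: "(\<lambda>x. (U x, V x)) \<in> M \<rightarrow>\<^sub>M count_space UNIV"
    unfolding pc[symmetric] by measurable
  let ?X = "{(u, v). Q v \<and> u = R v}"
  have sX: "?X \<in> sets (distr M (count_space UNIV) U \<Otimes>\<^sub>M distr M (count_space UNIV) V)"
    unfolding D pc by simp
  have "emeasure M {w\<in>space M. Q (V w) \<and> U w = R (V w)} = emeasure (distr M (count_space UNIV \<Otimes>\<^sub>M count_space UNIV) (\<lambda>x. (U x, V x))) ?X"
    unfolding pc by (subst emeasure_distr) (auto intro!: arg_cong[where f = "emeasure M"])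
  also have "\<dots> = (\<integral>\<^sup>+ v. emeasure (distr M (count_space UNIV) U) ((\<lambda>u. (u, v)) -` ?X) \<partial>distr M (count_space UNIV) V)"
    unfolding D[symmetric] by (rule emeasure_pair_measure_alt2[OF sX])
  also have "\<dots> \<le> (\<integral>\<^sup>+ v. ennreal s * indicator {v. Q v} v \<partial>distr M (count_space UNIV) V)"
  proof (intro nn_integral_mono)
    fix v
    have "emeasure (distr M (count_space UNIV) U) {R v} = ennreal (prob {w\<in>space M. U w = R v})"
      by (subst emeasure_distr) (auto simp: emeasure_eq_measure intro!: arg_cong[where f = prob])
    also have "\<dots> \<le> ennreal s" by (intro ennreal_leI s)
    finally have "emeasure (distr M (count_space UNIV) U) {R v} \<le> ennreal s" .
    moreover have "(\<lambda>u. (u, v)) -` ?X = (if Q v then {R v} else {})" by auto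
    ultimately show "emeasure (distr M (count_space UNIV) U) ((\<lambda>u. (u, v)) -` ?X) \<le> ennreal s * indicator {v. Q v} v"
      by (auto simp: indicator_def)
  qed
  also have "\<dots> = ennreal s * emeasure (distr M (count_space UNIV) V) {v. Q v}"
    by (subst nn_integral_cmult_indicator) auto
  also have "emeasure (distr M (count_space UNIV) V) {v. Q v} = ennreal (prob {w\<in>space M. Q (V w)})"
    by (subst emeasure_distr) (auto simp: emeasure_eq_measure intro!: arg_cong[where f = prob])
  also have "ennreal s * ennreal (prob {w\<in>space M. Q (V w)}) = ennreal (s * prob {w\<in>space M. Q (V w)})"
    using s0 by (simp add: ennreal_mult)
  finally show ?thesis
    using s0 by (simp add: emeasure_eq_measure)
qed

section \<open>Variance of the number of returns\<close>

text \<open>Split by which coordinate is larger. For fixed \<open>a\<close> there are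
  \<open>2 * |a| + 1\<close> values \<open>c\<close> of smaller modulus, so each row contributes at
  most 2. The total is linear in \<open>m\<close>, which keeps a logarithm out of the
  variance.\<close>

lemma sum_inverse_max_le:
  "(\<Sum>(a, c)\<in>{-int m..int m} \<times> {-int m..int m}. 1 / (real_of_int (max \<bar>a\<bar> \<bar>c\<bar>) + 1)) \<le> 4 * (2 * real m + 1)"
proof -
  let ?S = "{-int m..int m}"
  have inner: "(\<Sum>c\<in>?S. if \<bar>c\<bar> \<le> \<bar>a\<bar> then 1 / (real_of_int \<bar>a\<bar> + 1) else 0) \<le> 2" if "a \<in> ?S" for a
  proof -
    have "(\<Sum>c\<in>?S. if \<bar>c\<bar> \<le> \<bar>a\<bar> then 1 / (real_of_int \<bar>a\<bar> + 1) else 0) = (\<Sum>c\<in>{c\<in>?S. \<bar>c\<bar> \<le> \<bar>a\<bar>}. 1 / (real_of_int \<bar>a\<bar> + 1))"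
      by (subst sum.inter_filter) auto
    also have "{c\<in>?S. \<bar>c\<bar> \<le> \<bar>a\<bar>} = {-\<bar>a\<bar>..\<bar>a\<bar>}" using that by auto
    also have "(\<Sum>c\<in>{-\<bar>a\<bar>..\<bar>a\<bar>}. 1 / (real_of_int \<bar>a\<bar> + 1)) = (2 * real_of_int \<bar>a\<bar> + 1) / (real_of_int \<bar>a\<bar> + 1)"
      by simp
    also have "\<dots> \<le> 2" by (simp add: field_simps)
    finally show ?thesis .
  qed
  have "(\<Sum>(a, c)\<in>?S \<times> ?S. 1 / (real_of_int (max \<bar>a\<bar> \<bar>c\<bar>) + 1))
    \<le> (\<Sum>(a, c)\<in>?S \<times> ?S. (if \<bar>c\<bar> \<le> \<bar>a\<bar> then 1 / (real_of_int \<bar>a\<bar> + 1) else 0) + (if \<bar>a\<bar> \<le> \<bar>c\<bar> then 1 / (real_of_int \<bar>c\<bar> + 1) else 0))"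
    by (intro sum_mono) (auto simp: max_def)
  also have "\<dots> = (\<Sum>a\<in>?S. \<Sum>c\<in>?S. if \<bar>c\<bar> \<le> \<bar>a\<bar> then 1 / (real_of_int \<bar>a\<bar> + 1) else 0)
     + (\<Sum>a\<in>?S. \<Sum>c\<in>?S. if \<bar>a\<bar> \<le> \<bar>c\<bar> then 1 / (real_of_int \<bar>c\<bar> + 1) else 0)"
    by (simp add: sum.cartesian_product[symmetric] sum.distrib)
  also have "(\<Sum>a\<in>?S. \<Sum>c\<in>?S. if \<bar>a\<bar> \<le> \<bar>c\<bar> then 1 / (real_of_int \<bar>c\<bar> + 1) else 0)
     = (\<Sum>a\<in>?S. \<Sum>c\<in>?S. if \<bar>c\<bar> \<le> \<bar>a\<bar> then 1 / (real_of_int \<bar>a\<bar> + 1) else 0)"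
    by (rule sum.swap)
  also have "(\<Sum>a\<in>?S. \<Sum>c\<in>?S. if \<bar>c\<bar> \<le> \<bar>a\<bar> then 1 / (real_of_int \<bar>a\<bar> + 1) else 0)
     + (\<Sum>a\<in>?S. \<Sum>c\<in>?S. if \<bar>c\<bar> \<le> \<bar>a\<bar> then 1 / (real_of_int \<bar>a\<bar> + 1) else 0) \<le> (\<Sum>a\<in>?S. 2) + (\<Sum>a\<in>?S. 2)"
    by (intro add_mono sum_mono inner)
  also have "\<dots> = 4 * (2 * real m + 1)" by simp
  finally show ?thesis .
qed

section \<open>Joint probabilities of two coincidences of the walk\<close>

context planar_walk
begin

text \<open>Chosen once, so that bounds from different lemmas share the same constant.\<close>

definition "K0 = (SOME K. K > 0 \<and> (\<forall>k z. step_prob k z \<le> K / (real k + 1)))"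

lemma K0: "K0 > 0" "step_prob k z \<le> K0 / (real k + 1)"
proof -
  have "\<exists>K. K > 0 \<and> (\<forall>k z. step_prob k z \<le> K / (real k + 1))" using step_prob_bound by metis
  then have "K0 > 0 \<and> (\<forall>k z. step_prob k z \<le> K0 / (real k + 1))"
    unfolding K0_def by (rule someI_ex)
  then show "K0 > 0" "step_prob k z \<le> K0 / (real k + 1)" by blast+
qed

abbreviation "incr A w \<equiv> (\<Sum>h\<in>A. \<zeta> h w)"

definition "hit i j q = {w\<in>space P. incr {i..<j} w = q}"

lemma hit_events [measurable]: "hit i j q \<in> events"
  unfolding hit_def by measurable

lemma prob_hit: "prob (hit i j q) = step_prob (j - i) q"
  unfolding hit_def by (subst prob_walk_eq) auto

text \<open>The dummy component 0 gives both variables the type of pairs of lattice points; the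
  second variable has to record two increments at once.\<close>

lemma indep_incr:
  assumes "A \<inter> (B \<union> C) = {}"
  shows "indep_var (count_space UNIV) (\<lambda>w. (incr A w, 0)) (count_space UNIV) (\<lambda>w. (incr B w, incr C w))"
proof -
  have "indep_var (PiM A (\<lambda>_. count_space UNIV)) (\<lambda>w. restrict (\<lambda>i. \<zeta> i w) A)
    (PiM (B \<union> C) (\<lambda>_. count_space UNIV)) (\<lambda>w. restrict (\<lambda>i. \<zeta> i w) (B \<union> C))"
    by (rule indep_var_restrict[OF \<zeta>_indep assms]) auto
  moreover have "(\<lambda>v. (\<Sum>h\<in>A. v h, 0)) \<in> PiM A (\<lambda>_. count_space (UNIV :: (int \<times> int) set)) \<rightarrow>\<^sub>M (count_space UNIV \<Otimes>\<^sub>M count_space (UNIV :: (int \<times> int) set))"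
    by (intro measurable_Pair sum_count_space_measurable measurable_component_singleton) auto
  then have "(\<lambda>v. (\<Sum>h\<in>A. v h, 0)) \<in> PiM A (\<lambda>_. count_space (UNIV :: (int \<times> int) set)) \<rightarrow>\<^sub>M (count_space UNIV :: ((int \<times> int) \<times> int \<times> int) measure)"
    by (simp add: pair_measure_countable)
  moreover have "(\<lambda>v. (\<Sum>h\<in>B. v h, \<Sum>h\<in>C. v h)) \<in> PiM (B \<union> C) (\<lambda>_. count_space (UNIV :: (int \<times> int) set)) \<rightarrow>\<^sub>M (count_space UNIV \<Otimes>\<^sub>M count_space UNIV)"
    by (intro measurable_Pair sum_count_space_measurable measurable_component_singleton) auto
  then have "(\<lambda>v. (\<Sum>h\<in>B. v h, \<Sum>h\<in>C. v h)) \<in> PiM (B \<union> C) (\<lambda>_. count_space (UNIV :: (int \<times> int) set)) \<rightarrow>\<^sub>M count_space UNIV"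
    by (simp add: pair_measure_countable)
  ultimately have "indep_var (count_space UNIV) ((\<lambda>v. (\<Sum>h\<in>A. v h, 0)) \<circ> (\<lambda>w. restrict (\<lambda>i. \<zeta> i w) A))
     (count_space UNIV) ((\<lambda>v. (\<Sum>h\<in>B. v h, \<Sum>h\<in>C. v h)) \<circ> (\<lambda>w. restrict (\<lambda>i. \<zeta> i w) (B \<union> C)))"
    by (rule indep_var_compose)
  then show ?thesis by (simp add: comp_def)
qed

lemma prob_incr_le:
  assumes "A \<inter> (B \<union> C) = {}" "finite A"
  shows "prob {w\<in>space P. Q (incr B w, incr C w) \<and> incr A w = R (incr B w, incr C w)}
    \<le> K0 / (real (card A) + 1) * prob {w\<in>space P. Q (incr B w, incr C w)}"
proof -
  have "prob {w\<in>space P. (incr A w, 0) = x} \<le> K0 / (real (card A) + 1)" for x :: "(int \<times> int) \<times> int \<times> int"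
  proof (cases "snd x = 0")
    case True
    then have "{w\<in>space P. (incr A w, 0) = x} = {w\<in>space P. incr A w = fst x}" by (auto simp: prod_eq_iff)
    then show ?thesis by (simp add: prob_walk_eq assms(2) K0)
  next
    case False
    then have "{w\<in>space P. (incr A w, 0) = x} = {}" by (auto simp: prod_eq_iff)
    then show ?thesis using K0(1) by (simp only: measure_empty) simp
  qed
  from prob_indep_eq_le[OF indep_incr[OF assms(1)] this, of Q "\<lambda>v. (R v, 0)"] show ?thesis by simp
qed

lemma incr_split: "i \<le> k \<Longrightarrow> k \<le> j \<Longrightarrow> incr {i..<j} w = incr {i..<k} w + incr {k..<j} w"
  using sum.atLeastLessThan_concat[of i k j "\<lambda>h. \<zeta> h w"] by simp

lemma prob_hit_disjoint:
  assumes "j \<le> i'"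
  shows "prob (hit i j q \<inter> hit i' j' q) = prob (hit i j q) * prob (hit i' j' q)"
proof -
  have "indep_var (count_space UNIV) (\<lambda>w. (incr {i..<j} w, 0)) (count_space UNIV) (\<lambda>w. (incr {i'..<j'} w, incr {} w))"
    using assms by (intro indep_incr) auto
  from indep_varD[OF this, of "{q} \<times> UNIV" "{q} \<times> UNIV"] show ?thesis
    by (simp add: hit_def vimage_def Int_def conj_ac)
qed

text \<open>The two time windows share \<open>?B\<close> and differ by \<open>?A\<close> at the
  start and \<open>?C\<close> at the end. One of the two events does not involve the longer of
  \<open>?A\<close> and \<open>?C\<close>; given it, the other event prescribes the independent
  increment over that longer piece, which costs a factor \<open>K0 / (length + 1)\<close>.\<close>

lemma prob_hit_overlap:
  assumes "i \<le> i'" "i' < j" "i' \<le> j'"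
  shows "prob (hit i j q \<inter> hit i' j' q) \<le> (prob (hit i j q) + prob (hit i' j' q)) * (K0 / (real (max (i' - i) (max j j' - min j j')) + 1))"
proof -
  define a c where "a = i' - i" and "c = max j j' - min j j'"
  let ?k = "min j j'" let ?l = "max j j'"
  let ?A = "{i..<i'}" let ?B = "{i'..<?k}" let ?C = "{?k..<?l}"
  have le: "i' \<le> ?k" "?k \<le> ?l" using assms by auto
  have card: "card ?A = a" "card ?C = c" by (auto simp: a_def c_def)
  have fin: "K0 / (real x + 1) * prob H \<le> (prob (hit i j q) + prob (hit i' j' q)) * (K0 / (real (max a c) + 1))"
    if "H = hit i j q \<or> H = hit i' j' q" "x = max a c" for H x
  proof -
    have "prob H \<le> prob (hit i j q) + prob (hit i' j' q)" using that(1) by auto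
    then have "K0 / (real x + 1) * prob H \<le> K0 / (real x + 1) * (prob (hit i j q) + prob (hit i' j' q))"
      using K0(1) by (intro mult_left_mono) auto
    also have "\<dots> = (prob (hit i j q) + prob (hit i' j' q)) * (K0 / (real (max a c) + 1))"
      unfolding that(2) by (rule mult.commute)
    finally show ?thesis .
  qed
  show ?thesis unfolding a_def[symmetric] c_def[symmetric]
  proof (cases "j \<le> j'")
    case True
    have h1: "hit i j q = {w\<in>space P. incr ?A w + incr ?B w = q}"
      using incr_split[of i i' j] assms True by (simp add: hit_def min_def)
    have h2: "hit i' j' q = {w\<in>space P. incr ?B w + incr ?C w = q}"
      using incr_split[of i' j j'] assms True by (simp add: hit_def min_def max_def)
    show "prob (hit i j q \<inter> hit i' j' q) \<le> (prob (hit i j q) + prob (hit i' j' q)) * (K0 / (real (max a c) + 1))"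
    proof (cases "a \<le> c")
      case ac: True
      have "prob (hit i j q \<inter> hit i' j' q) = prob {w\<in>space P. (\<lambda>(x, y). x + y = q) (incr ?A w, incr ?B w) \<and> incr ?C w = (\<lambda>(x, y). q - y) (incr ?A w, incr ?B w)}"
        unfolding h1 h2 by (rule arg_cong[where f = prob]) (auto simp: algebra_simps)
      also have "\<dots> \<le> K0 / (real (card ?C) + 1) * prob {w\<in>space P. (\<lambda>(x, y). x + y = q) (incr ?A w, incr ?B w)}"
        using le by (intro prob_incr_le) auto
      also have "\<dots> \<le> (prob (hit i j q) + prob (hit i' j' q)) * (K0 / (real (max a c) + 1))"
        by (rule fin) (use ac in \<open>auto simp: h1 card simp del: card_atLeastLessThan\<close>)
      finally show ?thesis .
    next
      case ac: False
      have "prob (hit i j q \<inter> hit i' j' q) = prob {w\<in>space P. (\<lambda>(x, y). x + y = q) (incr ?B w, incr ?C w) \<and> incr ?A w = (\<lambda>(x, y). q - x) (incr ?B w, incr ?C w)}"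
        unfolding h1 h2 by (rule arg_cong[where f = prob]) (auto simp: algebra_simps)
      also have "\<dots> \<le> K0 / (real (card ?A) + 1) * prob {w\<in>space P. (\<lambda>(x, y). x + y = q) (incr ?B w, incr ?C w)}"
        using le by (intro prob_incr_le) auto
      also have "\<dots> \<le> (prob (hit i j q) + prob (hit i' j' q)) * (K0 / (real (max a c) + 1))"
        by (rule fin) (use ac in \<open>auto simp: h2 card simp del: card_atLeastLessThan\<close>)
      finally show ?thesis .
    qed
  next
    case False
    have h1: "hit i j q = {w\<in>space P. incr ?A w + incr ?B w + incr ?C w = q}"
      using incr_split[of i i' j] incr_split[of i' j' j] assms False by (simp add: hit_def min_def max_def add.assoc)
    have h2: "hit i' j' q = {w\<in>space P. incr ?B w = q}"
      using assms False by (simp add: hit_def min_def max_def)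
    show "prob (hit i j q \<inter> hit i' j' q) \<le> (prob (hit i j q) + prob (hit i' j' q)) * (K0 / (real (max a c) + 1))"
    proof (cases "a \<le> c")
      case ac: True
      have "prob (hit i j q \<inter> hit i' j' q) = prob {w\<in>space P. (\<lambda>(x, y). y = q) (incr ?A w, incr ?B w) \<and> incr ?C w = (\<lambda>(x, y). q - (x + y)) (incr ?A w, incr ?B w)}"
        unfolding h1 h2 by (rule arg_cong[where f = prob]) (auto simp: algebra_simps)
      also have "\<dots> \<le> K0 / (real (card ?C) + 1) * prob {w\<in>space P. (\<lambda>(x, y). y = q) (incr ?A w, incr ?B w)}"
        using le by (intro prob_incr_le) auto
      also have "\<dots> \<le> (prob (hit i j q) + prob (hit i' j' q)) * (K0 / (real (max a c) + 1))"
        by (rule fin) (use ac in \<open>auto simp: h2 card simp del: card_atLeastLessThan\<close>)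
      finally show ?thesis .
    next
      case ac: False
      have "prob (hit i j q \<inter> hit i' j' q) = prob {w\<in>space P. (\<lambda>(x, y). x = q) (incr ?B w, incr ?C w) \<and> incr ?A w = (\<lambda>(x, y). q - (x + y)) (incr ?B w, incr ?C w)}"
        unfolding h1 h2 by (rule arg_cong[where f = prob]) (auto simp: algebra_simps)
      also have "\<dots> \<le> K0 / (real (card ?A) + 1) * prob {w\<in>space P. (\<lambda>(x, y). x = q) (incr ?B w, incr ?C w)}"
        using le by (intro prob_incr_le) auto
      also have "\<dots> \<le> (prob (hit i j q) + prob (hit i' j' q)) * (K0 / (real (max a c) + 1))"
        by (rule fin) (use ac in \<open>auto simp: h2 card simp del: card_atLeastLessThan\<close>)
      finally show ?thesis .
    qed
  qed
qed

definition "overlapping e e' \<longleftrightarrow> fst e' < snd e \<and> fst e < snd (e' :: nat \<times> nat)"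

definition "edist e e' = max \<bar>int (fst e') - int (fst e)\<bar> \<bar>int (snd e') - int (snd (e :: nat \<times> nat))\<bar>"

text \<open>By symmetry the first window may be assumed to start first. Windows without overlap give
  independent events, so a correction to the product appears only for overlapping ones.\<close>

lemma prob_hit_pair:
  assumes "fst e < snd e" "fst e' < snd e'"
  shows "prob (hit (fst e) (snd e) q \<inter> hit (fst e') (snd e') q) \<le>
    prob (hit (fst e) (snd e) q) * prob (hit (fst e') (snd e') q)
    + (if overlapping e e' then (prob (hit (fst e) (snd e) q) + prob (hit (fst e') (snd e') q)) * (K0 / (real_of_int (edist e e') + 1)) else 0)"
proof -
  have *: "prob (hit (fst e) (snd e) q \<inter> hit (fst e') (snd e') q) \<le>
    prob (hit (fst e) (snd e) q) * prob (hit (fst e') (snd e') q)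
    + (if overlapping e e' then (prob (hit (fst e) (snd e) q) + prob (hit (fst e') (snd e') q)) * (K0 / (real_of_int (edist e e') + 1)) else 0)"
    if "fst e \<le> fst e'" "fst e < snd e" "fst e' < snd e'" for e e'
  proof (cases "snd e \<le> fst e'")
    case True
    then show ?thesis
      using prob_hit_disjoint[of "snd e" "fst e'" "fst e" q "snd e'"] by (simp add: overlapping_def)
  next
    case False
    have "real (max (fst e' - fst e) (max (snd e) (snd e') - min (snd e) (snd e'))) = real_of_int (edist e e')"
      using that by (auto simp: edist_def max_def min_def of_nat_diff)
    then show ?thesis
      using prob_hit_overlap[of "fst e" "fst e'" "snd e" "snd e'" q] that False
      by (auto simp: overlapping_def intro!: order_trans[OF _ le_add_same_cancel2[THEN iffD2]] measure_nonneg mult_nonneg_nonneg)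
  qed
  show ?thesis
  proof (cases "fst e \<le> fst e'")
    case True
    then show ?thesis using *[of e e'] assms by simp
  next
    case False
    have "overlapping e' e = overlapping e e'" "edist e' e = edist e e'"
      by (auto simp: overlapping_def edist_def abs_minus_commute)
    moreover from False have "fst e' \<le> fst e" by simp
    ultimately show ?thesis using *[OF _ assms(2,1)]
      by (simp only: Int_commute[of "hit (fst e') (snd e') q"] mult.commute[of "prob (hit (fst e') (snd e') q)"]
          add.commute[of "prob (hit (fst e') (snd e') q)"])
  qed
qed

definition "hits I q w = (\<Sum>e\<in>I. indicator (hit (fst e) (snd e) q) w :: real)"

definition "mean_hits I q = (\<Sum>e\<in>I. step_prob (snd e - fst e) q)"

lemma hits_measurable [measurable]: "hits I q \<in> borel_measurable P"
  unfolding hits_def by measurable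

lemma hits_nonneg: "0 \<le> hits I q w" by (simp add: hits_def sum_nonneg)

lemma mean_hits_nonneg: "0 \<le> mean_hits I q" by (simp add: mean_hits_def sum_nonneg step_prob_nonneg)

lemma hits_bounded: "\<bar>hits I q w\<bar> \<le> real (card I)"
proof -
  have "hits I q w \<le> (\<Sum>e\<in>I. 1)" unfolding hits_def by (intro sum_mono) (auto simp: indicator_def)
  then show ?thesis using hits_nonneg[of I q w] by simp
qed

lemma expectation_hits: "expectation (hits I q) = mean_hits I q"
  unfolding hits_def mean_hits_def
  by (subst Bochner_Integration.integral_sum) (auto simp: prob_hit emeasure_eq_measure intro!: integrable_real_indicator)

lemma hits_integrable: "integrable P (hits I q)" "integrable P (\<lambda>w. (hits I q w)\<^sup>2)"
proof -
  show "integrable P (hits I q)"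
    using hits_bounded by (intro integrable_const_bound[where B = "real (card I)"]) auto
  have "(hits I q w)\<^sup>2 \<le> (real (card I))\<^sup>2" for w
    using hits_bounded[of I q w] abs_le_square_iff[of "hits I q w" "real (card I)"] by simp
  then show "integrable P (\<lambda>w. (hits I q w)\<^sup>2)"
    by (intro integrable_const_bound[where B = "(real (card I))\<^sup>2"]) auto
qed

text \<open>Only overlapping windows contribute to the covariance. For a given window of length at
  most \<open>m\<close> their endpoints lie within distance \<open>m\<close> of its own, and the
  weights \<open>1 / (edist + 1)\<close> over this box sum to \<open>O(m)\<close>. The bound is
  linear in the maximal lag, which makes short lags cheap.\<close>

lemma variance_hits:
  assumes fin: "finite I" and I: "\<And>e. e \<in> I \<Longrightarrow> fst e < snd e \<and> snd e - fst e \<le> m"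
  shows "variance (hits I q) \<le> 8 * K0 * (2 * real m + 1) * mean_hits I q"
proof -
  let ?H = "\<lambda>e. hit (fst e) (snd e) q"
  let ?c = "\<lambda>e e'. if overlapping e e' then K0 / (real_of_int (edist e e') + 1) else 0"
  have row: "(\<Sum>e'\<in>I. ?c e e') \<le> K0 * (4 * (2 * real m + 1))" if e: "e \<in> I" for e
  proof -
    let ?J = "{e'\<in>I. overlapping e e'}"
    let ?g = "\<lambda>e'. (int (fst e') - int (fst e), int (snd e') - int (snd e))"
    have inj: "inj_on ?g ?J" by (auto simp: inj_on_def prod_eq_iff)
    have sub: "?g ` ?J \<subseteq> {-int m..int m} \<times> {-int m..int m}"
    proof (intro image_subsetI)
      fix e' assume e': "e' \<in> ?J"
      then show "?g e' \<in> {-int m..int m} \<times> {-int m..int m}"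
        using I[OF e] I[of e'] by (auto simp: overlapping_def)
    qed
    have "(\<Sum>e'\<in>I. ?c e e') = (\<Sum>e'\<in>?J. K0 / (real_of_int (edist e e') + 1))"
      using fin by (simp add: sum.inter_filter)
    also have "\<dots> = (\<Sum>p\<in>?g ` ?J. K0 / (real_of_int (max \<bar>fst p\<bar> \<bar>snd p\<bar>) + 1))"
      by (subst sum.reindex[OF inj]) (simp add: edist_def)
    also have "\<dots> \<le> (\<Sum>p\<in>{-int m..int m} \<times> {-int m..int m}. K0 / (real_of_int (max \<bar>fst p\<bar> \<bar>snd p\<bar>) + 1))"
      using K0(1) by (intro sum_mono2 sub) auto
    also have "\<dots> = K0 * (\<Sum>(a, c)\<in>{-int m..int m} \<times> {-int m..int m}. 1 / (real_of_int (max \<bar>a\<bar> \<bar>c\<bar>) + 1))"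
      by (simp add: sum_distrib_left case_prod_beta')
    also have "\<dots> \<le> K0 * (4 * (2 * real m + 1))"
      using K0(1) by (intro mult_left_mono sum_inverse_max_le) auto
    finally show ?thesis .
  qed
  have sym: "?c e e' = ?c e' e" for e e'
    by (auto simp: overlapping_def edist_def abs_minus_commute)
  have "expectation (\<lambda>w. (hits I q w)\<^sup>2) = expectation (\<lambda>w. \<Sum>e\<in>I. \<Sum>e'\<in>I. indicator (?H e \<inter> ?H e') w)"
    by (simp add: hits_def power2_eq_square sum_product indicator_inter_arith)
  also have "\<dots> = (\<Sum>e\<in>I. \<Sum>e'\<in>I. expectation (\<lambda>w. indicator (?H e \<inter> ?H e') w))"
  proof -
    have int: "integrable P (\<lambda>w. indicator (?H e \<inter> ?H e') w :: real)" for e e'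
      by (intro integrable_real_indicator) (auto simp: emeasure_eq_measure)
    show ?thesis
      by (subst Bochner_Integration.integral_sum, intro Bochner_Integration.integrable_sum int)
        (intro sum.cong refl Bochner_Integration.integral_sum int)
  qed
  also have "\<dots> = (\<Sum>e\<in>I. \<Sum>e'\<in>I. prob (?H e \<inter> ?H e'))"
    by simp
  also have "\<dots> \<le> (\<Sum>e\<in>I. \<Sum>e'\<in>I. prob (?H e) * prob (?H e') + (prob (?H e) + prob (?H e')) * ?c e e')"
  proof (intro sum_mono)
    fix e e' assume "e \<in> I" "e' \<in> I"
    then show "prob (?H e \<inter> ?H e') \<le> prob (?H e) * prob (?H e') + (prob (?H e) + prob (?H e')) * ?c e e'"
      using prob_hit_pair[of e e' q] I by (auto split: if_splits)
  qed
  also have "\<dots> = (\<Sum>e\<in>I. prob (?H e))\<^sup>2 + ((\<Sum>e\<in>I. \<Sum>e'\<in>I. prob (?H e) * ?c e e') + (\<Sum>e\<in>I. \<Sum>e'\<in>I. prob (?H e') * ?c e e'))"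
    by (simp only: sum.distrib distrib_right power2_eq_square sum_product)
  also have "(\<Sum>e\<in>I. \<Sum>e'\<in>I. prob (?H e') * ?c e e') = (\<Sum>e\<in>I. \<Sum>e'\<in>I. prob (?H e) * ?c e e')"
    by (subst sum.swap) (simp only: sym)
  also have "(\<Sum>e\<in>I. \<Sum>e'\<in>I. prob (?H e) * ?c e e') = (\<Sum>e\<in>I. prob (?H e) * (\<Sum>e'\<in>I. ?c e e'))"
    by (simp only: sum_distrib_left)
  also have "\<dots> \<le> (\<Sum>e\<in>I. prob (?H e) * (K0 * (4 * (2 * real m + 1))))"
    by (intro sum_mono mult_left_mono row) auto
  also have "\<dots> = mean_hits I q * (K0 * (4 * (2 * real m + 1)))"
    by (simp add: mean_hits_def prob_hit sum_distrib_right)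
  finally have "expectation (\<lambda>w. (hits I q w)\<^sup>2) \<le> (mean_hits I q)\<^sup>2 + 2 * (mean_hits I q * (K0 * (4 * (2 * real m + 1))))"
    by (simp add: mean_hits_def prob_hit mult_ac)
  then show ?thesis
    by (subst variance_eq[OF hits_integrable]) (simp add: expectation_hits algebra_simps)
qed

lemma hits_deviation:
  assumes fin: "finite I" and I: "\<And>e. e \<in> I \<Longrightarrow> fst e < snd e \<and> snd e - fst e \<le> m" and d: "d > 0"
  shows "prob {w\<in>space P. \<bar>hits I q w - mean_hits I q\<bar> \<ge> d} \<le> 8 * K0 * (2 * real m + 1) * mean_hits I q / d\<^sup>2"
proof -
  have "prob {w\<in>space P. \<bar>hits I q w - mean_hits I q\<bar> \<ge> d} \<le> variance (hits I q) / d\<^sup>2"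
    using Chebyshev_inequality[OF hits_measurable hits_integrable(2) d] by (simp add: expectation_hits)
  also have "\<dots> \<le> 8 * K0 * (2 * real m + 1) * mean_hits I q / d\<^sup>2"
    by (intro divide_right_mono variance_hits assms) auto
  finally show ?thesis .
qed

end

section \<open>Self-intersections along almost every path\<close>

text \<open>Ordered pairs including the diagonal, so that \<open>coll z A A 0\<close> is the
  variance of the scenery summed over the times in \<open>A\<close>.\<close>

definition coll :: "(nat \<Rightarrow> int \<times> int) \<Rightarrow> nat set \<Rightarrow> nat set \<Rightarrow> int \<times> int \<Rightarrow> real" where
  "coll z A B q = (\<Sum>i\<in>A. \<Sum>j\<in>B. of_bool (z j - z i = q))"

lemma coll_mono:
  assumes "A \<subseteq> A'" "B \<subseteq> B'" "finite A'" "finite B'"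
  shows "coll z A B q \<le> coll z A' B' q"
proof -
  have "coll z A B q \<le> (\<Sum>i\<in>A. \<Sum>j\<in>B'. of_bool (z j - z i = q))"
    unfolding coll_def using assms by (intro sum_mono sum_mono2) auto
  also have "\<dots> \<le> coll z A' B' q"
    unfolding coll_def using assms by (intro sum_mono2) (auto intro!: sum_nonneg)
  finally show ?thesis .
qed

lemma harmonic_tail:
  assumes "1 \<le> m" "m \<le> n"
  shows "(\<Sum>k\<in>{m<..n}. 1 / (real k + 1)) \<le> ln (real n) - ln (real m)"
  using assms(2)
proof (induction n rule: dec_induct)
  case (step n)
  have n: "n \<ge> 1" using step assms by simp
  have "ln (real n / (real n + 1)) \<le> real n / (real n + 1) - 1"
    using n by (intro ln_le_minus_one) auto
  also have "\<dots> = - (1 / (real n + 1))" by (simp add: field_simps)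
  finally have "1 / (real n + 1) \<le> ln (real n + 1) - ln (real n)"
    using n by (simp add: ln_div)
  moreover have "1 / (real (Suc n) + 1) \<le> 1 / (real n + 1)" by (simp add: field_simps)
  moreover have "{m<..Suc n} = insert (Suc n) {m<..n}" using step by auto
  ultimately show ?case using step by (simp add: add.commute)
qed simp

lemma deviation_algebra:
  fixes K n l c e :: real
  assumes "n > 0" "l > 0" "e > 0"
  shows "8 * K * (3 * n / l) * (n * ((c + 1) * l)) / (e * (n * l))\<^sup>2 = 8 * K * 3 * (c + 1) / e\<^sup>2 * (1 / l\<^sup>2)"
    and "8 * K * (3 * n) * (n * (K * sqrt l)) / (e * (n * l))\<^sup>2 = 8 * K * 3 * K / e\<^sup>2 * (sqrt l / l\<^sup>2)"
    and "sqrt l / l\<^sup>2 = 1 / (l * sqrt l)"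
  using assms by (simp_all add: field_simps power2_eq_square)

lemma deviation_sum:
  fixes h1 h2 n D G GD :: real
  assumes "h1 < G + D" "h2 < 2 * D" "G \<le> GD" "n \<le> D"
  shows "n + 2 * h1 + 2 * h2 < D + 2 * (GD + D) + 2 * (2 * D)"
proof -
  have "2 * h1 < 2 * (GD + D)" using assms(1,3) by simp
  moreover have "2 * h2 < 2 * (2 * D)" using assms(2) by simp
  ultimately show ?thesis using assms(4) by (intro add_less_le_mono add_le_less_mono) auto
qed

lemma mult_sqrt_le: "1 \<le> l \<Longrightarrow> l * sqrt l \<le> l * (l::real)"
  using mult_left_mono[of 1 "sqrt l" "sqrt l"] by simp

section \<open>Deviations of the collision counts at one time scale\<close>

context planar_walk
begin

definition "walk w i = (\<Sum>h<i. \<zeta> h w)"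

definition "pairs_lt A = {(i, j). i \<in> A \<and> j \<in> A \<and> i < (j :: nat)}"
text \<open>Every start carries all lags from 1 to \<open>m\<close>, even past the end of the
  window, so the mean is exactly \<open>M * green m q\<close>. With \<open>M = N\<close> the set
  covers all short pairs of a block and serves for upper bounds; with \<open>M = N - m\<close> it
  stays inside the block and serves for lower bounds.\<close>

definition "short_pairs a M m = (SIGMA i:{a..<a+M}. {i<..i+m :: nat})"
definition "long_pairs a N m = (SIGMA i:{a..<a+N}. {i+m<..i+N :: nat})"

text \<open>The limiting constant for pairs with \<open>i < j\<close>; both orders together give
  \<open>2 * gc\<close>.\<close>

definition "gc = 1 / (2 * pi * sqrt (s11 * s22 - s12\<^sup>2))"

lemma gc_pos: "gc > 0" using det_pos by (simp add: gc_def)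

lemma indicator_hit:
  assumes "w \<in> space P" "i \<le> j"
  shows "indicator (hit i j q) w = (of_bool (walk w j - walk w i = q) :: real)"
proof -
  have "walk w j = walk w i + incr {i..<j} w"
    using incr_split[of 0 i j w] assms(2) by (simp add: walk_def lessThan_atLeast0)
  then show ?thesis using assms(1) by (auto simp: hit_def indicator_def)
qed

lemma hits_eq:
  assumes "w \<in> space P" "\<And>e. e \<in> I \<Longrightarrow> fst e < snd e"
  shows "hits I q w = (\<Sum>(i, j)\<in>I. of_bool (walk w j - walk w i = q))"
  unfolding hits_def using assms
  by (intro sum.cong) (auto simp: indicator_hit case_prod_beta' less_imp_le)

lemma coll_eq_hits:
  assumes w: "w \<in> space P" and fin: "finite A"
  shows "coll (walk w) A A q = (if q = 0 then real (card A) else 0) + hits (pairs_lt A) q w + hits (pairs_lt A) (- q) w"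
proof -
  let ?f = "\<lambda>(i, j). of_bool (walk w j - walk w i = q) :: real"
  have finL: "finite (pairs_lt A)" by (rule finite_subset[of _ "A \<times> A"]) (use fin in \<open>auto simp: pairs_lt_def\<close>)
  have AA: "A \<times> A = ((\<lambda>i. (i, i)) ` A \<union> pairs_lt A) \<union> prod.swap ` pairs_lt A"
    by (force simp: pairs_lt_def image_iff)
  have "coll (walk w) A A q = sum ?f (A \<times> A)"
    by (simp add: coll_def sum.cartesian_product)
  also have "\<dots> = sum ?f ((\<lambda>i. (i, i)) ` A) + sum ?f (pairs_lt A) + sum ?f (prod.swap ` pairs_lt A)"
    unfolding AA using fin finL
    by (subst sum.union_disjoint, auto simp: pairs_lt_def)+
  also have "sum ?f ((\<lambda>i. (i, i)) ` A) = (if q = 0 then real (card A) else 0)"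
    by (subst sum.reindex) (auto simp: inj_on_def)
  also have "sum ?f (pairs_lt A) = hits (pairs_lt A) q w"
    by (subst hits_eq[OF w]) (auto simp: pairs_lt_def)
  also have "sum ?f (prod.swap ` pairs_lt A) = hits (pairs_lt A) (- q) w"
    by (subst hits_eq[OF w], force simp: pairs_lt_def, subst sum.reindex)
      (auto simp: inj_on_def case_prod_beta' algebra_simps intro!: sum.cong)
  finally show ?thesis .
qed

lemma hits_mono: "I \<subseteq> J \<Longrightarrow> finite J \<Longrightarrow> hits I q w \<le> hits J q w"
  unfolding hits_def by (intro sum_mono2) auto

lemma hits_Un_le: "finite I \<Longrightarrow> finite J \<Longrightarrow> hits (I \<union> J) q w \<le> hits I q w + hits J q w"
  unfolding hits_def by (subst sum_Un) (auto intro!: sum_nonneg)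

lemma finite_pairs [simp]: "finite (short_pairs a M m)" "finite (long_pairs a M m)"
  by (auto simp: short_pairs_def long_pairs_def)

lemma coll_upper:
  assumes "w \<in> space P"
  shows "coll (walk w) {a..<a+N} {a..<a+N} 0 \<le> real N + 2 * hits (short_pairs a N m) 0 w + 2 * hits (long_pairs a N m) 0 w"
proof -
  have "hits (pairs_lt {a..<a+N}) 0 w \<le> hits (short_pairs a N m \<union> long_pairs a N m) 0 w"
    by (rule hits_mono) (auto simp: pairs_lt_def short_pairs_def long_pairs_def)
  also have "\<dots> \<le> hits (short_pairs a N m) 0 w + hits (long_pairs a N m) 0 w"
    by (rule hits_Un_le) auto
  finally show ?thesis using coll_eq_hits[OF assms, of "{a..<a+N}" 0] by simp
qed

lemma coll_lower:
  assumes "w \<in> space P" "m \<le> N"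
  shows "coll (walk w) {a..<a+N} {a..<a+N} q \<ge> hits (short_pairs a (N - m) m) q w + hits (short_pairs a (N - m) m) (- q) w"
proof -
  have fin: "finite (pairs_lt {a..<a+N})"
    by (rule finite_subset[of _ "{a..<a+N} \<times> {a..<a+N}"]) (auto simp: pairs_lt_def)
  have "hits (short_pairs a (N - m) m) q w \<le> hits (pairs_lt {a..<a+N}) q w" for q
    by (rule hits_mono[OF _ fin]) (use assms in \<open>auto simp: pairs_lt_def short_pairs_def\<close>)
  moreover have "(if q = 0 then real (card {a..<a+N}) else 0) \<ge> 0" by simp
  ultimately show ?thesis
    unfolding coll_eq_hits[OF assms(1) finite_atLeastLessThan] using add_mono[OF add_mono] by (metis add_0)
qed

lemma mean_short: "mean_hits (short_pairs a M m) q = real M * green m q"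
proof -
  have "mean_hits (short_pairs a M m) q = (\<Sum>i\<in>{a..<a+M}. \<Sum>j\<in>{i<..i+m}. step_prob (j - i) q)"
    unfolding mean_hits_def short_pairs_def by (subst sum.Sigma) (auto simp: case_prod_beta')
  also have "\<dots> = (\<Sum>i\<in>{a..<a+M}. green m q)"
    unfolding green_def
    by (intro sum.cong refl sum.reindex_bij_witness[of _ "\<lambda>k. i + k" "\<lambda>j. j - i" for i]) auto
  finally show ?thesis by simp
qed

text \<open>The decay \<open>K0 / (k + 1)\<close> summed over lags between \<open>m\<close> and
  \<open>N\<close> grows like the logarithm of \<open>N / m\<close> only.\<close>

lemma mean_long:
  assumes "1 \<le> m" "m \<le> N"
  shows "mean_hits (long_pairs a N m) q \<le> real N * (K0 * (ln (real N) - ln (real m)))"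
proof -
  have "mean_hits (long_pairs a N m) q = (\<Sum>i\<in>{a..<a+N}. \<Sum>j\<in>{i+m<..i+N}. step_prob (j - i) q)"
    unfolding mean_hits_def long_pairs_def by (subst sum.Sigma) (auto simp: case_prod_beta')
  also have "\<dots> = (\<Sum>i\<in>{a..<a+N}. \<Sum>k\<in>{m<..N}. step_prob k q)"
    by (intro sum.cong refl sum.reindex_bij_witness[of _ "\<lambda>k. i + k" "\<lambda>j. j - i" for i]) auto
  also have "(\<Sum>i\<in>{a..<a+N}. \<Sum>k\<in>{m<..N}. step_prob k q) = real N * (\<Sum>k\<in>{m<..N}. step_prob k q)"
    by simp
  also have "\<dots> \<le> real N * (\<Sum>k\<in>{m<..N}. K0 * (1 / (real k + 1)))"
    using K0(2) by (intro mult_left_mono sum_mono) auto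
  also have "\<dots> = real N * (K0 * (\<Sum>k\<in>{m<..N}. 1 / (real k + 1)))"
    by (simp add: sum_distrib_left)
  also have "\<dots> \<le> real N * (K0 * (ln (real N) - ln (real m)))"
    using K0(1) assms by (intro mult_left_mono harmonic_tail) auto
  finally show ?thesis .
qed

text \<open>With all lags up to \<open>N\<close>, Chebyshev's inequality gives a probability of
  order \<open>1 / ln N\<close>. Cutting at \<open>N / ln N\<close> gains a factor
  \<open>1 / ln N\<close> in the variance of the short pairs, while the long pairs have a mean of
  order \<open>N * ln (ln N)\<close>, small against \<open>N * ln N\<close>.\<close>

definition "lag N = nat \<lfloor>real N / ln (real N)\<rfloor>"

text \<open>The larger of the two error probabilities: short pairs give \<open>(ln N)\<close> to the
  power -2, long pairs the power -3/2.\<close>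

definition "rate N = 1 / (ln (real N) * sqrt (ln (real N)))"

lemma lag_bounds:
  assumes "N \<ge> 2"
  shows "real N / ln (real N) - 1 \<le> real (lag N)" "real (lag N) \<le> real N / ln (real N)"
proof -
  have "0 \<le> real N / ln (real N)" using assms by simp
  then show "real N / ln (real N) - 1 \<le> real (lag N)" "real (lag N) \<le> real N / ln (real N)"
    unfolding lag_def by linarith+
qed

lemma lag_at_top: "filterlim lag at_top sequentially"
proof -
  have "filterlim (\<lambda>N. real N / ln (real N) - 1) at_top sequentially" by real_asymp
  then have "filterlim (\<lambda>N. real (lag N)) at_top sequentially"
    by (rule filterlim_at_top_mono) (use lag_bounds(1) in \<open>auto intro: eventually_sequentiallyI[of 2]\<close>)
  then show ?thesis by (simp add: filterlim_sequentially_iff_filterlim_real)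
qed

lemma ln_lag: "(\<lambda>N. ln (real (lag N)) / ln (real N)) \<longlonglongrightarrow> 1"
proof (rule tendsto_sandwich)
  show "(\<lambda>N. ln (real N / ln (real N) - 1) / ln (real N)) \<longlonglongrightarrow> 1" by real_asymp
  show "(\<lambda>N. ln (real N / ln (real N)) / ln (real N)) \<longlonglongrightarrow> 1" by real_asymp
  have ev: "\<forall>\<^sub>F N in sequentially. real N / ln (real N) - 1 > 0" by real_asymp
  show "\<forall>\<^sub>F N in sequentially. ln (real N / ln (real N) - 1) / ln (real N) \<le> ln (real (lag N)) / ln (real N)"
    using ev eventually_ge_at_top[of 2]
  proof eventually_elim
    case (elim N)
    then show ?case using lag_bounds(1)[of N] by (intro divide_right_mono ln_mono) auto
  qed
  show "\<forall>\<^sub>F N in sequentially. ln (real (lag N)) / ln (real N) \<le> ln (real N / ln (real N)) / ln (real N)"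
    using ev eventually_ge_at_top[of 2]
  proof eventually_elim
    case (elim N)
    then have "real (lag N) > 0" using lag_bounds(1)[of N] by linarith
    then show ?case using lag_bounds(2)[OF elim(2)] elim(2) by (intro divide_right_mono ln_mono) auto
  qed
qed

text \<open>\<open>lag N\<close> is \<open>N\<close> up to a logarithmic factor, so both have
  asymptotically the same logarithm and the cut does not change the constant.\<close>

lemma green_lag: "(\<lambda>N. green (lag N) q / ln (real N)) \<longlonglongrightarrow> gc"
proof -
  have "(\<lambda>N. green (lag N) q / ln (real (lag N))) \<longlonglongrightarrow> gc"
    unfolding gc_def by (rule filterlim_compose[OF green_asymp lag_at_top])
  from tendsto_mult[OF this ln_lag]
  have "(\<lambda>N. green (lag N) q / ln (real (lag N)) * (ln (real (lag N)) / ln (real N))) \<longlonglongrightarrow> gc" by simp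
  moreover have "\<forall>\<^sub>F N in sequentially. green (lag N) q / ln (real (lag N)) * (ln (real (lag N)) / ln (real N)) = green (lag N) q / ln (real N)"
    using lag_at_top[unfolded filterlim_at_top, rule_format, of 2] by eventually_elim auto
  ultimately show ?thesis by (rule Lim_transform_eventually)
qed

lemma eventually_lag:
  assumes "e > 0"
  shows "\<forall>\<^sub>F N in sequentially. 1 \<le> lag N \<and> lag N \<le> N \<and> 2 * real (lag N) + 1 \<le> 3 * real N / ln (real N)
     \<and> ln (real N) - ln (real (lag N)) \<le> sqrt (ln (real N)) \<and> 1 \<le> e * ln (real N)
     \<and> K0 * sqrt (ln (real N)) \<le> e * ln (real N) \<and> 1 \<le> ln (real N) \<and> 1 \<le> real N"
proof -
  have "\<forall>\<^sub>F N in sequentially. ln (real N) - ln (real N / ln (real N) - 1) \<le> sqrt (ln (real N))" by real_asymp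
  moreover have "\<forall>\<^sub>F N in sequentially. real N / ln (real N) - 1 > 0" by real_asymp
  moreover have "\<forall>\<^sub>F N in sequentially. 1 \<le> real N / ln (real N)" by real_asymp
  moreover have "\<forall>\<^sub>F N in sequentially. 1 \<le> e * ln (real N)" using assms by real_asymp
  moreover have "\<forall>\<^sub>F N in sequentially. K0 * sqrt (ln (real N)) \<le> e * ln (real N)"
  proof -
    have "\<forall>\<^sub>F N in sequentially. c \<le> sqrt (ln (real N))" for c :: real by real_asymp
    from this[of "K0 / e"] show ?thesis using \<open>\<forall>\<^sub>F N in sequentially. 1 \<le> e * ln (real N)\<close>
    proof eventually_elim
      case (elim N)
      have "K0 \<le> e * sqrt (ln (real N))" using elim(1) assms by (simp add: divide_le_eq mult.commute)
      moreover have pos: "0 < sqrt (ln (real N))"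
        by (rule less_le_trans[OF divide_pos_pos[OF K0(1) assms] elim(1)])
      ultimately have "K0 * sqrt (ln (real N)) \<le> e * sqrt (ln (real N)) * sqrt (ln (real N))"
        by (intro mult_right_mono) auto
      also have "\<dots> = e * ln (real N)" using pos by (simp add: mult.assoc)
      finally show ?case .
    qed
  qed
  moreover have "\<forall>\<^sub>F N in sequentially. 1 \<le> ln (real N)" by real_asymp
  moreover have "\<forall>\<^sub>F N in sequentially. 1 \<le> lag N"
    using lag_at_top[unfolded filterlim_at_top, rule_format, of 1] .
  ultimately show ?thesis using eventually_ge_at_top[of 2]
  proof eventually_elim
    case (elim N)
    note b = lag_bounds[OF elim(8)]
    have "real N / ln (real N) \<le> real N" using elim(6,8) by (simp add: divide_le_eq mult_le_cancel_left1)
    then have "lag N \<le> N" using b(2) by linarith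
    moreover have "2 * real (lag N) + 1 \<le> 3 * real N / ln (real N)" using b(2) elim(3) by simp
    moreover have "ln (real N) - ln (real (lag N)) \<le> sqrt (ln (real N))"
    proof -
      have "ln (real N / ln (real N) - 1) \<le> ln (real (lag N))" using b(1) elim(2) by (intro ln_mono) auto
      then show ?thesis using elim(1) by linarith
    qed
    ultimately show ?case using elim by simp
  qed
qed

text \<open>The variance is linear in the maximal lag, here at most of order
  \<open>N / ln N\<close>. The bound is uniform in the position \<open>a\<close>, which permits the
  blocks to move along the subsequence.\<close>

lemma short_deviation:
  assumes e: "e > 0"
  shows "\<exists>B. \<forall>\<^sub>F N in sequentially. \<forall>a M. M \<le> N \<longrightarrow>
    prob {w\<in>space P. \<bar>hits (short_pairs a M (lag N)) q w - real M * green (lag N) q\<bar> \<ge> e * (real N * ln (real N))} \<le> B * rate N"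
proof -
  let ?B = "8 * K0 * 3 * (gc + 1) / e\<^sup>2"
  have "\<forall>\<^sub>F N in sequentially. green (lag N) q / ln (real N) < gc + 1"
    by (rule order_tendstoD[OF green_lag]) simp
  then have "\<forall>\<^sub>F N in sequentially. \<forall>a M. M \<le> N \<longrightarrow>
    prob {w\<in>space P. \<bar>hits (short_pairs a M (lag N)) q w - real M * green (lag N) q\<bar> \<ge> e * (real N * ln (real N))} \<le> ?B * rate N"
    using eventually_lag[OF e]
  proof eventually_elim
    case (elim N)
    let ?L = "ln (real N)"
    have L: "?L \<ge> 1" "real N \<ge> 1" using elim by auto
    have dX: "e * (real N * ?L) > 0" by (intro mult_pos_pos) (use e L in linarith)+
    show ?case
    proof (intro allI impI)
      fix a M assume M: "M \<le> N"
      have g: "0 \<le> green (lag N) q" by (simp add: green_def step_prob_nonneg sum_nonneg)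
      have "0 < ?L" using L by linarith
      from elim(1) have g': "green (lag N) q \<le> (gc + 1) * ?L"
        unfolding pos_divide_less_eq[OF \<open>0 < ?L\<close>] by (rule less_imp_le)
      have "prob {w\<in>space P. \<bar>hits (short_pairs a M (lag N)) q w - real M * green (lag N) q\<bar> \<ge> e * (real N * ?L)}
        \<le> 8 * K0 * (2 * real (lag N) + 1) * (real M * green (lag N) q) / (e * (real N * ?L))\<^sup>2"
        unfolding mean_short[symmetric, of M "lag N" q a]
        by (rule hits_deviation[OF finite_pairs(1) _ dX]) (auto simp: short_pairs_def)
      also have "\<dots> \<le> 8 * K0 * (3 * real N / ?L) * (real N * ((gc + 1) * ?L)) / (e * (real N * ?L))\<^sup>2"
        using elim L g g' M K0(1) gc_pos by (intro divide_right_mono mult_mono) auto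
      also have "\<dots> = ?B * (1 / ?L\<^sup>2)"
        by (rule deviation_algebra(1)) (use L e in linarith)+
      also have "\<dots> \<le> ?B * rate N"
      proof (rule mult_left_mono)
        have "?L * sqrt ?L \<le> ?L * ?L" using L by (intro mult_sqrt_le) auto
        moreover have "0 < ?L" using L by linarith
        ultimately show "1 / ?L\<^sup>2 \<le> rate N" unfolding rate_def power2_eq_square
          by (intro divide_left_mono mult_pos_pos real_sqrt_gt_zero) simp_all
      qed (use K0(1) gc_pos in auto)
      finally show "prob {w\<in>space P. \<bar>hits (short_pairs a M (lag N)) q w - real M * green (lag N) q\<bar> \<ge> e * (real N * ?L)} \<le> ?B * rate N" .
    qed
  qed
  then show ?thesis by blast
qed

text \<open>The mean involves \<open>ln (N / lag N)\<close>, which is bounded crudely by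
  \<open>sqrt (ln N)\<close>; this already makes it negligible, so exceeding twice the threshold
  forces a deviation of at least the threshold.\<close>

lemma long_deviation:
  assumes e: "e > 0"
  shows "\<exists>B. \<forall>\<^sub>F N in sequentially. \<forall>a.
    prob {w\<in>space P. hits (long_pairs a N (lag N)) 0 w \<ge> 2 * e * (real N * ln (real N))} \<le> B * rate N"
proof -
  let ?B = "8 * K0 * 3 * K0 / e\<^sup>2"
  have "\<forall>\<^sub>F N in sequentially. \<forall>a.
    prob {w\<in>space P. hits (long_pairs a N (lag N)) 0 w \<ge> 2 * e * (real N * ln (real N))} \<le> ?B * rate N"
    using eventually_lag[OF e]
  proof eventually_elim
    case (elim N)
    let ?L = "ln (real N)"
    have L: "?L \<ge> 1" "real N \<ge> 1" using elim by auto
    have dX: "e * (real N * ?L) > 0" by (intro mult_pos_pos) (use e L in linarith)+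
    show ?case
    proof (intro allI)
      fix a
      let ?I = "long_pairs a N (lag N)"
      have mean: "mean_hits ?I 0 \<le> real N * (K0 * sqrt ?L)"
      proof -
        have "mean_hits ?I 0 \<le> real N * (K0 * (ln (real N) - ln (real (lag N))))" using elim by (intro mean_long) auto
        also have "\<dots> \<le> real N * (K0 * sqrt ?L)" using elim K0(1) by (intro mult_left_mono) auto
        finally show ?thesis .
      qed
      also have "\<dots> \<le> e * (real N * ?L)" using elim(1) L by (simp add: mult.left_commute)
      finally have mean2: "mean_hits ?I 0 \<le> e * (real N * ?L)" .
      have "prob {w\<in>space P. hits ?I 0 w \<ge> 2 * e * (real N * ?L)}
        \<le> prob {w\<in>space P. \<bar>hits ?I 0 w - mean_hits ?I 0\<bar> \<ge> e * (real N * ?L)}"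
        using mean2 by (intro finite_measure_mono) (auto simp: algebra_simps abs_if, measurable)
      also have "\<dots> \<le> 8 * K0 * (2 * real N + 1) * mean_hits ?I 0 / (e * (real N * ?L))\<^sup>2"
        by (rule hits_deviation[OF finite_pairs(2) _ dX]) (auto simp: long_pairs_def)
      also have "\<dots> \<le> 8 * K0 * (3 * real N) * (real N * (K0 * sqrt ?L)) / (e * (real N * ?L))\<^sup>2"
        using mean L K0(1) mean_hits_nonneg by (intro divide_right_mono mult_mono) auto
      also have "\<dots> = ?B * (sqrt ?L / ?L\<^sup>2)"
        by (rule deviation_algebra(2)) (use L e in linarith)+
      also have "sqrt ?L / ?L\<^sup>2 = rate N"
        unfolding rate_def by (rule deviation_algebra(3)[of 1 _ 1]) (use L in linarith)+
      finally show "prob {w\<in>space P. hits ?I 0 w \<ge> 2 * e * (real N * ?L)} \<le> ?B * rate N" .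
    qed
  qed
  then show ?thesis by blast
qed

lemma coll_measurable [measurable]: "(\<lambda>w. coll (walk w) A B q) \<in> borel_measurable P"
proof -
  have "(\<lambda>w. of_bool (walk w j - walk w i = q) :: real) \<in> borel_measurable P" for i j
  proof -
    have "(\<lambda>w. (walk w j, walk w i)) \<in> P \<rightarrow>\<^sub>M count_space UNIV \<Otimes>\<^sub>M count_space UNIV"
      unfolding walk_def by measurable
    then have "(\<lambda>w. (walk w j, walk w i)) \<in> P \<rightarrow>\<^sub>M count_space UNIV" by (simp add: pair_measure_countable)
    from measurable_compose[OF this, of "\<lambda>p. of_bool (fst p - snd p = q) :: real" borel] show ?thesis by simp
  qed
  then show ?thesis unfolding coll_def by (intro borel_measurable_sum)
qed

lemma prob_coll_upper:
  assumes e: "e > 0"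
  shows "\<exists>B. \<forall>\<^sub>F N in sequentially. \<forall>a.
    prob {w\<in>space P. coll (walk w) {a..<a+N} {a..<a+N} 0 \<ge> (2 * gc + e) * (real N * ln (real N))} \<le> B * rate N"
proof -
  \<comment> \<open>The errors add up to \<open>9 * d\<close>: one for the diagonal, four for the
    short pairs and four for the long ones.\<close>
  define d where "d = e / 10"
  have d: "d > 0" using e by (simp add: d_def)
  obtain B1 where B1: "\<forall>\<^sub>F N in sequentially. \<forall>a M. M \<le> N \<longrightarrow>
    prob {w\<in>space P. \<bar>hits (short_pairs a M (lag N)) 0 w - real M * green (lag N) 0\<bar> \<ge> d * (real N * ln (real N))} \<le> B1 * rate N"
    using short_deviation[OF d, of 0] by blast
  obtain B2 where B2: "\<forall>\<^sub>F N in sequentially. \<forall>a.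
    prob {w\<in>space P. hits (long_pairs a N (lag N)) 0 w \<ge> 2 * d * (real N * ln (real N))} \<le> B2 * rate N"
    using long_deviation[OF d] by blast
  have gr: "\<forall>\<^sub>F N in sequentially. green (lag N) 0 / ln (real N) < gc + d"
    by (rule order_tendstoD[OF green_lag]) (use d in simp)
  have "\<forall>\<^sub>F N in sequentially. \<forall>a.
    prob {w\<in>space P. coll (walk w) {a..<a+N} {a..<a+N} 0 \<ge> (2 * gc + e) * (real N * ln (real N))} \<le> (B1 + B2) * rate N"
    using eventually_lag[OF d] B1 B2 gr
  proof eventually_elim
    case (elim N)
    let ?L = "ln (real N)"
    let ?X = "real N * ?L"
    have L: "?L \<ge> 1" "real N \<ge> 1" using elim(1) by auto
    have X: "real N \<le> d * ?X" using elim(1) L by (simp add: mult.left_commute)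
    have X0: "d * ?X > 0" by (intro mult_pos_pos) (use d L in linarith)+
    have g: "real N * green (lag N) 0 \<le> (gc + d) * ?X"
    proof -
      have "0 < ?L" using L by linarith
      from elim(4) have "green (lag N) 0 \<le> (gc + d) * ?L"
        unfolding pos_divide_less_eq[OF \<open>0 < ?L\<close>] by (rule less_imp_le)
      from mult_left_mono[OF this, of "real N"] show ?thesis by (simp add: mult_ac)
    qed
    show ?case
    proof
      fix a
      let ?E1 = "{w\<in>space P. \<bar>hits (short_pairs a N (lag N)) 0 w - real N * green (lag N) 0\<bar> \<ge> d * ?X}"
      let ?E2 = "{w\<in>space P. hits (long_pairs a N (lag N)) 0 w \<ge> 2 * d * ?X}"
      have "{w\<in>space P. coll (walk w) {a..<a+N} {a..<a+N} 0 \<ge> (2 * gc + e) * ?X} \<subseteq> ?E1 \<union> ?E2"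
      proof (intro subsetI, rule ccontr)
        fix w assume w: "w \<in> {w\<in>space P. coll (walk w) {a..<a+N} {a..<a+N} 0 \<ge> (2 * gc + e) * ?X}" and "w \<notin> ?E1 \<union> ?E2"
        then have h: "hits (short_pairs a N (lag N)) 0 w < real N * green (lag N) 0 + d * ?X"
          "hits (long_pairs a N (lag N)) 0 w < 2 * (d * ?X)"
          by (auto simp: not_le)
        have "coll (walk w) {a..<a+N} {a..<a+N} 0 \<le> real N + 2 * hits (short_pairs a N (lag N)) 0 w + 2 * hits (long_pairs a N (lag N)) 0 w"
          using w by (intro coll_upper) auto
        also have "\<dots> < d * ?X + 2 * ((gc + d) * ?X + d * ?X) + 2 * (2 * (d * ?X))"
          by (rule deviation_sum[OF h g X])
        also have "\<dots> = (2 * gc + 9 * d) * ?X" by (simp add: algebra_simps)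
        also have "\<dots> \<le> (2 * gc + e) * ?X"
          using X0 d L by (intro mult_right_mono) (auto simp: d_def)
        finally show False using w by simp
      qed
      then have "prob {w\<in>space P. coll (walk w) {a..<a+N} {a..<a+N} 0 \<ge> (2 * gc + e) * ?X} \<le> prob (?E1 \<union> ?E2)"
        by (intro finite_measure_mono) measurable
      also have "\<dots> \<le> prob ?E1 + prob ?E2" by (intro measure_Un_le) measurable
      also have "\<dots> \<le> B1 * rate N + B2 * rate N" using elim(2,3) by (intro add_mono) auto
      finally show "prob {w\<in>space P. coll (walk w) {a..<a+N} {a..<a+N} 0 \<ge> (2 * gc + e) * ?X} \<le> (B1 + B2) * rate N"
        by (simp add: algebra_simps)
    qed
  qed
  then show ?thesis by blast
qed

lemma prob_coll_lower:
  assumes e: "e > 0"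
  shows "\<exists>B. \<forall>\<^sub>F N in sequentially. \<forall>a.
    prob {w\<in>space P. coll (walk w) {a..<a+N} {a..<a+N} q \<le> (2 * gc - e) * (real N * ln (real N))} \<le> B * rate N"
proof -
  \<comment> \<open>Each of the displacements \<open>q\<close> and \<open>- q\<close> loses
    \<open>d\<close> in the mean and \<open>d\<close> in the deviation; the total
    \<open>4 * d\<close> stays strictly below \<open>e\<close>.\<close>
  define d where "d = e / 6"
  have d: "d > 0" using e by (simp add: d_def)
  obtain B1 where B1: "\<forall>\<^sub>F N in sequentially. \<forall>a M. M \<le> N \<longrightarrow>
    prob {w\<in>space P. \<bar>hits (short_pairs a M (lag N)) q w - real M * green (lag N) q\<bar> \<ge> d * (real N * ln (real N))} \<le> B1 * rate N"
    using short_deviation[OF d, of q] by blast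
  obtain B2 where B2: "\<forall>\<^sub>F N in sequentially. \<forall>a M. M \<le> N \<longrightarrow>
    prob {w\<in>space P. \<bar>hits (short_pairs a M (lag N)) (- q) w - real M * green (lag N) (- q)\<bar> \<ge> d * (real N * ln (real N))} \<le> B2 * rate N"
    using short_deviation[OF d, of "- q"] by blast
  have gr: "\<forall>\<^sub>F N in sequentially. (1 - real (lag N) / real N) * (green (lag N) q / ln (real N)) > gc - d" for q
  proof -
    have "(\<lambda>N. real (lag N) / real N) \<longlonglongrightarrow> 0"
    proof (rule tendsto_sandwich[of "\<lambda>_. 0" _ _ "\<lambda>N. 1 / ln (real N)"])
      show "\<forall>\<^sub>F N in sequentially. real (lag N) / real N \<le> 1 / ln (real N)"
        using eventually_ge_at_top[of 2]
        by eventually_elim (use lag_bounds(2) in \<open>auto simp: field_simps\<close>)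
      show "(\<lambda>N. 1 / ln (real N)) \<longlonglongrightarrow> 0" by real_asymp
    qed auto
    then have "(\<lambda>N. (1 - real (lag N) / real N) * (green (lag N) q / ln (real N))) \<longlonglongrightarrow> (1 - 0) * gc"
      by (intro tendsto_intros green_lag)
    then show ?thesis using d by (intro order_tendstoD) auto
  qed
  have "\<forall>\<^sub>F N in sequentially. \<forall>a.
    prob {w\<in>space P. coll (walk w) {a..<a+N} {a..<a+N} q \<le> (2 * gc - e) * (real N * ln (real N))} \<le> (B1 + B2) * rate N"
    using eventually_lag[OF d] B1 B2 gr[of q] gr[of "- q"]
  proof eventually_elim
    case (elim N)
    let ?L = "ln (real N)"
    let ?X = "real N * ?L"
    let ?M = "N - lag N"
    have L: "?L \<ge> 1" "real N \<ge> 1" using elim(1) by auto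
    have X0: "d * ?X > 0" by (intro mult_pos_pos) (use d L in linarith)+
    have M: "real ?M = real N * (1 - real (lag N) / real N)" using elim(1) L by (simp add: of_nat_diff field_simps)
    have g: "real ?M * green (lag N) q' > (gc - d) * ?X"
      if "(1 - real (lag N) / real N) * (green (lag N) q' / ?L) > gc - d" for q'
    proof -
      have "(gc - d) * ?X < ((1 - real (lag N) / real N) * (green (lag N) q' / ?L)) * ?X"
        using that by (intro mult_strict_right_mono mult_pos_pos) (use L in linarith)+
      also have "\<dots> = real ?M * green (lag N) q'"
      proof -
        have "?L \<noteq> 0" using L by linarith
        moreover have "x * (g / l) * (n * l) = n * x * g" if "l \<noteq> 0" for x g l n :: real using that by simp
        ultimately show ?thesis unfolding M by blast
      qed
      finally show ?thesis .
    qed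
    show ?case
    proof
      fix a
      let ?E1 = "{w\<in>space P. \<bar>hits (short_pairs a ?M (lag N)) q w - real ?M * green (lag N) q\<bar> \<ge> d * ?X}"
      let ?E2 = "{w\<in>space P. \<bar>hits (short_pairs a ?M (lag N)) (- q) w - real ?M * green (lag N) (- q)\<bar> \<ge> d * ?X}"
      have "{w\<in>space P. coll (walk w) {a..<a+N} {a..<a+N} q \<le> (2 * gc - e) * ?X} \<subseteq> ?E1 \<union> ?E2"
      proof (intro subsetI, rule ccontr)
        fix w assume w: "w \<in> {w\<in>space P. coll (walk w) {a..<a+N} {a..<a+N} q \<le> (2 * gc - e) * ?X}" and "w \<notin> ?E1 \<union> ?E2"
        then have h: "hits (short_pairs a ?M (lag N)) q w > real ?M * green (lag N) q - d * ?X"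
          "hits (short_pairs a ?M (lag N)) (- q) w > real ?M * green (lag N) (- q) - d * ?X"
          by (auto simp: not_le abs_less_iff)
        have "(2 * gc - e) * ?X < (2 * gc - 4 * d) * ?X"
          by (intro mult_strict_right_mono mult_pos_pos) (use L d in \<open>unfold d_def, linarith\<close>)+
        also have "\<dots> = ((gc - d) * ?X - d * ?X) + ((gc - d) * ?X - d * ?X)" by (simp add: algebra_simps)
        also have "\<dots> < hits (short_pairs a ?M (lag N)) q w + hits (short_pairs a ?M (lag N)) (- q) w"
          by (rule add_strict_mono) (use h g[OF elim(4)] g[OF elim(5)] in linarith)+
        also have "\<dots> \<le> coll (walk w) {a..<a+N} {a..<a+N} q"
          using w elim(1) by (intro coll_lower) auto
        finally show False using w by simp
      qed
      then have "prob {w\<in>space P. coll (walk w) {a..<a+N} {a..<a+N} q \<le> (2 * gc - e) * ?X} \<le> prob (?E1 \<union> ?E2)"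
        by (intro finite_measure_mono) measurable
      also have "\<dots> \<le> prob ?E1 + prob ?E2" by (intro measure_Un_le) measurable
      also have "\<dots> \<le> B1 * rate N + B2 * rate N" using elim(2,3) by (intro add_mono) auto
      finally show "prob {w\<in>space P. coll (walk w) {a..<a+N} {a..<a+N} q \<le> (2 * gc - e) * ?X} \<le> (B1 + B2) * rate N"
        by (simp add: algebra_simps)
    qed
  qed
  then show ?thesis by blast
qed

end

section \<open>The subsequence and the interpolation between its members\<close>

definition tau :: "nat \<Rightarrow> real" where "tau r = exp (real r powr (3/4))"

definition tau_index :: "nat \<Rightarrow> nat" where "tau_index n = nat \<lfloor>ln (real n) powr (4/3)\<rfloor>"

lemma tau_pos: "tau r > 0" by (simp add: tau_def)

lemma tau_at_top: "filterlim tau at_top sequentially"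
  unfolding tau_def by real_asymp

text \<open>This uses that the exponent is below 1; it lets every \<open>n\<close> be replaced by a
  neighbouring member of the subsequence at the cost of a factor tending to 1.\<close>

lemma tau_ratio: "(\<lambda>r. tau (Suc r) / tau r) \<longlonglongrightarrow> 1"
  unfolding tau_def by real_asymp

lemma tau_ratio': "(\<lambda>r. tau r / tau (Suc r)) \<longlonglongrightarrow> 1"
  unfolding tau_def by real_asymp

lemma nat_floor_bounds: "x \<ge> 0 \<Longrightarrow> x - 1 \<le> real (nat \<lfloor>x\<rfloor>) \<and> real (nat \<lfloor>x\<rfloor>) \<le> x"
  by linarith

lemma tau_bracket:
  assumes "n \<ge> 2"
  shows "tau (tau_index n) \<le> real n" "real n \<le> tau (Suc (tau_index n))"
proof -
  define x where "x = ln (real n)"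
  have x: "x > 0" using assms by (simp add: x_def)
  have r: "real (tau_index n) \<le> x powr (4/3)" "x powr (4/3) \<le> real (Suc (tau_index n))"
    using nat_floor_bounds[of "x powr (4/3)"] real_of_int_floor_add_one_ge[of "x powr (4/3)"]
    by (auto simp: tau_index_def x_def add.commute)
  have xx: "(x powr (4/3)) powr (3/4) = x" using x by (simp add: powr_powr)
  have "real (tau_index n) powr (3/4) \<le> x" using powr_mono2[OF _ _ r(1), of "3/4"] xx by simp
  then show "tau (tau_index n) \<le> real n"
    using assms by (simp add: tau_def x_def flip: ln_ge_iff)
  have "x \<le> real (Suc (tau_index n)) powr (3/4)" using powr_mono2[OF _ _ r(2), of "3/4"] xx by simp
  then show "real n \<le> tau (Suc (tau_index n))"
    using assms exp_le_cancel_iff[of x "real (Suc (tau_index n)) powr (3/4)"] by (simp add: tau_def x_def)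
qed

lemma tau_index_at_top: "filterlim tau_index at_top sequentially"
proof -
  have "filterlim (\<lambda>n. ln (real n) powr (4/3) - 1) at_top sequentially" by real_asymp
  moreover have "\<forall>\<^sub>F n in sequentially. ln (real n) powr (4/3) - 1 \<le> real (tau_index n)"
    using nat_floor_bounds by (simp add: tau_index_def)
  ultimately have "filterlim (\<lambda>n. real (tau_index n)) at_top sequentially"
    by (rule filterlim_at_top_mono)
  then show ?thesis by (simp add: filterlim_sequentially_iff_filterlim_real)
qed

text \<open>The logarithms differ by a bounded amount and diverge, so their quotient tends to
  1.\<close>

lemma xlogx_ratio:
  fixes x y :: "nat \<Rightarrow> real"
  assumes lim: "(\<lambda>r. x r / y r) \<longlonglongrightarrow> L" and L: "L > 0" and y: "filterlim y at_top sequentially"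
  shows "(\<lambda>r. x r * ln (x r) / (y r * ln (y r))) \<longlonglongrightarrow> L"
proof -
  have ly: "filterlim (\<lambda>r. ln (y r)) at_top sequentially"
    by (rule filterlim_compose[OF ln_at_top y])
  have "(\<lambda>r. ln (x r / y r)) \<longlonglongrightarrow> ln L" using lim L by (intro tendsto_intros) auto
  then have "(\<lambda>r. 1 + ln (x r / y r) / ln (y r)) \<longlonglongrightarrow> 1 + 0"
    by (intro tendsto_add tendsto_const real_tendsto_divide_at_top[OF _ ly])
  then have "(\<lambda>r. x r / y r * (1 + ln (x r / y r) / ln (y r))) \<longlonglongrightarrow> L * (1 + 0)"
    by (intro tendsto_mult lim)
  moreover have "\<forall>\<^sub>F r in sequentially. x r / y r * (1 + ln (x r / y r) / ln (y r)) = x r * ln (x r) / (y r * ln (y r))"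
  proof -
    have "\<forall>\<^sub>F r in sequentially. x r / y r > 0" using lim L by (rule order_tendstoD)
    moreover have "\<forall>\<^sub>F r in sequentially. y r > 1" using y by (simp add: filterlim_at_top_dense)
    ultimately show ?thesis
    proof eventually_elim
      case (elim r)
      then have "x r > 0" by (simp add: zero_less_divide_iff)
      moreover have "ln (y r) \<noteq> 0" using elim by simp
      ultimately show ?case using elim by (simp add: ln_div field_simps)
    qed
  qed
  ultimately show ?thesis by (simp add: Lim_transform_eventually)
qed

text \<open>The two endpoints are scaled by different sequences because an interval is enlarged or
  shrunk by taking its endpoints from consecutive members of the subsequence.\<close>

lemma block_ratio:
  fixes u v :: "nat \<Rightarrow> real"
  assumes "0 \<le> s" "s < t" and u: "\<And>r. u r > 0" "\<And>r. v r > 0"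
    and lim: "(\<lambda>r. u r / w r) \<longlonglongrightarrow> 1" "(\<lambda>r. v r / w r) \<longlonglongrightarrow> 1" and w: "\<And>r. w r > 0" "filterlim w at_top sequentially"
  shows "(\<lambda>r. real (nat \<lfloor>v r * t\<rfloor> - nat \<lfloor>u r * s\<rfloor>) / w r) \<longlonglongrightarrow> t - s"
proof -
  have d: "(\<lambda>r. v r / w r * t - u r / w r * s) \<longlonglongrightarrow> 1 * t - 1 * s"
    by (intro tendsto_intros lim)
  have iw: "(\<lambda>r. 1 / w r) \<longlonglongrightarrow> 0" by (intro real_tendsto_divide_at_top[OF tendsto_const w(2)])
  have pos: "\<forall>\<^sub>F r in sequentially. v r / w r * t - u r / w r * s > 0"
    using d assms by (intro order_tendstoD) auto
  show ?thesis
  proof (rule tendsto_sandwich)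
    show "(\<lambda>r. (v r / w r * t - u r / w r * s) - 1 / w r) \<longlonglongrightarrow> t - s"
      using tendsto_diff[OF d iw] by simp
    show "(\<lambda>r. (v r / w r * t - u r / w r * s) + 1 / w r) \<longlonglongrightarrow> t - s"
      using tendsto_add[OF d iw] by simp
    have key: "(v r * t - u r * s) - 1 \<le> real (nat \<lfloor>v r * t\<rfloor> - nat \<lfloor>u r * s\<rfloor>) \<and>
      real (nat \<lfloor>v r * t\<rfloor> - nat \<lfloor>u r * s\<rfloor>) \<le> (v r * t - u r * s) + 1" if "v r / w r * t - u r / w r * s > 0" for r
    proof -
      have "0 < (v r * t - u r * s) / w r" using that by (simp add: diff_divide_distrib)
      then have "u r * s < v r * t" using w(1)[of r] by (simp add: zero_less_divide_iff)
      then have "nat \<lfloor>u r * s\<rfloor> \<le> nat \<lfloor>v r * t\<rfloor>" by (intro nat_mono floor_mono) simp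
      then have eq: "real (nat \<lfloor>v r * t\<rfloor> - nat \<lfloor>u r * s\<rfloor>) = real (nat \<lfloor>v r * t\<rfloor>) - real (nat \<lfloor>u r * s\<rfloor>)"
        by (rule of_nat_diff)
      have "0 \<le> u r * s" "0 \<le> v r * t" using u[of r] assms(1,2) by auto
      from nat_floor_bounds[OF this(1)] nat_floor_bounds[OF this(2)] show ?thesis
        unfolding eq by linarith
    qed
    show "\<forall>\<^sub>F r in sequentially. (v r / w r * t - u r / w r * s) - 1 / w r \<le> real (nat \<lfloor>v r * t\<rfloor> - nat \<lfloor>u r * s\<rfloor>) / w r"
      using pos
    proof eventually_elim
      case (elim r)
      have "(v r / w r * t - u r / w r * s) - 1 / w r = ((v r * t - u r * s) - 1) / w r"
        by (simp add: diff_divide_distrib)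
      also have "\<dots> \<le> real (nat \<lfloor>v r * t\<rfloor> - nat \<lfloor>u r * s\<rfloor>) / w r"
        using key[OF elim] w(1)[of r] by (intro divide_right_mono) auto
      finally show ?case .
    qed
    show "\<forall>\<^sub>F r in sequentially. real (nat \<lfloor>v r * t\<rfloor> - nat \<lfloor>u r * s\<rfloor>) / w r \<le> (v r / w r * t - u r / w r * s) + 1 / w r"
      using pos
    proof eventually_elim
      case (elim r)
      have "real (nat \<lfloor>v r * t\<rfloor> - nat \<lfloor>u r * s\<rfloor>) / w r \<le> ((v r * t - u r * s) + 1) / w r"
        using key[OF elim] w(1)[of r] by (intro divide_right_mono) auto
      also have "\<dots> = (v r / w r * t - u r / w r * s) + 1 / w r" by (simp add: diff_divide_distrib add_divide_distrib)
      finally show ?case .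
    qed
  qed
qed

context planar_walk
begin

lemma rate_summable:
  assumes c: "c > 0" and N: "\<forall>\<^sub>F r in sequentially. c * tau r \<le> real (N r)"
  shows "summable (\<lambda>r. rate (N r))"
proof (rule summable_comparison_test_ev)
  show "summable (\<lambda>r. 4 * real r powr (-9/8))"
    by (intro summable_mult) (simp add: summable_real_powr_iff)
  \<comment> \<open>Halving the exponent absorbs the constant \<open>c\<close>.\<close>
  have e1: "\<forall>\<^sub>F r in sequentially. exp (real r powr (3/4) / 2) \<le> c * tau r"
    unfolding tau_def using c by real_asymp
  \<comment> \<open>The power is \<open>3/4 * 3/2 = 9/8\<close>, larger than 1; the factor 4 pays
    for the halved exponent.\<close>
  have e2: "1 / (real r powr (3/4) / 2 * sqrt (real r powr (3/4) / 2)) \<le> 4 * real r powr (-9/8)" if "r > 0" for r :: nat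
  proof -
    let ?y = "real r powr (3/4)"
    have y: "?y > 0" using that by simp
    have "sqrt ?y = real r powr (3/8)" using that by (simp add: powr_half_sqrt[symmetric] powr_powr)
    then have "?y / 2 * (sqrt ?y / 2) = real r powr (9/8) / 4" using that by (simp add: powr_add[symmetric])
    moreover have "sqrt ?y / 2 \<le> sqrt (?y / 2)"
      using y real_sqrt_le_mono[of "?y / 4" "?y / 2"] by (simp add: real_sqrt_divide)
    ultimately have "real r powr (9/8) / 4 \<le> ?y / 2 * sqrt (?y / 2)"
      using y by (metis divide_pos_pos less_imp_le mult_left_mono zero_less_numeral)
    then have "1 / (?y / 2 * sqrt (?y / 2)) \<le> 1 / (real r powr (9/8) / 4)"
      using that y by (intro divide_left_mono mult_pos_pos) auto
    also have "\<dots> = 4 * real r powr (-9/8)" using that by (simp add: powr_minus_divide)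
    finally show ?thesis .
  qed
  show "\<forall>\<^sub>F r in sequentially. norm (rate (N r)) \<le> 4 * real r powr (-9/8)"
    using N e1 eventually_gt_at_top[of 0]
  proof eventually_elim
    case (elim r)
    let ?x = "real r powr (3/4) / 2"
    have x: "?x > 0" using elim by simp
    have "exp ?x \<le> real (N r)" using elim by linarith
    then have "?x \<le> ln (real (N r))" using exp_gt_zero[of ?x] by (metis less_le_trans ln_ge_iff)
    then have "0 < ln (real (N r))" using x by linarith
    then have le: "?x * sqrt ?x \<le> ln (real (N r)) * sqrt (ln (real (N r)))"
      using x \<open>?x \<le> ln (real (N r))\<close>
      by (intro mult_mono[OF _ real_sqrt_le_mono]) (simp_all only: real_sqrt_ge_zero less_imp_le)
    have "0 \<le> rate (N r)"
      unfolding rate_def using \<open>0 < ln (real (N r))\<close> by (intro divide_nonneg_nonneg mult_nonneg_nonneg) auto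
    then have "norm (rate (N r)) = rate (N r)" by simp
    also have "\<dots> \<le> 1 / (?x * sqrt ?x)"
      unfolding rate_def using le x \<open>0 < ln (real (N r))\<close> by (intro divide_left_mono mult_pos_pos real_sqrt_gt_zero) auto
    also have "\<dots> \<le> 4 * real r powr (-9/8)" by (rule e2) (use elim in simp)
    finally show ?case .
  qed
qed

text \<open>Borel-Cantelli for blocks whose position and length both vary with \<open>r\<close>;
  uniformity in the position is what makes the bound applicable.\<close>

lemma AE_eventually_rate:
  assumes B: "\<forall>\<^sub>F N in sequentially. \<forall>a. prob (A a N) \<le> B * rate N"
    and meas: "\<And>a N. A a N \<in> events"
    and c: "c > 0" and N: "\<forall>\<^sub>F r in sequentially. c * tau r \<le> real (N r)"
  shows "AE w in P. \<forall>\<^sub>F r in sequentially. w \<in> space P - A (\<alpha> r) (N r)"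
proof (rule borel_cantelli_AE1)
  have "filterlim (\<lambda>r. c * tau r) at_top sequentially"
    using c tau_at_top by (simp add: filterlim_tendsto_pos_mult_at_top[OF tendsto_const])
  then have "filterlim (\<lambda>r. real (N r)) at_top sequentially" using N by (rule filterlim_at_top_mono)
  then have top: "filterlim N at_top sequentially" by (simp add: filterlim_sequentially_iff_filterlim_real)
  have "\<forall>\<^sub>F r in sequentially. norm (prob (A (\<alpha> r) (N r))) \<le> B * rate (N r)"
    using eventually_compose_filterlim[OF B top] by eventually_elim auto
  then show "summable (\<lambda>r. prob (A (\<alpha> r) (N r)))"
    by (rule summable_comparison_test_ev) (intro summable_mult rate_summable[OF c N])
qed (use meas in \<open>auto simp: emeasure_eq_measure\<close>)

abbreviation "xlnx x \<equiv> (x :: real) * ln x"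

text \<open>Counts increase with the time set. The interval of \<open>n\<close> is enclosed in one
  that starts at the lower neighbour of \<open>n\<close> in the subsequence and ends at the upper
  one.\<close>

lemma AE_coll_upper:
  assumes st: "0 \<le> s" "s < t" and e: "e > 0"
  shows "AE w in P. \<forall>\<^sub>F n in sequentially.
    coll (walk w) {nat \<lfloor>real n * s\<rfloor>..<nat \<lfloor>real n * t\<rfloor>} {nat \<lfloor>real n * s\<rfloor>..<nat \<lfloor>real n * t\<rfloor>} 0
     \<le> (2 * gc * (t - s) + e) * (real n * ln (real n))"
proof -
  \<comment> \<open>Expanding \<open>(2 * gc + d) * (t - s + d)\<close> leaves
    \<open>d * (2 * gc + (t - s))\<close> and \<open>d * d\<close>; the cap 1 bounds the latter by
    \<open>d\<close>, whence the denominator.\<close>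
  define d where "d = min 1 (e / (2 * gc + (t - s) + 1))"
  have den: "2 * gc + (t - s) + 1 > 0" using gc_pos st by simp
  have d: "d > 0" using e den by (simp add: d_def)
  have dd: "(2 * gc + d) * (t - s + d) \<le> 2 * gc * (t - s) + e"
  proof -
    have "d \<le> e / (2 * gc + (t - s) + 1)" by (simp add: d_def)
    then have "d * (2 * gc + (t - s) + 1) \<le> e" using den by (simp add: pos_le_divide_eq)
    moreover have "d * d \<le> d * 1" using d by (intro mult_left_mono) (auto simp: d_def)
    ultimately show ?thesis by (simp add: algebra_simps)
  qed
  define \<alpha> where "\<alpha> r = nat \<lfloor>tau r * s\<rfloor>" for r
  define N where "N r = nat \<lfloor>tau (Suc r) * t\<rfloor> - \<alpha> r" for r
  have lim: "(\<lambda>r. real (N r) / tau r) \<longlonglongrightarrow> t - s"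
    unfolding N_def \<alpha>_def by (rule block_ratio[OF st]) (auto simp: tau_pos tau_ratio tau_at_top less_imp_neq[symmetric] intro: tendsto_eventually)
  have xl: "(\<lambda>r. xlnx (real (N r)) / xlnx (tau r)) \<longlonglongrightarrow> t - s"
    by (rule xlogx_ratio[OF lim _ tau_at_top]) (use st in simp)
  have "\<forall>\<^sub>F r in sequentially. real (N r) / tau r > (t - s) / 2"
    using st by (intro order_tendstoD[OF lim]) auto
  then have N: "\<forall>\<^sub>F r in sequentially. (t - s) / 2 * tau r \<le> real (N r)"
    by eventually_elim (use tau_pos in \<open>auto simp: less_divide_eq\<close>)
  have N2: "\<forall>\<^sub>F r in sequentially. xlnx (real (N r)) \<le> (t - s + d) * xlnx (tau r)"
  proof -
    have "\<forall>\<^sub>F r in sequentially. xlnx (real (N r)) / xlnx (tau r) < t - s + d"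
      using d by (intro order_tendstoD[OF xl]) auto
    moreover have "\<forall>\<^sub>F r in sequentially. tau r > 1" using tau_at_top by (simp add: filterlim_at_top_dense)
    ultimately show ?thesis
    proof eventually_elim
      case (elim r)
      have "0 < xlnx (tau r)" using elim by (intro mult_pos_pos) auto
      with elim show ?case by (simp add: pos_divide_less_eq)
    qed
  qed
  obtain B where B: "\<forall>\<^sub>F N in sequentially. \<forall>a.
    prob {w\<in>space P. coll (walk w) {a..<a+N} {a..<a+N} 0 \<ge> (2 * gc + d) * xlnx (real N)} \<le> B * rate N"
    using prob_coll_upper[OF d] by blast
  have "AE w in P. \<forall>\<^sub>F r in sequentially. w \<in> space P - {w\<in>space P. coll (walk w) {\<alpha> r..<\<alpha> r+N r} {\<alpha> r..<\<alpha> r+N r} 0 \<ge> (2 * gc + d) * xlnx (real (N r))}"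
    by (rule AE_eventually_rate[OF B _ _ N]) (use st in auto)
  then show ?thesis
  proof eventually_elim
    case (elim w)
    then have "\<forall>\<^sub>F r in sequentially. coll (walk w) {\<alpha> r..<\<alpha> r+N r} {\<alpha> r..<\<alpha> r+N r} 0 \<le> (2 * gc + d) * xlnx (real (N r)) \<and>
       xlnx (real (N r)) \<le> (t - s + d) * xlnx (tau r) \<and> tau r \<ge> 1"
      using N2 tau_at_top[unfolded filterlim_at_top, rule_format, of 1] by eventually_elim auto
    from eventually_compose_filterlim[OF this tau_index_at_top] show ?case
      using eventually_ge_at_top[of 2]
    proof eventually_elim
      case (elim n)
      let ?r = "tau_index n"
      note br = tau_bracket[OF elim(2)]
      have "nat \<lfloor>tau ?r * s\<rfloor> \<le> nat \<lfloor>real n * s\<rfloor>" "nat \<lfloor>real n * t\<rfloor> \<le> nat \<lfloor>tau (Suc ?r) * t\<rfloor>"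
        using br st by (auto intro!: nat_mono floor_mono mult_right_mono)
      then have sub: "{nat \<lfloor>real n * s\<rfloor>..<nat \<lfloor>real n * t\<rfloor>} \<subseteq> {\<alpha> ?r..<\<alpha> ?r+N ?r}"
        unfolding N_def \<alpha>_def by auto
      have mono: "xlnx (tau ?r) \<le> xlnx (real n)" using elim br by (intro mult_mono) auto
      have "coll (walk w) {nat \<lfloor>real n * s\<rfloor>..<nat \<lfloor>real n * t\<rfloor>} {nat \<lfloor>real n * s\<rfloor>..<nat \<lfloor>real n * t\<rfloor>} 0
         \<le> coll (walk w) {\<alpha> ?r..<\<alpha> ?r+N ?r} {\<alpha> ?r..<\<alpha> ?r+N ?r} 0"
        by (intro coll_mono sub) auto
      also have "\<dots> \<le> (2 * gc + d) * xlnx (real (N ?r))" using elim by simp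
      also have "\<dots> \<le> (2 * gc + d) * ((t - s + d) * xlnx (tau ?r))"
        using elim gc_pos d by (intro mult_left_mono) auto
      also have "\<dots> \<le> (2 * gc + d) * ((t - s + d) * xlnx (real n))"
        using gc_pos d st by (intro mult_left_mono mono) auto
      also have "\<dots> = ((2 * gc + d) * (t - s + d)) * xlnx (real n)" by (simp only: mult.assoc)
      also have "\<dots> \<le> (2 * gc * (t - s) + e) * xlnx (real n)"
        using elim(2) by (intro mult_right_mono dd) auto
      finally show ?case .
    qed
  qed
qed

text \<open>The mirror image of the upper bound: the interval of \<open>n\<close> contains one that
  starts at the upper neighbour and ends at the lower one. The displacement \<open>q\<close> is
  arbitrary, as the comparison of shifted paths will require.\<close>

lemma AE_coll_lower:
  assumes st: "0 \<le> s" "s < t" and e: "e > 0"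
  shows "AE w in P. \<forall>\<^sub>F n in sequentially.
    (2 * gc * (t - s) - e) * (real n * ln (real n)) \<le>
    coll (walk w) {nat \<lfloor>real n * s\<rfloor>..<nat \<lfloor>real n * t\<rfloor>} {nat \<lfloor>real n * s\<rfloor>..<nat \<lfloor>real n * t\<rfloor>} q"
proof -
  \<comment> \<open>The caps keep both factors \<open>2 * gc - d\<close> and
    \<open>t - s - d\<close> positive, so that inequalities can be multiplied.\<close>
  define d where "d = min (min gc ((t - s) / 2)) (e / (2 * gc + (t - s)))"
  have den: "2 * gc + (t - s) > 0" using gc_pos st by simp
  have d: "d > 0" using e den gc_pos st by (simp add: d_def)
  have d_gc: "d \<le> gc" unfolding d_def by (rule min.coboundedI1, rule min.cobounded1)
  have d_ts: "d \<le> (t - s) / 2" unfolding d_def by (rule min.coboundedI1, rule min.cobounded2)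
  have dd: "2 * gc * (t - s) - e \<le> (2 * gc - d) * (t - s - d)"
  proof -
    have "d \<le> e / (2 * gc + (t - s))" by (simp add: d_def)
    then have "d * (2 * gc + (t - s)) \<le> e" using den by (simp add: pos_le_divide_eq)
    moreover have "0 \<le> d * d" by simp
    moreover have "(2 * gc - d) * (t - s - d) = 2 * gc * (t - s) - d * (2 * gc + (t - s)) + d * d"
      by (simp add: algebra_simps)
    ultimately show ?thesis by linarith
  qed
  define \<alpha> where "\<alpha> r = nat \<lfloor>tau (Suc r) * s\<rfloor>" for r
  define N where "N r = nat \<lfloor>tau r * t\<rfloor> - \<alpha> r" for r
  have top: "filterlim (\<lambda>r. tau (Suc r)) at_top sequentially"
    by (rule filterlim_compose[OF tau_at_top filterlim_Suc])
  have lim: "(\<lambda>r. real (N r) / tau (Suc r)) \<longlonglongrightarrow> t - s"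
    unfolding N_def \<alpha>_def by (rule block_ratio[OF st]) (auto simp: tau_pos tau_ratio' top less_imp_neq[symmetric] intro: tendsto_eventually)
  have xl: "(\<lambda>r. xlnx (real (N r)) / xlnx (tau (Suc r))) \<longlonglongrightarrow> t - s"
    by (rule xlogx_ratio[OF lim _ top]) (use st in simp)
  have "\<forall>\<^sub>F r in sequentially. real (N r) / tau (Suc r) > (t - s) / 2"
    using st by (intro order_tendstoD[OF lim]) auto
  then have N: "\<forall>\<^sub>F r in sequentially. (t - s) / 2 * tau r \<le> real (N r)"
  proof eventually_elim
    case (elim r)
    have "tau r \<le> tau (Suc r)" unfolding tau_def by (simp add: powr_mono2)
    then have "(t - s) / 2 * tau r \<le> (t - s) / 2 * tau (Suc r)" using st by (intro mult_left_mono) auto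
    then show ?case using elim tau_pos[of "Suc r"] by (simp add: less_divide_eq)
  qed
  have N2: "\<forall>\<^sub>F r in sequentially. (t - s - d) * xlnx (tau (Suc r)) \<le> xlnx (real (N r))"
  proof -
    have "\<forall>\<^sub>F r in sequentially. xlnx (real (N r)) / xlnx (tau (Suc r)) > t - s - d"
      using d by (intro order_tendstoD[OF xl]) auto
    moreover have "\<forall>\<^sub>F r in sequentially. tau (Suc r) > 1" using top by (simp add: filterlim_at_top_dense)
    ultimately show ?thesis
    proof eventually_elim
      case (elim r)
      have "0 < xlnx (tau (Suc r))" using elim by (intro mult_pos_pos) auto
      with elim show ?case by (simp add: pos_less_divide_eq)
    qed
  qed
  obtain B where B: "\<forall>\<^sub>F N in sequentially. \<forall>a.
    prob {w\<in>space P. coll (walk w) {a..<a+N} {a..<a+N} q \<le> (2 * gc - d) * xlnx (real N)} \<le> B * rate N"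
    using prob_coll_lower[OF d] by blast
  have "AE w in P. \<forall>\<^sub>F r in sequentially. w \<in> space P - {w\<in>space P. coll (walk w) {\<alpha> r..<\<alpha> r+N r} {\<alpha> r..<\<alpha> r+N r} q \<le> (2 * gc - d) * xlnx (real (N r))}"
    by (rule AE_eventually_rate[OF B _ _ N]) (use st in auto)
  then show ?thesis
  proof eventually_elim
    case (elim w)
    then have "\<forall>\<^sub>F r in sequentially. coll (walk w) {\<alpha> r..<\<alpha> r+N r} {\<alpha> r..<\<alpha> r+N r} q \<ge> (2 * gc - d) * xlnx (real (N r)) \<and>
       (t - s - d) * xlnx (tau (Suc r)) \<le> xlnx (real (N r)) \<and> N r > 0"
      using N2 N
    proof eventually_elim
      case (elim r)
      have "0 < (t - s) / 2 * tau r" using st tau_pos by (intro mult_pos_pos) auto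
      then show ?case using elim by auto
    qed
    from eventually_compose_filterlim[OF this tau_index_at_top] show ?case
      using eventually_ge_at_top[of 2]
    proof eventually_elim
      case (elim n)
      let ?r = "tau_index n"
      note br = tau_bracket[OF elim(2)]
      have "nat \<lfloor>real n * s\<rfloor> \<le> nat \<lfloor>tau (Suc ?r) * s\<rfloor>" "nat \<lfloor>tau ?r * t\<rfloor> \<le> nat \<lfloor>real n * t\<rfloor>"
        using br st by (auto intro!: nat_mono floor_mono mult_right_mono)
      moreover have "N ?r > 0" using elim by simp
      ultimately have sub: "{\<alpha> ?r..<\<alpha> ?r+N ?r} \<subseteq> {nat \<lfloor>real n * s\<rfloor>..<nat \<lfloor>real n * t\<rfloor>}"
        unfolding N_def \<alpha>_def by auto
      have mono: "xlnx (real n) \<le> xlnx (tau (Suc ?r))" using elim br by (intro mult_mono) auto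
      have "(2 * gc * (t - s) - e) * xlnx (real n) \<le> ((2 * gc - d) * (t - s - d)) * xlnx (real n)"
        using elim(2) by (intro mult_right_mono dd) auto
      also have "\<dots> = (2 * gc - d) * ((t - s - d) * xlnx (real n))" by (simp only: mult.assoc)
      also have "\<dots> \<le> (2 * gc - d) * ((t - s - d) * xlnx (tau (Suc ?r)))"
        by (intro mult_left_mono mono) (use gc_pos d_gc d_ts st in \<open>simp_all, linarith?\<close>)
      also have "\<dots> \<le> (2 * gc - d) * xlnx (real (N ?r))"
        by (rule mult_left_mono) (use elim gc_pos d_gc in auto)
      also have "\<dots> \<le> coll (walk w) {\<alpha> ?r..<\<alpha> ?r+N ?r} {\<alpha> ?r..<\<alpha> ?r+N ?r} q" using elim by simp
      also have "\<dots> \<le> coll (walk w) {nat \<lfloor>real n * s\<rfloor>..<nat \<lfloor>real n * t\<rfloor>} {nat \<lfloor>real n * s\<rfloor>..<nat \<lfloor>real n * t\<rfloor>} q"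
        by (intro coll_mono sub) auto
      finally show ?case .
    qed
  qed
qed

lemma AE_coll_limit:
  assumes st: "0 \<le> s" "s < t"
  shows "AE w in P. (\<lambda>n. coll (walk w) {nat \<lfloor>real n * s\<rfloor>..<nat \<lfloor>real n * t\<rfloor>} {nat \<lfloor>real n * s\<rfloor>..<nat \<lfloor>real n * t\<rfloor>} 0
     / (real n * ln (real n))) \<longlonglongrightarrow> 2 * gc * (t - s)"
proof -
  let ?V = "\<lambda>w n. coll (walk w) {nat \<lfloor>real n * s\<rfloor>..<nat \<lfloor>real n * t\<rfloor>} {nat \<lfloor>real n * s\<rfloor>..<nat \<lfloor>real n * t\<rfloor>} 0"
  have "AE w in P. \<forall>k. (\<forall>\<^sub>F n in sequentially. ?V w n \<le> (2 * gc * (t - s) + 1 / real (Suc k)) * xlnx (real n))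
     \<and> (\<forall>\<^sub>F n in sequentially. (2 * gc * (t - s) - 1 / real (Suc k)) * xlnx (real n) \<le> ?V w n)"
    unfolding AE_all_countable using AE_coll_upper[OF st] AE_coll_lower[OF st, where q=0]
    by (intro allI AE_conjI) auto
  then show ?thesis
  proof eventually_elim
    case (elim w)
    show ?case
    proof (rule LIMSEQ_I)
      fix r :: real assume "r > 0"
      then obtain k where k: "1 / real (Suc k) < r" using nat_approx_posE by blast
      have "\<forall>\<^sub>F n in sequentially. norm (?V w n / xlnx (real n) - 2 * gc * (t - s)) < r"
        using elim[rule_format, of k, THEN conjunct1] elim[rule_format, of k, THEN conjunct2] eventually_ge_at_top[of 2]
      proof eventually_elim
        case (elim n)
        have X: "xlnx (real n) > 0" using elim by (intro mult_pos_pos) auto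
        have "?V w n / xlnx (real n) \<le> 2 * gc * (t - s) + 1 / real (Suc k)"
          using elim(1) X by (simp add: pos_divide_le_eq)
        moreover have "2 * gc * (t - s) - 1 / real (Suc k) \<le> ?V w n / xlnx (real n)"
          using elim(2) X by (simp add: pos_le_divide_eq)
        ultimately show ?case using k by (simp add: abs_less_iff)
      qed
      then show "\<exists>no. \<forall>n\<ge>no. norm (?V w n / xlnx (real n) - 2 * gc * (t - s)) < r"
        by (simp add: eventually_sequentially)
    qed
  qed
qed

text \<open>Block limits at rational endpoints, displacements and reciprocal tolerances form a
  countable family, so a single null set serves for all of them.\<close>

lemma AE_walk_regular:
  "AE w in P. (\<forall>m b. m > 0 \<longrightarrow> (\<lambda>n. coll (walk w) {nat \<lfloor>real n * (real b / real m)\<rfloor>..<nat \<lfloor>real n * (real (Suc b) / real m)\<rfloor>}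
        {nat \<lfloor>real n * (real b / real m)\<rfloor>..<nat \<lfloor>real n * (real (Suc b) / real m)\<rfloor>} 0 / (real n * ln (real n))) \<longlonglongrightarrow> 2 * gc / real m)
     \<and> (\<forall>q k. \<forall>\<^sub>F n in sequentially. (2 * gc - 1 / real (Suc k)) * (real n * ln (real n)) \<le> coll (walk w) {..<n} {..<n} q)"
proof (rule AE_conjI)
  show "AE w in P. \<forall>m b. m > 0 \<longrightarrow> (\<lambda>n. coll (walk w) {nat \<lfloor>real n * (real b / real m)\<rfloor>..<nat \<lfloor>real n * (real (Suc b) / real m)\<rfloor>}
        {nat \<lfloor>real n * (real b / real m)\<rfloor>..<nat \<lfloor>real n * (real (Suc b) / real m)\<rfloor>} 0 / (real n * ln (real n))) \<longlonglongrightarrow> 2 * gc / real m"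
    unfolding AE_all_countable
  proof (intro allI)
    fix m b :: nat
    show "AE w in P. m > 0 \<longrightarrow> (\<lambda>n. coll (walk w) {nat \<lfloor>real n * (real b / real m)\<rfloor>..<nat \<lfloor>real n * (real (Suc b) / real m)\<rfloor>}
        {nat \<lfloor>real n * (real b / real m)\<rfloor>..<nat \<lfloor>real n * (real (Suc b) / real m)\<rfloor>} 0 / (real n * ln (real n))) \<longlonglongrightarrow> 2 * gc / real m"
    proof (cases "m > 0")
      case True
      then have "0 \<le> real b / real m" "real b / real m < real (Suc b) / real m" by (auto simp: divide_strict_right_mono)
      from AE_coll_limit[OF this] show ?thesis
        by (simp only: True simp_thms) (simp add: diff_divide_distrib[symmetric])
    qed simp
  qed
  show "AE w in P. \<forall>q k. \<forall>\<^sub>F n in sequentially. (2 * gc - 1 / real (Suc k)) * (real n * ln (real n)) \<le> coll (walk w) {..<n} {..<n} q"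
    unfolding AE_all_countable
    using AE_coll_lower[of 0 1 "1 / real (Suc k)" for k] by (simp add: lessThan_atLeast0)
qed

end

section \<open>Maximal inequalities for sums of the scenery\<close>

text \<open>The index 0 is included, so the running maximum of partial sums is never
  negative.\<close>

definition run_max :: "nat \<Rightarrow> (nat \<Rightarrow> real) \<Rightarrow> real" where
  "run_max n f = Max (f ` {..n})"

lemma run_max_ge: "k \<le> n \<Longrightarrow> f k \<le> run_max n f"
  by (auto simp: run_max_def)

lemma run_max_le: "(\<And>k. k \<le> n \<Longrightarrow> f k \<le> c) \<Longrightarrow> run_max n f \<le> c"
  by (auto simp: run_max_def)

lemma run_max_attained: "\<exists>k\<le>n. run_max n f = f k"
proof -
  have "Max (f ` {..n}) \<in> f ` {..n}" by (intro Max_in) auto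
  then obtain k where "Max (f ` {..n}) = f k" "k \<in> {..n}" by (rule imageE)
  then have "k \<le> n \<and> run_max n f = f k" by (simp add: run_max_def)
  then show ?thesis ..
qed

lemma run_max_mono: "(\<And>k. k \<le> n \<Longrightarrow> f k \<le> g k) \<Longrightarrow> run_max n f \<le> run_max n g"
  by (intro run_max_le order_trans[OF _ run_max_ge[of _ n g]]) auto

lemma run_max_add: "run_max n (\<lambda>k. c + f k) = c + run_max n f"
proof (rule antisym)
  show "run_max n (\<lambda>k. c + f k) \<le> c + run_max n f" by (intro run_max_le add_left_mono run_max_ge)
  obtain k where "k \<le> n" "run_max n f = f k" using run_max_attained by blast
  then show "c + run_max n f \<le> run_max n (\<lambda>k. c + f k)" using run_max_ge[of k n "\<lambda>k. c + f k"] by simp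
qed

lemma run_max_Suc: "run_max (Suc n) f = max (f 0) (run_max n (\<lambda>k. f (Suc k)))"
proof -
  have "f ` {..Suc n} = insert (f 0) ((\<lambda>k. f (Suc k)) ` {..n})"
    by (auto simp: atMost_Suc_eq_insert_0 image_image)
  then show ?thesis by (simp add: run_max_def)
qed

lemma run_max_measurable:
  "(\<And>k. k \<le> n \<Longrightarrow> f k \<in> borel_measurable M) \<Longrightarrow> (\<lambda>x. run_max n (\<lambda>k. f k x)) \<in> borel_measurable M"
  unfolding run_max_def by (rule borel_measurable_Max) auto

lemma run_max_abs_le:
  assumes "\<And>k. k \<le> n \<Longrightarrow> \<bar>f k\<bar> \<le> c" shows "\<bar>run_max n f\<bar> \<le> c"
  using run_max_attained[of n f] assms by auto

text \<open>A partial sum along the path \<open>y\<close>, written as a function of the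
  configuration \<open>v\<close>: association concerns increasing functions of the independent
  coordinates.\<close>

definition psum :: "(nat \<Rightarrow> 'i) \<Rightarrow> nat \<Rightarrow> ('i \<Rightarrow> real) \<Rightarrow> real" where
  "psum y k v = (\<Sum>i<k. v (y i))"

lemma psum_0 [simp]: "psum y 0 v = 0" by (simp add: psum_def)

lemma psum_Suc: "psum y (Suc k) v = v (y 0) + psum (\<lambda>i. y (Suc i)) k v"
  unfolding psum_def by (subst sum.lessThan_Suc_shift) simp

lemma psum_diff:
  assumes "k \<le> n" shows "psum y n v - psum y k v = (\<Sum>i\<in>{k..<n}. v (y i))"
proof -
  have "psum y n v = psum y k v + (\<Sum>i\<in>{k..<n}. v (y i))"
    using sum.atLeastLessThan_concat[of 0 k n "\<lambda>i. v (y i)"] assms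
    by (simp add: psum_def lessThan_atLeast0)
  then show ?thesis by simp
qed

text \<open>Read backwards from time \<open>n\<close>, the shortfall is a partial sum of the negated
  configuration along the reversed path. The running maximum minus the final value thus becomes a
  running maximum of the same kind.\<close>

lemma psum_rev:
  assumes "k \<le> n" shows "psum y k v - psum y n v = psum (\<lambda>i. y (n - 1 - i)) (n - k) (\<lambda>l. - v l)"
proof -
  have "psum y n v - psum y k v = (\<Sum>i<n - k. v (y (n - 1 - i)))"
    unfolding psum_diff[OF assms]
    by (rule sum.reindex_bij_witness[of _ "\<lambda>i. n - 1 - i" "\<lambda>i. n - 1 - i"]) auto
  then show ?thesis by (simp add: psum_def sum_negf)
qed

section \<open>Moments and maximal inequalities of the scenery\<close>

locale scenery = prob_space \<mu> for \<mu> :: "'e measure" +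
  fixes X :: "int \<times> int \<Rightarrow> 'e \<Rightarrow> real"
  assumes X_indep: "indep_vars (\<lambda>_. borel) X UNIV"
    and X_ident: "\<And>l. distr \<mu> borel (X l) = distr \<mu> borel (X 0)"
    and X_centered0: "(\<integral>x. X 0 x \<partial>\<mu>) = 0"
    and X_sq0: "integrable \<mu> (\<lambda>x. (X 0 x)\<^sup>2)"
    and X_norm0: "(\<integral>x. (X 0 x)\<^sup>2 \<partial>\<mu>) = 1"
begin

lemma X_meas [measurable]: "X l \<in> borel_measurable \<mu>"
  using X_indep unfolding indep_vars_def by blast

lemma X_transfer:
  fixes h :: "real \<Rightarrow> 'b::{banach, second_countable_topology}"
  assumes [measurable]: "h \<in> borel_measurable borel"
  shows "expectation (\<lambda>x. h (X l x)) = expectation (\<lambda>x. h (X 0 x))"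
    and "integrable \<mu> (\<lambda>x. h (X l x)) \<longleftrightarrow> integrable \<mu> (\<lambda>x. h (X 0 x))"
proof -
  have "expectation (\<lambda>x. h (X l x)) = integral\<^sup>L (distr \<mu> borel (X l)) h"
    by (subst integral_distr) auto
  also have "\<dots> = expectation (\<lambda>x. h (X 0 x))"
    unfolding X_ident[of l] by (subst integral_distr) auto
  finally show "expectation (\<lambda>x. h (X l x)) = expectation (\<lambda>x. h (X 0 x))" .
  have "integrable \<mu> (\<lambda>x. h (X l x)) \<longleftrightarrow> integrable (distr \<mu> borel (X l)) h"
    by (subst integrable_distr_eq) auto
  also have "\<dots> \<longleftrightarrow> integrable \<mu> (\<lambda>x. h (X 0 x))"
    unfolding X_ident[of l] by (subst integrable_distr_eq) auto
  finally show "integrable \<mu> (\<lambda>x. h (X l x)) \<longleftrightarrow> integrable \<mu> (\<lambda>x. h (X 0 x))" .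
qed

lemma X_sq: "integrable \<mu> (\<lambda>x. (X l x)\<^sup>2)"
  using X_transfer(2)[of "\<lambda>x. x\<^sup>2" l] X_sq0 by simp

lemma X_norm: "expectation (\<lambda>x. (X l x)\<^sup>2) = 1"
  using X_transfer(1)[of "\<lambda>x. x\<^sup>2" l] X_norm0 by simp

lemma X_int: "integrable \<mu> (X l)"
  by (rule square_integrable_imp_integrable[OF _ X_sq]) simp

lemma X_centered: "expectation (X l) = 0"
  using X_transfer(1)[of "\<lambda>x. x" l] X_centered0 by simp

lemma X_mult_int: "integrable \<mu> (\<lambda>x. X l x * X l' x)"
proof (rule Bochner_Integration.integrable_bound[OF Bochner_Integration.integrable_add[OF X_sq[of l] X_sq[of l']]])
  have "\<bar>a * b\<bar> \<le> a\<^sup>2 + b\<^sup>2" for a b :: real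
  proof -
    have "\<bar>a * b\<bar> = \<bar>a\<bar> * \<bar>b\<bar>" "0 \<le> \<bar>a\<bar> * \<bar>b\<bar>" by (auto simp: abs_mult)
    then show ?thesis using sum_squares_bound[of "\<bar>a\<bar>" "\<bar>b\<bar>"] by simp
  qed
  then show "AE x in \<mu>. norm (X l x * X l' x) \<le> norm ((X l x)\<^sup>2 + (X l' x)\<^sup>2)" by simp
qed simp

lemma X_orthonormal: "expectation (\<lambda>x. X l x * X l' x) = of_bool (l = l')"
proof (cases "l = l'")
  case True
  then show ?thesis using X_norm[of l] by (simp add: power2_eq_square)
next
  case False
  have "expectation (\<lambda>x. \<Prod>i\<in>{l, l'}. X i x) = (\<Prod>i\<in>{l, l'}. expectation (X i))"
    by (rule indep_vars_lebesgue_integral[OF _ indep_vars_subset[OF X_indep]]) (auto intro: X_int)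
  then show ?thesis using False by (simp add: X_centered)
qed

lemma sq_integrable_dominated:
  assumes [measurable]: "f \<in> borel_measurable \<mu>" and le: "\<And>x. \<bar>f x\<bar> \<le> (\<Sum>i\<in>A. \<bar>X (y i) x\<bar>)"
  shows "integrable \<mu> (\<lambda>x. (f x)\<^sup>2)"
proof (rule Bochner_Integration.integrable_bound)
  show "integrable \<mu> (\<lambda>x. real (card A) * (\<Sum>i\<in>A. (X (y i) x)\<^sup>2))"
    by (intro integrable_mult_right Bochner_Integration.integrable_sum X_sq)
  have "(f x)\<^sup>2 \<le> real (card A) * (\<Sum>i\<in>A. (X (y i) x)\<^sup>2)" for x
  proof -
    have "(f x)\<^sup>2 \<le> (\<Sum>i\<in>A. \<bar>X (y i) x\<bar>)\<^sup>2"
      using le[of x] power_mono[of "\<bar>f x\<bar>" "\<Sum>i\<in>A. \<bar>X (y i) x\<bar>" 2] by simp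
    also have "\<dots> \<le> real (card A) * (\<Sum>i\<in>A. \<bar>X (y i) x\<bar>\<^sup>2)"
      using sum_squared_le_sum_of_squares[of "\<lambda>i. \<bar>X (y i) x\<bar>" A] by (simp add: mult.commute)
    finally show ?thesis by simp
  qed
  then show "AE x in \<mu>. norm ((f x)\<^sup>2) \<le> norm (real (card A) * (\<Sum>i\<in>A. (X (y i) x)\<^sup>2))"
    by (intro AE_I2) (simp add: sum_nonneg)
qed simp

definition "PS y k x = psum y k (\<lambda>l. X l x)"

lemma PS_meas [measurable]: "PS y k \<in> borel_measurable \<mu>"
  unfolding PS_def psum_def by measurable

lemma PS_abs_le: "k \<le> n \<Longrightarrow> \<bar>PS y k x\<bar> \<le> (\<Sum>i<n. \<bar>X (y i) x\<bar>)"
  unfolding PS_def psum_def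
  by (rule order_trans[OF sum_abs]) (auto intro!: sum_mono2)

lemma PS_sq_int: "integrable \<mu> (\<lambda>x. (PS y n x)\<^sup>2)"
  by (rule sq_integrable_dominated[OF _ PS_abs_le[OF order_refl]]) simp

lemma PS_max_meas [measurable]: "(\<lambda>x. run_max n (\<lambda>k. PS y k x)) \<in> borel_measurable \<mu>"
  by (intro run_max_measurable) simp

lemma PS_max_sq_int: "integrable \<mu> (\<lambda>x. (run_max n (\<lambda>k. PS y k x))\<^sup>2)"
  by (rule sq_integrable_dominated[where A = "{..<n}" and y = y]) (auto intro!: run_max_abs_le PS_abs_le)

lemma assoc_path:
  fixes f g :: "(int \<times> int \<Rightarrow> real) \<Rightarrow> real"
  assumes J: "finite J"
    and meas: "f \<in> borel_measurable (PiM J (\<lambda>_. borel))" "g \<in> borel_measurable (PiM J (\<lambda>_. borel))"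
    and mono: "\<And>u v. (\<And>i. i \<in> J \<Longrightarrow> u i \<le> v i) \<Longrightarrow> f u \<le> f v \<and> g u \<le> g v"
    and dep: "\<And>v. f (restrict v J) = f v" "\<And>v. g (restrict v J) = g v"
    and int: "integrable \<mu> (\<lambda>x. (f (\<lambda>l. X l x))\<^sup>2)" "integrable \<mu> (\<lambda>x. (g (\<lambda>l. X l x))\<^sup>2)"
  shows "expectation (\<lambda>x. f (\<lambda>l. X l x)) * expectation (\<lambda>x. g (\<lambda>l. X l x))
    \<le> expectation (\<lambda>x. f (\<lambda>l. X l x) * g (\<lambda>l. X l x))"
  using associated_indep_vars[OF indep_vars_subset[OF X_indep subset_UNIV] J meas mono]
  using int by (simp add: dep)

lemma psum_meas_PiM: "y ` {..<k} \<subseteq> J \<Longrightarrow> psum y k \<in> borel_measurable (PiM J (\<lambda>_. borel))"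
  unfolding psum_def by (intro borel_measurable_sum measurable_component_singleton) auto

lemma psum_restrict: "y ` {..<k} \<subseteq> J \<Longrightarrow> psum y k (restrict v J) = psum y k v"
  unfolding psum_def by (intro sum.cong) auto

text \<open>The Newman-Wright inequality. Peeling off the first step leaves
  \<open>max 0 (X + L)\<close> with \<open>L\<close> the running maximum of the rest, so its square
  is at most \<open>(X + L)^2\<close>. Association bounds the mixed term by the one with the full
  sum in place of \<open>L\<close>, and the induction hypothesis handles the square of
  \<open>L\<close>.\<close>

theorem max_second_moment: "expectation (\<lambda>x. (run_max n (\<lambda>k. PS y k x))\<^sup>2) \<le> expectation (\<lambda>x. (PS y n x)\<^sup>2)"
proof (induction n arbitrary: y)
  case 0
  then show ?case by (simp add: run_max_def PS_def)
next
  case (Suc n)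
  define y' where "y' i = y (Suc i)" for i
  define L where "L x = run_max n (\<lambda>k. PS y' k x)" for x
  define S where "S x = PS y' n x" for x
  have PS_Suc: "PS y (Suc k) x = X (y 0) x + PS y' k x" for k x
    by (simp add: PS_def psum_Suc y'_def[abs_def])
  have [measurable]: "L \<in> borel_measurable \<mu>" "S \<in> borel_measurable \<mu>" by (auto simp: L_def[abs_def] S_def[abs_def])
  have L2: "integrable \<mu> (\<lambda>x. (L x)\<^sup>2)" unfolding L_def by (rule PS_max_sq_int)
  have S2: "integrable \<mu> (\<lambda>x. (S x)\<^sup>2)" unfolding S_def by (rule PS_sq_int)
  have prod_int: "integrable \<mu> (\<lambda>x. X (y 0) x * f x)" if "integrable \<mu> (\<lambda>x. (f x)\<^sup>2)" "f \<in> borel_measurable \<mu>" for f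
  proof (rule Bochner_Integration.integrable_bound[OF Bochner_Integration.integrable_add[OF X_sq[of "y 0"] that(1)]])
    have "\<bar>a * b\<bar> \<le> a\<^sup>2 + b\<^sup>2" for a b :: real
    proof -
      have "\<bar>a * b\<bar> = \<bar>a\<bar> * \<bar>b\<bar>" "0 \<le> \<bar>a\<bar> * \<bar>b\<bar>" by (auto simp: abs_mult)
      then show ?thesis using sum_squares_bound[of "\<bar>a\<bar>" "\<bar>b\<bar>"] by simp
    qed
    then show "AE x in \<mu>. norm (X (y 0) x * f x) \<le> norm ((X (y 0) x)\<^sup>2 + (f x)\<^sup>2)" by simp
  qed (use that in simp)
  let ?J = "y ` {..Suc n}"
  have y'J: "y' ` {..<k} \<subseteq> ?J" if "k \<le> n" for k using that by (auto simp: y'_def)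
  \<comment> \<open>\<open>S - L\<close> is the minimum over \<open>k\<close> of the sums from step
    \<open>k\<close> on, hence increasing in the configuration. It is positively correlated with the
    first variable even if the path returns to \<open>y 0\<close>.\<close>
  have "expectation (\<lambda>x. X (y 0) x) * expectation (\<lambda>x. S x - L x) \<le> expectation (\<lambda>x. X (y 0) x * (S x - L x))"
  proof -
    let ?g = "\<lambda>v. psum y' n v - run_max n (\<lambda>k. psum y' k v)"
    have g_eq: "S x - L x = ?g (\<lambda>l. X l x)" for x by (simp add: S_def L_def PS_def)
    show ?thesis unfolding g_eq
    proof (rule assoc_path[where f = "\<lambda>v. v (y 0)" and J = ?J])
      show "(\<lambda>v. v (y 0)) \<in> borel_measurable (PiM ?J (\<lambda>_. borel))"
        by (rule measurable_component_singleton) auto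
      show "?g \<in> borel_measurable (PiM ?J (\<lambda>_. borel))"
        by (intro borel_measurable_diff run_max_measurable psum_meas_PiM y'J) auto
      show "?g (restrict v ?J) = ?g v" for v
      proof -
        have "run_max n (\<lambda>k. psum y' k (restrict v ?J)) = run_max n (\<lambda>k. psum y' k v)"
          unfolding run_max_def by (intro arg_cong[where f = Max] image_cong refl psum_restrict y'J) simp
        then show ?thesis using psum_restrict[OF y'J[OF order_refl], of v] by simp
      qed
      show "restrict v ?J (y 0) = v (y 0)" for v by auto
      show "integrable \<mu> (\<lambda>x. (?g (\<lambda>l. X l x))\<^sup>2)"
        unfolding g_eq[symmetric]
      proof (rule Bochner_Integration.integrable_bound[OF integrable_mult_right[OF Bochner_Integration.integrable_add[OF S2 L2], of 2]])
        have "(a - b)\<^sup>2 \<le> 2 * (a\<^sup>2 + b\<^sup>2)" for a b :: real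
          using zero_le_power2[of "a + b"] by (simp add: power2_eq_square algebra_simps)
        then show "AE x in \<mu>. norm ((S x - L x)\<^sup>2) \<le> norm (2 * ((S x)\<^sup>2 + (L x)\<^sup>2))" by simp
      qed simp
      fix u v :: "int \<times> int \<Rightarrow> real" assume uv: "\<And>i. i \<in> ?J \<Longrightarrow> u i \<le> v i"
      have "?g u \<le> ?g v"
      proof -
        obtain k where k: "k \<le> n" "run_max n (\<lambda>k. psum y' k v) = psum y' k v"
          using run_max_attained by blast
        have "psum y' n u - psum y' k u \<le> psum y' n v - psum y' k v"
          unfolding psum_diff[OF k(1)] by (intro sum_mono uv) (auto simp: y'_def)
        moreover have "psum y' k u \<le> run_max n (\<lambda>k. psum y' k u)" by (rule run_max_ge[OF k(1)])
        ultimately show ?thesis using k(2) by linarith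
      qed
      then show "u (y 0) \<le> v (y 0) \<and> ?g u \<le> ?g v" using uv by auto
    qed (auto intro: X_sq)
  qed
  then have cov: "expectation (\<lambda>x. X (y 0) x * L x) \<le> expectation (\<lambda>x. X (y 0) x * S x)"
    using prod_int[OF L2] prod_int[OF S2] by (simp add: X_centered right_diff_distrib)
  have "expectation (\<lambda>x. (run_max (Suc n) (\<lambda>k. PS y k x))\<^sup>2) \<le> expectation (\<lambda>x. (X (y 0) x)\<^sup>2 + 2 * (X (y 0) x * L x) + (L x)\<^sup>2)"
  proof (intro integral_mono PS_max_sq_int)
    show "integrable \<mu> (\<lambda>x. (X (y 0) x)\<^sup>2 + 2 * (X (y 0) x * L x) + (L x)\<^sup>2)"
      using X_sq[of "y 0"] prod_int[OF L2] L2 by simp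
    fix x
    have "run_max (Suc n) (\<lambda>k. PS y k x) = max 0 (X (y 0) x + L x)"
      unfolding run_max_Suc L_def PS_Suc run_max_add by (simp add: PS_def)
    then have "(run_max (Suc n) (\<lambda>k. PS y k x))\<^sup>2 \<le> (X (y 0) x + L x)\<^sup>2" by (simp add: max_def)
    then show "(run_max (Suc n) (\<lambda>k. PS y k x))\<^sup>2 \<le> (X (y 0) x)\<^sup>2 + 2 * (X (y 0) x * L x) + (L x)\<^sup>2"
      by (simp add: power2_eq_square algebra_simps)
  qed
  also have "\<dots> = expectation (\<lambda>x. (X (y 0) x)\<^sup>2) + 2 * expectation (\<lambda>x. X (y 0) x * L x) + expectation (\<lambda>x. (L x)\<^sup>2)"
    using X_sq[of "y 0"] prod_int[OF L2] L2 by simp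
  also have "\<dots> \<le> expectation (\<lambda>x. (X (y 0) x)\<^sup>2) + 2 * expectation (\<lambda>x. X (y 0) x * S x) + expectation (\<lambda>x. (S x)\<^sup>2)"
    using cov Suc.IH[of y'] by (simp add: L_def S_def)
  also have "\<dots> = expectation (\<lambda>x. (X (y 0) x)\<^sup>2 + 2 * (X (y 0) x * S x) + (S x)\<^sup>2)"
    using X_sq[of "y 0"] prod_int[OF S2] S2 by simp
  also have "\<dots> = expectation (\<lambda>x. (PS y (Suc n) x)\<^sup>2)"
    unfolding PS_Suc S_def by (intro Bochner_Integration.integral_cong) (auto simp: power2_eq_square algebra_simps)
  finally show ?case .
qed

end

text \<open>Lets every one-sided estimate be applied to the negated scenery as well.\<close>

lemma scenery_neg:
  assumes "scenery \<mu> X" shows "scenery \<mu> (\<lambda>l x. - X l x)"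
proof -
  interpret scenery \<mu> X by fact
  show ?thesis
  proof
    show "indep_vars (\<lambda>_. borel) (\<lambda>l x. - X l x) UNIV"
      by (rule indep_vars_compose2[OF X_indep]) auto
    show "distr \<mu> borel (\<lambda>x. - X l x) = distr \<mu> borel (\<lambda>x. - X 0 x)" for l
    proof -
      have "distr \<mu> borel (\<lambda>x. - X l x) = distr (distr \<mu> borel (X l)) borel uminus" for l
        by (subst distr_distr) (auto simp: comp_def)
      then show ?thesis using X_ident by metis
    qed
  qed (use X_centered X_sq X_norm in auto)
qed

context scenery
begin

lemma PS_neg: "scenery.PS (\<lambda>l x. - X l x) y k x = - PS y k x"
proof -
  interpret neg: scenery \<mu> "\<lambda>l x. - X l x" by (rule scenery_neg) unfold_locales
  show ?thesis by (simp add: neg.PS_def PS_def psum_def sum_negf)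
qed

text \<open>If the maximum \<open>M\<close> reaches \<open>2 * a\<close>, then the final value
  reaches \<open>a\<close> or the drop \<open>D\<close> from the maximum does. \<open>M\<close> is
  increasing and \<open>D\<close> decreasing in the configuration, so both being large is at most as
  likely as under independence. The variance hypothesis makes a large drop at most an even chance,
  and the first term is absorbed on the left.\<close>

lemma max_tail:
  assumes a: "a > 0" and var: "expectation (\<lambda>x. (PS y n x)\<^sup>2) \<le> a\<^sup>2 / 2"
  shows "prob {x\<in>space \<mu>. run_max n (\<lambda>k. PS y k x) \<ge> 2 * a} \<le> 2 * prob {x\<in>space \<mu>. PS y n x \<ge> a}"
proof -
  interpret neg: scenery \<mu> "\<lambda>l x. - X l x" by (rule scenery_neg) unfold_locales
  define M where "M x = run_max n (\<lambda>k. PS y k x)" for x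
  define D where "D x = M x - PS y n x" for x
  have [measurable]: "M \<in> borel_measurable \<mu>" by (simp add: M_def[abs_def])
  have [measurable]: "D \<in> borel_measurable \<mu>" unfolding D_def by measurable
  let ?z = "\<lambda>i. y (n - 1 - i)"
  have D_eq: "D x = run_max n (\<lambda>k. neg.PS ?z k x)" for x
  proof (rule antisym)
    obtain k where k: "k \<le> n" "M x = PS y k x" using run_max_attained M_def by metis
    have "D x = neg.PS ?z (n - k) x"
      unfolding D_def k(2) by (simp add: PS_def neg.PS_def psum_rev[OF k(1)])
    then show "D x \<le> run_max n (\<lambda>k. neg.PS ?z k x)" using run_max_ge[of "n - k" n "\<lambda>k. neg.PS ?z k x"] by simp
    obtain k where k: "k \<le> n" "run_max n (\<lambda>k. neg.PS ?z k x) = neg.PS ?z k x" using run_max_attained by metis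
    have "neg.PS ?z k x = PS y (n - k) x - PS y n x"
      using psum_rev[of "n - k" n y "\<lambda>l. X l x"] k(1) by (simp add: PS_def neg.PS_def)
    moreover have "PS y (n - k) x \<le> M x" unfolding M_def by (rule run_max_ge) simp
    ultimately show "run_max n (\<lambda>k. neg.PS ?z k x) \<le> D x" using k by (simp add: D_def)
  qed
  have D2: "integrable \<mu> (\<lambda>x. (D x)\<^sup>2)" unfolding D_eq by (rule neg.PS_max_sq_int)
  have "neg.PS ?z n x = - PS y n x" for x
    using psum_rev[of 0 n y "\<lambda>l. X l x"] by (simp add: PS_def neg.PS_def)
  then have ED: "expectation (\<lambda>x. (D x)\<^sup>2) \<le> a\<^sup>2 / 2"
    using neg.max_second_moment[of n ?z] var unfolding D_eq by simp
  have "prob {x\<in>space \<mu>. D x \<ge> a} \<le> prob {x\<in>space \<mu>. (D x)\<^sup>2 \<ge> a\<^sup>2}"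
    using a by (intro finite_measure_mono) (auto intro: power_mono)
  also have "\<dots> \<le> expectation (\<lambda>x. (D x)\<^sup>2) / a\<^sup>2"
    using integral_Markov_inequality_measure[OF D2, of "space \<mu>" "a\<^sup>2"] a by simp
  also have "\<dots> \<le> 1 / 2" using ED a by (simp add: divide_le_eq)
  finally have PD: "prob {x\<in>space \<mu>. D x \<ge> a} \<le> 1 / 2" .
  let ?J = "y ` {..<n}"
  have yJ: "y ` {..<k} \<subseteq> ?J" if "k \<le> n" for k using that by auto
  let ?f = "\<lambda>v. of_bool (run_max n (\<lambda>k. psum y k v) \<ge> 2 * a) :: real"
  \<comment> \<open>The sign turns the indicator of a decreasing event into an increasing
    function.\<close>
  let ?g = "\<lambda>v. - of_bool (run_max n (\<lambda>k. psum y k v) - psum y n v \<ge> a) :: real"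
  have mx_restrict: "run_max n (\<lambda>k. psum y k (restrict v ?J)) = run_max n (\<lambda>k. psum y k v)" for v
    unfolding run_max_def by (intro arg_cong[where f = Max] image_cong refl psum_restrict yJ) simp
  have f_eq: "?f (\<lambda>l. X l x) = indicator {x\<in>space \<mu>. M x \<ge> 2 * a} x" if "x \<in> space \<mu>" for x
    using that by (simp add: M_def PS_def indicator_def)
  have g_eq: "?g (\<lambda>l. X l x) = - indicator {x\<in>space \<mu>. D x \<ge> a} x" if "x \<in> space \<mu>" for x
    using that by (simp add: M_def D_def PS_def indicator_def)
  have [measurable]: "(\<lambda>v. run_max n (\<lambda>k. psum y k v)) \<in> borel_measurable (PiM ?J (\<lambda>_. borel))"
    "psum y n \<in> borel_measurable (PiM ?J (\<lambda>_. borel))"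
    by (intro run_max_measurable psum_meas_PiM yJ; simp)+
  have "expectation (\<lambda>x. ?f (\<lambda>l. X l x)) * expectation (\<lambda>x. ?g (\<lambda>l. X l x)) \<le> expectation (\<lambda>x. ?f (\<lambda>l. X l x) * ?g (\<lambda>l. X l x))"
  proof (rule assoc_path[where J = ?J])
    show "?f \<in> borel_measurable (PiM ?J (\<lambda>_. borel))" "?g \<in> borel_measurable (PiM ?J (\<lambda>_. borel))"
      by measurable
    show "?f (restrict v ?J) = ?f v" "?g (restrict v ?J) = ?g v" for v
      using psum_restrict[OF yJ[OF order_refl], of v] by (simp_all add: mx_restrict)
    fix u v :: "int \<times> int \<Rightarrow> real" assume uv: "\<And>i. i \<in> ?J \<Longrightarrow> u i \<le> v i"
    have 1: "run_max n (\<lambda>k. psum y k u) \<le> run_max n (\<lambda>k. psum y k v)"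
      by (intro run_max_mono) (auto simp: psum_def intro!: sum_mono uv)
    have 2: "run_max n (\<lambda>k. psum y k v) - psum y n v \<le> run_max n (\<lambda>k. psum y k u) - psum y n u"
    proof -
      obtain k where k: "k \<le> n" "run_max n (\<lambda>k. psum y k v) = psum y k v"
        using run_max_attained by blast
      have "psum y n u - psum y k u \<le> psum y n v - psum y k v"
        unfolding psum_diff[OF k(1)] by (intro sum_mono uv) auto
      moreover have "psum y k u \<le> run_max n (\<lambda>k. psum y k u)" by (rule run_max_ge[OF k(1)])
      ultimately show ?thesis using k(2) by linarith
    qed
    show "?f u \<le> ?f v \<and> ?g u \<le> ?g v" using 1 2 by auto
  next
    have [measurable]: "(\<lambda>x. run_max n (\<lambda>k. psum y k (\<lambda>l. X l x))) \<in> borel_measurable \<mu>"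
      "(\<lambda>x. psum y n (\<lambda>l. X l x)) \<in> borel_measurable \<mu>"
      using PS_max_meas[of n y] PS_meas[of y n] by (simp_all add: PS_def[abs_def])
    show "integrable \<mu> (\<lambda>x. (?f (\<lambda>l. X l x))\<^sup>2)" "integrable \<mu> (\<lambda>x. (?g (\<lambda>l. X l x))\<^sup>2)"
      by (auto intro!: integrable_const_bound[where B = 1])
  qed simp
  also have "expectation (\<lambda>x. ?f (\<lambda>l. X l x)) = prob {x\<in>space \<mu>. M x \<ge> 2 * a}"
    by (subst Bochner_Integration.integral_cong[OF refl f_eq]) auto
  also have "expectation (\<lambda>x. ?g (\<lambda>l. X l x)) = - prob {x\<in>space \<mu>. D x \<ge> a}"
    by (subst Bochner_Integration.integral_cong[OF refl g_eq]) auto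
  also have "expectation (\<lambda>x. ?f (\<lambda>l. X l x) * ?g (\<lambda>l. X l x)) = - prob ({x\<in>space \<mu>. M x \<ge> 2 * a} \<inter> {x\<in>space \<mu>. D x \<ge> a})"
  proof -
    have "expectation (\<lambda>x. ?f (\<lambda>l. X l x) * ?g (\<lambda>l. X l x)) = expectation (\<lambda>x. - indicator ({x\<in>space \<mu>. M x \<ge> 2 * a} \<inter> {x\<in>space \<mu>. D x \<ge> a}) x)"
      by (intro Bochner_Integration.integral_cong refl) (simp only: f_eq g_eq, simp add: indicator_inter_arith)
    then show ?thesis by simp
  qed
  finally have "prob ({x\<in>space \<mu>. M x \<ge> 2 * a} \<inter> {x\<in>space \<mu>. D x \<ge> a}) \<le> prob {x\<in>space \<mu>. M x \<ge> 2 * a} * prob {x\<in>space \<mu>. D x \<ge> a}"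
    by simp
  also have "\<dots> \<le> prob {x\<in>space \<mu>. M x \<ge> 2 * a} * (1 / 2)" by (intro mult_left_mono PD) auto
  finally have half: "prob ({x\<in>space \<mu>. M x \<ge> 2 * a} \<inter> {x\<in>space \<mu>. D x \<ge> a}) \<le> prob {x\<in>space \<mu>. M x \<ge> 2 * a} / 2" by simp
  have "prob {x\<in>space \<mu>. M x \<ge> 2 * a} \<le> prob (({x\<in>space \<mu>. M x \<ge> 2 * a} \<inter> {x\<in>space \<mu>. D x \<ge> a}) \<union> {x\<in>space \<mu>. PS y n x \<ge> a})"
    by (intro finite_measure_mono) (auto simp: D_def)
  also have "\<dots> \<le> prob ({x\<in>space \<mu>. M x \<ge> 2 * a} \<inter> {x\<in>space \<mu>. D x \<ge> a}) + prob {x\<in>space \<mu>. PS y n x \<ge> a}"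
    by (intro measure_Un_le) auto
  finally show ?thesis using half unfolding M_def[symmetric] by linarith
qed

lemma max_abs_tail:
  assumes a: "a > 0" and var: "expectation (\<lambda>x. (PS y n x)\<^sup>2) \<le> a\<^sup>2 / 2"
  shows "prob {x\<in>space \<mu>. \<exists>k\<le>n. \<bar>PS y k x\<bar> \<ge> 2 * a} \<le> 4 * prob {x\<in>space \<mu>. \<bar>PS y n x\<bar> \<ge> a}"
proof -
  interpret neg: scenery \<mu> "\<lambda>l x. - X l x" by (rule scenery_neg) unfold_locales
  let ?A = "{x\<in>space \<mu>. run_max n (\<lambda>k. PS y k x) \<ge> 2 * a}"
  let ?B = "{x\<in>space \<mu>. run_max n (\<lambda>k. neg.PS y k x) \<ge> 2 * a}"
  have "{x\<in>space \<mu>. \<exists>k\<le>n. \<bar>PS y k x\<bar> \<ge> 2 * a} \<subseteq> ?A \<union> ?B"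
  proof
    fix x assume "x \<in> {x\<in>space \<mu>. \<exists>k\<le>n. \<bar>PS y k x\<bar> \<ge> 2 * a}"
    then obtain k where x: "x \<in> space \<mu>" "k \<le> n" "\<bar>PS y k x\<bar> \<ge> 2 * a" by auto
    have "PS y k x \<ge> 2 * a \<or> neg.PS y k x \<ge> 2 * a" using x(3) by (auto simp: PS_neg abs_if split: if_splits)
    then show "x \<in> ?A \<union> ?B"
      using x run_max_ge[OF x(2), of "\<lambda>k. PS y k x"] run_max_ge[OF x(2), of "\<lambda>k. neg.PS y k x"] by auto
  qed
  then have "prob {x\<in>space \<mu>. \<exists>k\<le>n. \<bar>PS y k x\<bar> \<ge> 2 * a} \<le> prob (?A \<union> ?B)"
    by (intro finite_measure_mono) auto
  also have "\<dots> \<le> prob ?A + prob ?B" by (intro measure_Un_le) auto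
  also have "prob ?A \<le> 2 * prob {x\<in>space \<mu>. PS y n x \<ge> a}" by (rule max_tail[OF assms])
  also have "prob {x\<in>space \<mu>. PS y n x \<ge> a} \<le> prob {x\<in>space \<mu>. \<bar>PS y n x\<bar> \<ge> a}"
    by (intro finite_measure_mono) auto
  also have "prob ?B \<le> 2 * prob {x\<in>space \<mu>. neg.PS y n x \<ge> a}"
    using var by (intro neg.max_tail[OF a]) (simp add: PS_neg)
  also have "prob {x\<in>space \<mu>. neg.PS y n x \<ge> a} \<le> prob {x\<in>space \<mu>. \<bar>PS y n x\<bar> \<ge> a}"
    by (intro finite_measure_mono) (auto simp: PS_neg)
  finally show ?thesis by simp
qed

lemma max_abs_second_moment:
  shows "integrable \<mu> (\<lambda>x. (run_max n (\<lambda>k. \<bar>PS y k x\<bar>))\<^sup>2)"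
    and "expectation (\<lambda>x. (run_max n (\<lambda>k. \<bar>PS y k x\<bar>))\<^sup>2) \<le> 2 * expectation (\<lambda>x. (PS y n x)\<^sup>2)"
proof -
  interpret neg: scenery \<mu> "\<lambda>l x. - X l x" by (rule scenery_neg) unfold_locales
  have [measurable]: "(\<lambda>x. run_max n (\<lambda>k. \<bar>PS y k x\<bar>)) \<in> borel_measurable \<mu>"
    by (intro run_max_measurable) simp
  show int: "integrable \<mu> (\<lambda>x. (run_max n (\<lambda>k. \<bar>PS y k x\<bar>))\<^sup>2)"
    by (rule sq_integrable_dominated[where A = "{..<n}" and y = y]) (auto intro!: run_max_abs_le PS_abs_le)
  have "expectation (\<lambda>x. (run_max n (\<lambda>k. \<bar>PS y k x\<bar>))\<^sup>2) \<le> expectation (\<lambda>x. (run_max n (\<lambda>k. PS y k x))\<^sup>2 + (run_max n (\<lambda>k. neg.PS y k x))\<^sup>2)"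
  proof (intro integral_mono int Bochner_Integration.integrable_add PS_max_sq_int neg.PS_max_sq_int)
    fix x
    obtain k where k: "k \<le> n" "run_max n (\<lambda>k. \<bar>PS y k x\<bar>) = \<bar>PS y k x\<bar>" using run_max_attained by metis
    have ge: "PS y k x \<le> run_max n (\<lambda>k. PS y k x)" "- PS y k x \<le> run_max n (\<lambda>k. neg.PS y k x)"
      using run_max_ge[OF k(1), of "\<lambda>k. PS y k x"] run_max_ge[OF k(1), of "\<lambda>k. neg.PS y k x"] by (auto simp: PS_neg)
    show "(run_max n (\<lambda>k. \<bar>PS y k x\<bar>))\<^sup>2 \<le> (run_max n (\<lambda>k. PS y k x))\<^sup>2 + (run_max n (\<lambda>k. neg.PS y k x))\<^sup>2"
    proof (cases "PS y k x \<ge> 0")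
      case True
      then have "\<bar>PS y k x\<bar>\<^sup>2 \<le> (run_max n (\<lambda>k. PS y k x))\<^sup>2" using ge by (intro power_mono) auto
      then show ?thesis unfolding k(2) by (intro add_increasing2) auto
    next
      case False
      then have "\<bar>PS y k x\<bar>\<^sup>2 \<le> (run_max n (\<lambda>k. neg.PS y k x))\<^sup>2" using ge by (intro power_mono) auto
      then show ?thesis unfolding k(2) by (intro add_increasing) auto
    qed
  qed
  also have "\<dots> = expectation (\<lambda>x. (run_max n (\<lambda>k. PS y k x))\<^sup>2) + expectation (\<lambda>x. (run_max n (\<lambda>k. neg.PS y k x))\<^sup>2)"
    by (intro Bochner_Integration.integral_add PS_max_sq_int neg.PS_max_sq_int)
  also have "\<dots> \<le> expectation (\<lambda>x. (PS y n x)\<^sup>2) + expectation (\<lambda>x. (neg.PS y n x)\<^sup>2)"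
    by (intro add_mono max_second_moment neg.max_second_moment)
  finally show "expectation (\<lambda>x. (run_max n (\<lambda>k. \<bar>PS y k x\<bar>))\<^sup>2) \<le> 2 * expectation (\<lambda>x. (PS y n x)\<^sup>2)"
    by (simp add: PS_neg)
qed

end

section \<open>Central limit theorem for weighted sums\<close>

text \<open>An image measure and not a density, so that variance 0 is covered as a point
  mass.\<close>

definition "gauss v = distr std_normal_distribution borel (\<lambda>x. sqrt v * x)"

lemma real_distribution_gauss: "real_distribution (gauss v)"
proof -
  interpret D: real_distribution std_normal_distribution by (rule real_dist_normal_dist)
  show ?thesis unfolding gauss_def by (rule D.real_distribution_distr) simp
qed

lemma char_gauss: "v \<ge> 0 \<Longrightarrow> char (gauss v) t = exp (- (v * t\<^sup>2) / 2)"
proof -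
  assume v: "v \<ge> 0"
  have "char (gauss v) t = char std_normal_distribution (t * sqrt v)"
    unfolding gauss_def char_def by (subst integral_distr) (auto simp: mult_ac)
  also have "\<dots> = exp (- (v * t\<^sup>2) / 2)"
    using v by (simp add: char_std_normal_distribution power_mult_distrib mult.commute)
  finally show ?thesis .
qed

text \<open>Serves the oscillation estimate: with \<open>v\<close> of order \<open>1 / m\<close>, a
  tail of order \<open>v^2\<close> for each of \<open>m\<close> blocks adds up to
  \<open>O(1 / m)\<close>.\<close>

lemma gauss_fourth_moment:
  fixes v :: real
  assumes "v \<ge> 0"
  shows "(\<integral>x. x ^ 4 \<partial>gauss v) = 3 * v\<^sup>2" and "integrable (gauss v) (\<lambda>x. x ^ 4)"
proof -
  have v: "(sqrt v * x) ^ 4 = v\<^sup>2 * x ^ (2 * 2)" for x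
  proof -
    have "sqrt v ^ 4 = (sqrt v ^ 2) ^ 2" by (simp only: power_mult[symmetric]) simp
    also have "\<dots> = v\<^sup>2" using assms by simp
    finally show ?thesis by (simp add: power_mult_distrib)
  qed
  have i: "integrable std_normal_distribution (\<lambda>x. (sqrt v * x) ^ 4)"
    unfolding v by (intro integrable_mult_right std_normal_distribution_even_moments)
  show "integrable (gauss v) (\<lambda>x. x ^ 4)"
    unfolding gauss_def by (rule integrable_distr_eq[THEN iffD2]) (use i in auto)
  have "(\<integral>x. x ^ 4 \<partial>gauss v) = (\<integral>x. v\<^sup>2 * x ^ (2 * 2) \<partial>std_normal_distribution)"
    unfolding gauss_def v[symmetric] by (rule integral_distr) auto
  also have "\<dots> = v\<^sup>2 * (fact (2 * 2) / (2 ^ 2 * fact 2))"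
    unfolding integral_mult_right_zero std_normal_distribution_even_moments(1) ..
  also have "\<dots> = 3 * v\<^sup>2" by (simp add: fact_numeral)
  finally show "(\<integral>x. x ^ 4 \<partial>gauss v) = 3 * v\<^sup>2" .
qed

lemma gauss_eq_normal:
  assumes v: "v > 0"
  shows "gauss v = density lborel (normal_density 0 (sqrt v))"
proof -
  interpret D: real_distribution std_normal_distribution by (rule real_dist_normal_dist)
  have "distributed std_normal_distribution lborel (\<lambda>x. x) (normal_density 0 1)"
    by (auto simp: distributed_def distr_id2)
  from D.normal_density_affine[OF this, of "sqrt v" 0]
  have "distributed std_normal_distribution lborel (\<lambda>x. sqrt v * x) (normal_density 0 (sqrt v))"
    using v by simp
  from distributed_distr_eq_density[OF this]
  have "distr std_normal_distribution lborel (\<lambda>x. sqrt v * x) = density lborel (normal_density 0 (sqrt v))" .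
  moreover have "distr std_normal_distribution lborel (\<lambda>x. sqrt v * x) = gauss v"
    unfolding gauss_def by (intro distr_cong) auto
  ultimately show ?thesis by simp
qed

context scenery
begin

definition "cf t = char (distr \<mu> borel (X 0)) t"

lemma char_X: "char (distr \<mu> borel (X l)) = cf"
  unfolding cf_def X_ident[of l] by simp

lemma norm_cf: "cmod (cf t) \<le> 1"
proof -
  interpret D: real_distribution "distr \<mu> borel (X 0)" by (rule real_distribution_distr) simp
  show ?thesis unfolding cf_def by (rule D.cmod_char_le_1)
qed

text \<open>Relative to \<open>t^2\<close> the characteristic function of one scenery variable is as
  close to the Gaussian one as desired near 0; this needs second moments only, by the same dominated
  remainder as for the walk.\<close>

lemma cf_approx:
  assumes e: "e > 0"
  obtains d where "d > 0" "\<And>t. \<bar>t\<bar> \<le> d \<Longrightarrow> cmod (cf t - exp (- t\<^sup>2 / 2)) \<le> e * t\<^sup>2"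
proof -
  define E where "E t = expectation (\<lambda>x. min (6 * (X 0 x)\<^sup>2) (\<bar>t\<bar> * \<bar>X 0 x\<bar> ^ 3))" for t
  have lim: "(E \<longlongrightarrow> expectation (\<lambda>x. 0)) (at 0)"
    unfolding E_def tendsto_at_iff_sequentially comp_def
  proof (intro allI impI)
    fix u assume u: "\<forall>i. u i \<in> UNIV - {0::real}" "u \<longlonglongrightarrow> 0"
    show "(\<lambda>i. expectation (\<lambda>x. min (6 * (X 0 x)\<^sup>2) (\<bar>u i\<bar> * \<bar>X 0 x\<bar> ^ 3))) \<longlonglongrightarrow> expectation (\<lambda>x. 0)"
    proof (rule integral_dominated_convergence[where w = "\<lambda>x. 6 * (X 0 x)\<^sup>2"])
      show "AE x in \<mu>. (\<lambda>i. min (6 * (X 0 x)\<^sup>2) (\<bar>u i\<bar> * \<bar>X 0 x\<bar> ^ 3)) \<longlonglongrightarrow> 0"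
      proof (rule AE_I2)
        fix x
        have "(\<lambda>i. min (6 * (X 0 x)\<^sup>2) (\<bar>u i\<bar> * \<bar>X 0 x\<bar> ^ 3)) \<longlonglongrightarrow> min (6 * (X 0 x)\<^sup>2) (\<bar>0\<bar> * \<bar>X 0 x\<bar> ^ 3)"
          by (intro tendsto_intros u(2))
        then show "(\<lambda>i. min (6 * (X 0 x)\<^sup>2) (\<bar>u i\<bar> * \<bar>X 0 x\<bar> ^ 3)) \<longlonglongrightarrow> 0" by simp
      qed
    qed (use X_sq in auto)
  qed
  have E0: "E 0 = 0" by (simp add: E_def)
  have "\<forall>\<^sub>F t in at 0. E t < e" using lim e by (intro order_tendstoD) auto
  then obtain d0 where d0: "d0 > 0" "\<And>t. \<bar>t\<bar> < d0 \<Longrightarrow> E t < e"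
    using E0 e by (auto simp: eventually_at dist_real_def) metis
  \<comment> \<open>The bound \<open>sqrt e\<close> controls the error \<open>(t^2 / 2)^2\<close>
    between the exponential and its linearisation.\<close>
  define d where "d = min (d0 / 2) (sqrt e)"
  have d: "d > 0" using d0 e by (simp add: d_def)
  moreover have "cmod (cf t - exp (- t\<^sup>2 / 2)) \<le> e * t\<^sup>2" if t: "\<bar>t\<bar> \<le> d" for t
  proof -
    have "variance (X 0) = 1" by (simp add: X_centered X_norm)
    from char_approx3'[OF X_meas X_int X_sq X_centered this refl, of t]
    have "cmod (cf t - (1 - t\<^sup>2 * 1 / 2)) \<le> t\<^sup>2 / 6 * E t"
      unfolding E_def cf_def .
    also have "\<dots> \<le> t\<^sup>2 / 6 * e"
    proof -
      have "\<bar>t\<bar> < d0" using t d0 by (simp add: d_def)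
      then show ?thesis using d0(2)[of t] by (intro mult_left_mono) auto
    qed
    finally have 1: "cmod (cf t - complex_of_real (1 - t\<^sup>2 / 2)) \<le> t\<^sup>2 / 6 * e" by simp
    have 2: "\<bar>(1 - s) - exp (- s)\<bar> \<le> s\<^sup>2" if "s \<ge> 0" for s :: real
    proof -
      have "1 - s \<le> exp (- s)" using exp_ge_add_one_self[of "- s"] by simp
      moreover have "exp (- s) \<le> 1 - s + s\<^sup>2"
      proof -
        have "exp (- s) * (1 + s) \<le> 1"
        proof -
          have "exp (- s) * (1 + s) \<le> exp (- s) * exp s" by (intro mult_left_mono exp_ge_add_one_self) simp
          also have "\<dots> = 1" by (simp flip: exp_add)
          finally show ?thesis .
        qed
        moreover have "1 \<le> (1 - s + s\<^sup>2) * (1 + s)" using that by (simp add: algebra_simps power2_eq_square)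
        ultimately have "exp (- s) * (1 + s) \<le> (1 - s + s\<^sup>2) * (1 + s)" by linarith
        then show ?thesis using that by simp
      qed
      ultimately show ?thesis by (simp add: abs_le_iff)
    qed
    have "cmod (complex_of_real (1 - t\<^sup>2 / 2) - complex_of_real (exp (- t\<^sup>2 / 2))) \<le> (t\<^sup>2 / 2)\<^sup>2"
      using 2[of "t\<^sup>2 / 2"] by (simp flip: of_real_diff)
    also have "\<dots> = t\<^sup>2 * (t\<^sup>2 / 4)" by (simp add: power2_eq_square)
    also have "\<dots> \<le> t\<^sup>2 * (e / 4)"
    proof -
      have "\<bar>t\<bar>\<^sup>2 \<le> (sqrt e)\<^sup>2" using t by (intro power_mono) (auto simp: d_def)
      then show ?thesis using e by (intro mult_left_mono) auto
    qed
    finally have 3: "cmod (complex_of_real (1 - t\<^sup>2 / 2) - complex_of_real (exp (- t\<^sup>2 / 2))) \<le> t\<^sup>2 * (e / 4)" .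
    have "cmod (cf t - exp (- t\<^sup>2 / 2)) \<le> cmod (cf t - complex_of_real (1 - t\<^sup>2 / 2)) + cmod (complex_of_real (1 - t\<^sup>2 / 2) - complex_of_real (exp (- t\<^sup>2 / 2)))"
      using norm_triangle_ineq[of "cf t - complex_of_real (1 - t\<^sup>2 / 2)" "complex_of_real (1 - t\<^sup>2 / 2) - complex_of_real (exp (- t\<^sup>2 / 2))"]
      by simp
    also have "\<dots> \<le> t\<^sup>2 / 6 * e + t\<^sup>2 * (e / 4)" by (intro add_mono 1 3)
    also have "\<dots> \<le> e * t\<^sup>2" using e by (simp add: field_simps)
    finally show ?thesis .
  qed
  ultimately show ?thesis using that by blast
qed

text \<open>Lindeberg's argument for characteristic functions: small weights let
  \<open>cf_approx\<close> act on each factor, and the errors of a product of factors of modulus at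
  most 1 add up to a multiple of \<open>e\<close> times the total variance. The exponential with the
  actual variance \<open>s n\<close> is compared first; its limit is then immediate.\<close>

theorem weighted_clt:
  fixes J :: "nat \<Rightarrow> (int \<times> int) set" and c :: "nat \<Rightarrow> int \<times> int \<Rightarrow> real"
  assumes fin: "\<And>n. finite (J n)"
    and small: "\<And>e. e > 0 \<Longrightarrow> \<forall>\<^sub>F n in sequentially. \<forall>l\<in>J n. \<bar>c n l\<bar> \<le> e"
    and var: "(\<lambda>n. \<Sum>l\<in>J n. (c n l)\<^sup>2) \<longlonglongrightarrow> v" and v: "v \<ge> 0"
  shows "weak_conv_m (\<lambda>n. distr \<mu> borel (\<lambda>x. \<Sum>l\<in>J n. c n l * X l x)) (gauss v)"
proof (rule levy_continuity)
  show "real_distribution (distr \<mu> borel (\<lambda>x. \<Sum>l\<in>J n. c n l * X l x))" for n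
    by (rule real_distribution_distr) simp
  show "real_distribution (gauss v)" by (rule real_distribution_gauss)
  fix t
  have char: "char (distr \<mu> borel (\<lambda>x. \<Sum>l\<in>J n. c n l * X l x)) t = (\<Prod>l\<in>J n. cf (c n l * t))" for n
  proof -
    have "char (distr \<mu> borel (\<lambda>x. \<Sum>l\<in>J n. c n l * X l x)) t = (\<Prod>l\<in>J n. char (distr \<mu> borel (\<lambda>x. c n l * X l x)) t)"
      by (rule char_distr_sum) (rule indep_vars_compose2[OF indep_vars_subset[OF X_indep subset_UNIV]], auto)
    also have "\<dots> = (\<Prod>l\<in>J n. cf (c n l * t))"
    proof (rule prod.cong[OF refl])
      fix l
      show "char (distr \<mu> borel (\<lambda>x. c n l * X l x)) t = cf (c n l * t)"
        unfolding char_X[of l, symmetric] char_def by (simp add: integral_distr mult_ac)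
    qed
    finally show ?thesis .
  qed
  define s where "s n = (\<Sum>l\<in>J n. (c n l)\<^sup>2)" for n
  have s_nonneg: "s n \<ge> 0" for n by (simp add: s_def sum_nonneg)
  obtain B where B: "\<And>n. s n \<le> B" "B > 0"
  proof -
    obtain K where "K > 0" "\<And>n. norm (s n) \<le> K"
      using convergent_imp_Bseq[OF convergentI[OF var]] unfolding Bseq_def s_def by blast
    then show ?thesis using that[of K] by (auto simp: abs_le_iff)
  qed
  have "(\<lambda>n. (\<Prod>l\<in>J n. cf (c n l * t)) - complex_of_real (exp (- (s n * t\<^sup>2) / 2))) \<longlonglongrightarrow> 0"
  proof (rule LIMSEQ_I)
    fix r :: real assume r: "r > 0"
    \<comment> \<open>\<open>B\<close> bounds all variances, so the total error is at most
      \<open>r / 2\<close>; the added 1 avoids division by zero at \<open>t = 0\<close>.\<close>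
    define e where "e = r / (2 * (B * (t\<^sup>2 + 1)))"
    have e: "e > 0" using r B by (simp add: e_def add_nonneg_pos)
    obtain d where d: "d > 0" "\<And>t. \<bar>t\<bar> \<le> d \<Longrightarrow> cmod (cf t - exp (- t\<^sup>2 / 2)) \<le> e * t\<^sup>2"
      using cf_approx[OF e] by blast
    have "d / (\<bar>t\<bar> + 1) > 0" using d by (simp add: add_nonneg_pos)
    from small[OF this] obtain n0 where n0: "\<And>n l. n \<ge> n0 \<Longrightarrow> l \<in> J n \<Longrightarrow> \<bar>c n l\<bar> \<le> d / (\<bar>t\<bar> + 1)"
      by (auto simp: eventually_sequentially)
    have "norm ((\<Prod>l\<in>J n. cf (c n l * t)) - complex_of_real (exp (- (s n * t\<^sup>2) / 2)) - 0) < r" if n: "n \<ge> n0" for n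
    proof -
      have "exp (- (s n * t\<^sup>2) / 2) = (\<Prod>l\<in>J n. exp (- (c n l * t)\<^sup>2 / 2))"
        unfolding exp_sum[OF fin, symmetric] s_def
        by (simp add: sum_distrib_right sum_divide_distrib sum_negf power_mult_distrib)
      then have "norm ((\<Prod>l\<in>J n. cf (c n l * t)) - complex_of_real (exp (- (s n * t\<^sup>2) / 2)) - 0)
        = norm ((\<Prod>l\<in>J n. cf (c n l * t)) - (\<Prod>l\<in>J n. complex_of_real (exp (- (c n l * t)\<^sup>2 / 2))))"
        by (simp only: of_real_prod diff_zero)
      also have "\<dots> \<le> (\<Sum>l\<in>J n. norm (cf (c n l * t) - complex_of_real (exp (- (c n l * t)\<^sup>2 / 2))))"
        by (intro norm_prod_diff norm_cf) simp
      also have "\<dots> \<le> (\<Sum>l\<in>J n. e * (c n l * t)\<^sup>2)"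
      proof (intro sum_mono d(2))
        fix l assume l: "l \<in> J n"
        have "\<bar>c n l * t\<bar> \<le> d / (\<bar>t\<bar> + 1) * \<bar>t\<bar>"
          unfolding abs_mult using n0[OF n l] by (intro mult_right_mono) auto
        also have "\<dots> \<le> d" using d by (simp add: field_simps)
        finally show "\<bar>c n l * t\<bar> \<le> d" .
      qed
      also have "\<dots> = e * t\<^sup>2 * s n"
        by (simp add: s_def sum_distrib_left power_mult_distrib mult_ac)
      also have "\<dots> \<le> e * (t\<^sup>2 + 1) * B" using e B s_nonneg by (intro mult_mono) auto
      also have "\<dots> = r / 2" using B by (simp add: e_def field_simps add_nonneg_eq_0_iff)
      also have "\<dots> < r" using r by simp
      finally show ?thesis .
    qed
    then show "\<exists>no. \<forall>n\<ge>no. norm ((\<Prod>l\<in>J n. cf (c n l * t)) - complex_of_real (exp (- (s n * t\<^sup>2) / 2)) - 0) < r" by blast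
  qed
  moreover have "(\<lambda>n. complex_of_real (exp (- (s n * t\<^sup>2) / 2))) \<longlonglongrightarrow> complex_of_real (exp (- (v * t\<^sup>2) / 2))"
    using var unfolding s_def by (intro tendsto_intros) auto
  ultimately have "(\<lambda>n. (\<Prod>l\<in>J n. cf (c n l * t)) - complex_of_real (exp (- (s n * t\<^sup>2) / 2)) + complex_of_real (exp (- (s n * t\<^sup>2) / 2)))
     \<longlonglongrightarrow> 0 + complex_of_real (exp (- (v * t\<^sup>2) / 2))"
    by (rule tendsto_add)
  then show "(\<lambda>n. char (distr \<mu> borel (\<lambda>x. \<Sum>l\<in>J n. c n l * X l x)) t) \<longlonglongrightarrow> char (gauss v) t"
    by (simp add: char char_gauss[OF v])
qed

end

section \<open>Weak convergence of independent coordinates\<close>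

text \<open>Finite vectors are embedded into sequences by padding with zeros, so that one
  topological space and one Borel structure serve for every \<open>m\<close>.\<close>

definition trunc_fun :: "nat \<Rightarrow> (nat \<Rightarrow> real) \<Rightarrow> nat \<Rightarrow> real" where
  "trunc_fun m v = (\<lambda>b. if b < m then v b else 0)"

lemma trunc_fun_measurable [measurable]: "trunc_fun m \<in> PiM {..<m} (\<lambda>_. borel) \<rightarrow>\<^sub>M borel"
proof (rule measurable_coordinatewise_then_product)
  fix b
  show "(\<lambda>v. trunc_fun m v b) \<in> borel_measurable (PiM {..<m} (\<lambda>_. borel))"
    by (cases "b < m") (auto simp: trunc_fun_def)
qed

lemma trunc_fun_restrict: "trunc_fun m (\<lambda>b\<in>{..<m}. v b) = trunc_fun m v"
  by (auto simp: trunc_fun_def)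

text \<open>For independent coordinates the expectation depends on the marginal laws only, which
  permits a change of probability space.\<close>

lemma (in prob_space) integral_indep_trunc_fun:
  fixes W :: "nat \<Rightarrow> 'a \<Rightarrow> real" and H :: "(nat \<Rightarrow> real) \<Rightarrow> real"
  assumes ind: "indep_vars (\<lambda>_. borel) W {..<m}" and m: "m > 0" and [measurable]: "H \<in> borel_measurable borel"
  shows "expectation (\<lambda>w. H (trunc_fun m (\<lambda>b. W b w))) = (\<integral>v. H (trunc_fun m v) \<partial>PiM {..<m} (\<lambda>b. distr M borel (W b)))"
proof -
  have rv: "random_variable borel (W b)" if "b \<in> {..<m}" for b
    using ind that unfolding indep_vars_def by blast
  have [measurable]: "(\<lambda>w. \<lambda>b\<in>{..<m}. W b w) \<in> M \<rightarrow>\<^sub>M PiM {..<m} (\<lambda>_. borel)"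
    using rv by (intro measurable_restrict)
  have D: "PiM {..<m} (\<lambda>b. distr M borel (W b)) = distr M (PiM {..<m} (\<lambda>_. borel)) (\<lambda>w. \<lambda>b\<in>{..<m}. W b w)"
    proof -
    have "{..<m} \<noteq> {}" using m by auto
    from indep_vars_iff_distr_eq_PiM'[where I = "{..<m}" and M' = "\<lambda>_. borel" and X = W, OF this rv] ind
    show ?thesis by simp
  qed
  show ?thesis
    unfolding D by (subst integral_distr) (auto simp: trunc_fun_restrict)
qed

lemma indep_vars_PiM_coords:
  assumes "I \<noteq> {}" "\<And>i. prob_space (N i)"
  shows "prob_space.indep_vars (PiM I N) N (\<lambda>i \<omega>. \<omega> i) I"
proof -
  interpret prob_space "PiM I N" by (intro prob_space_PiM assms)
  have "distr (PiM I N) (PiM I N) (\<lambda>x. \<lambda>i\<in>I. x i) = distr (PiM I N) (PiM I N) (\<lambda>x. x)"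
    by (intro distr_cong refl) (auto simp: space_PiM)
  also have "\<dots> = PiM I N" by (rule distr_id)
  also have "\<dots> = PiM I (\<lambda>i. distr (PiM I N) (N i) (\<lambda>\<omega>. \<omega> i))"
    by (intro PiM_cong refl distr_PiM_component[symmetric] assms)
  finally show ?thesis
    by (subst indep_vars_iff_distr_eq_PiM'[OF assms(1)]) auto
qed

lemma tendsto_coordinatewise:
  fixes f :: "'a \<Rightarrow> 'i \<Rightarrow> 'b::topological_space"
  shows "(f \<longlongrightarrow> l) F \<longleftrightarrow> (\<forall>i. ((\<lambda>x. f x i) \<longlongrightarrow> l i) F)"
  using limitin_componentwise[of "\<lambda>_. euclidean" UNIV f l F]
  by (simp add: euclidean_product_topology limitin_canonical_iff)

lemma continuous_on_coordinatewise_lipschitz: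
  fixes H :: "(nat \<Rightarrow> real) \<Rightarrow> real"
  assumes H: "\<And>u v. \<bar>H u - H v\<bar> \<le> L * (\<Sum>b<m. \<bar>u b - v b\<bar>)"
  shows "continuous_on UNIV H"
proof -
  have "(H \<longlongrightarrow> H v) (at v)" for v
  proof (rule LIM_zero_cancel, rule Lim_null_comparison)
    show "\<forall>\<^sub>F u in at v. norm (H u - H v) \<le> L * (\<Sum>b<m. \<bar>u b - v b\<bar>)"
      unfolding real_norm_def by (intro always_eventually allI H)
    have coord: "((\<lambda>u. u b) \<longlongrightarrow> v b) (at v)" for b
      by (rule tendsto_coordinatewise[THEN iffD1, rule_format]) (rule tendsto_ident_at)
    have "((\<lambda>u. L * (\<Sum>b<m. \<bar>u b - v b\<bar>)) \<longlongrightarrow> L * (\<Sum>b<m. \<bar>v b - v b\<bar>)) (at v)"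
      by (intro tendsto_mult_left tendsto_sum tendsto_rabs tendsto_diff tendsto_const coord)
    then show "((\<lambda>u. L * (\<Sum>b<m. \<bar>u b - v b\<bar>)) \<longlongrightarrow> 0) (at v)" by simp
  qed
  then show ?thesis unfolding continuous_on_def by (intro ballI)
qed

text \<open>Skorokhod's representation in each coordinate separately gives pointwise convergence
  with the prescribed marginals; on the product of these spaces the coordinates are independent and
  converge together, so dominated convergence applies.\<close>

theorem product_weak_convergence:
  fixes \<mu> :: "'e measure" and M :: "'w measure" and D :: "nat \<Rightarrow> nat \<Rightarrow> 'e \<Rightarrow> real" and W :: "nat \<Rightarrow> 'w \<Rightarrow> real"
    and H :: "(nat \<Rightarrow> real) \<Rightarrow> real"
  assumes \<mu>: "prob_space \<mu>" and M: "prob_space M" and m: "m > 0"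
    and D: "\<And>n. prob_space.indep_vars \<mu> (\<lambda>_. borel) (D n) {..<m}"
    and W: "prob_space.indep_vars M (\<lambda>_. borel) W {..<m}"
    and conv: "\<And>b. b < m \<Longrightarrow> weak_conv_m (\<lambda>n. distr \<mu> borel (D n b)) (distr M borel (W b))"
    and H: "continuous_on UNIV H" "\<And>v. \<bar>H v\<bar> \<le> B"
  shows "(\<lambda>n. \<integral>x. H (trunc_fun m (\<lambda>b. D n b x)) \<partial>\<mu>) \<longlonglongrightarrow> (\<integral>w. H (trunc_fun m (\<lambda>b. W b w)) \<partial>M)"
proof -
  interpret \<mu>: prob_space \<mu> by fact
  interpret M: prob_space M by fact
  have Drv: "D n b \<in> borel_measurable \<mu>" if "b < m" for n b
    using D[of n] that unfolding \<mu>.indep_vars_def by auto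
  have Wrv: "W b \<in> borel_measurable M" if "b < m" for b
    using W that unfolding M.indep_vars_def by auto
  have H_meas [measurable]: "H \<in> borel_measurable borel" using H(1) by (rule borel_measurable_continuous_onI)
  have "\<exists>\<Omega> Ys Y. prob_space (\<Omega> :: real measure) \<and> (\<forall>n. Ys n \<in> borel_measurable \<Omega>) \<and> Y \<in> borel_measurable \<Omega> \<and>
     (b < m \<longrightarrow> (\<forall>n. distr \<Omega> borel (Ys n) = distr \<mu> borel (D n b)) \<and> distr \<Omega> borel Y = distr M borel (W b)
      \<and> (\<forall>x\<in>space \<Omega>. (\<lambda>n. Ys n x) \<longlonglongrightarrow> Y x))" for b
  proof (cases "b < m")
    case True
    have "real_distribution (distr \<mu> borel (D n b))" for n by (rule \<mu>.real_distribution_distr[OF Drv[OF True]])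
    moreover have "real_distribution (distr M borel (W b))" by (rule M.real_distribution_distr[OF Wrv[OF True]])
    ultimately obtain \<Omega> Ys Y where "prob_space (\<Omega> :: real measure)" "\<forall>n. Ys n \<in> measurable \<Omega> borel"
      "\<forall>n. distr \<Omega> borel (Ys n) = distr \<mu> borel (D n b)" "Y \<in> measurable \<Omega> lborel" "distr \<Omega> borel Y = distr M borel (W b)"
      "\<forall>x\<in>space \<Omega>. (\<lambda>n. Ys n x) \<longlonglongrightarrow> Y x"
      using Skorohod[of "\<lambda>n. distr \<mu> borel (D n b)" "distr M borel (W b)"] conv[OF True] by blast
    then show ?thesis by (intro exI[of _ \<Omega>] exI[of _ Ys] exI[of _ Y]) auto
  next
    \<comment> \<open>A filler space for the indices beyond \<open>m\<close>, so that the
      representation can be chosen for every index.\<close>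
    case False
    have "prob_space (return borel (0::real))" by (rule prob_space_return) simp
    with False show ?thesis by (intro exI[of _ "return borel 0"] exI[of _ "\<lambda>_ _. 0"] exI[of _ "\<lambda>_. 0"]) auto
  qed
  then obtain \<Omega> Ys Y where \<Omega>: "\<And>b. prob_space (\<Omega> b :: real measure)" and Ys [measurable]: "\<And>b n. Ys b n \<in> borel_measurable (\<Omega> b)"
    and Y [measurable]: "\<And>b. Y b \<in> borel_measurable (\<Omega> b)"
    and dYs: "\<And>b n. b < m \<Longrightarrow> distr (\<Omega> b) borel (Ys b n) = distr \<mu> borel (D n b)"
    and dY: "\<And>b. b < m \<Longrightarrow> distr (\<Omega> b) borel (Y b) = distr M borel (W b)"
    and lim: "\<And>b x. b < m \<Longrightarrow> x \<in> space (\<Omega> b) \<Longrightarrow> (\<lambda>n. Ys b n x) \<longlonglongrightarrow> Y b x"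
    by metis
  define PP where "PP = PiM {..<m} \<Omega>"
  interpret PP: prob_space PP unfolding PP_def by (intro prob_space_PiM \<Omega>)
  have comp [measurable]: "(\<lambda>\<omega>. \<omega> b) \<in> PP \<rightarrow>\<^sub>M \<Omega> b" if "b < m" for b
    unfolding PP_def using that by (intro measurable_component_singleton) auto
  have "{..<m} \<noteq> {}" using m by auto
  from indep_vars_PiM_coords[OF this \<Omega>]
  have coords: "PP.indep_vars \<Omega> (\<lambda>i \<omega>. \<omega> i) {..<m}" unfolding PP_def .
  have ind: "PP.indep_vars (\<lambda>_. borel) (\<lambda>b \<omega>. Ys b n (\<omega> b)) {..<m}" "PP.indep_vars (\<lambda>_. borel) (\<lambda>b \<omega>. Y b (\<omega> b)) {..<m}" for n
    by (rule PP.indep_vars_compose2[OF coords]; simp)+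
  have marg: "distr PP borel (\<lambda>\<omega>. f (\<omega> b)) = distr (\<Omega> b) borel f" if "b < m" "f \<in> borel_measurable (\<Omega> b)" for f :: "real \<Rightarrow> real" and b
  proof -
    have "distr (\<Omega> b) borel f = distr (distr PP (\<Omega> b) (\<lambda>\<omega>. \<omega> b)) borel f"
      unfolding PP_def using that \<Omega> by (subst distr_PiM_component) auto
    also have "\<dots> = distr PP borel (\<lambda>\<omega>. f (\<omega> b))"
      using that by (subst distr_distr) (auto simp: comp_def)
    finally show ?thesis by simp
  qed
  have eq1: "(\<integral>x. H (trunc_fun m (\<lambda>b. D n b x)) \<partial>\<mu>) = (\<integral>\<omega>. H (trunc_fun m (\<lambda>b. Ys b n (\<omega> b))) \<partial>PP)" for n
    unfolding \<mu>.integral_indep_trunc_fun[OF D m H_meas] PP.integral_indep_trunc_fun[OF ind(1) m H_meas]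
    by (intro arg_cong2[where f = "integral\<^sup>L"] PiM_cong refl) (simp add: marg dYs)
  have eq2: "(\<integral>w. H (trunc_fun m (\<lambda>b. W b w)) \<partial>M) = (\<integral>\<omega>. H (trunc_fun m (\<lambda>b. Y b (\<omega> b))) \<partial>PP)"
    unfolding M.integral_indep_trunc_fun[OF W m H_meas] PP.integral_indep_trunc_fun[OF ind(2) m H_meas]
    by (intro arg_cong2[where f = "integral\<^sup>L"] PiM_cong refl) (simp add: marg dY)
  have meas: "(\<lambda>\<omega>. H (trunc_fun m (\<lambda>b. f b (\<omega> b)))) \<in> borel_measurable PP"
    if f: "\<And>b. f b \<in> borel_measurable (\<Omega> b)" for f :: "nat \<Rightarrow> real \<Rightarrow> real"
  proof -
    have "(\<lambda>\<omega>. \<lambda>b\<in>{..<m}. f b (\<omega> b)) \<in> PP \<rightarrow>\<^sub>M PiM {..<m} (\<lambda>_. borel)"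
      using measurable_compose[OF comp f] by (intro measurable_restrict) auto
    from measurable_compose[OF this trunc_fun_measurable] have "(\<lambda>\<omega>. trunc_fun m (\<lambda>b. f b (\<omega> b))) \<in> PP \<rightarrow>\<^sub>M borel"
      by (simp add: trunc_fun_restrict)
    from measurable_compose[OF this H_meas] show ?thesis .
  qed
  show ?thesis unfolding eq1 eq2
  proof (rule integral_dominated_convergence[where w = "\<lambda>_. B"])
    show "AE \<omega> in PP. (\<lambda>n. H (trunc_fun m (\<lambda>b. Ys b n (\<omega> b)))) \<longlonglongrightarrow> H (trunc_fun m (\<lambda>b. Y b (\<omega> b)))"
    proof (rule AE_I2)
      fix \<omega> assume \<omega>: "\<omega> \<in> space PP"
      have "(\<lambda>n. trunc_fun m (\<lambda>b. Ys b n (\<omega> b))) \<longlonglongrightarrow> trunc_fun m (\<lambda>b. Y b (\<omega> b))"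
      proof (rule tendsto_coordinatewise[THEN iffD2], intro allI)
        fix b
        show "(\<lambda>n. trunc_fun m (\<lambda>b. Ys b n (\<omega> b)) b) \<longlonglongrightarrow> trunc_fun m (\<lambda>b. Y b (\<omega> b)) b"
        proof (cases "b < m")
          case True
          have "\<omega> b \<in> space (\<Omega> b)" using measurable_space[OF comp[OF True] \<omega>] .
          then show ?thesis using lim[OF True] by (simp add: trunc_fun_def True)
        qed (simp add: trunc_fun_def)
      qed
      then show "(\<lambda>n. H (trunc_fun m (\<lambda>b. Ys b n (\<omega> b)))) \<longlonglongrightarrow> H (trunc_fun m (\<lambda>b. Y b (\<omega> b)))"
        by (rule continuous_on_tendsto_compose[OF H(1)]) auto
    qed
    show "(\<lambda>\<omega>. H (trunc_fun m (\<lambda>b. Y b (\<omega> b)))) \<in> borel_measurable PP" by (rule meas) simp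
    show "(\<lambda>\<omega>. H (trunc_fun m (\<lambda>b. Ys b n (\<omega> b)))) \<in> borel_measurable PP" for n by (rule meas) simp
  qed (use H(2) in auto)
qed

section \<open>Reduction of the functional limit theorem to Lipschitz functionals\<close>

text \<open>Uniform closeness as a relation; a supremum would call for bounded differences
  first.\<close>

definition close01 :: "real \<Rightarrow> (real \<Rightarrow> real) \<Rightarrow> (real \<Rightarrow> real) \<Rightarrow> bool" where
  "close01 e x y \<longleftrightarrow> (\<forall>t\<in>{0..1}. \<bar>x t - y t\<bar> \<le> e)"

text \<open>On the unit interval exactly the entries \<open>v 0, ..., v m\<close> are read, the last
  one only at \<open>t = 1\<close>.\<close>

definition step01 :: "nat \<Rightarrow> (nat \<Rightarrow> real) \<Rightarrow> real \<Rightarrow> real" where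
  "step01 m v = (\<lambda>t. v (nat \<lfloor>real m * t\<rfloor>))"

lemma close01_refl: "e \<ge> 0 \<Longrightarrow> close01 e x x"
  by (simp add: close01_def)

lemma close01_sym: "close01 e x y \<longleftrightarrow> close01 e y x"
  by (simp add: close01_def abs_minus_commute)

lemma close01_triangle: "close01 d x y \<Longrightarrow> close01 e y z \<Longrightarrow> close01 (d + e) x z"
  unfolding close01_def
proof
  fix t :: real assume "\<forall>t\<in>{0..1}. \<bar>x t - y t\<bar> \<le> d" "\<forall>t\<in>{0..1}. \<bar>y t - z t\<bar> \<le> e" "t \<in> {0..1}"
  then have "\<bar>x t - y t\<bar> \<le> d" "\<bar>y t - z t\<bar> \<le> e" by blast+
  then show "\<bar>x t - z t\<bar> \<le> d + e" by linarith
qed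

lemma step01_in_D01: "step01 m v \<in> D01"
proof (cases "m = 0")
  case True
  then show ?thesis by (auto simp: D01_def cadlag01_def step01_def)
next
  case False
  then have m: "real m > 0" by simp
  have right: "(step01 m v \<longlongrightarrow> step01 m v t) (at_right t)" for t
  proof (rule tendsto_eventually)
    have "t < (of_int \<lfloor>real m * t\<rfloor> + 1) / real m"
      using m by (simp add: pos_less_divide_eq mult.commute)
    then have "\<forall>\<^sub>F s in at_right t. s \<in> {t<..<(of_int \<lfloor>real m * t\<rfloor> + 1) / real m}"
      by (rule eventually_at_right_real)
    then show "\<forall>\<^sub>F s in at_right t. step01 m v s = step01 m v t"
    proof eventually_elim
      case (elim s)
      have "real m * s < of_int \<lfloor>real m * t\<rfloor> + 1" using elim m by (simp add: pos_less_divide_eq mult.commute)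
      moreover have "real m * t \<le> real m * s" using elim m by (intro mult_left_mono) auto
      ultimately have "\<lfloor>real m * s\<rfloor> = \<lfloor>real m * t\<rfloor>" by (intro floor_unique) linarith+
      then show ?case by (simp add: step01_def)
    qed
  qed
  \<comment> \<open>At a jump time the left limit is the previous value, hence the ceiling minus 1
    in place of the floor.\<close>
  have left: "(step01 m v \<longlongrightarrow> v (nat (\<lceil>real m * t\<rceil> - 1))) (at_left t)" for t
  proof (rule tendsto_eventually)
    have "(of_int \<lceil>real m * t\<rceil> - 1) / real m < t"
      using m by (simp add: pos_divide_less_eq mult.commute) linarith
    then have "\<forall>\<^sub>F s in at_left t. s \<in> {(of_int \<lceil>real m * t\<rceil> - 1) / real m<..<t}"
      by (rule eventually_at_left_real)
    then show "\<forall>\<^sub>F s in at_left t. step01 m v s = v (nat (\<lceil>real m * t\<rceil> - 1))"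
    proof eventually_elim
      case (elim s)
      have "of_int \<lceil>real m * t\<rceil> - 1 < real m * s" using elim m by (simp add: pos_divide_less_eq mult.commute)
      moreover have "real m * s < of_int \<lceil>real m * t\<rceil>"
        by (rule less_le_trans[OF mult_strict_left_mono le_of_int_ceiling]) (use elim m in auto)
      ultimately have "\<lfloor>real m * s\<rfloor> = \<lceil>real m * t\<rceil> - 1" by (intro floor_unique) auto
      then show ?case by (simp add: step01_def)
    qed
  qed
  show ?thesis unfolding D01_def cadlag01_def using right left by blast
qed

lemma continuous_in_D01:
  assumes "continuous_on {0..1} x"
  shows "x \<in> D01"
proof -
  have right: "(x \<longlongrightarrow> x t) (at_right t)" if t: "t \<in> {0..<1}" for t
  proof -
    have "(x \<longlongrightarrow> x t) (at t within {0..1})" using assms t by (auto simp: continuous_on_def)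
    then have "(x \<longlongrightarrow> x t) (at t within {t..1})" by (rule tendsto_within_subset) (use t in auto)
    then show ?thesis using t by (simp add: at_within_Icc_at_right)
  qed
  have left: "(x \<longlongrightarrow> x t) (at_left t)" if t: "t \<in> {0<..1}" for t
  proof -
    have "(x \<longlongrightarrow> x t) (at t within {0..1})" using assms t by (auto simp: continuous_on_def)
    then have "(x \<longlongrightarrow> x t) (at t within {0..t})" by (rule tendsto_within_subset) (use t in auto)
    then show ?thesis using t by (simp add: at_within_Icc_at_left)
  qed
  show ?thesis unfolding D01_def cadlag01_def using right left by blast
qed

text \<open>The identity is an admissible time change. Through this comparison every
  Skorokhod-continuous functional becomes continuous for the uniform distance.\<close>

lemma skorokhod_dist_le:
  assumes "close01 e x y" "e \<ge> 0"
  shows "skorokhod_dist x y \<le> e"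
proof -
  let ?S = "{max (SUP t\<in>{0..1}. \<bar>r t - t\<bar>) (SUP t\<in>{0..1}. \<bar>x t - y (r t)\<bar>) | r. r \<in> time_changes}"
  let ?m = "max (SUP t\<in>{0..1}. \<bar>t - t\<bar> :: real) (SUP t\<in>{0..1}. \<bar>x t - y t\<bar>)"
  have "(\<lambda>t. t) \<in> time_changes"
    by (auto simp: time_changes_def strict_mono_on_def)
  then have "?m \<in> ?S" by (intro CollectI exI[of _ "\<lambda>t. t"] conjI refl)
  moreover have "bdd_below ?S"
  proof (rule bdd_belowI[of _ 0])
    fix u assume "u \<in> ?S"
    then obtain r where r: "r \<in> time_changes"
      and u: "u = max (SUP t\<in>{0..1}. \<bar>r t - t\<bar>) (SUP t\<in>{0..1}. \<bar>x t - y (r t)\<bar>)" by blast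
    have "bdd_above ((\<lambda>t. \<bar>r t - t\<bar>) ` {0..1})"
    proof (rule bdd_aboveI[of _ 1])
      fix w assume "w \<in> (\<lambda>t. \<bar>r t - t\<bar>) ` {0..1}"
      then obtain t where t: "t \<in> {0..1}" "w = \<bar>r t - t\<bar>" by blast
      have "r t \<in> {0..1}" using r t by (auto simp: time_changes_def)
      then show "w \<le> 1" using t by auto
    qed
    then have "\<bar>r 0 - 0\<bar> \<le> (SUP t\<in>{0..1}. \<bar>r t - t\<bar>)" by (intro cSUP_upper) auto
    then show "0 \<le> u" unfolding u by linarith
  qed
  ultimately have "Inf ?S \<le> ?m" by (rule cInf_lower)
  moreover have "?m \<le> e"
    using assms by (intro max.boundedI cSUP_least) (auto simp: close01_def)
  ultimately show ?thesis unfolding skorokhod_dist_def by linarith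
qed

definition supcont :: "((real \<Rightarrow> real) \<Rightarrow> real) \<Rightarrow> bool" where
  "supcont g \<longleftrightarrow> (\<forall>x\<in>D01. \<forall>e>0. \<exists>d>0. \<forall>y\<in>D01. close01 d x y \<longrightarrow> \<bar>g y - g x\<bar> < e)"

lemma bcont_D01_supcont:
  assumes "bcont_D01 f"
  shows "supcont f"
  unfolding supcont_def
proof (intro ballI allI impI)
  fix x and e :: real assume x: "x \<in> D01" and e: "e > 0"
  obtain d where d: "d > 0" "\<And>y. y \<in> D01 \<Longrightarrow> skorokhod_dist x y < d \<Longrightarrow> \<bar>f y - f x\<bar> < e"
    using assms x e unfolding bcont_D01_def by blast
  have "\<bar>f y - f x\<bar> < e" if "y \<in> D01" "close01 (d / 2) x y" for y
    using d(2)[OF that(1)] skorokhod_dist_le[OF that(2)] d(1) by simp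
  then show "\<exists>d>0. \<forall>y\<in>D01. close01 d x y \<longrightarrow> \<bar>f y - f x\<bar> < e"
    using d(1) by (intro exI[of _ "d / 2"]) auto
qed

lemma supcont_tendsto:
  assumes g: "supcont g" and x: "x \<in> D01" and y: "\<And>a. y a \<in> D01"
    and c: "\<And>d. d > 0 \<Longrightarrow> \<forall>\<^sub>F a in F. close01 d x (y a)"
  shows "((\<lambda>a. g (y a)) \<longlongrightarrow> g x) F"
proof (rule tendstoI)
  fix e :: real assume "e > 0"
  then obtain d where d: "d > 0" "\<forall>y\<in>D01. close01 d x y \<longrightarrow> \<bar>g y - g x\<bar> < e"
    using g x unfolding supcont_def by blast
  from c[OF d(1)] show "\<forall>\<^sub>F a in F. dist (g (y a)) (g x) < e"
  proof eventually_elim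
    case (elim a)
    then show ?case using d(2) y[of a] by (simp add: dist_real_def)
  qed
qed

text \<open>On step paths a functional depends on \<open>m + 1\<close> values, continuously for
  pointwise convergence. This is the source of all measurability on path space.\<close>

lemma supcont_step_continuous:
  assumes g: "supcont g"
  shows "continuous_on UNIV (\<lambda>v. g (step01 m v))"
  unfolding continuous_on_def
proof
  fix v :: "nat \<Rightarrow> real"
  show "((\<lambda>v. g (step01 m v)) \<longlongrightarrow> g (step01 m v)) (at v)"
  proof (rule supcont_tendsto[OF g step01_in_D01 step01_in_D01])
    fix d :: real assume d: "d > 0"
    have "\<forall>\<^sub>F u in at v. \<forall>k\<in>{..m}. dist (u k) (v k) < d"
    proof (rule eventually_ball_finite)
      show "\<forall>k\<in>{..m}. \<forall>\<^sub>F u in at v. dist (u k) (v k) < d"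
      proof
        fix k
        have "((\<lambda>u. u k) \<longlongrightarrow> v k) (at v)"
          by (rule tendsto_coordinatewise[THEN iffD1, rule_format]) (rule tendsto_ident_at)
        then show "\<forall>\<^sub>F u in at v. dist (u k) (v k) < d" using d by (rule tendstoD)
      qed
    qed simp
    then show "\<forall>\<^sub>F u in at v. close01 d (step01 m v) (step01 m u)"
    proof eventually_elim
      case (elim u)
      show ?case unfolding close01_def step01_def
      proof
        fix t :: real assume "t \<in> {0..1}"
        then have "real m * t \<le> real m * 1" by (intro mult_left_mono) auto
        then have "nat \<lfloor>real m * t\<rfloor> \<in> {..m}" by (simp add: floor_le_iff nat_le_iff)
        from bspec[OF elim this] show "\<bar>v (nat \<lfloor>real m * t\<rfloor>) - u (nat \<lfloor>real m * t\<rfloor>)\<bar> \<le> d"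
          by (simp add: dist_real_def abs_minus_commute)
      qed
    qed
  qed
qed

lemma supcont_step_measurable:
  assumes g: "supcont g" and v: "\<And>k. (\<lambda>x. v x k) \<in> borel_measurable M"
  shows "(\<lambda>x. g (step01 m (v x))) \<in> borel_measurable M"
proof -
  have "v \<in> M \<rightarrow>\<^sub>M borel" by (rule measurable_coordinatewise_then_product) (rule v)
  from measurable_compose[OF this borel_measurable_continuous_onI[OF supcont_step_continuous[OF g]]]
  show ?thesis .
qed

section \<open>Lipschitz regularisation of functionals\<close>

definition lip01 :: "real \<Rightarrow> ((real \<Rightarrow> real) \<Rightarrow> real) \<Rightarrow> bool" where
  "lip01 L g \<longleftrightarrow> L \<ge> 0 \<and> (\<forall>x\<in>D01. \<forall>y\<in>D01. \<forall>d\<ge>0. close01 d x y \<longrightarrow> \<bar>g x - g y\<bar> \<le> L * d)"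

lemma lip01_supcont:
  assumes "lip01 L g"
  shows "supcont g"
  unfolding supcont_def
proof (intro ballI allI impI)
  fix x and e :: real assume x: "x \<in> D01" and e: "e > 0"
  have L: "L \<ge> 0" using assms by (simp add: lip01_def)
  define d where "d = e / (L + 1)"
  have d: "d > 0" using e L by (simp add: d_def)
  have "\<bar>g y - g x\<bar> < e" if "y \<in> D01" "close01 d x y" for y
  proof -
    have "\<bar>g x - g y\<bar> \<le> L * d" using assms x that d unfolding lip01_def by (meson less_imp_le)
    also have "L * d < (L + 1) * d" using d by (intro mult_strict_right_mono) auto
    also have "(L + 1) * d = e" using L by (simp add: d_def)
    finally show ?thesis by (simp add: abs_minus_commute)
  qed
  then show "\<exists>d>0. \<forall>y\<in>D01. close01 d x y \<longrightarrow> \<bar>g y - g x\<bar> < e" using d by blast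
qed

text \<open>The inf-convolution of \<open>f\<close> with \<open>k\<close> times the uniform
  distance, a \<open>k\<close>-Lipschitz minorant of \<open>f\<close> (its Pasch-Hausdorff
  envelope); the variable \<open>e\<close> runs over upper bounds of the distance.\<close>

definition reg :: "((real \<Rightarrow> real) \<Rightarrow> real) \<Rightarrow> real \<Rightarrow> (real \<Rightarrow> real) \<Rightarrow> real" where
  "reg f k x = Inf {f y + k * e | y e. y \<in> D01 \<and> 0 \<le> e \<and> close01 e x y}"

context
  fixes f :: "(real \<Rightarrow> real) \<Rightarrow> real" and B :: real
  assumes B: "\<And>x. x \<in> D01 \<Longrightarrow> \<bar>f x\<bar> \<le> B"
begin

lemma reg_lower:
  assumes "k \<ge> 0" "y \<in> D01" "0 \<le> e" "close01 e x y"
  shows "reg f k x \<le> f y + k * e"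
  unfolding reg_def
proof (rule cInf_lower)
  show "f y + k * e \<in> {f y + k * e | y e. y \<in> D01 \<and> 0 \<le> e \<and> close01 e x y}" using assms by blast
  show "bdd_below {f y + k * e | y e. y \<in> D01 \<and> 0 \<le> e \<and> close01 e x y}"
  proof (rule bdd_belowI[of _ "- B"])
    fix u assume "u \<in> {f y + k * e | y e. y \<in> D01 \<and> 0 \<le> e \<and> close01 e x y}"
    then obtain y e where "u = f y + k * e" "y \<in> D01" "0 \<le> e" by blast
    moreover have "0 \<le> k * e" using assms(1) \<open>0 \<le> e\<close> by simp
    ultimately show "- B \<le> u" using B[of y] by linarith
  qed
qed

lemma reg_greatest:
  assumes "x \<in> D01" "\<And>y e. y \<in> D01 \<Longrightarrow> 0 \<le> e \<Longrightarrow> close01 e x y \<Longrightarrow> c \<le> f y + k * e"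
  shows "c \<le> reg f k x"
  unfolding reg_def
proof (rule cInf_greatest)
  have "close01 0 x x" by (simp add: close01_refl)
  then show "{f y + k * e | y e. y \<in> D01 \<and> 0 \<le> e \<and> close01 e x y} \<noteq> {}" using assms(1) by blast
  show "c \<le> u" if "u \<in> {f y + k * e | y e. y \<in> D01 \<and> 0 \<le> e \<and> close01 e x y}" for u
    using that assms(2) by blast
qed

lemma reg_le: "k \<ge> 0 \<Longrightarrow> x \<in> D01 \<Longrightarrow> reg f k x \<le> f x"
  using reg_lower[of k x 0 x] by (simp add: close01_refl)

lemma reg_bounded:
  assumes "k \<ge> 0" "x \<in> D01"
  shows "\<bar>reg f k x\<bar> \<le> B"
proof -
  have "- B \<le> reg f k x"
  proof (rule reg_greatest[OF assms(2)])
    fix y and e :: real assume "y \<in> D01" "0 \<le> e"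
    moreover have "0 \<le> k * e" using assms(1) \<open>0 \<le> e\<close> by simp
    ultimately show "- B \<le> f y + k * e" using B[of y] by linarith
  qed
  then show ?thesis using reg_le[OF assms] B[OF assms(2)] by linarith
qed

lemma reg_lip01:
  assumes k: "k \<ge> 0"
  shows "lip01 k (reg f k)"
proof -
  have le: "reg f k x \<le> reg f k y + k * d" if "x \<in> D01" "y \<in> D01" "0 \<le> d" "close01 d x y" for x y d
  proof -
    have "reg f k x - k * d \<le> reg f k y"
    proof (rule reg_greatest[OF that(2)])
      fix y' and e :: real assume y': "y' \<in> D01" "0 \<le> e" "close01 e y y'"
      have "reg f k x \<le> f y' + k * (d + e)"
        using k y' that by (intro reg_lower close01_triangle[of d x y e y']) auto
      then show "reg f k x - k * d \<le> f y' + k * e" by (simp add: distrib_left)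
    qed
    then show ?thesis by simp
  qed
  show ?thesis unfolding lip01_def
  proof (intro conjI ballI allI impI)
    fix x y d assume h: "x \<in> D01" "y \<in> D01" "(0::real) \<le> d" "close01 d x y"
    have "close01 d y x" using h(4) by (simp add: close01_sym)
    then show "\<bar>reg f k x - reg f k y\<bar> \<le> k * d"
      using le[OF h] le[OF h(2) h(1) h(3)] by linarith
  qed (rule k)
qed

text \<open>Competitors \<open>y\<close> near \<open>x\<close> have values near \<open>f x\<close>;
  distant ones pay a penalty exceeding the total range of \<open>f\<close>.\<close>

lemma reg_tendsto:
  assumes f: "supcont f" and x: "x \<in> D01"
  shows "(\<lambda>k. reg f (real k) x) \<longlonglongrightarrow> f x"
proof (rule LIMSEQ_I)
  fix r :: real assume r: "r > 0"
  obtain d where d: "d > 0" "\<forall>y\<in>D01. close01 d x y \<longrightarrow> \<bar>f y - f x\<bar> < r / 2"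
    using f x r unfolding supcont_def by (meson half_gt_zero)
  \<comment> \<open>Beyond distance \<open>d\<close> the penalty is then at least
    \<open>2 * B\<close>, which lifts any value above \<open>f x\<close>.\<close>
  obtain k0 :: nat where k0: "2 * B / d \<le> real k0" using real_arch_simple by blast
  have "norm (reg f (real k) x - f x) < r" if k: "k \<ge> k0" for k
  proof -
    have "f x - r / 2 \<le> reg f (real k) x"
    proof (rule reg_greatest[OF x])
      fix y e assume y: "y \<in> D01" "(0::real) \<le> e" "close01 e x y"
      show "f x - r / 2 \<le> f y + real k * e"
      proof (cases "e \<le> d")
        case True
        then have "close01 d x y" using y(3) unfolding close01_def by (meson order_trans)
        then have "\<bar>f y - f x\<bar> < r / 2" using d(2) y(1) by blast
        moreover have "0 \<le> real k * e" using y(2) by simp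
        ultimately show ?thesis by linarith
      next
        case False
        have "2 * B \<le> real k0 * d" using k0 d(1) by (simp add: pos_divide_le_eq)
        also have "\<dots> \<le> real k * e" using False k d(1) by (intro mult_mono) auto
        finally have "2 * B \<le> real k * e" .
        then show ?thesis using B[OF x] B[OF y(1)] r by linarith
      qed
    qed
    moreover have "reg f (real k) x \<le> f x" by (rule reg_le) (use x in auto)
    ultimately show ?thesis using r by (simp add: abs_if)
  qed
  then show "\<exists>k0. \<forall>k\<ge>k0. norm (reg f (real k) x - f x) < r" by blast
qed

end

section \<open>Step approximations of the Wiener path and reduction to Lipschitz functionals\<close>

lemma wiener_prob_space: "wiener01 M W \<Longrightarrow> prob_space M"
  by (simp add: wiener01_def)

text \<open>The minimum keeps all sampling times in the unit interval, so every entry is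
  measurable.\<close>

definition wstep :: "('w \<Rightarrow> real \<Rightarrow> real) \<Rightarrow> real \<Rightarrow> nat \<Rightarrow> 'w \<Rightarrow> real \<Rightarrow> real" where
  "wstep W s m w = step01 m (\<lambda>k. s * W w (real (min k m) / real m))"

lemma wiener_path_D01:
  assumes W: "wiener01 M W" and w: "w \<in> space M"
  shows "(\<lambda>t. s * W w t) \<in> D01"
  using W w by (intro continuous_in_D01 continuous_intros) (simp add: wiener01_def)

text \<open>Paths are uniformly continuous on the unit interval, so the sampled step paths converge
  uniformly.\<close>

lemma wiener_step_tendsto:
  assumes W: "wiener01 M W" and g: "supcont g" and w: "w \<in> space M"
  shows "(\<lambda>m. g (wstep W s m w)) \<longlonglongrightarrow> g (\<lambda>t. s * W w t)"
proof (rule supcont_tendsto[OF g wiener_path_D01[OF W w]])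
  show "wstep W s m w \<in> D01" for m by (simp add: wstep_def step01_in_D01)
  fix e :: real assume e: "e > 0"
  have "continuous_on {0..1} (\<lambda>t. s * W w t)"
    using W w by (intro continuous_intros) (simp add: wiener01_def)
  then have "uniformly_continuous_on {0..1} (\<lambda>t. s * W w t)"
    by (rule compact_uniformly_continuous) simp
  then obtain d where d: "d > 0" "\<And>t u. t \<in> {0..1} \<Longrightarrow> u \<in> {0..1} \<Longrightarrow> dist u t < d \<Longrightarrow> dist (s * W w u) (s * W w t) < e"
    using e unfolding uniformly_continuous_on_def by metis
  obtain m0 :: nat where m0: "1 / d < real m0" using reals_Archimedean2 by blast
  show "\<forall>\<^sub>F m in sequentially. close01 e (\<lambda>t. s * W w t) (wstep W s m w)"
    using eventually_ge_at_top[of m0]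
  proof eventually_elim
    case (elim m)
    have md: "1 / d < real m" using m0 elim by simp
    moreover have "0 < 1 / d" using d(1) by simp
    ultimately have m: "real m > 0" by linarith
    show ?case unfolding close01_def
    proof
      fix t :: real assume t: "t \<in> {0..1}"
      let ?k = "nat \<lfloor>real m * t\<rfloor>"
      have "real m * t \<le> real m * 1" using t by (intro mult_left_mono) auto
      then have k: "?k \<le> m" by (simp add: floor_le_iff nat_le_iff)
      have fl: "real ?k = of_int \<lfloor>real m * t\<rfloor>" using t by simp
      have "real ?k \<le> real m * t" "real m * t < real ?k + 1" unfolding fl by linarith+
      then have "real ?k / real m \<le> t" "t < (real ?k + 1) / real m"
        using m unfolding pos_divide_le_eq[OF m] pos_less_divide_eq[OF m] by (simp_all only: mult.commute)
      then have "real ?k / real m \<le> t" "t - real ?k / real m < 1 / real m"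
        by (simp_all add: add_divide_distrib)
      moreover have "1 / real m < d" using md d(1) m by (simp add: field_simps)
      ultimately have "dist (real ?k / real m) t < d" by (simp add: dist_real_def)
      moreover have "real ?k / real m \<in> {0..1}" using k m by simp
      ultimately have "dist (s * W w (real ?k / real m)) (s * W w t) < e" using t by (intro d(2))
      then show "\<bar>s * W w t - wstep W s m w t\<bar> \<le> e"
        using k by (simp add: wstep_def step01_def min_absorb1 dist_real_def abs_minus_commute)
    qed
  qed
qed

lemma wiener_step_measurable:
  assumes W: "wiener01 M W" and g: "supcont g"
  shows "(\<lambda>w. g (wstep W s m w)) \<in> borel_measurable M"
  unfolding wstep_def
proof (rule supcont_step_measurable[OF g])
  fix k
  have "(\<lambda>w. W w (real (min k m) / real m)) \<in> borel_measurable M"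
    using W by (cases "m = 0") (auto simp: wiener01_def)
  then show "(\<lambda>w. s * W w (real (min k m) / real m)) \<in> borel_measurable M" by (intro borel_measurable_times) auto
qed

text \<open>A pointwise limit of the functional evaluated on step approximations, where
  measurability is known.\<close>

lemma wiener_measurable:
  assumes W: "wiener01 M W" and g: "supcont g"
  shows "(\<lambda>w. g (\<lambda>t. s * W w t)) \<in> borel_measurable M"
  by (rule borel_measurable_LIMSEQ_metric[OF wiener_step_measurable[OF W g, of s] wiener_step_tendsto[OF W g]])

lemma wiener_step_limit:
  assumes W: "wiener01 M W" and g: "supcont g" and B: "\<And>x. x \<in> D01 \<Longrightarrow> \<bar>g x\<bar> \<le> B"
  shows "(\<lambda>m. \<integral>w. g (wstep W s m w) \<partial>M) \<longlonglongrightarrow> (\<integral>w. g (\<lambda>t. s * W w t) \<partial>M)"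
proof -
  interpret prob_space M using W by (rule wiener_prob_space)
  show ?thesis
  proof (rule integral_dominated_convergence[where w = "\<lambda>_. B"])
    show "AE w in M. (\<lambda>m. g (wstep W s m w)) \<longlonglongrightarrow> g (\<lambda>t. s * W w t)"
      using wiener_step_tendsto[OF W g] by (intro AE_I2)
    show "AE w in M. norm (g (wstep W s m w)) \<le> B" for m
      by (intro AE_I2) (simp add: wstep_def B step01_in_D01)
  qed (use wiener_step_measurable[OF W g] wiener_measurable[OF W g] in auto)
qed

text \<open>One half of a portmanteau argument: a regularisation lies below \<open>f\<close>, its
  integrals converge by hypothesis, and for large \<open>k\<close> its Wiener integral is within
  \<open>e\<close> of that of \<open>f\<close>.\<close>

lemma regularization_lower_bound:
  fixes \<mu> :: "'e measure" and V :: "nat \<Rightarrow> 'e \<Rightarrow> nat \<Rightarrow> real"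
  assumes \<mu>: "prob_space \<mu>" and V: "\<And>n k. (\<lambda>x. V n x k) \<in> borel_measurable \<mu>"
    and W: "wiener01 M W" and f: "supcont f" and B: "\<And>x. x \<in> D01 \<Longrightarrow> \<bar>f x\<bar> \<le> B"
    and lip: "\<And>g L B. lip01 L g \<Longrightarrow> (\<And>x. x \<in> D01 \<Longrightarrow> \<bar>g x\<bar> \<le> B) \<Longrightarrow>
       (\<lambda>n. \<integral>x. g (step01 n (V n x)) \<partial>\<mu>) \<longlonglongrightarrow> (\<integral>w. g (\<lambda>t. s * W w t) \<partial>M)"
    and e: "e > 0"
  shows "\<forall>\<^sub>F n in sequentially. (\<integral>w. f (\<lambda>t. s * W w t) \<partial>M) - e < (\<integral>x. f (step01 n (V n x)) \<partial>\<mu>)"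
proof -
  interpret \<mu>: prob_space \<mu> by fact
  interpret prob_space M using W by (rule wiener_prob_space)
  have reg_sc: "supcont (reg f (real k))" for k
    by (rule lip01_supcont[OF reg_lip01[OF B]]) auto
  have "(\<lambda>k. \<integral>w. reg f (real k) (\<lambda>t. s * W w t) \<partial>M) \<longlonglongrightarrow> (\<integral>w. f (\<lambda>t. s * W w t) \<partial>M)"
  proof (rule integral_dominated_convergence[where w = "\<lambda>_. B"])
    show "AE w in M. (\<lambda>k. reg f (real k) (\<lambda>t. s * W w t)) \<longlonglongrightarrow> f (\<lambda>t. s * W w t)"
      by (intro AE_I2 reg_tendsto[OF B f] wiener_path_D01[OF W])
    show "AE w in M. norm (reg f (real k) (\<lambda>t. s * W w t)) \<le> B" for k
      unfolding real_norm_def by (intro AE_I2 reg_bounded[OF B] wiener_path_D01[OF W]) auto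
  qed (use wiener_measurable[OF W f] wiener_measurable[OF W reg_sc] in auto)
  from order_tendstoD(1)[OF this, of "(\<integral>w. f (\<lambda>t. s * W w t) \<partial>M) - e"] e
  obtain k where k: "(\<integral>w. f (\<lambda>t. s * W w t) \<partial>M) - e < (\<integral>w. reg f (real k) (\<lambda>t. s * W w t) \<partial>M)"
    unfolding eventually_sequentially by auto
  have lipk: "lip01 (real k) (reg f (real k))" by (rule reg_lip01[OF B]) auto
  have bk: "\<bar>reg f (real k) x\<bar> \<le> B" if "x \<in> D01" for x using that by (intro reg_bounded[OF B]) auto
  have "(\<lambda>n. \<integral>x. reg f (real k) (step01 n (V n x)) \<partial>\<mu>) \<longlonglongrightarrow> (\<integral>w. reg f (real k) (\<lambda>t. s * W w t) \<partial>M)"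
    by (rule lip[OF lipk]) (rule bk)
  from order_tendstoD(1)[OF this k]
  show ?thesis
  proof eventually_elim
    case (elim n)
    have "(\<integral>x. reg f (real k) (step01 n (V n x)) \<partial>\<mu>) \<le> (\<integral>x. f (step01 n (V n x)) \<partial>\<mu>)"
    proof (rule integral_mono)
      show "integrable \<mu> (\<lambda>x. reg f (real k) (step01 n (V n x)))"
        by (rule \<mu>.integrable_const_bound[where B = B])
          (use bk step01_in_D01 in \<open>auto intro!: supcont_step_measurable[OF reg_sc] V\<close>)
      show "integrable \<mu> (\<lambda>x. f (step01 n (V n x)))"
        by (rule \<mu>.integrable_const_bound[where B = B])
          (use B step01_in_D01 in \<open>auto intro!: supcont_step_measurable[OF f] V\<close>)
      show "reg f (real k) (step01 n (V n x)) \<le> f (step01 n (V n x))" for x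
        by (rule reg_le[OF B]) (auto simp: step01_in_D01)
    qed
    then show ?case using elim by linarith
  qed
qed

lemma supcont_uminus: "supcont f \<Longrightarrow> supcont (\<lambda>x. - f x)"
  unfolding supcont_def by (simp add: abs_minus_commute)

text \<open>The lower bound applied to both \<open>f\<close> and its negative gives the
  limit.\<close>

theorem fclt_from_lipschitz:
  fixes \<mu> :: "'e measure" and V :: "nat \<Rightarrow> 'e \<Rightarrow> nat \<Rightarrow> real"
  assumes \<mu>: "prob_space \<mu>" and V: "\<And>n k. (\<lambda>x. V n x k) \<in> borel_measurable \<mu>"
    and lip: "\<And>(M :: (real \<Rightarrow> real) measure) W g L B. wiener01 M W \<Longrightarrow> lip01 L g \<Longrightarrow> (\<And>x. x \<in> D01 \<Longrightarrow> \<bar>g x\<bar> \<le> B) \<Longrightarrow>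
       (\<lambda>n. \<integral>x. g (step01 n (V n x)) \<partial>\<mu>) \<longlonglongrightarrow> (\<integral>w. g (\<lambda>t. sqrt \<sigma>2 * W w t) \<partial>M)"
  shows "fclt \<mu> (\<lambda>n x. step01 n (V n x)) \<sigma>2"
  unfolding fclt_def
proof (intro allI impI)
  fix M :: "(real \<Rightarrow> real) measure" and W f
  assume h: "wiener01 M W \<and> bcont_D01 f"
  then have W: "wiener01 M W" and sc: "supcont f" by (auto intro: bcont_D01_supcont)
  obtain B where B: "\<And>x. x \<in> D01 \<Longrightarrow> \<bar>f x\<bar> \<le> B" using h unfolding bcont_D01_def by blast
  then have B': "\<And>x. x \<in> D01 \<Longrightarrow> \<bar>- f x\<bar> \<le> B" by simp
  have low: "\<forall>\<^sub>F n in sequentially. (\<integral>w. h (\<lambda>t. sqrt \<sigma>2 * W w t) \<partial>M) - e < (\<integral>x. h (step01 n (V n x)) \<partial>\<mu>)"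
    if "supcont h" "\<And>x. x \<in> D01 \<Longrightarrow> \<bar>h x\<bar> \<le> B" "e > 0" for h e
  proof (rule regularization_lower_bound[OF \<mu> V W that(1)])
    show "(\<lambda>n. \<integral>x. g (step01 n (V n x)) \<partial>\<mu>) \<longlonglongrightarrow> (\<integral>w. g (\<lambda>t. sqrt \<sigma>2 * W w t) \<partial>M)"
      if "lip01 L g" "\<And>x. x \<in> D01 \<Longrightarrow> \<bar>g x\<bar> \<le> B'" for g L B'
      by (rule lip[OF W that(1)]) (rule that(2))
  qed (use that in auto)
  show "(\<lambda>n. \<integral>x. f (step01 n (V n x)) \<partial>\<mu>) \<longlonglongrightarrow> (\<integral>w. f (\<lambda>t. sqrt \<sigma>2 * W w t) \<partial>M)"
  proof (rule tendstoI)
    fix e :: real assume e: "e > 0"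
    have "\<forall>\<^sub>F n in sequentially. (\<integral>w. f (\<lambda>t. sqrt \<sigma>2 * W w t) \<partial>M) - e < (\<integral>x. f (step01 n (V n x)) \<partial>\<mu>)"
      by (rule low[OF sc B e])
    moreover have "\<forall>\<^sub>F n in sequentially. (\<integral>w. - f (\<lambda>t. sqrt \<sigma>2 * W w t) \<partial>M) - e < (\<integral>x. - f (step01 n (V n x)) \<partial>\<mu>)"
      by (rule low[OF supcont_uminus[OF sc] B' e])
    ultimately
    show "\<forall>\<^sub>F n in sequentially. dist (\<integral>x. f (step01 n (V n x)) \<partial>\<mu>) (\<integral>w. f (\<lambda>t. sqrt \<sigma>2 * W w t) \<partial>M) < e"
    proof eventually_elim
      case (elim n)
      then show ?case by (auto simp: dist_real_def abs_if)
    qed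
  qed
qed

section \<open>Random walk in random scenery along a fixed path\<close>

definition grid :: "nat \<Rightarrow> nat \<Rightarrow> nat \<Rightarrow> nat" where
  "grid m n b = nat \<lfloor>real n * (real b / real m)\<rfloor>"

definition blk :: "nat \<Rightarrow> nat \<Rightarrow> nat \<Rightarrow> nat set" where
  "blk m n b = {grid m n b..<grid m n (Suc b)}"

lemma grid_0 [simp]: "grid m n 0 = 0" by (simp add: grid_def)

lemma grid_full: "m > 0 \<Longrightarrow> grid m n m = n" by (simp add: grid_def)

lemma grid_mono: "b \<le> b' \<Longrightarrow> grid m n b \<le> grid m n b'"
  unfolding grid_def by (intro nat_mono floor_mono mult_left_mono divide_right_mono) auto

lemma grid_le: "m > 0 \<Longrightarrow> b \<le> m \<Longrightarrow> grid m n b \<le> n"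
  using grid_mono[of b m m n] by (simp add: grid_full)

lemma blk_finite [simp]: "finite (blk m n b)" by (simp add: blk_def)

lemma blk_subset: "m > 0 \<Longrightarrow> b < m \<Longrightarrow> blk m n b \<subseteq> {..<n}"
  using grid_le[of m "Suc b" n] by (auto simp: blk_def)

lemma sum_grid: "(\<Sum>i<grid m n k. f i) = (\<Sum>b<k. \<Sum>i\<in>blk m n b. f i :: 'a::comm_monoid_add)"
proof (induction k)
  case (Suc k)
  have "(\<Sum>i<grid m n (Suc k). f i) = (\<Sum>i<grid m n k. f i) + (\<Sum>i\<in>blk m n k. f i)"
    using sum.atLeastLessThan_concat[of 0 "grid m n k" "grid m n (Suc k)" f] grid_mono[of k "Suc k" m n]
    by (simp add: blk_def lessThan_atLeast0)
  then show ?case using Suc by simp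
qed simp

lemma sum_blocks: "m > 0 \<Longrightarrow> (\<Sum>i<n. f i) = (\<Sum>b<m. \<Sum>i\<in>blk m n b. f i :: 'a::comm_monoid_add)"
  using sum_grid[of f m n m] by (simp add: grid_full)

definition "nrm n = sqrt (real n * ln (real n))"

lemma nrm_sq: "n \<ge> 1 \<Longrightarrow> (nrm n)\<^sup>2 = real n * ln (real n)"
  by (simp add: nrm_def)

lemma nrm_pos: "n \<ge> 2 \<Longrightarrow> nrm n > 0"
  by (simp add: nrm_def)

lemma coll_nonneg: "coll z A B q \<ge> 0"
  by (simp add: coll_def sum_nonneg)

definition "ltime z A l = (\<Sum>i\<in>A. of_bool (z i = l) :: real)"

lemma ltime_nonneg: "ltime z A l \<ge> 0" by (simp add: ltime_def sum_nonneg)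

lemma sum_ltime:
  assumes "finite S" "z ` A \<subseteq> S" "finite A"
  shows "(\<Sum>i\<in>A. f (z i)) = (\<Sum>l\<in>S. ltime z A l * f l)"
proof -
  have "(\<Sum>l\<in>S. ltime z A l * f l) = (\<Sum>i\<in>A. \<Sum>l\<in>S. of_bool (z i = l) * f l)"
    unfolding ltime_def sum_distrib_right by (rule sum.swap)
  also have "\<dots> = (\<Sum>i\<in>A. f (z i))"
  proof (rule sum.cong[OF refl])
    fix i assume "i \<in> A"
    then have "z i \<in> S" using assms by auto
    have "(\<Sum>l\<in>S. of_bool (z i = l) * f l) = (\<Sum>l\<in>S. if z i = l then f l else 0)"
      by (intro sum.cong) auto
    also have "\<dots> = f (z i)" using \<open>z i \<in> S\<close> assms(1) by simp
    finally show "(\<Sum>l\<in>S. of_bool (z i = l) * f l) = f (z i)" .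
  qed
  finally show ?thesis by simp
qed

text \<open>Collisions as an inner product of occupation counts, which is the form needed to assign
  sites to blocks.\<close>

lemma coll_ltime:
  assumes "finite S" "z ` A \<subseteq> S" "finite A"
  shows "coll z A B 0 = (\<Sum>l\<in>S. ltime z A l * ltime z B l)"
proof -
  have "coll z A B 0 = (\<Sum>i\<in>A. ltime z B (z i))"
    unfolding coll_def ltime_def by simp
  then show ?thesis using sum_ltime[OF assms, of "\<lambda>l. ltime z B l"] by simp
qed

lemma ltime_mult_le_coll:
  assumes "finite A" "finite B"
  shows "ltime z A l * ltime z B l \<le> coll z A B 0"
proof -
  have "ltime z A l * ltime z B l \<le> (\<Sum>l\<in>insert l (z ` A). ltime z A l * ltime z B l)"
    by (rule member_le_sum) (use assms in \<open>auto intro!: mult_nonneg_nonneg ltime_nonneg\<close>)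
  also have "\<dots> = coll z A B 0"
    by (rule coll_ltime[symmetric]) (use assms in auto)
  finally show ?thesis .
qed

text \<open>From here on the path \<open>z\<close> is deterministic; the two assumptions are all
  that is retained of the walk, and \<open>C\<close> takes the value \<open>2 * gc\<close> for
  it.\<close>

locale rwrs = scenery \<mu> X for \<mu> :: "'e measure" and X +
  fixes z :: "nat \<Rightarrow> int \<times> int" and C :: real
  assumes C_pos: "C > 0"
    and blk_limit: "\<And>m b. m > 0 \<Longrightarrow> (\<lambda>n. coll z (blk m n b) (blk m n b) 0 / (real n * ln (real n))) \<longlonglongrightarrow> C / real m"
    and shift_lower: "\<And>q e. e > 0 \<Longrightarrow> \<forall>\<^sub>F n in sequentially. (C - e) * (real n * ln (real n)) \<le> coll z {..<n} {..<n} q"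
begin

definition "ws A x = (\<Sum>i\<in>A. X (z i) x)"

lemma ws_meas [measurable]: "ws A \<in> borel_measurable \<mu>"
  unfolding ws_def by measurable

lemma full_limit: "(\<lambda>n. coll z {..<n} {..<n} 0 / (real n * ln (real n))) \<longlonglongrightarrow> C"
  using blk_limit[of 1 0] by (simp add: blk_def grid_def lessThan_atLeast0)

lemma coll_blocks:
  assumes "m > 0"
  shows "coll z {..<n} {..<n} 0 = (\<Sum>b<m. \<Sum>b'<m. coll z (blk m n b) (blk m n b') 0)"
proof -
  have "coll z {..<n} {..<n} 0 = (\<Sum>b<m. \<Sum>i\<in>blk m n b. \<Sum>b'<m. \<Sum>j\<in>blk m n b'. of_bool (z j - z i = 0))"
    unfolding coll_def sum_blocks[OF assms, where n=n] ..
  also have "\<dots> = (\<Sum>b<m. \<Sum>b'<m. coll z (blk m n b) (blk m n b') 0)"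
    unfolding coll_def by (intro sum.cong refl sum.swap)
  finally show ?thesis .
qed

text \<open>The \<open>m\<close> diagonal blocks already account for \<open>m * (C / m) = C\<close>,
  the constant of the entire count, so collisions between different blocks are of smaller
  order.\<close>

lemma cross_sum_limit:
  assumes m: "m > 0"
  shows "(\<lambda>n. (\<Sum>b<m. \<Sum>b'\<in>{..<m}-{b}. coll z (blk m n b) (blk m n b') 0) / (real n * ln (real n))) \<longlonglongrightarrow> 0"
proof -
  have "(\<lambda>n. coll z {..<n} {..<n} 0 / (real n * ln (real n)) - (\<Sum>b<m. coll z (blk m n b) (blk m n b) 0 / (real n * ln (real n))))
     \<longlonglongrightarrow> C - (\<Sum>b<m. C / real m)"
    by (intro tendsto_diff full_limit tendsto_sum blk_limit m)
  moreover have "(\<Sum>b<m. C / real m) = C" using m by simp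
  moreover have "coll z {..<n} {..<n} 0 / (real n * ln (real n)) - (\<Sum>b<m. coll z (blk m n b) (blk m n b) 0 / (real n * ln (real n)))
    = (\<Sum>b<m. \<Sum>b'\<in>{..<m}-{b}. coll z (blk m n b) (blk m n b') 0) / (real n * ln (real n))" for n
  proof -
    have "(\<Sum>b'<m. coll z (blk m n b) (blk m n b') 0) = coll z (blk m n b) (blk m n b) 0 + (\<Sum>b'\<in>{..<m}-{b}. coll z (blk m n b) (blk m n b') 0)"
      if "b < m" for b
      using that by (subst sum.remove[of _ b]) auto
    then have "coll z {..<n} {..<n} 0 = (\<Sum>b<m. coll z (blk m n b) (blk m n b) 0) + (\<Sum>b<m. \<Sum>b'\<in>{..<m}-{b}. coll z (blk m n b) (blk m n b') 0)"
      unfolding coll_blocks[OF m] by (simp add: sum.distrib)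
    then show ?thesis by (simp add: sum_divide_distrib[symmetric] diff_divide_distrib[symmetric])
  qed
  ultimately show ?thesis by simp
qed

lemma row_le_cross:
  assumes "b < m"
  shows "(\<Sum>b'\<in>{..<m}-{b}. coll z (blk m n b) (blk m n b') 0) \<le> (\<Sum>b<m. \<Sum>b'\<in>{..<m}-{b}. coll z (blk m n b) (blk m n b') 0)"
  using assms by (intro member_le_sum[of b "{..<m}" "\<lambda>b. \<Sum>b'\<in>{..<m}-{b}. coll z (blk m n b) (blk m n b') 0"]) (auto intro!: sum_nonneg coll_nonneg)

text \<open>A site visited too often would create too many collisions. Within a block the square of
  the occupation count is at most about \<open>C / m\<close>; products over different blocks are
  cross collisions, and so are the squares outside the busiest block, since they are dominated by
  the product with the busiest count.\<close>

lemma small_ltime: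
  assumes e: "e > 0"
  shows "\<forall>\<^sub>F n in sequentially. \<forall>l. ltime z {..<n} l \<le> e * nrm n"
proof -
  \<comment> \<open>The squared count is bounded by \<open>4 * C / m\<close>: at most
    \<open>2 * C / m\<close> from the busiest block and twice \<open>C / m\<close> from cross
    collisions.\<close>
  obtain m :: nat where m0: "real m > 4 * C / e\<^sup>2" using reals_Archimedean2 by blast
  have "4 * C / e\<^sup>2 > 0" using C_pos e by simp
  then have mp: "real m > 0" using m0 by linarith
  have "e\<^sup>2 > 0" using e by simp
  then have "4 * C < real m * e\<^sup>2" using m0 by (simp add: pos_divide_less_eq)
  then have m: "m > 0" "4 * C / real m \<le> e\<^sup>2"
    using mp by (simp_all add: pos_divide_le_eq mult.commute)
  let ?X = "\<lambda>n. real n * ln (real n)"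
  let ?O = "\<lambda>n. \<Sum>b<m. \<Sum>b'\<in>{..<m}-{b}. coll z (blk m n b) (blk m n b') 0"
  have d: "C / real m > 0" using C_pos m by simp
  have "\<forall>\<^sub>F n in sequentially. \<forall>b\<in>{..<m}. coll z (blk m n b) (blk m n b) 0 / ?X n < 2 * (C / real m)"
    by (rule eventually_ball_finite) (use d in \<open>auto intro!: order_tendstoD(2)[OF blk_limit] m\<close>)
  moreover have "\<forall>\<^sub>F n in sequentially. ?O n / ?X n < C / real m"
    by (rule order_tendstoD(2)[OF cross_sum_limit[OF m(1)] d])
  ultimately show ?thesis using eventually_ge_at_top[of 2]
  proof eventually_elim
    case (elim n)
    have X: "?X n > 0" using elim by (intro mult_pos_pos) auto
    have diag: "coll z (blk m n b) (blk m n b) 0 \<le> 2 * (C / real m) * ?X n" if "b < m" for b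
      using elim(1) that X by (auto simp: pos_divide_less_eq intro: less_imp_le)
    have cross: "?O n \<le> C / real m * ?X n" using elim(2) X by (simp add: pos_divide_less_eq)
    show ?case
    proof
      fix l
      let ?t = "\<lambda>b. ltime z (blk m n b) l"
      have "Max (?t ` {..<m}) \<in> ?t ` {..<m}" using m by (intro Max_in) auto
      then obtain s where s': "Max (?t ` {..<m}) = ?t s" "s \<in> {..<m}" by (rule imageE)
  note s = s'(2) s'(1)
      have smax: "?t b \<le> ?t s" if "b < m" for b unfolding s(2)[symmetric] using that by (intro Max_ge) auto
      have eq: "ltime z {..<n} l = (\<Sum>b<m. ?t b)"
        unfolding ltime_def by (rule sum_blocks[OF m(1)])
      have le: "?t b * ?t b' \<le> coll z (blk m n b) (blk m n b') 0" for b b'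
        by (rule ltime_mult_le_coll) auto
      have "(ltime z {..<n} l)\<^sup>2 = (\<Sum>b<m. \<Sum>b'<m. ?t b * ?t b')"
        unfolding eq power2_eq_square sum_product ..
      also have "\<dots> = (\<Sum>b<m. ?t b * ?t b + (\<Sum>b'\<in>{..<m}-{b}. ?t b * ?t b'))"
        by (intro sum.cong refl sum.remove) auto
      also have "\<dots> = (\<Sum>b<m. ?t b * ?t b) + (\<Sum>b<m. \<Sum>b'\<in>{..<m}-{b}. ?t b * ?t b')"
        by (rule sum.distrib)
      also have "(\<Sum>b<m. ?t b * ?t b) = ?t s * ?t s + (\<Sum>b\<in>{..<m}-{s}. ?t b * ?t b)"
        using s(1) by (intro sum.remove) auto
      also have "(\<Sum>b\<in>{..<m}-{s}. ?t b * ?t b) \<le> (\<Sum>b\<in>{..<m}-{s}. coll z (blk m n s) (blk m n b) 0)"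
      proof (intro sum_mono)
        fix b assume "b \<in> {..<m}-{s}"
        then have "?t b * ?t b \<le> ?t s * ?t b" using smax[of b] by (intro mult_right_mono ltime_nonneg) auto
        then show "?t b * ?t b \<le> coll z (blk m n s) (blk m n b) 0" using le[of s b] by linarith
      qed
      also have "(\<Sum>b\<in>{..<m}-{s}. coll z (blk m n s) (blk m n b) 0) \<le> ?O n"
        using s(1) by (intro row_le_cross) auto
      also have "?t s * ?t s \<le> coll z (blk m n s) (blk m n s) 0" by (rule le)
      also have "coll z (blk m n s) (blk m n s) 0 \<le> 2 * (C / real m) * ?X n" using s(1) by (intro diag) auto
      also have "(\<Sum>b<m. \<Sum>b'\<in>{..<m}-{b}. ?t b * ?t b') \<le> ?O n"
        by (intro sum_mono le)
      finally have "(ltime z {..<n} l)\<^sup>2 \<le> 2 * (C / real m) * ?X n + ?O n + ?O n" by simp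
      also have "\<dots> \<le> (4 * C / real m) * ?X n"
      proof -
        have h: "2 * (C / real m) * ?X n = 2 * (C / real m * ?X n)" "(4 * C / real m) * ?X n = 4 * (C / real m * ?X n)"
          by simp_all
        have "s = 2 * r \<Longrightarrow> t = 4 * r \<Longrightarrow> y \<le> r \<Longrightarrow> s + y + y \<le> t" for s t y r :: real by linarith
        from this[OF h cross] show ?thesis .
      qed
      also have "\<dots> \<le> e\<^sup>2 * ?X n" using X by (intro mult_right_mono m(2)) auto
      also have "\<dots> = (e * nrm n)\<^sup>2" using elim by (simp add: power_mult_distrib nrm_sq)
      finally show "ltime z {..<n} l \<le> e * nrm n"
        by (rule power2_le_imp_le) (use e nrm_pos[of n] elim in auto)
    qed
  qed
qed

lemma expectation_ws_mult: "expectation (\<lambda>x. ws A x * ws B x) = coll z A B 0"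
proof -
  have "expectation (\<lambda>x. ws A x * ws B x) = expectation (\<lambda>x. \<Sum>i\<in>A. \<Sum>j\<in>B. X (z i) x * X (z j) x)"
    by (simp add: ws_def sum_product)
  also have "\<dots> = (\<Sum>i\<in>A. \<Sum>j\<in>B. expectation (\<lambda>x. X (z i) x * X (z j) x))"
    by (simp add: Bochner_Integration.integral_sum Bochner_Integration.integrable_sum X_mult_int)
  also have "\<dots> = coll z A B 0"
    unfolding coll_def X_orthonormal by (intro sum.cong refl) auto
  finally show ?thesis .
qed

definition "sites n = z ` {..<n}"

lemma sites_finite [simp]: "finite (sites n)" by (simp add: sites_def)

lemma ltime_mono: "A \<subseteq> B \<Longrightarrow> finite B \<Longrightarrow> ltime z A l \<le> ltime z B l"
  unfolding ltime_def by (intro sum_mono2) auto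

lemma blk_image: "m > 0 \<Longrightarrow> b < m \<Longrightarrow> z ` blk m n b \<subseteq> sites n"
  using blk_subset[of m b n] by (auto simp: sites_def)

lemma ws_blk_weighted:
  assumes "m > 0" "b < m"
  shows "ws (blk m n b) x = (\<Sum>l\<in>sites n. ltime z (blk m n b) l * X l x)"
  unfolding ws_def by (rule sum_ltime[where z = z and f = "\<lambda>l. X l x"]) (use blk_image[OF assms] in auto)

text \<open>The site \<open>l\<close> is assigned to the block in which it is visited most often. Blocks then use
  disjoint sets of sites, at the price of an error bounded by the collisions between blocks.\<close>

definition "own m n l = (SOME b. b < m \<and> (\<forall>b'<m. ltime z (blk m n b') l \<le> ltime z (blk m n b) l))"

lemma own:
  assumes "m > 0"
  shows "own m n l < m" "b < m \<Longrightarrow> ltime z (blk m n b) l \<le> ltime z (blk m n (own m n l)) l"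
proof -
  let ?t = "\<lambda>b. ltime z (blk m n b) l"
  have "Max (?t ` {..<m}) \<in> ?t ` {..<m}" using assms by (intro Max_in) auto
  then obtain s where s': "Max (?t ` {..<m}) = ?t s" "s \<in> {..<m}" by (rule imageE)
  note s = s'(2) s'(1)
  have "s < m \<and> (\<forall>b'<m. ?t b' \<le> ?t s)" unfolding s(2)[symmetric] using s(1) by (auto intro!: Max_ge)
  then have "own m n l < m \<and> (\<forall>b'<m. ?t b' \<le> ?t (own m n l))" unfolding own_def by (rule someI)
  then show "own m n l < m" "b < m \<Longrightarrow> ?t b \<le> ?t (own m n l)" by auto
qed

definition "own_sites m n b = {l \<in> sites n. own m n l = b}"

definition "own_sum m n b x = (\<Sum>l\<in>own_sites m n b. ltime z (blk m n b) l * X l x)"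

lemma own_sites_finite [simp]: "finite (own_sites m n b)" by (simp add: own_sites_def)

lemma own_sum_meas [measurable]: "own_sum m n b \<in> borel_measurable \<mu>"
  unfolding own_sum_def by measurable

text \<open>At a site owned by another block, the count of block \<open>b\<close> is at most that of
  the owner, so its square is bounded by a product of counts in two different blocks.\<close>

lemma foreign_sum_le:
  assumes m: "m > 0" "b < m"
  shows "(\<Sum>l\<in>sites n - own_sites m n b. (ltime z (blk m n b) l)\<^sup>2) \<le> (\<Sum>b'\<in>{..<m}-{b}. coll z (blk m n b) (blk m n b') 0)"
proof -
  have "(\<Sum>l\<in>sites n - own_sites m n b. (ltime z (blk m n b) l)\<^sup>2)
    \<le> (\<Sum>l\<in>sites n. \<Sum>b'\<in>{..<m}-{b}. ltime z (blk m n b) l * ltime z (blk m n b') l)"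
  proof (rule order_trans[OF _ sum_mono2])
    show "(\<Sum>l\<in>sites n - own_sites m n b. (ltime z (blk m n b) l)\<^sup>2)
      \<le> (\<Sum>l\<in>sites n - own_sites m n b. \<Sum>b'\<in>{..<m}-{b}. ltime z (blk m n b) l * ltime z (blk m n b') l)"
    proof (intro sum_mono)
      fix l assume "l \<in> sites n - own_sites m n b"
      then have o: "own m n l \<in> {..<m} - {b}" using own(1)[OF m(1)] by (auto simp: own_sites_def)
      have "(ltime z (blk m n b) l)\<^sup>2 \<le> ltime z (blk m n b) l * ltime z (blk m n (own m n l)) l"
        unfolding power2_eq_square using own(2)[OF m] by (intro mult_left_mono ltime_nonneg) auto
      also have "\<dots> \<le> (\<Sum>b'\<in>{..<m}-{b}. ltime z (blk m n b) l * ltime z (blk m n b') l)"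
        by (rule member_le_sum[OF o]) (auto intro!: mult_nonneg_nonneg ltime_nonneg)
      finally show "(ltime z (blk m n b) l)\<^sup>2 \<le> (\<Sum>b'\<in>{..<m}-{b}. ltime z (blk m n b) l * ltime z (blk m n b') l)" .
    qed
  qed (auto intro!: sum_nonneg mult_nonneg_nonneg ltime_nonneg)
  also have "\<dots> = (\<Sum>b'\<in>{..<m}-{b}. \<Sum>l\<in>sites n. ltime z (blk m n b) l * ltime z (blk m n b') l)"
    by (rule sum.swap)
  also have "\<dots> = (\<Sum>b'\<in>{..<m}-{b}. coll z (blk m n b) (blk m n b') 0)"
    by (intro sum.cong refl coll_ltime[symmetric] blk_image m) auto
  finally show ?thesis .
qed

lemma foreign_limit:
  assumes m: "m > 0" "b < m"
  shows "(\<lambda>n. (\<Sum>l\<in>sites n - own_sites m n b. (ltime z (blk m n b) l)\<^sup>2) / (real n * ln (real n))) \<longlonglongrightarrow> 0"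
proof (rule tendsto_sandwich[OF _ _ tendsto_const cross_sum_limit[OF m(1)]])
  show "\<forall>\<^sub>F n in sequentially. 0 \<le> (\<Sum>l\<in>sites n - own_sites m n b. (ltime z (blk m n b) l)\<^sup>2) / (real n * ln (real n))"
    using eventually_ge_at_top[of 1] by eventually_elim (auto intro!: divide_nonneg_nonneg sum_nonneg)
  show "\<forall>\<^sub>F n in sequentially. (\<Sum>l\<in>sites n - own_sites m n b. (ltime z (blk m n b) l)\<^sup>2) / (real n * ln (real n))
    \<le> (\<Sum>b<m. \<Sum>b'\<in>{..<m}-{b}. coll z (blk m n b) (blk m n b') 0) / (real n * ln (real n))"
    using eventually_ge_at_top[of 1]
    by eventually_elim (auto intro!: divide_right_mono order_trans[OF foreign_sum_le[OF m] row_le_cross[OF m(2)]])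
qed

lemma expectation_weighted_sq:
  assumes "finite S"
  shows "expectation (\<lambda>x. (\<Sum>l\<in>S. c l * X l x)\<^sup>2) = (\<Sum>l\<in>S. (c l)\<^sup>2)"
    and "integrable \<mu> (\<lambda>x. (\<Sum>l\<in>S. c l * X l x)\<^sup>2)"
proof -
  have eq: "(\<Sum>l\<in>S. c l * X l x)\<^sup>2 = (\<Sum>l\<in>S. \<Sum>l'\<in>S. (c l * c l') * (X l x * X l' x))" for x
    unfolding power2_eq_square sum_product by (intro sum.cong refl) (simp add: mult_ac)
  have int: "integrable \<mu> (\<lambda>x. (c l * c l') * (X l x * X l' x))" for l l'
    by (intro integrable_mult_right X_mult_int)
  show "integrable \<mu> (\<lambda>x. (\<Sum>l\<in>S. c l * X l x)\<^sup>2)"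
    unfolding eq by (intro Bochner_Integration.integrable_sum int)
  have "expectation (\<lambda>x. (\<Sum>l\<in>S. c l * X l x)\<^sup>2) = (\<Sum>l\<in>S. \<Sum>l'\<in>S. expectation (\<lambda>x. (c l * c l') * (X l x * X l' x)))"
    unfolding eq
    by (subst Bochner_Integration.integral_sum, intro Bochner_Integration.integrable_sum int)
      (intro sum.cong refl Bochner_Integration.integral_sum int)
  also have "\<dots> = (\<Sum>l\<in>S. \<Sum>l'\<in>S. if l = l' then c l * c l' else 0)"
    by (intro sum.cong refl) (auto simp: X_orthonormal)
  also have "\<dots> = (\<Sum>l\<in>S. (c l)\<^sup>2)" using assms by (simp add: power2_eq_square)
  finally show "expectation (\<lambda>x. (\<Sum>l\<in>S. c l * X l x)\<^sup>2) = (\<Sum>l\<in>S. (c l)\<^sup>2)" .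
qed

lemma own_sum_error:
  assumes m: "m > 0" "b < m"
  shows "expectation (\<lambda>x. (ws (blk m n b) x - own_sum m n b x)\<^sup>2) = (\<Sum>l\<in>sites n - own_sites m n b. (ltime z (blk m n b) l)\<^sup>2)"
    and "integrable \<mu> (\<lambda>x. (ws (blk m n b) x - own_sum m n b x)\<^sup>2)"
proof -
  have eq: "ws (blk m n b) x - own_sum m n b x = (\<Sum>l\<in>sites n - own_sites m n b. ltime z (blk m n b) l * X l x)" for x
    unfolding ws_blk_weighted[OF m] own_sum_def by (subst sum_diff) (auto simp: own_sites_def)
  show "expectation (\<lambda>x. (ws (blk m n b) x - own_sum m n b x)\<^sup>2) = (\<Sum>l\<in>sites n - own_sites m n b. (ltime z (blk m n b) l)\<^sup>2)"
    unfolding eq by (rule expectation_weighted_sq) simp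
  show "integrable \<mu> (\<lambda>x. (ws (blk m n b) x - own_sum m n b x)\<^sup>2)"
    unfolding eq by (rule expectation_weighted_sq) simp
qed

lemma small_weights:
  assumes m: "m > 0" "b < m" and e: "e > 0"
  shows "\<forall>\<^sub>F n in sequentially. \<forall>l. \<bar>a * ltime z (blk m n b) l / nrm n\<bar> \<le> e"
proof -
  have "e / (\<bar>a\<bar> + 1) > 0" using e by (simp add: add_nonneg_pos)
  from small_ltime[OF this] show ?thesis using eventually_ge_at_top[of 2]
  proof eventually_elim
    case (elim n)
    have p: "nrm n > 0" using elim by (intro nrm_pos) auto
    show ?case
    proof
      fix l
      have "ltime z (blk m n b) l \<le> ltime z {..<n} l" by (rule ltime_mono[OF blk_subset[OF m]]) simp
      also have "\<dots> \<le> e / (\<bar>a\<bar> + 1) * nrm n" using elim(1) by (rule spec)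
      finally have "ltime z (blk m n b) l / nrm n \<le> e / (\<bar>a\<bar> + 1)" unfolding pos_divide_le_eq[OF p] .
      then have "\<bar>a\<bar> * (ltime z (blk m n b) l / nrm n) \<le> (\<bar>a\<bar> + 1) * (e / (\<bar>a\<bar> + 1))"
        using p ltime_nonneg[of z "blk m n b" l] by (intro mult_mono) auto
      also have "\<dots> = e" by (simp add: add_nonneg_eq_0_iff)
      finally show "\<bar>a * ltime z (blk m n b) l / nrm n\<bar> \<le> e"
        using p ltime_nonneg[of z "blk m n b" l] by (simp add: abs_mult)
    qed
  qed
qed

lemma weights_sq: "n \<ge> 1 \<Longrightarrow> (\<Sum>l\<in>S. (a * ltime z A l / nrm n)\<^sup>2) = a\<^sup>2 * ((\<Sum>l\<in>S. (ltime z A l)\<^sup>2) / (real n * ln (real n)))"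
  by (simp add: power_divide power_mult_distrib nrm_sq sum_divide_distrib sum_distrib_left)

lemma blk_sq: "m > 0 \<Longrightarrow> b < m \<Longrightarrow> (\<Sum>l\<in>sites n. (ltime z (blk m n b) l)\<^sup>2) = coll z (blk m n b) (blk m n b) 0"
  using coll_ltime[of "sites n" z "blk m n b" "blk m n b"] blk_image[of m b n] by (simp add: power2_eq_square)

lemma ws_blk_clt:
  assumes m: "m > 0" "b < m"
  shows "weak_conv_m (\<lambda>n. distr \<mu> borel (\<lambda>x. a * ws (blk m n b) x / nrm n)) (gauss (a\<^sup>2 * C / real m))"
proof -
  have eq: "a * ws (blk m n b) x / nrm n = (\<Sum>l\<in>sites n. (a * ltime z (blk m n b) l / nrm n) * X l x)" for n x
    unfolding ws_blk_weighted[OF m] by (simp add: sum_distrib_left sum_divide_distrib mult_ac)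
  show ?thesis unfolding eq
  proof (rule weighted_clt)
    show "\<forall>\<^sub>F n in sequentially. \<forall>l\<in>sites n. \<bar>a * ltime z (blk m n b) l / nrm n\<bar> \<le> e" if "e > 0" for e
      using small_weights[OF m that, of a] by eventually_elim auto
    have "(\<lambda>n. a\<^sup>2 * (coll z (blk m n b) (blk m n b) 0 / (real n * ln (real n)))) \<longlonglongrightarrow> a\<^sup>2 * (C / real m)"
      by (intro tendsto_mult_left blk_limit m)
    then have "(\<lambda>n. a\<^sup>2 * (coll z (blk m n b) (blk m n b) 0 / (real n * ln (real n)))) \<longlonglongrightarrow> a\<^sup>2 * C / real m" by simp
    then show "(\<lambda>n. \<Sum>l\<in>sites n. (a * ltime z (blk m n b) l / nrm n)\<^sup>2) \<longlonglongrightarrow> a\<^sup>2 * C / real m"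
      by (rule Lim_transform_eventually, intro eventually_mono[OF eventually_ge_at_top[of 1]]) (simp add: weights_sq blk_sq[OF m])
  qed (use C_pos in auto)
qed

text \<open>The variance of the owned part is the block count minus the foreign part, and the latter
  is negligible by \<open>foreign_limit\<close>.\<close>

lemma own_sum_clt:
  assumes m: "m > 0" "b < m"
  shows "weak_conv_m (\<lambda>n. distr \<mu> borel (\<lambda>x. a * own_sum m n b x / nrm n)) (gauss (a\<^sup>2 * C / real m))"
proof -
  have eq: "a * own_sum m n b x / nrm n = (\<Sum>l\<in>own_sites m n b. (a * ltime z (blk m n b) l / nrm n) * X l x)" for n x
    unfolding own_sum_def by (simp add: sum_distrib_left sum_divide_distrib mult_ac)
  show ?thesis unfolding eq
  proof (rule weighted_clt)
    show "\<forall>\<^sub>F n in sequentially. \<forall>l\<in>own_sites m n b. \<bar>a * ltime z (blk m n b) l / nrm n\<bar> \<le> e" if "e > 0" for e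
      using small_weights[OF m that, of a] by eventually_elim auto
    have "(\<lambda>n. a\<^sup>2 * (coll z (blk m n b) (blk m n b) 0 / (real n * ln (real n)) - (\<Sum>l\<in>sites n - own_sites m n b. (ltime z (blk m n b) l)\<^sup>2) / (real n * ln (real n))))
       \<longlonglongrightarrow> a\<^sup>2 * (C / real m - 0)"
      by (intro tendsto_mult_left tendsto_diff blk_limit foreign_limit m)
    then have lim: "(\<lambda>n. a\<^sup>2 * (coll z (blk m n b) (blk m n b) 0 / (real n * ln (real n)) - (\<Sum>l\<in>sites n - own_sites m n b. (ltime z (blk m n b) l)\<^sup>2) / (real n * ln (real n))))
       \<longlonglongrightarrow> a\<^sup>2 * C / real m" by simp
    have split: "(\<Sum>l\<in>own_sites m n b. (ltime z (blk m n b) l)\<^sup>2) = coll z (blk m n b) (blk m n b) 0 - (\<Sum>l\<in>sites n - own_sites m n b. (ltime z (blk m n b) l)\<^sup>2)" for n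
      unfolding blk_sq[OF m, symmetric] by (subst sum_diff) (auto simp: own_sites_def)
    show "(\<lambda>n. \<Sum>l\<in>own_sites m n b. (a * ltime z (blk m n b) l / nrm n)\<^sup>2) \<longlonglongrightarrow> a\<^sup>2 * C / real m"
      by (rule Lim_transform_eventually[OF lim], intro eventually_mono[OF eventually_ge_at_top[of 1]]) (simp add: weights_sq split diff_divide_distrib)
  qed (use C_pos in auto)
qed

lemma own_sum_indep: "indep_vars (\<lambda>_. borel) (\<lambda>b x. a * own_sum m n b x / nrm n) {..<m}"
proof -
  have "indep_vars (\<lambda>b. PiM (own_sites m n b) (\<lambda>_. borel)) (\<lambda>b \<omega>. restrict (\<lambda>l. X l \<omega>) (own_sites m n b)) {..<m}"
    by (rule indep_vars_restrict[OF X_indep]) (auto simp: disjoint_family_on_def own_sites_def)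
  then have "indep_vars (\<lambda>_. borel) (\<lambda>b \<omega>. (\<lambda>v. a * (\<Sum>l\<in>own_sites m n b. ltime z (blk m n b) l * v l) / nrm n) (restrict (\<lambda>l. X l \<omega>) (own_sites m n b))) {..<m}"
    by (rule indep_vars_compose2) (intro borel_measurable_divide borel_measurable_times borel_measurable_sum borel_measurable_const measurable_component_singleton)
  then show ?thesis by (simp add: own_sum_def)
qed

text \<open>Convergence is shown for the owned sums, which are independent across blocks. Returning
  to the true block sums costs at most \<open>L\<close> times the first moments of the differences,
  which are controlled by cross collisions.\<close>

theorem increments_converge:
  fixes M :: "'w measure" and W :: "nat \<Rightarrow> 'w \<Rightarrow> real" and H :: "(nat \<Rightarrow> real) \<Rightarrow> real"
  assumes M: "prob_space M" and m: "m > 0"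
    and W: "prob_space.indep_vars M (\<lambda>_. borel) W {..<m}" and dW: "\<And>b. b < m \<Longrightarrow> distr M borel (W b) = gauss (a\<^sup>2 * C / real m)"
    and H: "\<And>v. \<bar>H v\<bar> \<le> B" "\<And>u v. \<bar>H u - H v\<bar> \<le> L * (\<Sum>b<m. \<bar>u b - v b\<bar>)" "L \<ge> 0"
  shows "(\<lambda>n. \<integral>x. H (\<lambda>b. a * ws (blk m n b) x / nrm n) \<partial>\<mu>) \<longlonglongrightarrow> (\<integral>w. H (\<lambda>b. W b w) \<partial>M)"
proof -
  have cont: "continuous_on UNIV H" by (rule continuous_on_coordinatewise_lipschitz[where L = L and m = m]) (rule H(2))
  have [measurable]: "H \<in> borel_measurable borel" using cont by (rule borel_measurable_continuous_onI)
  \<comment> \<open>The Lipschitz bound sees the first \<open>m\<close> coordinates only, so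
    \<open>H\<close> ignores the others.\<close>
  have trunc: "H (trunc_fun m v) = H v" for v
  proof -
    have "(\<Sum>b<m. \<bar>trunc_fun m v b - v b\<bar>) = 0" by (simp add: trunc_fun_def)
    then have "\<bar>H (trunc_fun m v) - H v\<bar> \<le> 0" using H(2)[of "trunc_fun m v" v] by simp
    then show ?thesis by simp
  qed
  have "(\<lambda>n. \<integral>x. H (trunc_fun m (\<lambda>b. a * own_sum m n b x / nrm n)) \<partial>\<mu>) \<longlonglongrightarrow> (\<integral>w. H (trunc_fun m (\<lambda>b. W b w)) \<partial>M)"
  proof (rule product_weak_convergence[where D = "\<lambda>n b x. a * own_sum m n b x / nrm n" and B = B])
    show "weak_conv_m (\<lambda>n. distr \<mu> borel (\<lambda>x. a * own_sum m n b x / nrm n)) (distr M borel (W b))" if "b < m" for b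
      unfolding dW[OF that] by (rule own_sum_clt[OF m that])
  qed (use prob_space_axioms M m own_sum_indep W cont H(1) in simp_all)
  then have lim: "(\<lambda>n. \<integral>x. H (\<lambda>b. a * own_sum m n b x / nrm n) \<partial>\<mu>) \<longlonglongrightarrow> (\<integral>w. H (\<lambda>b. W b w) \<partial>M)"
    by (simp only: trunc)
  have Hm: "(\<lambda>x. H (\<lambda>b. f b x)) \<in> borel_measurable \<mu>" if "\<And>b. f b \<in> borel_measurable \<mu>" for f
    
  proof -
    have "(\<lambda>x b. f b x) \<in> \<mu> \<rightarrow>\<^sub>M borel" by (rule measurable_coordinatewise_then_product) (rule that)
    from measurable_compose[OF this \<open>H \<in> borel_measurable borel\<close>] show ?thesis .
  qed
  have small: "(\<lambda>n. \<integral>x. \<bar>a * ws (blk m n b) x / nrm n - a * own_sum m n b x / nrm n\<bar> \<partial>\<mu>) \<longlonglongrightarrow> 0" if b: "b < m" for b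
  proof -
    let ?F = "\<lambda>n. (\<Sum>l\<in>sites n - own_sites m n b. (ltime z (blk m n b) l)\<^sup>2) / (real n * ln (real n))"
    have "(\<lambda>n. \<bar>a\<bar> * sqrt (?F n)) \<longlonglongrightarrow> \<bar>a\<bar> * sqrt 0"
      by (rule tendsto_mult_left[OF tendsto_real_sqrt[OF foreign_limit[OF m b]]])
    then have F0: "(\<lambda>n. \<bar>a\<bar> * sqrt (?F n)) \<longlonglongrightarrow> 0" by simp
    show ?thesis
    proof (rule tendsto_sandwich[OF _ _ tendsto_const F0])
      show "\<forall>\<^sub>F n in sequentially. (\<integral>x. \<bar>a * ws (blk m n b) x / nrm n - a * own_sum m n b x / nrm n\<bar> \<partial>\<mu>) \<le> \<bar>a\<bar> * sqrt (?F n)"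
        using eventually_ge_at_top[of 2]
      proof eventually_elim
        case (elim n)
        let ?D = "\<lambda>x. ws (blk m n b) x - own_sum m n b x"
        have p: "nrm n > 0" using elim by (rule nrm_pos)
        have D1: "integrable \<mu> ?D" by (rule square_integrable_imp_integrable[OF _ own_sum_error(2)[OF m b]]) simp
        have "(expectation (\<lambda>x. \<bar>?D x\<bar>))\<^sup>2 \<le> expectation (\<lambda>x. \<bar>?D x\<bar>\<^sup>2)"
        proof -
          have "0 \<le> variance (\<lambda>x. \<bar>?D x\<bar>)" by (rule variance_positive)
          also have "\<dots> = expectation (\<lambda>x. \<bar>?D x\<bar>\<^sup>2) - (expectation (\<lambda>x. \<bar>?D x\<bar>))\<^sup>2"
            using D1 own_sum_error(2)[OF m b] by (intro variance_eq) auto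
          finally show ?thesis by simp
        qed
        then have "expectation (\<lambda>x. \<bar>?D x\<bar>) \<le> sqrt (\<Sum>l\<in>sites n - own_sites m n b. (ltime z (blk m n b) l)\<^sup>2)"
          using own_sum_error(1)[OF m b, of n] by (intro real_le_rsqrt) simp
        then have "\<bar>a\<bar> / nrm n * expectation (\<lambda>x. \<bar>?D x\<bar>) \<le> \<bar>a\<bar> / nrm n * sqrt (\<Sum>l\<in>sites n - own_sites m n b. (ltime z (blk m n b) l)\<^sup>2)"
          using p by (intro mult_left_mono) auto
        moreover have "\<bar>a * ws (blk m n b) x / nrm n - a * own_sum m n b x / nrm n\<bar> = \<bar>a\<bar> / nrm n * \<bar>?D x\<bar>" for x
        proof -
          have "a * ws (blk m n b) x / nrm n - a * own_sum m n b x / nrm n = a / nrm n * ?D x"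
            by (simp add: right_diff_distrib diff_divide_distrib)
          then show ?thesis using p by (simp add: abs_mult)
        qed
        moreover have "\<bar>a\<bar> * sqrt (?F n) = \<bar>a\<bar> / nrm n * sqrt (\<Sum>l\<in>sites n - own_sites m n b. (ltime z (blk m n b) l)\<^sup>2)"
          by (simp add: real_sqrt_divide nrm_def)
        ultimately show ?case by simp
      qed
    qed (auto intro!: always_eventually)
  qed
  have diff: "(\<lambda>n. (\<integral>x. H (\<lambda>b. a * ws (blk m n b) x / nrm n) \<partial>\<mu>) - (\<integral>x. H (\<lambda>b. a * own_sum m n b x / nrm n) \<partial>\<mu>)) \<longlonglongrightarrow> 0"
  proof (rule Lim_null_comparison)
    have "(\<lambda>n. L * (\<Sum>b<m. \<integral>x. \<bar>a * ws (blk m n b) x / nrm n - a * own_sum m n b x / nrm n\<bar> \<partial>\<mu>)) \<longlonglongrightarrow> L * (\<Sum>b<m. 0)"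
      by (intro tendsto_mult_left tendsto_sum small) simp
    then show "(\<lambda>n. L * (\<Sum>b<m. \<integral>x. \<bar>a * ws (blk m n b) x / nrm n - a * own_sum m n b x / nrm n\<bar> \<partial>\<mu>)) \<longlonglongrightarrow> 0" by simp
    show "\<forall>\<^sub>F n in sequentially. norm ((\<integral>x. H (\<lambda>b. a * ws (blk m n b) x / nrm n) \<partial>\<mu>) - (\<integral>x. H (\<lambda>b. a * own_sum m n b x / nrm n) \<partial>\<mu>))
      \<le> L * (\<Sum>b<m. \<integral>x. \<bar>a * ws (blk m n b) x / nrm n - a * own_sum m n b x / nrm n\<bar> \<partial>\<mu>)"
    proof (rule always_eventually, intro allI)
      fix n
      have iD: "integrable \<mu> (\<lambda>x. \<bar>a * ws (blk m n b) x / nrm n - a * own_sum m n b x / nrm n\<bar>)" if "b < m" for b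
      proof -
        have "integrable \<mu> (\<lambda>x. a / nrm n * (ws (blk m n b) x - own_sum m n b x))"
          by (intro integrable_mult_right square_integrable_imp_integrable[OF _ own_sum_error(2)[OF m that]]) simp
        then show ?thesis by (intro integrable_abs) (simp add: right_diff_distrib diff_divide_distrib)
      qed
      have iH: "integrable \<mu> (\<lambda>x. H (\<lambda>b. a * ws (blk m n b) x / nrm n))" "integrable \<mu> (\<lambda>x. H (\<lambda>b. a * own_sum m n b x / nrm n))"
        using H(1) by (auto intro!: integrable_const_bound[where B = B] Hm)
      have "norm ((\<integral>x. H (\<lambda>b. a * ws (blk m n b) x / nrm n) \<partial>\<mu>) - (\<integral>x. H (\<lambda>b. a * own_sum m n b x / nrm n) \<partial>\<mu>))
        \<le> (\<integral>x. norm (H (\<lambda>b. a * ws (blk m n b) x / nrm n) - H (\<lambda>b. a * own_sum m n b x / nrm n)) \<partial>\<mu>)"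
        unfolding Bochner_Integration.integral_diff[OF iH, symmetric] by (rule integral_norm_bound)
      also have "\<dots> \<le> (\<integral>x. L * (\<Sum>b<m. \<bar>a * ws (blk m n b) x / nrm n - a * own_sum m n b x / nrm n\<bar>) \<partial>\<mu>)"
      proof (rule integral_mono)
        show "integrable \<mu> (\<lambda>x. norm (H (\<lambda>b. a * ws (blk m n b) x / nrm n) - H (\<lambda>b. a * own_sum m n b x / nrm n)))"
          using iH by (intro integrable_norm Bochner_Integration.integrable_diff)
        show "integrable \<mu> (\<lambda>x. L * (\<Sum>b<m. \<bar>a * ws (blk m n b) x / nrm n - a * own_sum m n b x / nrm n\<bar>))"
          by (intro integrable_mult_right Bochner_Integration.integrable_sum iD) auto
        show "norm (H (\<lambda>b. a * ws (blk m n b) x / nrm n) - H (\<lambda>b. a * own_sum m n b x / nrm n))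
          \<le> L * (\<Sum>b<m. \<bar>a * ws (blk m n b) x / nrm n - a * own_sum m n b x / nrm n\<bar>)" for x
          using H(2) by simp
      qed
      also have "\<dots> = L * (\<Sum>b<m. \<integral>x. \<bar>a * ws (blk m n b) x / nrm n - a * own_sum m n b x / nrm n\<bar> \<partial>\<mu>)"
        using iD by (subst integral_mult_right_zero, subst Bochner_Integration.integral_sum) auto
      finally show "norm ((\<integral>x. H (\<lambda>b. a * ws (blk m n b) x / nrm n) \<partial>\<mu>) - (\<integral>x. H (\<lambda>b. a * own_sum m n b x / nrm n) \<partial>\<mu>))
        \<le> L * (\<Sum>b<m. \<integral>x. \<bar>a * ws (blk m n b) x / nrm n - a * own_sum m n b x / nrm n\<bar> \<partial>\<mu>)" .
    qed
  qed
  from tendsto_add[OF diff lim] show ?thesis by simp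
qed

end

section \<open>Oscillation of the sums within a block\<close>

context rwrs
begin

text \<open>The second moment would give a tail of order \<open>1 / m\<close> per block, too much
  for \<open>m\<close> blocks, and the scenery need not have a fourth moment. The Gaussian limit has
  one, equal to \<open>3 * v^2\<close>, and a truncated fourth power transfers the resulting bound;
  4 in place of 3 leaves room for the limit.\<close>

lemma ws_tail:
  assumes m: "m > 0" "b < m" and c: "c > 0"
  shows "\<forall>\<^sub>F n in sequentially. prob {x\<in>space \<mu>. \<bar>ws (blk m n b) x\<bar> \<ge> c * nrm n} \<le> 4 * (C / real m)\<^sup>2 / c ^ 4"
proof -
  \<comment> \<open>Capping at 1 makes the fourth power bounded and continuous, as weak convergence
    requires, while it still dominates the indicator of the tail.\<close>
  define h where "h x = min 1 (x ^ 4 / c ^ 4)" for x :: real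
  have h01: "0 \<le> h x" "h x \<le> 1" for x using c by (auto simp: h_def)
  have h_meas [measurable]: "h \<in> borel_measurable borel" unfolding h_def by measurable
  define v where "v = C / real m"
  have v: "v > 0" using C_pos m by (simp add: v_def)
  interpret G: real_distribution "gauss v" by (rule real_distribution_gauss)
  have clt: "weak_conv_m (\<lambda>n. distr \<mu> borel (\<lambda>x. ws (blk m n b) x / nrm n)) (gauss v)"
    using ws_blk_clt[OF m, of 1] by (simp add: v_def)
  have "(\<lambda>n. \<integral>y. h y \<partial>distr \<mu> borel (\<lambda>x. ws (blk m n b) x / nrm n)) \<longlonglongrightarrow> (\<integral>y. h y \<partial>gauss v)"
  proof (rule weak_conv_imp_integral_bdd_continuous_conv)
    show "real_distribution (distr \<mu> borel (\<lambda>x. ws (blk m n b) x / nrm n))" for n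
      by (rule real_distribution_distr) simp
    show "isCont h y" for y unfolding h_def using c by (intro continuous_intros) auto
    show "norm (h y) \<le> 1" for y using h01[of y] by simp
  qed (use clt real_distribution_gauss in auto)
  then have lim: "(\<lambda>n. expectation (\<lambda>x. h (ws (blk m n b) x / nrm n))) \<longlonglongrightarrow> (\<integral>y. h y \<partial>gauss v)"
    by (simp add: integral_distr)
  have "(\<integral>y. h y \<partial>gauss v) \<le> (\<integral>y. y ^ 4 / c ^ 4 \<partial>gauss v)"
  proof (rule integral_mono)
    show "integrable (gauss v) h" using h01 by (intro G.integrable_const_bound[where B = 1]) auto
    show "integrable (gauss v) (\<lambda>y. y ^ 4 / c ^ 4)" using gauss_fourth_moment(2)[of v] v by simp
    show "h y \<le> y ^ 4 / c ^ 4" for y by (simp add: h_def)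
  qed
  also have "\<dots> = 3 * v\<^sup>2 / c ^ 4" using gauss_fourth_moment(1)[of v] v by simp
  also have "\<dots> < 4 * v\<^sup>2 / c ^ 4" using v c by (intro divide_strict_right_mono) auto
  finally have "\<forall>\<^sub>F n in sequentially. expectation (\<lambda>x. h (ws (blk m n b) x / nrm n)) < 4 * v\<^sup>2 / c ^ 4"
    by (rule order_tendstoD(2)[OF lim])
  then show ?thesis using eventually_ge_at_top[of 2]
  proof eventually_elim
    case (elim n)
    have p: "nrm n > 0" using elim by (intro nrm_pos) auto
    let ?A = "{x\<in>space \<mu>. \<bar>ws (blk m n b) x\<bar> \<ge> c * nrm n}"
    have "prob ?A = expectation (\<lambda>x. indicator ?A x)" by simp
    also have "\<dots> \<le> expectation (\<lambda>x. h (ws (blk m n b) x / nrm n))"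
    proof (rule integral_mono)
      show "integrable \<mu> (\<lambda>x. indicator ?A x :: real)" by (intro integrable_real_indicator) (auto simp: emeasure_eq_measure)
      show "integrable \<mu> (\<lambda>x. h (ws (blk m n b) x / nrm n))" using h01 by (intro integrable_const_bound[where B = 1]) auto
      show "indicator ?A x \<le> h (ws (blk m n b) x / nrm n)" for x
      proof (cases "x \<in> ?A")
        case True
        then have "c \<le> \<bar>ws (blk m n b) x / nrm n\<bar>" using p by (simp add: pos_le_divide_eq)
        then have "c ^ 4 \<le> \<bar>ws (blk m n b) x / nrm n\<bar> ^ 4" using c by (intro power_mono) auto
        also have "\<dots> = (ws (blk m n b) x / nrm n) ^ 4" by (rule power_even_abs) simp
        finally have "1 \<le> (ws (blk m n b) x / nrm n) ^ 4 / c ^ 4" using c by (subst pos_le_divide_eq) auto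
        then show ?thesis using True unfolding h_def by simp
      qed (use h01 in simp)
    qed
    finally show ?case using elim(1) unfolding v_def by linarith
  qed
qed

lemma PS_shift: "PS (\<lambda>i. z (g + i)) k x = ws {..<g + k} x - ws {..<g} x"
proof -
  have "ws {..<g + k} x = ws {..<g} x + (\<Sum>i\<in>{g..<g + k}. X (z i) x)"
    unfolding ws_def using sum.atLeastLessThan_concat[of 0 g "g + k" "\<lambda>i. X (z i) x"] by (simp add: lessThan_atLeast0)
  also have "(\<Sum>i\<in>{g..<g + k}. X (z i) x) = (\<Sum>i<k. X (z (g + i)) x)"
    using sum.shift_bounds_nat_ivl[of "\<lambda>i. X (z i) x" 0 g k] by (simp add: lessThan_atLeast0 add.commute)
  finally show ?thesis by (simp add: PS_def psum_def)
qed

lemma ws_blk_eq: "ws (blk m n b) x = PS (\<lambda>i. z (grid m n b + i)) (grid m n (Suc b) - grid m n b) x"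
proof -
  have "ws {..<grid m n (Suc b)} x = ws {..<grid m n b} x + ws (blk m n b) x"
    unfolding ws_def blk_def
    using sum.atLeastLessThan_concat[of 0 "grid m n b" "grid m n (Suc b)" "\<lambda>i. X (z i) x"] grid_mono[of b "Suc b" m n]
    by (simp add: lessThan_atLeast0)
  then show ?thesis using grid_mono[of b "Suc b" m n] by (simp add: PS_shift)
qed

lemma ws_mult_int: "integrable \<mu> (\<lambda>x. ws A x * ws B x)"
  unfolding ws_def sum_product by (intro Bochner_Integration.integrable_sum X_mult_int)

lemma expectation_ws_sq: "expectation (\<lambda>x. (ws A x)\<^sup>2) = coll z A A 0"
  using expectation_ws_mult[of A A] by (simp add: power2_eq_square)

text \<open>For \<open>M \<ge> 0\<close> and \<open>c, \<delta>, s > 0\<close> one has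
  \<open>M \<le> c + (\<delta> M\<^sup>2 / s + s 1{M \<ge> c} / \<delta>) / 2\<close>; the last two terms have small expectation when \<open>M\<close>
  is the oscillation over one of \<open>m\<close> blocks, even after summing over the blocks.\<close>

lemma modulus:
  assumes e: "e > 0"
  shows "\<exists>m0>0. \<forall>m\<ge>m0. \<forall>\<^sub>F n in sequentially. \<exists>R. integrable \<mu> R \<and> expectation R \<le> 3 * e * nrm n \<and>
    (\<forall>x\<in>space \<mu>. \<forall>b k. b < m \<longrightarrow> grid m n b \<le> k \<longrightarrow> k \<le> grid m n (Suc b) \<longrightarrow> \<bar>ws {..<k} x - ws {..<grid m n b} x\<bar> \<le> R x)"
proof -
  \<comment> \<open>Makes the quadratic terms of the \<open>m\<close> blocks, each at most
    \<open>d / (2 * s) * (4 * (C / m) * s^2)\<close>, add up to \<open>e * s\<close>.\<close>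
  define d where "d = e / (2 * C)"
  have d: "d > 0" using e C_pos by (simp add: d_def)
  \<comment> \<open>The maximal inequality doubles the level.\<close>
  define c where "c = e / 2"
  have c: "c > 0" using e by (simp add: c_def)
  \<comment> \<open>The indicator terms add up to \<open>K / m * s\<close>: \<open>m\<close> blocks,
    the factor \<open>s / (2 * d)\<close>, and the tail bound
    \<open>16 * (C / m)^2 / c^4\<close>.\<close>
  define K where "K = 8 * C\<^sup>2 / (d * c ^ 4)"
  \<comment> \<open>The first bound makes the indicator terms at most \<open>e * s\<close>; the
    second brings the block variance below the threshold of \<open>max_abs_tail\<close>.\<close>
  define m0 where "m0 = Suc (nat \<lceil>max (K / e) (8 * C / c\<^sup>2)\<rceil>)"
  have m0: "m0 > 0" "real m0 \<ge> max (K / e) (8 * C / c\<^sup>2)"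
    unfolding m0_def by (auto simp: le_nat_iff) linarith+
  show ?thesis
  proof (intro exI conjI allI impI)
    show "m0 > 0" by (rule m0)
    fix m assume mm: "m0 \<le> m"
    have m: "m > 0" using m0 mm by simp
    have mr: "real m \<ge> K / e" "real m \<ge> 8 * C / c\<^sup>2" using m0(2) mm by auto
    have Km: "K / real m \<le> e" using mr(1) e m by (simp add: field_simps)
    have Cm: "2 * (C / real m) \<le> c\<^sup>2 / 4" using mr(2) c m by (simp add: field_simps)
    have "C / real m > 0" using C_pos m by simp
    then have Cm2: "C / real m < 2 * (C / real m)" by linarith
    have ev1: "\<forall>\<^sub>F n in sequentially. \<forall>b\<in>{..<m}. coll z (blk m n b) (blk m n b) 0 / (real n * ln (real n)) < 2 * (C / real m)"
      by (rule eventually_ball_finite, simp, intro ballI order_tendstoD(2)[OF blk_limit[OF m] Cm2])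
    have ev2: "\<forall>\<^sub>F n in sequentially. \<forall>b\<in>{..<m}. prob {x\<in>space \<mu>. \<bar>ws (blk m n b) x\<bar> \<ge> c * nrm n} \<le> 4 * (C / real m)\<^sup>2 / c ^ 4"
      by (rule eventually_ball_finite) (use c m in \<open>auto intro!: ws_tail\<close>)
    from ev1 ev2 eventually_ge_at_top[of 2]
    show "\<forall>\<^sub>F n in sequentially. \<exists>R. integrable \<mu> R \<and> expectation R \<le> 3 * e * nrm n \<and>
      (\<forall>x\<in>space \<mu>. \<forall>b k. b < m \<longrightarrow> grid m n b \<le> k \<longrightarrow> k \<le> grid m n (Suc b) \<longrightarrow> \<bar>ws {..<k} x - ws {..<grid m n b} x\<bar> \<le> R x)"
    proof eventually_elim
      case (elim n)
      define s where "s = nrm n"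
      have s: "s > 0" unfolding s_def using elim by (intro nrm_pos) auto
      have s2: "s\<^sup>2 = real n * ln (real n)" unfolding s_def using elim by (intro nrm_sq) auto
      have Xp: "real n * ln (real n) > 0" using s s2 by (metis zero_less_power)
      define N where "N b = grid m n (Suc b) - grid m n b" for b
      define y where "y b i = z (grid m n b + i)" for b i
      define Q where "Q b x = run_max (N b) (\<lambda>k. \<bar>PS (y b) k x\<bar>)" for b x
      have var: "expectation (\<lambda>x. (PS (y b) (N b) x)\<^sup>2) \<le> 2 * (C / real m) * s\<^sup>2" if "b < m" for b
      proof -
        have "expectation (\<lambda>x. (PS (y b) (N b) x)\<^sup>2) = coll z (blk m n b) (blk m n b) 0"
          unfolding expectation_ws_sq[symmetric] ws_blk_eq N_def y_def ..
        also have "\<dots> \<le> 2 * (C / real m) * (real n * ln (real n))"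
          using bspec[OF elim(1), of b] that unfolding pos_divide_less_eq[OF Xp] by simp
        finally show ?thesis unfolding s2 .
      qed
      have Q_meas [measurable]: "Q b \<in> borel_measurable \<mu>" for b unfolding Q_def by (intro run_max_measurable) simp
      have Qsq: "integrable \<mu> (\<lambda>x. (Q b x)\<^sup>2)" for b unfolding Q_def by (rule max_abs_second_moment)
      have EQ: "expectation (\<lambda>x. (Q b x)\<^sup>2) \<le> 4 * (C / real m) * s\<^sup>2" if "b < m" for b
        using max_abs_second_moment(2)[of "N b" "y b"] var[OF that] unfolding Q_def by linarith
      define A where "A b = {x\<in>space \<mu>. Q b x \<ge> e * s}" for b
      have A_meas [measurable]: "A b \<in> sets \<mu>" for b unfolding A_def by measurable
      have PA: "prob (A b) \<le> 16 * (C / real m)\<^sup>2 / c ^ 4" if b: "b < m" for b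
      proof -
        have "2 * (C / real m) * s\<^sup>2 \<le> c\<^sup>2 / 4 * s\<^sup>2" using Cm by (intro mult_right_mono) auto
        also have "c\<^sup>2 / 4 * s\<^sup>2 \<le> (c * s)\<^sup>2 / 2" by (simp add: power_mult_distrib)
        finally have "expectation (\<lambda>x. (PS (y b) (N b) x)\<^sup>2) \<le> (c * s)\<^sup>2 / 2"
          by (rule order_trans[OF var[OF b]])
        from max_abs_tail[OF _ this] have t: "prob {x\<in>space \<mu>. \<exists>k\<le>N b. \<bar>PS (y b) k x\<bar> \<ge> 2 * (c * s)}
            \<le> 4 * prob {x\<in>space \<mu>. \<bar>PS (y b) (N b) x\<bar> \<ge> c * s}"
          using c s by simp
        have "A b \<subseteq> {x\<in>space \<mu>. \<exists>k\<le>N b. \<bar>PS (y b) k x\<bar> \<ge> 2 * (c * s)}"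
        proof
          fix x assume x: "x \<in> A b"
          obtain k where k: "k \<le> N b" "Q b x = \<bar>PS (y b) k x\<bar>"
            using run_max_attained[of "N b" "\<lambda>k. \<bar>PS (y b) k x\<bar>"] unfolding Q_def by blast
          have "2 * (c * s) = e * s" by (simp add: c_def)
          moreover have "e * s \<le> Q b x" using x by (simp add: A_def)
          ultimately have "2 * (c * s) \<le> \<bar>PS (y b) k x\<bar>" unfolding k(2) by (simp only:)
          then show "x \<in> {x\<in>space \<mu>. \<exists>k\<le>N b. \<bar>PS (y b) k x\<bar> \<ge> 2 * (c * s)}"
            using x k(1) unfolding A_def by blast
        qed
        then have "prob (A b) \<le> prob {x\<in>space \<mu>. \<exists>k\<le>N b. \<bar>PS (y b) k x\<bar> \<ge> 2 * (c * s)}"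
          by (intro finite_measure_mono) auto
        also note t
        also have "prob {x\<in>space \<mu>. \<bar>PS (y b) (N b) x\<bar> \<ge> c * s} \<le> 4 * (C / real m)\<^sup>2 / c ^ 4"
          using bspec[OF elim(2), of b] b unfolding ws_blk_eq N_def y_def s_def by simp
        finally show ?thesis by simp
      qed
      define R where "R x = e * s + (\<Sum>b<m. d / (2 * s) * (Q b x)\<^sup>2 + s / (2 * d) * indicator (A b) x)" for x
      have int: "integrable \<mu> (\<lambda>x. d / (2 * s) * (Q b x)\<^sup>2 + s / (2 * d) * indicator (A b) x)" for b
        by (intro Bochner_Integration.integrable_add integrable_mult_right Qsq integrable_real_indicator)
           (auto simp: emeasure_eq_measure)
      have "expectation R = e * s + (\<Sum>b<m. expectation (\<lambda>x. d / (2 * s) * (Q b x)\<^sup>2 + s / (2 * d) * indicator (A b) x))"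
        unfolding R_def using int by (simp add: prob_space Bochner_Integration.integral_add Bochner_Integration.integral_sum Bochner_Integration.integrable_sum)
      also have "\<dots> \<le> e * s + (\<Sum>b<m. (e * s + K / real m * s) / real m)"
      proof (intro add_left_mono sum_mono)
        fix b assume "b \<in> {..<m}"
        then have b: "b < m" by simp
        have "expectation (\<lambda>x. d / (2 * s) * (Q b x)\<^sup>2 + s / (2 * d) * indicator (A b) x)
          = d / (2 * s) * expectation (\<lambda>x. (Q b x)\<^sup>2) + s / (2 * d) * prob (A b)"
          by (subst Bochner_Integration.integral_add)
            (auto intro!: integrable_mult_right Qsq integrable_real_indicator simp: emeasure_eq_measure)
        also have "\<dots> \<le> d / (2 * s) * (4 * (C / real m) * s\<^sup>2) + s / (2 * d) * (16 * (C / real m)\<^sup>2 / c ^ 4)"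
          using d s EQ[OF b] PA[OF b] by (intro add_mono mult_left_mono) auto
        also have "\<dots> = (e * s + K / real m * s) / real m"
          using s m c d C_pos e by (simp add: K_def d_def field_simps power2_eq_square)
        finally show "expectation (\<lambda>x. d / (2 * s) * (Q b x)\<^sup>2 + s / (2 * d) * indicator (A b) x) \<le> (e * s + K / real m * s) / real m" .
      qed
      also have "\<dots> = 2 * e * s + K / real m * s" using m by simp
      also have "\<dots> \<le> 2 * e * s + e * s" using Km s by (intro add_left_mono mult_right_mono) auto
      finally have ER: "expectation R \<le> 3 * e * nrm n" by (simp add: s_def)
      have intR: "integrable \<mu> R" unfolding R_def
        by (intro Bochner_Integration.integrable_add Bochner_Integration.integrable_sum int integrable_const)
      have pt: "\<bar>ws {..<k} x - ws {..<grid m n b} x\<bar> \<le> R x"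
        if b: "b < m" and k: "grid m n b \<le> k" "k \<le> grid m n (Suc b)" and x: "x \<in> space \<mu>" for x b k
      proof -
        have "\<bar>ws {..<k} x - ws {..<grid m n b} x\<bar> = \<bar>PS (y b) (k - grid m n b) x\<bar>"
          unfolding y_def PS_shift using k by simp
        also have "\<dots> \<le> Q b x" unfolding Q_def N_def
          using k by (intro run_max_ge[where f = "\<lambda>k. \<bar>PS (y b) k x\<bar>"]) auto
        also have "\<dots> \<le> e * s + (d / (2 * s) * (Q b x)\<^sup>2 + s / (2 * d) * indicator (A b) x)"
        proof (cases "x \<in> A b")
          case True
          have "0 \<le> (d * Q b x - s)\<^sup>2" by simp
          then have "2 * d * s * Q b x \<le> d\<^sup>2 * (Q b x)\<^sup>2 + s\<^sup>2" by (simp add: power2_diff power_mult_distrib algebra_simps)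
          then have "Q b x \<le> (d\<^sup>2 * (Q b x)\<^sup>2 + s\<^sup>2) / (2 * d * s)" using d s by (simp add: pos_le_divide_eq algebra_simps)
          also have "\<dots> = d / (2 * s) * (Q b x)\<^sup>2 + s / (2 * d)" using d s by (simp add: field_simps power2_eq_square)
          finally have 1: "Q b x \<le> d / (2 * s) * (Q b x)\<^sup>2 + s / (2 * d)" .
          have "0 \<le> e * s" using e s by simp
          then show ?thesis using 1 True by simp
        next
          case False
          then have "Q b x \<le> e * s" using x by (simp add: A_def)
          moreover have "0 \<le> d / (2 * s) * (Q b x)\<^sup>2" using d s by simp
          ultimately show ?thesis using False by simp
        qed
        also have "\<dots> \<le> R x" unfolding R_def
          using b d s by (intro add_left_mono member_le_sum[where f = "\<lambda>b. d / (2 * s) * (Q b x)\<^sup>2 + s / (2 * d) * indicator (A b) x"]) auto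
        finally show ?thesis .
      qed
      show ?case using intR ER pt by (intro exI[of _ R]) blast
    qed
  qed
qed

end

section \<open>Moving averages of the scenery\<close>

lemma coll_shift: "coll (\<lambda>i. z i - q) A B r = coll z A B r"
  by (simp add: coll_def)

text \<open>Turns sums over the lattice into integrals over counting measure, where Fubini and
  dominated convergence are available; both sides are 0 in the absence of summability.\<close>

lemma count_space_infsum:
  fixes f :: "'a \<Rightarrow> real"
  shows "infsum f UNIV = (\<integral>q. f q \<partial>count_space UNIV)"
proof (cases "integrable (count_space UNIV) f")
  case True
  then have "Infinite_Set_Sum.abs_summable_on f UNIV" by (simp add: Infinite_Set_Sum.abs_summable_on_def)
  from infsetsum_infsum[OF this] show ?thesis by (simp add: infsetsum_def)
next
  case False
  have "\<not> f summable_on UNIV"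
  proof
    assume "f summable_on UNIV"
    then have "Infinite_Sum.abs_summable_on f UNIV" by (rule summable_on_iff_abs_summable_on_real[THEN iffD1])
    then have "Infinite_Set_Sum.abs_summable_on f UNIV" by (rule abs_summable_equivalent[THEN iffD1])
    with False show False by (simp add: Infinite_Set_Sum.abs_summable_on_def)
  qed
  then show ?thesis using False by (simp add: infsum_not_exists not_integrable_integral_eq)
qed

lemma (in prob_space) countable_Fubini:
  fixes F :: "'q::countable \<Rightarrow> 'a \<Rightarrow> real"
  assumes F: "\<And>q. integrable M (F q)" and s: "integrable (count_space UNIV) (\<lambda>q. expectation (\<lambda>x. \<bar>F q x\<bar>))"
  shows "AE x in M. integrable (count_space UNIV) (\<lambda>q. F q x)"
    and "integrable M (\<lambda>x. \<integral>q. F q x \<partial>count_space UNIV)"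
    and "expectation (\<lambda>x. \<integral>q. F q x \<partial>count_space UNIV) = (\<integral>q. expectation (F q) \<partial>count_space UNIV)"
proof -
  interpret Q: sigma_finite_measure "count_space (UNIV :: 'q set)" by (intro sigma_finite_measure_count_space)
  interpret pair_sigma_finite "count_space (UNIV :: 'q set)" M ..
  have [measurable]: "F q \<in> borel_measurable M" for q using F by (rule borel_measurable_integrable)
  have meas: "(\<lambda>p. F (fst p) (snd p)) \<in> borel_measurable (count_space UNIV \<Otimes>\<^sub>M M)"
    by (rule measurable_pair_measure_countable1) auto
  then have meas': "case_prod F \<in> borel_measurable (count_space UNIV \<Otimes>\<^sub>M M)" by (simp add: case_prod_beta')
  have int: "integrable (count_space UNIV \<Otimes>\<^sub>M M) (case_prod F)"
    by (rule Fubini_integrable) (use meas' s F in auto)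
  show "AE x in M. integrable (count_space UNIV) (\<lambda>q. F q x)" by (rule AE_integrable_snd[OF int])
  show "integrable M (\<lambda>x. \<integral>q. F q x \<partial>count_space UNIV)" by (rule integrable_snd[OF int])
  show "expectation (\<lambda>x. \<integral>q. F q x \<partial>count_space UNIV) = (\<integral>q. expectation (F q) \<partial>count_space UNIV)"
    by (rule Fubini_integral[OF int])
qed

lemma (in prob_space) first_moment_le:
  fixes D :: "'a \<Rightarrow> real"
  assumes [measurable]: "D \<in> borel_measurable M" and int: "integrable M (\<lambda>x. (D x)\<^sup>2)"
    and le: "expectation (\<lambda>x. (D x)\<^sup>2) \<le> t\<^sup>2" and t: "t > 0"
  shows "expectation (\<lambda>x. \<bar>D x\<bar>) \<le> t"
proof -
  have "expectation (\<lambda>x. \<bar>D x\<bar>) \<le> expectation (\<lambda>x. ((D x)\<^sup>2 / t + t) / 2)"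
  proof (rule integral_mono)
    show "integrable M (\<lambda>x. \<bar>D x\<bar>)" by (intro integrable_abs square_integrable_imp_integrable[OF _ int]) simp
    show "\<bar>D x\<bar> \<le> ((D x)\<^sup>2 / t + t) / 2" for x
    proof -
      have "(y\<^sup>2 / t + t) / 2 - y = (y - t)\<^sup>2 / (2 * t)" for y :: real
        using t by (simp add: divide_simps power2_eq_square) (simp add: algebra_simps)
      from this[of "\<bar>D x\<bar>"] have "0 \<le> ((D x)\<^sup>2 / t + t) / 2 - \<bar>D x\<bar>" using t by simp
      then show ?thesis by simp
    qed
    show "integrable M (\<lambda>x. ((D x)\<^sup>2 / t + t) / 2)"
      by (intro integrable_divide Bochner_Integration.integrable_add int integrable_const)
  qed
  also have "\<dots> = (expectation (\<lambda>x. (D x)\<^sup>2) / t + t) / 2"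
    using int by (simp add: prob_space)
  also have "\<dots> \<le> (t\<^sup>2 / t + t) / 2" using le t by (intro divide_right_mono add_right_mono) auto
  also have "\<dots> = t" using t by (simp add: power2_eq_square)
  finally show ?thesis .
qed

lemma grid_at_top: "m > 0 \<Longrightarrow> b > 0 \<Longrightarrow> filterlim (\<lambda>n. grid m n b) at_top sequentially"
  unfolding filterlim_at_top
proof
  fix Z assume mb: "m > 0" "b > 0"
  show "\<forall>\<^sub>F n in sequentially. Z \<le> grid m n b"
    using eventually_ge_at_top[of "Z * m"]
  proof eventually_elim
    case (elim n)
    have "real Z * real m \<le> real n" using elim by (simp only: of_nat_mult[symmetric] of_nat_le_iff)
    then have "real Z \<le> real n * (1 / real m)" using mb by (simp add: pos_le_divide_eq)
    also have "\<dots> \<le> real n * (real b / real m)" using mb by (intro mult_left_mono divide_right_mono) auto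
    finally show ?case unfolding grid_def by (simp add: le_nat_floor)
  qed
qed

lemma in_block:
  assumes m: "m > 0" and k: "k \<le> n"
  obtains b where "b < m" "grid m n b \<le> k" "k \<le> grid m n (Suc b)"
proof -
  have "\<exists>b<j. grid m n b \<le> k \<and> k \<le> grid m n (Suc b)" if "k \<le> grid m n j" "j > 0" for j
    using that
  proof (induction j)
    case (Suc j)
    show ?case
    proof (cases "grid m n j \<le> k")
      case True
      then show ?thesis using Suc by blast
    next
      case False
      then have "j > 0" by (cases j) auto
      with Suc.IH False have "\<exists>b<j. grid m n b \<le> k \<and> k \<le> grid m n (Suc b)" by simp
      then show ?thesis using less_SucI by blast
    qed
  qed simp
  from this[of m] show thesis using that k m by (auto simp: grid_full)
qed

section \<open>Comparison of the sums along shifted paths\<close>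

context rwrs
begin

text \<open>Collision counts see only differences of positions, so every estimate for the path holds
  for its translates with the same constant.\<close>

lemma rwrs_shift: "rwrs \<mu> X (\<lambda>i. z i - q) C"
proof unfold_locales
  show "C > 0" by (rule C_pos)
  show "(\<lambda>n. coll (\<lambda>i. z i - q) (blk m n b) (blk m n b) 0 / (real n * ln (real n))) \<longlonglongrightarrow> C / real m" if "m > 0" for m b
    unfolding coll_shift by (rule blk_limit[OF that])
  show "\<forall>\<^sub>F n in sequentially. (C - e) * (real n * ln (real n)) \<le> coll (\<lambda>i. z i - q) {..<n} {..<n} r" if "e > 0" for r e
    unfolding coll_shift by (rule shift_lower[OF that])
qed

text \<open>The scenery is orthonormal, so the mixed moment counts the pairs with
  \<open>z i - q = z j\<close>. The mean square difference is therefore twice the gap between the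
  counts at displacements 0 and \<open>- q\<close>.\<close>

lemma shift_diff_sq:
  "expectation (\<lambda>x. (rwrs.ws X (\<lambda>i. z i - q) A x - ws A x)\<^sup>2) = 2 * coll z A A 0 - 2 * coll z A A (- q)"
  "integrable \<mu> (\<lambda>x. (rwrs.ws X (\<lambda>i. z i - q) A x - ws A x)\<^sup>2)"
proof -
  interpret q: rwrs \<mu> X "\<lambda>i. z i - q" C by (rule rwrs_shift)
  have iqc: "integrable \<mu> (\<lambda>x. q.ws A x * ws A x)"
    unfolding q.ws_def ws_def sum_product by (intro Bochner_Integration.integrable_sum X_mult_int)
  have ec: "expectation (\<lambda>x. q.ws A x * ws A x) = coll z A A (- q)"
  proof -
    have "expectation (\<lambda>x. q.ws A x * ws A x) = (\<Sum>i\<in>A. \<Sum>j\<in>A. expectation (\<lambda>x. X (z i - q) x * X (z j) x))"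
      unfolding q.ws_def ws_def sum_product
      by (simp add: Bochner_Integration.integral_sum Bochner_Integration.integrable_sum X_mult_int)
    also have "\<dots> = (\<Sum>i\<in>A. \<Sum>j\<in>A. of_bool (z j - z i = - q))"
      unfolding X_orthonormal
    proof (intro sum.cong refl)
      fix i j
      have "z i - q = z j \<longleftrightarrow> z j - z i = - q"
      proof
        assume "z j - z i = - q"
        then have "z i + (z j - z i) = z i + - q" by (rule arg_cong)
        then show "z i - q = z j" by simp
      next
        assume "z i - q = z j"
        then have "z j = z i - q" by (rule sym)
        then show "z j - z i = - q" by simp
      qed
      then show "of_bool (z i - q = z j) = (of_bool (z j - z i = - q) :: real)" by simp
    qed
    finally show ?thesis by (simp add: coll_def)
  qed
  have sq: "(q.ws A x - ws A x)\<^sup>2 = q.ws A x * q.ws A x + ws A x * ws A x - 2 * (q.ws A x * ws A x)" for x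
    by (simp add: power2_eq_square algebra_simps)
  show "integrable \<mu> (\<lambda>x. (q.ws A x - ws A x)\<^sup>2)"
    unfolding sq by (intro Bochner_Integration.integrable_diff Bochner_Integration.integrable_add integrable_mult_right ws_mult_int q.ws_mult_int iqc)
  have "expectation (\<lambda>x. (q.ws A x - ws A x)\<^sup>2) = expectation (\<lambda>x. q.ws A x * q.ws A x) + expectation (\<lambda>x. ws A x * ws A x) - 2 * expectation (\<lambda>x. q.ws A x * ws A x)"
    unfolding sq using ws_mult_int[of A A] q.ws_mult_int[of A A] iqc by simp
  then show "expectation (\<lambda>x. (q.ws A x - ws A x)\<^sup>2) = 2 * coll z A A 0 - 2 * coll z A A (- q)"
    by (simp add: expectation_ws_mult q.expectation_ws_mult ec coll_shift)
qed

lemma shift_grid: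
  assumes m: "m > 0" "b \<le> m" and e: "e > 0"
  shows "\<forall>\<^sub>F n in sequentially. expectation (\<lambda>x. \<bar>rwrs.ws X (\<lambda>i. z i - q) {..<grid m n b} x - ws {..<grid m n b} x\<bar>) \<le> e * nrm n"
proof -
  interpret q: rwrs \<mu> X "\<lambda>i. z i - q" C by (rule rwrs_shift)
  \<comment> \<open>The two counts differ by at most \<open>2 * d\<close> on the scale of
    \<open>n * ln n\<close>, and the mean square is twice that.\<close>
  define d where "d = e\<^sup>2 / 4"
  have d: "d > 0" using e by (simp add: d_def)
  show ?thesis
  proof (cases "b = 0")
    case True
    have "\<forall>\<^sub>F n in sequentially. 0 \<le> e * nrm n"
      using eventually_ge_at_top[of 2]
    proof eventually_elim
      case (elim n)
      then show ?case using nrm_pos[of n] e by simp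
    qed
    then show ?thesis using True by (simp add: q.ws_def ws_def)
  next
    case False
    have "\<forall>\<^sub>F N in sequentially. coll z {..<N} {..<N} 0 / (real N * ln (real N)) < C + d"
      by (rule order_tendstoD(2)[OF full_limit]) (use d in simp)
    then have "\<forall>\<^sub>F N in sequentially. 2 * coll z {..<N} {..<N} 0 - 2 * coll z {..<N} {..<N} (- q) \<le> 4 * d * (real N * ln (real N)) \<and> N \<ge> 2"
      using shift_lower[OF d, of "- q"] eventually_ge_at_top[of 2]
    proof eventually_elim
      case (elim N)
      have X: "real N * ln (real N) > 0" using elim by (intro mult_pos_pos) auto
      have "coll z {..<N} {..<N} 0 \<le> (C + d) * (real N * ln (real N))"
        using elim(1) unfolding pos_divide_less_eq[OF X] by simp
      moreover have "(C + d) * (real N * ln (real N)) - (C - d) * (real N * ln (real N)) = 2 * d * (real N * ln (real N))"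
        by (simp only: left_diff_distrib[symmetric]) simp
      ultimately have "coll z {..<N} {..<N} 0 - coll z {..<N} {..<N} (- q) \<le> 2 * d * (real N * ln (real N))"
        using elim(2) by linarith
      moreover have "4 * d * (real N * ln (real N)) = 2 * (2 * d * (real N * ln (real N)))" by simp
      ultimately have "2 * coll z {..<N} {..<N} 0 - 2 * coll z {..<N} {..<N} (- q) \<le> 4 * d * (real N * ln (real N))" by linarith
      then show ?case using elim(3) by (intro conjI)
    qed
    moreover have "filterlim (\<lambda>n. grid m n b) at_top sequentially" using False m by (intro grid_at_top) auto
    ultimately have "\<forall>\<^sub>F n in sequentially. (let N = grid m n b in 2 * coll z {..<N} {..<N} 0 - 2 * coll z {..<N} {..<N} (- q) \<le> 4 * d * (real N * ln (real N)) \<and> N \<ge> 2)"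
      unfolding Let_def by (rule eventually_compose_filterlim)
    then show ?thesis using eventually_ge_at_top[of 2]
    proof eventually_elim
      case (elim n)
      define N where "N = grid m n b"
      have N: "2 * coll z {..<N} {..<N} 0 - 2 * coll z {..<N} {..<N} (- q) \<le> 4 * d * (real N * ln (real N))" "N \<ge> 2"
        using elim(1) by (auto simp: N_def Let_def)
      have "N \<le> n" unfolding N_def using m by (intro grid_le)
      then have "real N * ln (real N) \<le> real n * ln (real n)" using N(2) by (intro mult_mono) auto
      then have "4 * d * (real N * ln (real N)) \<le> 4 * d * (real n * ln (real n))" using d by (intro mult_left_mono) auto
      also have "\<dots> = (e * nrm n)\<^sup>2" using elim(2) by (simp add: d_def power_mult_distrib nrm_sq)
      finally have le: "expectation (\<lambda>x. (q.ws {..<N} x - ws {..<N} x)\<^sup>2) \<le> (e * nrm n)\<^sup>2"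
        using N(1) unfolding shift_diff_sq by linarith
      show ?case unfolding N_def[symmetric]
        by (rule first_moment_le[OF _ shift_diff_sq(2) le]) (use e elim(2) nrm_pos[of n] in auto)
    qed
  qed
qed

definition "shift_max q n x = run_max n (\<lambda>k. \<bar>rwrs.ws X (\<lambda>i. z i - q) {..<k} x - ws {..<k} x\<bar>)"

lemma shift_max_meas [measurable]: "shift_max q n \<in> borel_measurable \<mu>"
proof -
  interpret q: rwrs \<mu> X "\<lambda>i. z i - q" C by (rule rwrs_shift)
  show ?thesis unfolding shift_max_def by (intro run_max_measurable) simp
qed

lemma shift_max_nonneg: "0 \<le> shift_max q n x"
  using run_max_ge[of 0 n "\<lambda>k. \<bar>rwrs.ws X (\<lambda>i. z i - q) {..<k} x - ws {..<k} x\<bar>"] unfolding shift_max_def by linarith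

lemma max_first_moment:
  "integrable \<mu> (\<lambda>x. run_max n (\<lambda>k. \<bar>ws {..<k} x\<bar>))"
  "n \<ge> 2 \<Longrightarrow> coll z {..<n} {..<n} 0 \<le> c * (nrm n)\<^sup>2 \<Longrightarrow> c > 0 \<Longrightarrow> expectation (\<lambda>x. run_max n (\<lambda>k. \<bar>ws {..<k} x\<bar>)) \<le> sqrt (2 * c) * nrm n"
proof -
  have PS: "PS z k x = ws {..<k} x" for k x by (simp add: PS_def psum_def ws_def)
  note i = max_abs_second_moment[of n z, unfolded PS]
  have [measurable]: "(\<lambda>x. run_max n (\<lambda>k. \<bar>ws {..<k} x\<bar>)) \<in> borel_measurable \<mu>"
    by (intro run_max_measurable) simp
  show int: "integrable \<mu> (\<lambda>x. run_max n (\<lambda>k. \<bar>ws {..<k} x\<bar>))"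
    by (rule square_integrable_imp_integrable[OF _ i(1)]) simp
  assume n: "n \<ge> 2" and c: "coll z {..<n} {..<n} 0 \<le> c * (nrm n)\<^sup>2" "c > 0"
  have "expectation (\<lambda>x. (run_max n (\<lambda>k. \<bar>ws {..<k} x\<bar>))\<^sup>2) \<le> (sqrt (2 * c) * nrm n)\<^sup>2"
    using i(2) c unfolding expectation_ws_sq power_mult_distrib by simp
  from first_moment_le[OF _ i(1) this]
  have "expectation (\<lambda>x. \<bar>run_max n (\<lambda>k. \<bar>ws {..<k} x\<bar>)\<bar>) \<le> sqrt (2 * c) * nrm n"
    using n nrm_pos[of n] c(2) by simp
  moreover have "\<bar>run_max n (\<lambda>k. \<bar>ws {..<k} x\<bar>)\<bar> = run_max n (\<lambda>k. \<bar>ws {..<k} x\<bar>)" for x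
    using run_max_ge[of 0 n "\<lambda>k. \<bar>ws {..<k} x\<bar>"] by simp
  ultimately show "expectation (\<lambda>x. run_max n (\<lambda>k. \<bar>ws {..<k} x\<bar>)) \<le> sqrt (2 * c) * nrm n" by simp
qed

lemma shift_max_le: "shift_max q n x \<le> run_max n (\<lambda>k. \<bar>rwrs.ws X (\<lambda>i. z i - q) {..<k} x\<bar>) + run_max n (\<lambda>k. \<bar>ws {..<k} x\<bar>)"
  unfolding shift_max_def
proof (rule run_max_le)
  fix k assume k: "k \<le> n"
  show "\<bar>rwrs.ws X (\<lambda>i. z i - q) {..<k} x - ws {..<k} x\<bar> \<le> run_max n (\<lambda>k. \<bar>rwrs.ws X (\<lambda>i. z i - q) {..<k} x\<bar>) + run_max n (\<lambda>k. \<bar>ws {..<k} x\<bar>)"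
    using run_max_ge[OF k, of "\<lambda>k. \<bar>rwrs.ws X (\<lambda>i. z i - q) {..<k} x\<bar>"] run_max_ge[OF k, of "\<lambda>k. \<bar>ws {..<k} x\<bar>"] by linarith
qed

lemma shift_max_int: "integrable \<mu> (shift_max q n)"
proof -
  interpret q: rwrs \<mu> X "\<lambda>i. z i - q" C by (rule rwrs_shift)
  show ?thesis
    by (rule Bochner_Integration.integrable_bound[OF Bochner_Integration.integrable_add[OF q.max_first_moment(1)[of n] max_first_moment(1)[of n]]])
      (use shift_max_le[of q n] shift_max_nonneg[of q n] in \<open>auto intro!: AE_I2 intro: order_trans[OF _ abs_ge_self]\<close>)
qed

text \<open>Cruder than the limit below, but uniform in \<open>q\<close>: this provides the majorant
  for the sum over all shifts.\<close>

lemma shift_max_bound: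
  assumes "n \<ge> 2" "coll z {..<n} {..<n} 0 \<le> c * (nrm n)\<^sup>2" "c > 0"
  shows "expectation (shift_max q n) \<le> 2 * sqrt (2 * c) * nrm n"
proof -
  interpret q: rwrs \<mu> X "\<lambda>i. z i - q" C by (rule rwrs_shift)
  have "expectation (shift_max q n) \<le> expectation (\<lambda>x. run_max n (\<lambda>k. \<bar>q.ws {..<k} x\<bar>) + run_max n (\<lambda>k. \<bar>ws {..<k} x\<bar>))"
    by (intro integral_mono shift_max_int Bochner_Integration.integrable_add q.max_first_moment max_first_moment shift_max_le)
  also have "\<dots> = expectation (\<lambda>x. run_max n (\<lambda>k. \<bar>q.ws {..<k} x\<bar>)) + expectation (\<lambda>x. run_max n (\<lambda>k. \<bar>ws {..<k} x\<bar>))"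
    by (intro Bochner_Integration.integral_add q.max_first_moment max_first_moment)
  also have "\<dots> \<le> sqrt (2 * c) * nrm n + sqrt (2 * c) * nrm n"
    using assms by (intro add_mono q.max_first_moment(2) max_first_moment(2)) (simp_all add: coll_shift)
  also have "\<dots> = 2 * sqrt (2 * c) * nrm n" by simp
  finally show ?thesis .
qed

text \<open>The maximum over all times is bounded by the oscillations of both sums within blocks
  plus the differences at finitely many grid times. The oscillation bound fixes \<open>m\<close>
  first; only then are the \<open>m\<close> grid differences made small.\<close>

lemma shift_max_limit: "(\<lambda>n. expectation (shift_max q n) / nrm n) \<longlonglongrightarrow> 0"
proof (rule LIMSEQ_I)
  fix r :: real assume r: "r > 0"
  interpret q: rwrs \<mu> X "\<lambda>i. z i - q" C by (rule rwrs_shift)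
  \<comment> \<open>Two oscillations cost \<open>3 * e\<close> each and the grid differences
    together \<open>e\<close>, hence \<open>7 * e\<close> in total.\<close>
  define e where "e = r / 8"
  have e: "e > 0" using r by (simp add: e_def)
  obtain m0 where m0: "\<forall>m\<ge>m0. \<forall>\<^sub>F n in sequentially. \<exists>R. integrable \<mu> R \<and> expectation R \<le> 3 * e * nrm n \<and>
    (\<forall>x\<in>space \<mu>. \<forall>b k. b < m \<longrightarrow> grid m n b \<le> k \<longrightarrow> k \<le> grid m n (Suc b) \<longrightarrow> \<bar>ws {..<k} x - ws {..<grid m n b} x\<bar> \<le> R x)"
    using modulus[OF e] by blast
  obtain m1 where m1: "\<forall>m\<ge>m1. \<forall>\<^sub>F n in sequentially. \<exists>R. integrable \<mu> R \<and> expectation R \<le> 3 * e * nrm n \<and>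
    (\<forall>x\<in>space \<mu>. \<forall>b k. b < m \<longrightarrow> grid m n b \<le> k \<longrightarrow> k \<le> grid m n (Suc b) \<longrightarrow> \<bar>q.ws {..<k} x - q.ws {..<grid m n b} x\<bar> \<le> R x)"
    using q.modulus[OF e] by blast
  define m where "m = Suc (max m0 m1)"
  have m: "m > 0" "m \<ge> m0" "m \<ge> m1" by (auto simp: m_def)
  define e' where "e' = e / real m"
  have e': "e' > 0" using e m by (simp add: e'_def)
  have "\<forall>\<^sub>F n in sequentially. \<forall>b\<in>{..<m}. expectation (\<lambda>x. \<bar>q.ws {..<grid m n b} x - ws {..<grid m n b} x\<bar>) \<le> e' * nrm n"
    by (rule eventually_ball_finite) (use m e' in \<open>auto intro!: shift_grid\<close>)
  with m0[rule_format, OF m(2)] m1[rule_format, OF m(3)] eventually_ge_at_top[of 2]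
  have "\<forall>\<^sub>F n in sequentially. norm (expectation (shift_max q n) / nrm n - 0) < r"
  proof eventually_elim
    case (elim n)
    have p: "nrm n > 0" using elim(3) by (rule nrm_pos)
    obtain R where R: "integrable \<mu> R" "expectation R \<le> 3 * e * nrm n"
      "\<And>x b k. x \<in> space \<mu> \<Longrightarrow> b < m \<Longrightarrow> grid m n b \<le> k \<Longrightarrow> k \<le> grid m n (Suc b) \<Longrightarrow> \<bar>ws {..<k} x - ws {..<grid m n b} x\<bar> \<le> R x"
      using elim(1) by blast
    obtain R' where R': "integrable \<mu> R'" "expectation R' \<le> 3 * e * nrm n"
      "\<And>x b k. x \<in> space \<mu> \<Longrightarrow> b < m \<Longrightarrow> grid m n b \<le> k \<Longrightarrow> k \<le> grid m n (Suc b) \<Longrightarrow> \<bar>q.ws {..<k} x - q.ws {..<grid m n b} x\<bar> \<le> R' x"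
      using elim(2) by blast
    let ?D = "\<lambda>b x. \<bar>q.ws {..<grid m n b} x - ws {..<grid m n b} x\<bar>"
    have iD: "integrable \<mu> (?D b)" for b
      by (intro integrable_abs square_integrable_imp_integrable[OF _ shift_diff_sq(2)]) simp
    have "expectation (shift_max q n) \<le> expectation (\<lambda>x. R x + R' x + (\<Sum>b<m. ?D b x))"
    proof (rule integral_mono)
      show "integrable \<mu> (\<lambda>x. R x + R' x + (\<Sum>b<m. ?D b x))"
        by (intro Bochner_Integration.integrable_add Bochner_Integration.integrable_sum R R' iD)
      show "shift_max q n x \<le> R x + R' x + (\<Sum>b<m. ?D b x)" if x: "x \<in> space \<mu>" for x
        unfolding shift_max_def
      proof (rule run_max_le)
        fix k assume k: "k \<le> n"
        obtain b where b: "b < m" "grid m n b \<le> k" "k \<le> grid m n (Suc b)" using in_block[OF m(1) k] .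
        have "?D b x \<le> (\<Sum>b<m. ?D b x)" using b(1) by (intro member_le_sum[where f = "\<lambda>b. ?D b x"]) auto
        then show "\<bar>q.ws {..<k} x - ws {..<k} x\<bar> \<le> R x + R' x + (\<Sum>b<m. ?D b x)"
          using R(3)[OF x b] R'(3)[OF x b] by linarith
      qed
    qed (rule shift_max_int)
    also have "\<dots> = expectation R + expectation R' + (\<Sum>b<m. expectation (?D b))"
      using R(1) R'(1) iD by (simp add: Bochner_Integration.integral_add Bochner_Integration.integral_sum Bochner_Integration.integrable_sum)
    also have "(\<Sum>b<m. expectation (?D b)) \<le> (\<Sum>b<m. e' * nrm n)"
      using elim(4) by (intro sum_mono) auto
    also have "(\<Sum>b<m. e' * nrm n) = e * nrm n" using m by (simp add: e'_def)
    finally have "expectation (shift_max q n) \<le> 7 * e * nrm n" using R(2) R'(2) by simp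
    then have "expectation (shift_max q n) / nrm n \<le> 7 * e" using p by (subst pos_divide_le_eq) auto
    moreover have "0 \<le> expectation (shift_max q n) / nrm n"
      using p by (intro divide_nonneg_nonneg integral_nonneg_AE) (auto simp: shift_max_nonneg)
    ultimately have "norm (expectation (shift_max q n) / nrm n) \<le> 7 * e" by (subst real_norm_def, subst abs_of_nonneg)
    also have "7 * e < r" using r by (simp add: e_def)
    finally show ?case by simp
  qed
  then show "\<exists>no. \<forall>n\<ge>no. norm (expectation (shift_max q n) / nrm n - 0) < r"
    by (simp add: eventually_sequentially)
qed

end

lemma run_max_nonneg: "(\<And>k. 0 \<le> f k) \<Longrightarrow> 0 \<le> run_max n f"
  by (rule order_trans[OF _ run_max_ge[of 0]]) auto

section \<open>The moving average as a superposition of shifted sums\<close>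

context rwrs
begin

lemma field_meas [measurable]: "(\<lambda>x. infsum (\<lambda>q. a q * X (l - q) x) UNIV) \<in> borel_measurable \<mu>"
proof -
  have "(\<lambda>p. a (snd p) * X (l - snd p) (fst p)) \<in> borel_measurable (\<mu> \<Otimes>\<^sub>M count_space UNIV)"
    by (rule measurable_compose_countable'[where f = "\<lambda>q p. a q * X (l - q) (fst p)" and g = snd and I = UNIV]) auto
  then have [measurable]: "(\<lambda>(x, q). a q * X (l - q) x) \<in> borel_measurable (\<mu> \<Otimes>\<^sub>M count_space UNIV)"
    by (simp add: case_prod_beta')
  interpret Q: sigma_finite_measure "count_space (UNIV :: (int \<times> int) set)"
    by (intro sigma_finite_measure_count_space)
  show ?thesis unfolding count_space_infsum by (rule Q.borel_measurable_lebesgue_integral) measurable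
qed

lemma expectation_abs_X: "expectation (\<lambda>x. \<bar>X l x\<bar>) \<le> 1"
  by (rule first_moment_le) (use X_sq X_norm in auto)

text \<open>First absolute moments of the scenery are at most 1, so summability of \<open>a\<close>
  gives almost sure absolute convergence at each site, and the lattice is countable.\<close>

lemma field_AE:
  assumes a: "integrable (count_space UNIV) a"
  shows "AE x in \<mu>. \<forall>l. integrable (count_space UNIV) (\<lambda>q. a q * X (l - q) x)"
proof -
  have "AE x in \<mu>. integrable (count_space UNIV) (\<lambda>q. a q * X (l - q) x)" for l
  proof (rule countable_Fubini(1))
    show "integrable \<mu> (\<lambda>x. a q * X (l - q) x)" for q by (intro integrable_mult_right X_int)
    show "integrable (count_space UNIV) (\<lambda>q. expectation (\<lambda>x. \<bar>a q * X (l - q) x\<bar>))"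
    proof (rule Bochner_Integration.integrable_bound[OF a])
      have "\<bar>expectation (\<lambda>x. \<bar>a q * X (l - q) x\<bar>)\<bar> \<le> \<bar>a q\<bar>" for q
      proof -
        have "expectation (\<lambda>x. \<bar>a q * X (l - q) x\<bar>) = \<bar>a q\<bar> * expectation (\<lambda>x. \<bar>X (l - q) x\<bar>)"
          by (simp add: abs_mult)
        also have "\<dots> \<le> \<bar>a q\<bar> * 1" by (intro mult_left_mono expectation_abs_X) simp
        finally show ?thesis by (simp add: abs_mult)
      qed
      then show "AE q in count_space UNIV. norm (expectation (\<lambda>x. \<bar>a q * X (l - q) x\<bar>)) \<le> norm (a q)" by simp
    qed simp
  qed
  then show ?thesis by (simp add: AE_all_countable)
qed

definition "fs a k x = (\<Sum>i<k. infsum (\<lambda>q. a q * X (z i - q) x) UNIV)"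

lemma fs_meas [measurable]: "fs a k \<in> borel_measurable \<mu>"
  unfolding fs_def by measurable

definition "field_err a n x = run_max n (\<lambda>k. \<bar>fs a k x - infsum a UNIV * ws {..<k} x\<bar>)"

lemma field_err_meas [measurable]: "field_err a n \<in> borel_measurable \<mu>"
  unfolding field_err_def by (intro run_max_measurable) measurable

text \<open>Exchanging the finite sum over times with the sum over \<open>q\<close> writes the
  moving average along the path as the combination, with weights \<open>a q\<close>, of the scenery
  sums along the paths shifted by \<open>q\<close>.\<close>

lemma field_err_le:
  assumes a: "integrable (count_space UNIV) a"
    and x: "\<forall>l. integrable (count_space UNIV) (\<lambda>q. a q * X (l - q) x)"
    and s: "integrable (count_space UNIV) (\<lambda>q. \<bar>a q\<bar> * shift_max q n x)"
  shows "field_err a n x \<le> (\<integral>q. \<bar>a q\<bar> * shift_max q n x \<partial>count_space UNIV)"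
  unfolding field_err_def
proof (rule run_max_le)
  fix k assume k: "k \<le> n"
  define wq where "wq q = rwrs.ws X (\<lambda>i. z i - q) {..<k} x" for q
  have wq: "wq q = (\<Sum>i<k. X (z i - q) x)" for q
  proof -
    interpret q: rwrs \<mu> X "\<lambda>i. z i - q" C by (rule rwrs_shift)
    show ?thesis by (simp add: wq_def q.ws_def)
  qed
  have i1: "integrable (count_space UNIV) (\<lambda>q. a q * wq q)"
    unfolding wq sum_distrib_left by (intro Bochner_Integration.integrable_sum x[rule_format])
  have i2: "integrable (count_space UNIV) (\<lambda>q. a q * ws {..<k} x)"
    using a by (rule integrable_mult_left)
  have i3: "integrable (count_space UNIV) (\<lambda>q. a q * (wq q - ws {..<k} x))"
    using Bochner_Integration.integrable_diff[OF i1 i2] by (simp only: right_diff_distrib)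
  have "fs a k x = (\<Sum>i<k. \<integral>q. a q * X (z i - q) x \<partial>count_space UNIV)"
    unfolding fs_def count_space_infsum ..
  also have "\<dots> = (\<integral>q. (\<Sum>i<k. a q * X (z i - q) x) \<partial>count_space UNIV)"
    by (rule Bochner_Integration.integral_sum[symmetric]) (rule x[rule_format])
  also have "\<dots> = (\<integral>q. a q * wq q \<partial>count_space UNIV)"
    unfolding wq sum_distrib_left ..
  finally have "fs a k x - infsum a UNIV * ws {..<k} x = (\<integral>q. a q * wq q \<partial>count_space UNIV) - (\<integral>q. a q * ws {..<k} x \<partial>count_space UNIV)"
    unfolding count_space_infsum by simp
  also have "\<dots> = (\<integral>q. a q * wq q - a q * ws {..<k} x \<partial>count_space UNIV)"
    by (rule Bochner_Integration.integral_diff[OF i1 i2, symmetric])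
  also have "\<dots> = (\<integral>q. a q * (wq q - ws {..<k} x) \<partial>count_space UNIV)"
    by (simp only: right_diff_distrib)
  finally have "\<bar>fs a k x - infsum a UNIV * ws {..<k} x\<bar> \<le> (\<integral>q. \<bar>a q * (wq q - ws {..<k} x)\<bar> \<partial>count_space UNIV)"
    by simp
  also have "\<dots> \<le> (\<integral>q. \<bar>a q\<bar> * shift_max q n x \<partial>count_space UNIV)"
  proof (rule integral_mono[OF integrable_abs[OF i3] s])
    fix q
    have "\<bar>wq q - ws {..<k} x\<bar> \<le> shift_max q n x"
      unfolding shift_max_def wq_def using k by (rule run_max_ge[where f = "\<lambda>k. \<bar>rwrs.ws X (\<lambda>i. z i - q) {..<k} x - ws {..<k} x\<bar>"])
    then show "\<bar>a q * (wq q - ws {..<k} x)\<bar> \<le> \<bar>a q\<bar> * shift_max q n x"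
      unfolding abs_mult by (intro mult_left_mono) auto
  qed
  finally show "\<bar>fs a k x - infsum a UNIV * ws {..<k} x\<bar> \<le> (\<integral>q. \<bar>a q\<bar> * shift_max q n x \<partial>count_space UNIV)" .
qed

lemma expectation_field_err:
  assumes a: "integrable (count_space UNIV) a" and n: "n \<ge> 2"
    and c: "coll z {..<n} {..<n} 0 \<le> c * (nrm n)\<^sup>2" "c > 0"
  shows "integrable \<mu> (field_err a n)"
    and "expectation (field_err a n) \<le> (\<integral>q. \<bar>a q\<bar> * expectation (shift_max q n) \<partial>count_space UNIV)"
proof -
  have abs_int: "expectation (\<lambda>x. \<bar>\<bar>a q\<bar> * shift_max q n x\<bar>) = \<bar>a q\<bar> * expectation (shift_max q n)" for q
    by (simp add: abs_mult abs_of_nonneg[OF shift_max_nonneg])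
  have int: "integrable (count_space UNIV) (\<lambda>q. \<bar>a q\<bar> * expectation (shift_max q n))"
  proof (rule Bochner_Integration.integrable_bound[OF integrable_mult_left[OF integrable_abs[OF a], of "2 * sqrt (2 * c) * nrm n"]])
    have "norm (\<bar>a q\<bar> * expectation (shift_max q n)) \<le> norm (\<bar>a q\<bar> * (2 * sqrt (2 * c) * nrm n))" for q
    proof -
      have "0 \<le> expectation (shift_max q n)" by (intro integral_nonneg_AE) (simp add: shift_max_nonneg)
      then have "norm (\<bar>a q\<bar> * expectation (shift_max q n)) = \<bar>a q\<bar> * expectation (shift_max q n)"
        by (simp add: abs_mult)
      also have "\<dots> \<le> \<bar>a q\<bar> * (2 * sqrt (2 * c) * nrm n)"
        by (intro mult_left_mono shift_max_bound[OF n c]) simp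
      also have "\<dots> \<le> norm (\<bar>a q\<bar> * (2 * sqrt (2 * c) * nrm n))"
        unfolding real_norm_def by (rule abs_ge_self)
      finally show ?thesis .
    qed
    then show "AE q in count_space UNIV. norm (\<bar>a q\<bar> * expectation (shift_max q n)) \<le> norm (\<bar>a q\<bar> * (2 * sqrt (2 * c) * nrm n))"
      by simp
  qed simp
  have F: "integrable \<mu> (\<lambda>x. \<bar>a q\<bar> * shift_max q n x)" for q by (intro integrable_mult_right shift_max_int)
  have s: "integrable (count_space UNIV) (\<lambda>q. expectation (\<lambda>x. \<bar>\<bar>a q\<bar> * shift_max q n x\<bar>))"
    unfolding abs_int by (rule int)
  note Fub = countable_Fubini[where F = "\<lambda>q x. \<bar>a q\<bar> * shift_max q n x", OF F s]
  have le: "AE x in \<mu>. field_err a n x \<le> (\<integral>q. \<bar>a q\<bar> * shift_max q n x \<partial>count_space UNIV)"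
    using field_AE[OF a] Fub(1)
  proof eventually_elim
    case (elim x)
    then show ?case by (rule field_err_le[OF a])
  qed
  have nn: "0 \<le> field_err a n x" for x unfolding field_err_def by (intro run_max_nonneg) simp
  show int_e: "integrable \<mu> (field_err a n)"
  proof (rule Bochner_Integration.integrable_bound[OF Fub(2)])
    show "AE x in \<mu>. norm (field_err a n x) \<le> norm (\<integral>q. \<bar>a q\<bar> * shift_max q n x \<partial>count_space UNIV)"
      using le by eventually_elim (use nn in \<open>auto intro: order_trans[OF _ abs_ge_self]\<close>)
  qed simp
  have "expectation (field_err a n) \<le> expectation (\<lambda>x. \<integral>q. \<bar>a q\<bar> * shift_max q n x \<partial>count_space UNIV)"
    by (rule integral_mono_AE[OF int_e Fub(2) le])
  also have "\<dots> = (\<integral>q. \<bar>a q\<bar> * expectation (shift_max q n) \<partial>count_space UNIV)"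
    unfolding Fub(3) by simp
  finally show "expectation (field_err a n) \<le> (\<integral>q. \<bar>a q\<bar> * expectation (shift_max q n) \<partial>count_space UNIV)" .
qed

lemma coll_bound: "\<forall>\<^sub>F n in sequentially. n \<ge> 2 \<and> coll z {..<n} {..<n} 0 \<le> (C + 1) * (nrm n)\<^sup>2"
proof -
  have "\<forall>\<^sub>F n in sequentially. coll z {..<n} {..<n} 0 / (real n * ln (real n)) < C + 1"
    by (rule order_tendstoD(2)[OF full_limit]) simp
  then show ?thesis using eventually_ge_at_top[of 2]
  proof eventually_elim
    case (elim n)
    have X: "real n * ln (real n) > 0" using elim by (intro mult_pos_pos) auto
    have "coll z {..<n} {..<n} 0 \<le> (C + 1) * (real n * ln (real n))"
      using elim(1) unfolding pos_divide_less_eq[OF X] by simp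
    moreover have "(nrm n)\<^sup>2 = real n * ln (real n)" using elim by (intro nrm_sq) auto
    ultimately show ?case using elim by simp
  qed
qed

text \<open>Dominated convergence over \<open>q\<close>: each shift contributes a vanishing term,
  and the uniform bound times the modulus of \<open>a q\<close> is summable.\<close>

theorem field_err_limit:
  assumes a: "integrable (count_space UNIV) a"
  shows "(\<lambda>n. expectation (field_err a n) / nrm n) \<longlonglongrightarrow> 0"
    and "\<forall>\<^sub>F n in sequentially. integrable \<mu> (field_err a n)"
proof -
  show "\<forall>\<^sub>F n in sequentially. integrable \<mu> (field_err a n)"
    using coll_bound by eventually_elim (use C_pos in \<open>auto intro!: expectation_field_err(1)[OF a, of _ "C + 1"]\<close>)
  obtain n0 where n0: "\<And>n. n \<ge> n0 \<Longrightarrow> n \<ge> 2 \<and> coll z {..<n} {..<n} 0 \<le> (C + 1) * (nrm n)\<^sup>2"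
    using coll_bound unfolding eventually_sequentially by blast
  let ?K = "2 * sqrt (2 * (C + 1))"
  have K: "0 \<le> expectation (shift_max q n) / nrm n \<and> expectation (shift_max q n) / nrm n \<le> ?K" if "n \<ge> n0" for q n
  proof -
    have p: "nrm n > 0" using n0[OF that] by (intro nrm_pos) auto
    have "0 \<le> expectation (shift_max q n)" by (intro integral_nonneg_AE) (simp add: shift_max_nonneg)
    moreover have "expectation (shift_max q n) \<le> ?K * nrm n"
      using n0[OF that] C_pos by (intro shift_max_bound) auto
    ultimately show ?thesis using p by (simp add: pos_divide_le_eq)
  qed
  \<comment> \<open>The majorant is available from \<open>n0\<close> on only, hence the offset in
    the index.\<close>
  have "(\<lambda>n. \<integral>q. \<bar>a q\<bar> * (expectation (shift_max q (n + n0)) / nrm (n + n0)) \<partial>count_space UNIV) \<longlonglongrightarrow> (\<integral>q. 0 \<partial>count_space (UNIV :: (int \<times> int) set))"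
  proof (rule integral_dominated_convergence[where w = "\<lambda>q. \<bar>a q\<bar> * ?K"])
    show "integrable (count_space UNIV) (\<lambda>q. \<bar>a q\<bar> * ?K)" by (intro integrable_mult_left integrable_abs a)
    have "(\<lambda>n. \<bar>a q\<bar> * (expectation (shift_max q (n + n0)) / nrm (n + n0))) \<longlonglongrightarrow> \<bar>a q\<bar> * 0" for q
      by (intro tendsto_mult_left LIMSEQ_ignore_initial_segment[OF shift_max_limit])
    then show "AE q in count_space UNIV. (\<lambda>n. \<bar>a q\<bar> * (expectation (shift_max q (n + n0)) / nrm (n + n0))) \<longlonglongrightarrow> 0"
      by simp
    show "AE q in count_space UNIV. norm (\<bar>a q\<bar> * (expectation (shift_max q (n + n0)) / nrm (n + n0))) \<le> \<bar>a q\<bar> * ?K" for n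
    proof (rule AE_I2)
      fix q
      note k = K[of "n + n0" q]
      have "norm (\<bar>a q\<bar> * (expectation (shift_max q (n + n0)) / nrm (n + n0))) = \<bar>a q\<bar> * (expectation (shift_max q (n + n0)) / nrm (n + n0))"
        using k unfolding real_norm_def by (intro abs_of_nonneg mult_nonneg_nonneg) auto
      also have "\<dots> \<le> \<bar>a q\<bar> * ?K" using k by (intro mult_left_mono) auto
      finally show "norm (\<bar>a q\<bar> * (expectation (shift_max q (n + n0)) / nrm (n + n0))) \<le> \<bar>a q\<bar> * ?K" .
    qed
  qed auto
  then have lim0: "(\<lambda>n. \<integral>q. \<bar>a q\<bar> * (expectation (shift_max q (n + n0)) / nrm (n + n0)) \<partial>count_space UNIV) \<longlonglongrightarrow> 0"
    by simp
  have "(\<lambda>n. expectation (field_err a (n + n0)) / nrm (n + n0)) \<longlonglongrightarrow> 0"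
  proof (rule tendsto_sandwich[OF _ _ tendsto_const lim0]; rule always_eventually; intro allI)
    fix n
    have m: "n + n0 \<ge> 2" "coll z {..<n + n0} {..<n + n0} 0 \<le> (C + 1) * (nrm (n + n0))\<^sup>2" using n0[of "n + n0"] by auto
    have p: "nrm (n + n0) > 0" by (rule nrm_pos[OF m(1)])
    have "0 \<le> expectation (field_err a (n + n0))"
      by (intro integral_nonneg_AE) (auto simp: field_err_def intro!: AE_I2 run_max_nonneg)
    then show "0 \<le> expectation (field_err a (n + n0)) / nrm (n + n0)" using p by simp
    have "expectation (field_err a (n + n0)) / nrm (n + n0)
      \<le> (\<integral>q. \<bar>a q\<bar> * expectation (shift_max q (n + n0)) \<partial>count_space UNIV) / nrm (n + n0)"
      using p expectation_field_err(2)[OF a m] C_pos by (intro divide_right_mono) auto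
    then show "expectation (field_err a (n + n0)) / nrm (n + n0)
      \<le> (\<integral>q. \<bar>a q\<bar> * (expectation (shift_max q (n + n0)) / nrm (n + n0)) \<partial>count_space UNIV)"
      by simp
  qed
  then show "(\<lambda>n. expectation (field_err a n) / nrm n) \<longlonglongrightarrow> 0" by (rule LIMSEQ_offset)
qed

end

section \<open>The limit theorem along a fixed path\<close>

lemma lip01_step:
  assumes g: "lip01 L g" and e: "e \<ge> 0" and le: "\<And>k. \<bar>u k - v k\<bar> \<le> e"
  shows "\<bar>g (step01 m u) - g (step01 m v)\<bar> \<le> L * e"
proof -
  have "close01 e (step01 m u) (step01 m v)" using le by (simp add: close01_def step01_def)
  then show ?thesis using g e step01_in_D01 unfolding lip01_def by blast
qed

lemma telescope_increments:
  "k \<le> m \<Longrightarrow> (\<Sum>b<k. h (real (Suc b) / real m) - h (real b / real m)) = h (real k / real m) - (h 0 :: real)"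
  using sum_lessThan_telescope[of "\<lambda>b. h (real b / real m)" k] by simp

section \<open>Comparison with a finite skeleton of the process\<close>

context rwrs
begin

context
  fixes M :: "'w measure" and W :: "'w \<Rightarrow> real \<Rightarrow> real" and \<alpha> :: real
  assumes W: "wiener01 M W" and \<alpha>: "\<alpha> \<noteq> 0"
begin

lemma wiener_increments:
  assumes m: "m > 0"
  shows "prob_space.indep_vars M (\<lambda>_. borel) (\<lambda>b w. sqrt (\<alpha>\<^sup>2 * C) * (W w (real (Suc b) / real m) - W w (real b / real m))) {..<m}" (is ?I)
    and "b < m \<Longrightarrow> distr M borel (\<lambda>w. sqrt (\<alpha>\<^sup>2 * C) * (W w (real (Suc b) / real m) - W w (real b / real m))) = gauss (\<alpha>\<^sup>2 * C / real m)"
proof -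
  interpret M: prob_space M using W by (rule wiener_prob_space)
  have "\<forall>(k::nat) (ts::nat \<Rightarrow> real). 0 \<le> ts 0 \<and> ts k \<le> 1 \<and> (\<forall>i<k. ts i < ts (Suc i)) \<longrightarrow>
        M.indep_vars (\<lambda>_. borel) (\<lambda>i w. W w (ts (Suc i)) - W w (ts i)) {..<k}"
    using W unfolding wiener01_def by blast
  from this[rule_format, of "\<lambda>b. real b / real m" m]
  have ind: "M.indep_vars (\<lambda>_. borel) (\<lambda>b w. W w (real (Suc b) / real m) - W w (real b / real m)) {..<m}"
    using m by (auto simp: divide_strict_right_mono)
  show ?I by (rule M.indep_vars_compose2[OF ind, where Y = "\<lambda>_ x. sqrt (\<alpha>\<^sup>2 * C) * x"]) simp
  assume b: "b < m"
  have "\<forall>s t. 0 \<le> s \<and> s < t \<and> t \<le> 1 \<longrightarrow>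
        distributed M lborel (\<lambda>w. W w t - W w s) (normal_density 0 (sqrt (t - s)))"
    using W unfolding wiener01_def by blast
  from this[rule_format, of "real b / real m" "real (Suc b) / real m"]
  have "distributed M lborel (\<lambda>w. W w (real (Suc b) / real m) - W w (real b / real m)) (normal_density 0 (sqrt (real (Suc b) / real m - real b / real m)))"
    using m b by (simp add: divide_strict_right_mono)
  also have "real (Suc b) / real m - real b / real m = 1 / real m" by (simp add: diff_divide_distrib[symmetric])
  finally have "distributed M lborel (\<lambda>w. W w (real (Suc b) / real m) - W w (real b / real m)) (normal_density 0 (sqrt (1 / real m)))" .
  from M.normal_density_affine[OF this, of "sqrt (\<alpha>\<^sup>2 * C)" 0]
  have "distributed M lborel (\<lambda>w. sqrt (\<alpha>\<^sup>2 * C) * (W w (real (Suc b) / real m) - W w (real b / real m)))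
      (normal_density 0 (sqrt (\<alpha>\<^sup>2 * C) * sqrt (1 / real m)))"
    using C_pos \<alpha> m by simp
  also have "sqrt (\<alpha>\<^sup>2 * C) * sqrt (1 / real m) = sqrt (\<alpha>\<^sup>2 * C / real m)"
    by (simp only: real_sqrt_mult[symmetric]) simp
  finally have d: "distributed M lborel (\<lambda>w. sqrt (\<alpha>\<^sup>2 * C) * (W w (real (Suc b) / real m) - W w (real b / real m)))
      (normal_density 0 (sqrt (\<alpha>\<^sup>2 * C / real m)))" .
  have "distr M borel (\<lambda>w. sqrt (\<alpha>\<^sup>2 * C) * (W w (real (Suc b) / real m) - W w (real b / real m)))
    = distr M lborel (\<lambda>w. sqrt (\<alpha>\<^sup>2 * C) * (W w (real (Suc b) / real m) - W w (real b / real m)))"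
    by (intro distr_cong) auto
  also have "\<dots> = density lborel (normal_density 0 (sqrt (\<alpha>\<^sup>2 * C / real m)))"
    by (rule distributed_distr_eq_density[OF d])
  also have "\<dots> = gauss (\<alpha>\<^sup>2 * C / real m)"
    using m C_pos \<alpha> by (intro gauss_eq_normal[symmetric]) simp
  finally show "distr M borel (\<lambda>w. sqrt (\<alpha>\<^sup>2 * C) * (W w (real (Suc b) / real m) - W w (real b / real m))) = gauss (\<alpha>\<^sup>2 * C / real m)" .
qed

text \<open>The process frozen at the left end of each of the \<open>m\<close> blocks; like
  \<open>wstep\<close> it is a step path on the coarse grid, so both are functions of
  \<open>m\<close> increments.\<close>

definition "skeleton m n x = step01 m (\<lambda>k. \<alpha> * ws {..<grid m n (min k m)} x / nrm n)"

text \<open>A Lipschitz functional of the skeleton is a Lipschitz function of the block increments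
  through their partial sums; on the Wiener side these telescope, since the path starts at
  0.\<close>

lemma skeleton_converges:
  assumes g: "lip01 L g" and B: "\<And>x. x \<in> D01 \<Longrightarrow> \<bar>g x\<bar> \<le> B" and m: "m > 0"
  shows "(\<lambda>n. expectation (\<lambda>x. g (skeleton m n x))) \<longlonglongrightarrow> (\<integral>w. g (wstep W (sqrt (\<alpha>\<^sup>2 * C)) m w) \<partial>M)"
proof -
  interpret M: prob_space M using W by (rule wiener_prob_space)
  define s where "s = sqrt (\<alpha>\<^sup>2 * C)"
  define H where "H u = g (step01 m (\<lambda>k. \<Sum>b<min k m. u b))" for u
  have "(\<lambda>n. expectation (\<lambda>x. H (\<lambda>b. \<alpha> * ws (blk m n b) x / nrm n)))
    \<longlonglongrightarrow> (\<integral>w. H (\<lambda>b. s * (W w (real (Suc b) / real m) - W w (real b / real m))) \<partial>M)"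
  proof (rule increments_converge[where W = "\<lambda>b w. s * (W w (real (Suc b) / real m) - W w (real b / real m))"])
    show "prob_space M" by (rule M.prob_space_axioms)
    show "m > 0" by fact
    show "M.indep_vars (\<lambda>_. borel) (\<lambda>b w. s * (W w (real (Suc b) / real m) - W w (real b / real m))) {..<m}"
      unfolding s_def by (rule wiener_increments(1)[OF m])
    show "distr M borel (\<lambda>w. s * (W w (real (Suc b) / real m) - W w (real b / real m))) = gauss (\<alpha>\<^sup>2 * C / real m)" if "b < m" for b
      unfolding s_def by (rule wiener_increments(2)[OF m that])
    show "\<bar>H v\<bar> \<le> B" for v unfolding H_def by (rule B[OF step01_in_D01])
    show "L \<ge> 0" using g by (simp add: lip01_def)
    show "\<bar>H u - H v\<bar> \<le> L * (\<Sum>b<m. \<bar>u b - v b\<bar>)" for u v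
      unfolding H_def
    proof (rule lip01_step[OF g])
      show "0 \<le> (\<Sum>b<m. \<bar>u b - v b\<bar>)" by (intro sum_nonneg) simp
      show "\<bar>(\<Sum>b<min k m. u b) - (\<Sum>b<min k m. v b)\<bar> \<le> (\<Sum>b<m. \<bar>u b - v b\<bar>)" for k
      proof -
        have "\<bar>(\<Sum>b<min k m. u b) - (\<Sum>b<min k m. v b)\<bar> \<le> (\<Sum>b<min k m. \<bar>u b - v b\<bar>)"
          unfolding sum_subtractf[symmetric] by (rule sum_abs)
        also have "\<dots> \<le> (\<Sum>b<m. \<bar>u b - v b\<bar>)" by (intro sum_mono2) auto
        finally show ?thesis .
      qed
    qed
  qed
  moreover have "H (\<lambda>b. \<alpha> * ws (blk m n b) x / nrm n) = g (skeleton m n x)" for n x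
  proof -
    have "(\<Sum>b<k. \<alpha> * ws (blk m n b) x / nrm n) = \<alpha> * ws {..<grid m n k} x / nrm n" for k
      unfolding ws_def sum_grid by (simp add: sum_distrib_left sum_divide_distrib)
    then show ?thesis by (simp add: H_def skeleton_def)
  qed
  moreover have "(\<integral>w. H (\<lambda>b. s * (W w (real (Suc b) / real m) - W w (real b / real m))) \<partial>M) = (\<integral>w. g (wstep W s m w) \<partial>M)"
  proof (rule Bochner_Integration.integral_cong[OF refl])
    fix w assume w: "w \<in> space M"
    have 0: "W w 0 = 0" using W w by (simp add: wiener01_def)
    have "(\<Sum>b<min k m. s * (W w (real (Suc b) / real m) - W w (real b / real m))) = s * W w (real (min k m) / real m)" for k
      using telescope_increments[of "min k m" m "W w"] by (simp add: sum_distrib_left[symmetric] 0)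
    then show "H (\<lambda>b. s * (W w (real (Suc b) / real m) - W w (real b / real m))) = g (wstep W s m w)"
      by (simp add: H_def wstep_def)
  qed
  ultimately show ?thesis by (simp add: s_def)
qed

lemma skeleton_close:
  assumes m: "m > 0" and n: "n \<ge> 2" and x: "x \<in> space \<mu>"
    and R: "\<And>b k. b < m \<Longrightarrow> grid m n b \<le> k \<Longrightarrow> k \<le> grid m n (Suc b) \<Longrightarrow> \<bar>ws {..<k} x - ws {..<grid m n b} x\<bar> \<le> R"
    and a: "infsum a UNIV = \<alpha>"
  shows "close01 ((field_err a n x + \<bar>\<alpha>\<bar> * R) / nrm n) (step01 n (\<lambda>k. fs a k x / nrm n)) (skeleton m n x)"
  unfolding close01_def
proof
  fix t :: real assume t: "t \<in> {0..1}"
  define k where "k = nat \<lfloor>real n * t\<rfloor>"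
  define b where "b = nat \<lfloor>real m * t\<rfloor>"
  have p: "nrm n > 0" using n by (rule nrm_pos)
  have "real n * t \<le> real n * 1" using t by (intro mult_left_mono) auto
  then have k: "k \<le> n" unfolding k_def by (simp add: floor_le_iff nat_le_iff)
  have "real m * t \<le> real m * 1" using t by (intro mult_left_mono) auto
  then have b: "b \<le> m" unfolding b_def by (simp add: floor_le_iff nat_le_iff)
  have "of_int \<lfloor>real m * t\<rfloor> = real b" unfolding b_def using t by simp
  then have bt: "real b \<le> real m * t" "real m * t < real b + 1" by linarith+
  have "R \<ge> 0" using R[of 0 "grid m n 0"] m grid_mono[of 0 1 m n] by simp
  have osc: "\<bar>ws {..<k} x - ws {..<grid m n b} x\<bar> \<le> R"
  proof (cases "b < m")
    case True
    show ?thesis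
    proof (rule R[OF True])
      have "real b / real m \<le> t" using bt(1) m by (simp add: pos_divide_le_eq mult.commute)
      then show "grid m n b \<le> k" unfolding grid_def k_def by (intro nat_mono floor_mono mult_left_mono) auto
      have "t \<le> real (Suc b) / real m" using bt(2) m by (simp add: pos_le_divide_eq mult.commute)
      then show "k \<le> grid m n (Suc b)" unfolding grid_def k_def by (intro nat_mono floor_mono mult_left_mono) auto
    qed
  next
    case False
    \<comment> \<open>This happens at \<open>t = 1\<close> only, which belongs to no block; there
      the time \<open>n\<close> is itself a grid point and the difference vanishes.\<close>
    then have bm: "b = m" using b by simp
    have "1 \<le> t" using bt(1) m unfolding bm by simp
    then have "t = 1" using t by simp
    then have "k = grid m n b" unfolding k_def bm grid_full[OF m] by simp
    then show ?thesis using \<open>R \<ge> 0\<close> by simp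
  qed
  have "\<bar>fs a k x - \<alpha> * ws {..<k} x\<bar> \<le> field_err a n x"
    unfolding field_err_def a[symmetric] using k by (rule run_max_ge[where f = "\<lambda>k. \<bar>fs a k x - infsum a UNIV * ws {..<k} x\<bar>"])
  moreover have "\<bar>\<alpha> * ws {..<k} x - \<alpha> * ws {..<grid m n b} x\<bar> \<le> \<bar>\<alpha>\<bar> * R"
    unfolding right_diff_distrib[symmetric] abs_mult using osc by (intro mult_left_mono) auto
  ultimately have "\<bar>fs a k x - \<alpha> * ws {..<grid m n b} x\<bar> \<le> field_err a n x + \<bar>\<alpha>\<bar> * R" by linarith
  then have "\<bar>fs a k x - \<alpha> * ws {..<grid m n b} x\<bar> / nrm n \<le> (field_err a n x + \<bar>\<alpha>\<bar> * R) / nrm n"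
    using p by (intro divide_right_mono) auto
  moreover have "step01 n (\<lambda>k. fs a k x / nrm n) t = fs a k x / nrm n" by (simp add: step01_def k_def)
  moreover have "skeleton m n x t = \<alpha> * ws {..<grid m n b} x / nrm n"
    using b by (simp add: skeleton_def step01_def b_def min_absorb1)
  ultimately show "\<bar>step01 n (\<lambda>k. fs a k x / nrm n) t - skeleton m n x t\<bar> \<le> (field_err a n x + \<bar>\<alpha>\<bar> * R) / nrm n"
    using p by (simp add: diff_divide_distrib[symmetric] abs_divide)
qed

lemma skeleton_measurable: "supcont g \<Longrightarrow> (\<lambda>x. g (skeleton m n x)) \<in> borel_measurable \<mu>"
  unfolding skeleton_def by (rule supcont_step_measurable) simp_all

lemma fs_measurable: "supcont g \<Longrightarrow> (\<lambda>x. g (step01 n (\<lambda>k. fs a k x / nrm n))) \<in> borel_measurable \<mu>"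
  by (rule supcont_step_measurable) simp_all

text \<open>The coarseness \<open>m\<close> is fixed first, so that both the oscillation and the
  Wiener step error are small; then \<open>n\<close> tends to infinity in the convergence of the
  skeleton and in the error of the moving average.\<close>

lemma lipschitz_limit:
  assumes a: "integrable (count_space UNIV) a" and \<alpha>_eq: "infsum a UNIV = \<alpha>"
    and g: "lip01 L g" and B: "\<And>x. x \<in> D01 \<Longrightarrow> \<bar>g x\<bar> \<le> B"
  shows "(\<lambda>n. expectation (\<lambda>x. g (step01 n (\<lambda>k. fs a k x / nrm n)))) \<longlonglongrightarrow> (\<integral>w. g (\<lambda>t. sqrt (\<alpha>\<^sup>2 * C) * W w t) \<partial>M)"
proof (rule LIMSEQ_I)
  fix r :: real assume r: "r > 0"
  have sc: "supcont g" by (rule lip01_supcont[OF g])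
  have L: "L \<ge> 0" using g by (simp add: lip01_def)
  \<comment> \<open>The modulus returns \<open>3 * e\<close>, so its contribution is
    \<open>r / 5\<close>. Three more errors of \<open>r / 5\<close> follow: moving average, skeleton
    and Wiener step path.\<close>
  define e where "e = r / (15 * (L + 1) * (\<bar>\<alpha>\<bar> + 1))"
  have e: "e > 0" unfolding e_def using r L by (intro divide_pos_pos mult_pos_pos) auto
  obtain m0 where m0: "\<forall>m\<ge>m0. \<forall>\<^sub>F n in sequentially. \<exists>R. integrable \<mu> R \<and> expectation R \<le> 3 * e * nrm n \<and>
    (\<forall>x\<in>space \<mu>. \<forall>b k. b < m \<longrightarrow> grid m n b \<le> k \<longrightarrow> k \<le> grid m n (Suc b) \<longrightarrow> \<bar>ws {..<k} x - ws {..<grid m n b} x\<bar> \<le> R x)"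
    using modulus[OF e] by blast
  let ?G = "\<integral>w. g (\<lambda>t. sqrt (\<alpha>\<^sup>2 * C) * W w t) \<partial>M"
  let ?Gm = "\<lambda>m. \<integral>w. g (wstep W (sqrt (\<alpha>\<^sup>2 * C)) m w) \<partial>M"
  have "r / 5 > 0" using r by simp
  from LIMSEQ_D[OF wiener_step_limit[OF W sc B] this]
  obtain m1 where m1: "\<And>m. m \<ge> m1 \<Longrightarrow> norm (?Gm m - ?G) < r / 5" by blast
  define m where "m = Suc (max m0 m1)"
  have m: "m > 0" "m \<ge> m0" "m \<ge> m1" by (auto simp: m_def)
  have ev1: "\<forall>\<^sub>F n in sequentially. dist (expectation (\<lambda>x. g (skeleton m n x))) (?Gm m) < r / 5"
    by (rule tendstoD[OF skeleton_converges[OF g B m(1)]]) (use r in auto)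
  have "r / (5 * (L + 1)) > 0" using r L by simp
  then have ev2: "\<forall>\<^sub>F n in sequentially. expectation (field_err a n) / nrm n < r / (5 * (L + 1))"
    by (rule order_tendstoD(2)[OF field_err_limit(1)[OF a]])
  from ev1 ev2 field_err_limit(2)[OF a] m0[rule_format, OF m(2)] eventually_ge_at_top[of 2]
  have "\<forall>\<^sub>F n in sequentially. norm (expectation (\<lambda>x. g (step01 n (\<lambda>k. fs a k x / nrm n))) - ?G) < r"
  proof eventually_elim
    case (elim n)
    have p: "nrm n > 0" using elim(5) by (rule nrm_pos)
    obtain R where R: "integrable \<mu> R" "expectation R \<le> 3 * e * nrm n"
      "\<And>x b k. x \<in> space \<mu> \<Longrightarrow> b < m \<Longrightarrow> grid m n b \<le> k \<Longrightarrow> k \<le> grid m n (Suc b) \<Longrightarrow> \<bar>ws {..<k} x - ws {..<grid m n b} x\<bar> \<le> R x"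
      using elim(4) by blast
    let ?Y = "\<lambda>x. step01 n (\<lambda>k. fs a k x / nrm n)"
    let ?E = "\<lambda>x. (field_err a n x + \<bar>\<alpha>\<bar> * R x) / nrm n"
    have iE: "integrable \<mu> (\<lambda>x. L * ?E x)"
      by (intro integrable_mult_right integrable_divide Bochner_Integration.integrable_add elim(3) R(1))
    have i1: "integrable \<mu> (\<lambda>x. g (?Y x))"
      by (rule integrable_const_bound[where B = B]) (use B step01_in_D01 in \<open>auto intro!: fs_measurable[OF sc]\<close>)
    have i2: "integrable \<mu> (\<lambda>x. g (skeleton m n x))"
      by (rule integrable_const_bound[where B = B])
        (use B step01_in_D01 skeleton_measurable[OF sc] in \<open>auto simp: skeleton_def\<close>)
    have "\<bar>expectation (\<lambda>x. g (?Y x)) - expectation (\<lambda>x. g (skeleton m n x))\<bar>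
      \<le> expectation (\<lambda>x. \<bar>g (?Y x) - g (skeleton m n x)\<bar>)"
      unfolding Bochner_Integration.integral_diff[OF i1 i2, symmetric] by (rule integral_abs_bound)
    also have "\<dots> \<le> expectation (\<lambda>x. L * ?E x)"
    proof (rule integral_mono[OF integrable_abs[OF Bochner_Integration.integrable_diff[OF i1 i2]] iE])
      fix x assume x: "x \<in> space \<mu>"
      have R0: "R x \<ge> 0" using R(3)[OF x, of 0 "grid m n 0"] m grid_mono[of 0 1 m n] by simp
      have "0 \<le> field_err a n x" unfolding field_err_def by (intro run_max_nonneg) simp
      then have "0 \<le> ?E x" using R0 p by simp
      moreover have "close01 (?E x) (?Y x) (skeleton m n x)"
        by (rule skeleton_close[OF m(1) elim(5) x R(3)[OF x] \<alpha>_eq])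
      moreover have "?Y x \<in> D01" "skeleton m n x \<in> D01" by (simp_all add: step01_in_D01 skeleton_def)
      ultimately show "\<bar>g (?Y x) - g (skeleton m n x)\<bar> \<le> L * ?E x" using g unfolding lip01_def by blast
    qed
    also have "\<dots> = L * (expectation (field_err a n) / nrm n + \<bar>\<alpha>\<bar> * (expectation R / nrm n))"
      using elim(3) R(1) by (simp add: add_divide_distrib)
    also have "\<dots> \<le> (L + 1) * (r / (5 * (L + 1)) + (\<bar>\<alpha>\<bar> + 1) * (3 * e))"
    proof (intro mult_mono add_mono)
      show "expectation (field_err a n) / nrm n \<le> r / (5 * (L + 1))" using elim(2) by simp
      show "expectation R / nrm n \<le> 3 * e" using R(2) unfolding pos_divide_le_eq[OF p] .
      have "0 \<le> expectation R"
      proof (rule integral_nonneg_AE, rule AE_I2)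
        fix x assume "x \<in> space \<mu>"
        from R(3)[OF this, of 0 "grid m n 0"] show "0 \<le> R x" using m grid_mono[of 0 1 m n] by simp
      qed
      then show R0: "0 \<le> expectation R / nrm n" using p by simp
      have "0 \<le> expectation (field_err a n)"
        by (intro integral_nonneg_AE) (auto simp: field_err_def intro!: AE_I2 run_max_nonneg)
      then show "0 \<le> expectation (field_err a n) / nrm n + \<bar>\<alpha>\<bar> * (expectation R / nrm n)"
        using p R0 by (intro add_nonneg_nonneg mult_nonneg_nonneg) auto
    qed (use L e in auto)
    also have "\<dots> = 2 * (r / 5)"
    proof -
      have "(L + 1) * (r / (5 * (L + 1))) = r / 5" using L by (simp add: divide_simps)
      moreover have "(L + 1) * ((\<bar>\<alpha>\<bar> + 1) * (3 * e)) = r / 5"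
        unfolding e_def using L by (simp add: divide_simps)
      ultimately show ?thesis by (simp add: distrib_left)
    qed
    finally have "\<bar>expectation (\<lambda>x. g (?Y x)) - expectation (\<lambda>x. g (skeleton m n x))\<bar> \<le> 2 * (r / 5)" .
    moreover have "\<bar>expectation (\<lambda>x. g (skeleton m n x)) - ?Gm m\<bar> < r / 5" using elim(1) by (simp add: dist_real_def)
    moreover have "\<bar>?Gm m - ?G\<bar> < r / 5" using m1[OF m(3)] by simp
    ultimately show ?case unfolding real_norm_def using r by linarith
  qed
  then show "\<exists>no. \<forall>n\<ge>no. norm (expectation (\<lambda>x. g (step01 n (\<lambda>k. fs a k x / nrm n))) - ?G) < r"
    by (simp add: eventually_sequentially)
qed

end

theorem quenched_fclt:
  assumes a: "integrable (count_space UNIV) a" and \<alpha>: "infsum a UNIV \<noteq> 0"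
  shows "fclt \<mu> (\<lambda>n x t. (\<Sum>i<nat \<lfloor>real n * t\<rfloor>. infsum (\<lambda>q. a q * X (z i - q) x) UNIV) / sqrt (real n * ln (real n)))
    ((infsum a UNIV)\<^sup>2 * C)"
proof -
  have "fclt \<mu> (\<lambda>n x. step01 n (\<lambda>k. fs a k x / nrm n)) ((infsum a UNIV)\<^sup>2 * C)"
  proof (rule fclt_from_lipschitz[OF prob_space_axioms])
    show "(\<lambda>x. fs a k x / nrm n) \<in> borel_measurable \<mu>" for n k by simp
    show "(\<lambda>n. expectation (\<lambda>x. g (step01 n (\<lambda>k. fs a k x / nrm n)))) \<longlonglongrightarrow> (\<integral>w. g (\<lambda>t. sqrt ((infsum a UNIV)\<^sup>2 * C) * W w t) \<partial>M)"
      if "wiener01 M W" "lip01 L g" "\<And>x. x \<in> D01 \<Longrightarrow> \<bar>g x\<bar> \<le> B" for M :: "(real \<Rightarrow> real) measure" and W g L B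
      by (rule lipschitz_limit[OF that(1) \<alpha> a refl that(2)]) (rule that(3))
  qed
  then show ?thesis by (simp only: step01_def fs_def nrm_def)
qed

end

theorem theorem4p1:
  fixes P :: "'o measure" and \<zeta> :: "nat \<Rightarrow> 'o \<Rightarrow> int \<times> int"
    and \<mu> :: "'e measure" and X :: "int \<times> int \<Rightarrow> 'e \<Rightarrow> real"
    and a :: "int \<times> int \<Rightarrow> real"
    and \<Sigma>11 \<Sigma>12 \<Sigma>22 :: real
  assumes P: "prob_space P"
    and \<zeta>_indep: "prob_space.indep_vars P (\<lambda>_. count_space UNIV) \<zeta> UNIV"
    and \<zeta>_ident: "\<And>i. distr P (count_space UNIV) (\<zeta> i) = distr P (count_space UNIV) (\<zeta> 0)"
    and \<zeta>_sq1: "integrable P (\<lambda>w. (real_of_int (fst (\<zeta> 0 w)))\<^sup>2)"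
    and \<zeta>_sq2: "integrable P (\<lambda>w. (real_of_int (snd (\<zeta> 0 w)))\<^sup>2)"
    and \<zeta>_mean1: "(\<integral>w. real_of_int (fst (\<zeta> 0 w)) \<partial>P) = 0"
    and \<zeta>_mean2: "(\<integral>w. real_of_int (snd (\<zeta> 0 w)) \<partial>P) = 0"
    and \<Sigma>11: "\<Sigma>11 = (\<integral>w. (real_of_int (fst (\<zeta> 0 w)))\<^sup>2 \<partial>P)"
    and \<Sigma>22: "\<Sigma>22 = (\<integral>w. (real_of_int (snd (\<zeta> 0 w)))\<^sup>2 \<partial>P)"
    and \<Sigma>12: "\<Sigma>12 = (\<integral>w. real_of_int (fst (\<zeta> 0 w)) * real_of_int (snd (\<zeta> 0 w)) \<partial>P)"
    and nonsing: "\<Sigma>11 * \<Sigma>22 - \<Sigma>12\<^sup>2 \<noteq> 0"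
    and aperiodic: "gen_subgroup {z. measure P {w\<in>space P. \<zeta> 0 w = z} > 0} = UNIV"
    and \<mu>: "prob_space \<mu>"
    and X_indep: "prob_space.indep_vars \<mu> (\<lambda>_. borel) X UNIV"
    and X_ident: "\<And>l. distr \<mu> borel (X l) = distr \<mu> borel (X 0)"
    and X_int: "integrable \<mu> (X 0)"
    and X_centered: "(\<integral>x. X 0 x \<partial>\<mu>) = 0"
    and X_sq: "integrable \<mu> (\<lambda>x. (X 0 x)\<^sup>2)"
    and X_norm: "(\<integral>x. (X 0 x)\<^sup>2 \<partial>\<mu>) = 1"
    and a_abs: "(\<lambda>q. \<bar>a q\<bar>) summable_on UNIV"
    and a_sum: "infsum a UNIV \<noteq> 0"
  shows "AE \<omega> in P. fclt \<mu>
      (\<lambda>n x t. (\<Sum>i<nat \<lfloor>real n * t\<rfloor>.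
                  infsum (\<lambda>q. a q * X ((\<Sum>j<i. \<zeta> j \<omega>) - q) x) UNIV)
                / sqrt (real n * ln (real n)))
      ((infsum a UNIV)\<^sup>2 / (pi * sqrt (\<Sigma>11 * \<Sigma>22 - \<Sigma>12\<^sup>2)))"
proof -
  interpret P: prob_space P by (rule P)
  interpret planar_walk P \<zeta> \<Sigma>11 \<Sigma>12 \<Sigma>22
    by unfold_locales (fact \<zeta>_indep \<zeta>_ident \<zeta>_sq1 \<zeta>_sq2 \<zeta>_mean1 \<zeta>_mean2 \<Sigma>11 \<Sigma>22 \<Sigma>12 nonsing aperiodic)+
  interpret \<mu>: prob_space \<mu> by (rule \<mu>)
  interpret S: scenery \<mu> X
    by unfold_locales (fact X_indep X_ident X_centered X_sq X_norm)+
  have a: "integrable (count_space UNIV) a"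
  proof -
    have "Infinite_Sum.abs_summable_on a UNIV" using a_abs by simp
    then have "Infinite_Set_Sum.abs_summable_on a UNIV" by (rule abs_summable_equivalent[THEN iffD1])
    then show ?thesis by (simp add: Infinite_Set_Sum.abs_summable_on_def)
  qed
  \<comment> \<open>Counting both orders of a pair doubles \<open>gc\<close>, which removes the 2 in
    its denominator and leaves the stated variance.\<close>
  have \<sigma>2: "(infsum a UNIV)\<^sup>2 * (2 * gc) = (infsum a UNIV)\<^sup>2 / (pi * sqrt (\<Sigma>11 * \<Sigma>22 - \<Sigma>12\<^sup>2))"
    by (simp add: gc_def)
  show ?thesis
    using AE_walk_regular
  proof eventually_elim
    case (elim \<omega>)
    \<comment> \<open>The exceptional null set comes from \<open>AE_walk_regular\<close> and so
      depends on the walk alone, neither on the scenery nor on the coefficients.\<close>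
    interpret R: rwrs \<mu> X "walk \<omega>" "2 * gc"
    proof unfold_locales
      show "2 * gc > 0" using gc_pos by simp
      show "(\<lambda>n. coll (walk \<omega>) (blk m n b) (blk m n b) 0 / (real n * ln (real n))) \<longlonglongrightarrow> 2 * gc / real m" if "m > 0" for m b
        unfolding blk_def grid_def using elim that by blast
      show "\<forall>\<^sub>F n in sequentially. (2 * gc - e) * (real n * ln (real n)) \<le> coll (walk \<omega>) {..<n} {..<n} q" if e: "e > 0" for q e
      proof -
        obtain k where k: "1 / real (Suc k) < e" using e by (rule nat_approx_posE)
        have "\<forall>\<^sub>F n in sequentially. (2 * gc - 1 / real (Suc k)) * (real n * ln (real n)) \<le> coll (walk \<omega>) {..<n} {..<n} q"
          using elim by blast
        then show ?thesis using eventually_ge_at_top[of 1]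
        proof eventually_elim
          case (elim n)
          have "(2 * gc - e) * (real n * ln (real n)) \<le> (2 * gc - 1 / real (Suc k)) * (real n * ln (real n))"
            using k elim by (intro mult_right_mono) auto
          then show ?case using elim by linarith
        qed
      qed
    qed
    show ?case using R.quenched_fclt[OF a a_sum] unfolding \<sigma>2 walk_def .
  qed
qed

end
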